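(* Let $1\le r\le\infty$, $\bar r=\max(r,2)$, $\alpha\in\{n-1/2:n\in\mathbb N\}$, and let $p_0$ be a probability density on $[0,1]$ such that (a) $p_0\in\mathcal C^\alpha([0,1])$, and (b) $p_0$ is bounded and bounded away from zero, say, $2\|\log p_0\|_\infty\le c<\infty$. Let $\Pi$ be the prior $$\Pi=\mathcal L\Big(\frac{e^{\bar B_\alpha}}{\int_0^1e^{\bar B_\alpha(t)}dt}\ \Big|\ \|\bar B_\alpha\|_\infty\le c\Big),$$ where $\bar B_\alpha$ is the released integrated Brownian motion with $\alpha$ as in (a), and $c$ is as in (b). Then, if $X_1,X_2,\dots$ are i.i.d. with common law $P_0$ of density $p_0$, there exists $M<\infty$ such that $$\Pi\Big\{p\in\mathcal P:\|p-p_0\|_r\ge Mn^{-\frac{\alpha-1/2+1/\bar r}{2\alpha+1}}(\log n)^{\frac12 1_{\{r=\infty\}}}\,\Big|\,X_1,\dots,X_n\Big\}\to0$$ in $P_0^{\mathbb N}$-probability as $n\to\infty$.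
   Context: $\mathcal P$ is the class of probability densities on $[0,1]$; $\|\cdot\|_r$ is the $L^r([0,1])$-norm, $\|\cdot\|_\infty$ the supremum norm, $1/\bar r=0$ if $r=\infty$. The posterior is $\Pi(A|X_1,\dots,X_n)=\int_A\prod_{i=1}^np(X_i)\,d\Pi(p)\big/\int\prod_{i=1}^np(X_i)\,d\Pi(p)$. $\mathcal C^\alpha([0,1])$ is the Hölder space of order $\alpha$ (here $\alpha$ is not an integer). Integrated Brownian motion: $B_{1/2}=B$ is a (sample-continuous) standard Brownian motion on $[0,1]$; for $\alpha>1$, $\alpha\in\{n-1/2:n\in\mathbb N\}$, with $[\alpha]$ the integer part of $\alpha$, $B_\alpha$ is the $[\alpha]$-fold integral $B_\alpha(t)=\frac1{([\alpha]-1)!}\int_0^t(t-s)^{[\alpha]-1}B(s)\,ds$, $t\in[0,1]$. The released process is $\bar B_\alpha(t)=\sum_{k=0}^{[\alpha]}Z_kt^k/k!+B_\alpha(t)$, with $Z_k$ i.i.d. $N(0,1)$ independent of $B_\alpha$. The prior means: for measurable $A\subset C([0,1])$, $\Pi(A)=\Pr\{e^{\bar B_\alpha}/\int_0^1e^{\bar B_\alpha}\in A,\ \|\bar B_\alpha\|_\infty\le c\}/\Pr\{\|\bar B_\alpha\|_\infty\le c\}$; here $c>0$. *)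

theory Defs
  imports "HOL-Probability.Probability"
begin

abbreviation unit_lborel :: "real measure"
  where "unit_lborel \<equiv> restrict_space lborel {0..1}"

text \<open>
  Norms are taken over [0,1] with values in \<^typ>\<open>ennreal\<close>, so that they are meaningful for
  unbounded functions too. The case of infinite exponent is the genuine supremum norm, not the
  essential supremum.
\<close>

definition Lr_norm :: "ennreal \<Rightarrow> (real \<Rightarrow> real) \<Rightarrow> ennreal" where
  "Lr_norm r f =
     (if r = \<infinity> then (SUP t\<in>{0..1}. ennreal \<bar>f t\<bar>)
      else (let I = (\<integral>\<^sup>+ t. ennreal (\<bar>f t\<bar> powr enn2real r) \<partial>unit_lborel)
            in if I = \<infinity> then \<infinity> else ennreal (enn2real I powr (1 / enn2real r))))"

definition prob_densities :: "(real \<Rightarrow> real) set" where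
  "prob_densities =
     {p \<in> borel_measurable unit_lborel.
        (\<forall>t\<in>{0..1}. 0 \<le> p t) \<and> (\<integral>\<^sup>+ t. ennreal (p t) \<partial>unit_lborel) = 1}"

text \<open>
  Hoelder space of non-integer order: \<^term>\<open>nat \<lfloor>\<alpha>\<rfloor>\<close> derivatives on the closed
  interval (one-sided at the endpoints), the last of which is Hoelder continuous with the
  fractional part of the order as exponent. The function \<open>D j\<close> is the derivative of order \<open>j\<close>.
\<close>

definition holder_space :: "real \<Rightarrow> (real \<Rightarrow> real) set" where
  "holder_space \<alpha> =
     {f. \<exists>D L. (\<forall>t\<in>{0..1}. D 0 t = f t)
       \<and> (\<forall>j < nat \<lfloor>\<alpha>\<rfloor>. \<forall>t\<in>{0..1}.
            (D j has_real_derivative D (Suc j) t) (at t within {0..1}))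
       \<and> (\<forall>s\<in>{0..1}. \<forall>t\<in>{0..1}.
            \<bar>D (nat \<lfloor>\<alpha>\<rfloor>) s - D (nat \<lfloor>\<alpha>\<rfloor>) t\<bar> \<le> L * \<bar>s - t\<bar> powr frac \<alpha>)}"

text \<open>
  The space C([0,1]), its elements represented by extensional functions, with the Borel
  sigma-algebra of the supremum norm.
\<close>

definition C01 :: "(real \<Rightarrow> real) set" where
  "C01 = {f \<in> extensional {0..1}. continuous_on {0..1} f}"

definition C01_borel :: "(real \<Rightarrow> real) measure" where
  "C01_borel = sigma C01
     {U. U \<subseteq> C01 \<and>
         (\<forall>f\<in>U. \<exists>e>0. \<forall>g\<in>C01. Lr_norm \<infinity> (\<lambda>t. g t - f t) < ennreal e \<longrightarrow> g \<in> U)}"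

locale brownian_motion01 = prob_space M for M :: "'w measure" +
  fixes B :: "real \<Rightarrow> 'w \<Rightarrow> real"
  assumes random_variable: "t \<in> {0..1} \<Longrightarrow> random_variable borel (B t)"
    and start_zero: "AE \<omega> in M. B 0 \<omega> = 0"
    and increments_normal: "0 \<le> s \<Longrightarrow> s < t \<Longrightarrow> t \<le> 1 \<Longrightarrow>
      distributed M lborel (\<lambda>\<omega>. B t \<omega> - B s \<omega>) (normal_density 0 (sqrt (t - s)))"
    and increments_indep: "mono u \<Longrightarrow> range u \<subseteq> {0..1} \<Longrightarrow>
      indep_vars (\<lambda>_. borel) (\<lambda>i \<omega>. B (u (Suc i)) \<omega> - B (u i) \<omega>) {..<k::nat}"
    and sample_continuous: "\<omega> \<in> space M \<Longrightarrow> continuous_on {0..1} (\<lambda>t. B t \<omega>)"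

definition iterated_integral :: "nat \<Rightarrow> (real \<Rightarrow> real) \<Rightarrow> real \<Rightarrow> real" where
  "iterated_integral m b t =
     (if m = 0 then b t
      else 1 / fact (m - 1) * (LBINT s:{0..t}. (t - s) ^ (m - 1) * b s))"

definition integrated_bm :: "real \<Rightarrow> (real \<Rightarrow> 'w \<Rightarrow> real) \<Rightarrow> real \<Rightarrow> 'w \<Rightarrow> real" where
  "integrated_bm \<alpha> B t \<omega> = iterated_integral (nat \<lfloor>\<alpha>\<rfloor>) (\<lambda>s. B s \<omega>) t"

definition released_bm ::
    "real \<Rightarrow> (real \<Rightarrow> 'w \<Rightarrow> real) \<Rightarrow> (nat \<Rightarrow> 'w \<Rightarrow> real) \<Rightarrow> real \<Rightarrow> 'w \<Rightarrow> real" where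
  "released_bm \<alpha> B Z t \<omega> =
     (\<Sum>k\<le>nat \<lfloor>\<alpha>\<rfloor>. Z k \<omega> * t ^ k / fact k) + integrated_bm \<alpha> B t \<omega>"

text \<open>
  The two families have different index types, so their independence is expressed through the
  sigma-algebras they generate on the sample space.
\<close>

locale released_integrated_bm = brownian_motion01 M B
  for M :: "'w measure" and B :: "real \<Rightarrow> 'w \<Rightarrow> real" +
  fixes \<alpha> :: real and Z :: "nat \<Rightarrow> 'w \<Rightarrow> real"
  assumes Z_normal: "k \<le> nat \<lfloor>\<alpha>\<rfloor> \<Longrightarrow> distributed M lborel (Z k) std_normal_density"
    and Z_indep: "indep_vars (\<lambda>_. borel) Z {..nat \<lfloor>\<alpha>\<rfloor>}"
    and Z_indep_process: "indep_set
      (sets (vimage_algebra (space M) (\<lambda>\<omega>. \<lambda>k\<in>{..nat \<lfloor>\<alpha>\<rfloor>}. Z k \<omega>)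
               (\<Pi>\<^sub>M k\<in>{..nat \<lfloor>\<alpha>\<rfloor>}. borel)))
      (sets (vimage_algebra (space M) (\<lambda>\<omega>. \<lambda>t\<in>{0..1}. integrated_bm \<alpha> B t \<omega>)
               (\<Pi>\<^sub>M t\<in>{0..1}. borel)))"

definition exp_density :: "(real \<Rightarrow> real) \<Rightarrow> real \<Rightarrow> real" where
  "exp_density w = (\<lambda>t\<in>{0..1}. exp (w t) / (LINT s|unit_lborel. exp (w s)))"

definition conditioned_prior ::
    "'w measure \<Rightarrow> (real \<Rightarrow> 'w \<Rightarrow> real) \<Rightarrow> real \<Rightarrow> (real \<Rightarrow> real) measure" where
  "conditioned_prior M W c =
     distr (uniform_measure M {\<omega> \<in> space M. Lr_norm \<infinity> (\<lambda>t. W t \<omega>) \<le> ennreal c})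
       C01_borel (\<lambda>\<omega>. exp_density (\<lambda>t. W t \<omega>))"

text \<open>The observations are \<open>x 0, \<dots>, x (n - 1)\<close>.\<close>

definition posterior ::
    "(real \<Rightarrow> real) measure \<Rightarrow> nat \<Rightarrow> (nat \<Rightarrow> real) \<Rightarrow> (real \<Rightarrow> real) set \<Rightarrow> real" where
  "posterior prior n x A =
     (LINT p:A|prior. (\<Prod>i<n. p (x i))) / (LINT p|prior. (\<Prod>i<n. p (x i)))"

definition sampling_dist :: "(real \<Rightarrow> real) \<Rightarrow> real measure" where
  "sampling_dist p = density unit_lborel (\<lambda>t. ennreal (p t))"

definition iid_dist :: "(real \<Rightarrow> real) \<Rightarrow> (nat \<Rightarrow> real) measure" where
  "iid_dist p = (\<Pi>\<^sub>M i\<in>UNIV. sampling_dist p)"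

definition contraction_rate :: "real \<Rightarrow> ennreal \<Rightarrow> nat \<Rightarrow> real" where
  "contraction_rate \<alpha> r n =
     real n powr (- ((\<alpha> - 1 / 2 + enn2real (1 / max r 2)) / (2 * \<alpha> + 1)))
     * (if r = \<infinity> then sqrt (ln (real n)) else 1)"

end

theory Submission
  imports Defs
begin

text \<open>
  Put \<open>\<alpha> = m - 1/2\<close>, cut [0,1] into \<open>N \<approx> n powr (1 / (2 m))\<close> blocks, and let
  \<open>\<epsilon> = N powr (- \<alpha>)\<close>, so that \<open>n \<epsilon>\<^sup>2\<close> is of order \<open>N\<close>.

  Up to normalisation the log density is the released process \<open>W\<close>, and \<open>log p0\<close> is a
  polynomial plus the \<open>(m-1)\<close>-fold integral of a 1/2-Hoelder function. The probability that \<open>W\<close> is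
  uniformly \<open>C \<epsilon>\<close>-close to \<open>log p0\<close> is at least \<open>\<kappa> ^ N\<close>: on each block, the \<open>m\<close> accumulated
  deviations of the integrals are steered back by a polynomial shift of the Gaussian noise, which has
  bounded cost per block.

  Outside an event of probability \<open>exp (- K N)\<close> the sum over the blocks of the integrated squared
  Brownian increments is bounded. On this sieve, log densities are polynomials of degree
  less than \<open>m\<close> on each block up to an \<open>L\<^sup>2\<close> error \<open>\<epsilon>\<close>, so they are described by \<open>m N\<close> coordinates. Tests
  for the \<open>\<epsilon>\<close>-cells in coordinate space have errors summing to \<open>exp (- \<Lambda> N)\<close>, because both the number of
  cells at a given distance and the error exponent are governed by that distance. This gives contraction
  in \<open>L\<^sup>2\<close> at rate \<open>\<epsilon>\<close>; the polynomial description also bounds the uniform norm by \<open>sqrt N\<close> times the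
  \<open>L\<^sup>2\<close> norm, and the other norms follow by interpolation.
\<close>

section \<open>Polynomials dual to the monomials\<close>

text \<open>Conditioning bounds every log density by \<open>2 * c\<close>, so L2 distances of
  densities, L2 distances of their logarithms and chi-square discrepancies agree up to constants,
  and only the L2 geometry of logarithms matters. The rate \<open>\<kappa>\<close> of the small ball
  is some constant that cannot be improved, so the other rates must beat it: the energy bound
  \<open>K\<close> of the sieve and the radius \<open>R\<close> of the excluded ball are chosen
  after \<open>\<kappa>\<close>. This is possible because energy tails and summed test errors both
  attain any prescribed exponential rate in \<open>N\<close>. The obstacle to the small ball is that
  deviations of the lower integrals propagate into all later blocks and would grow with their
  number. Feedback that aims at state zero at the end of each block keeps them bounded, at a cost
  independent of \<open>N\<close>. To use finite-dimensional Gaussian shifts, the noise of a block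
  is first sampled at \<open>F\<close> points; every bound is uniform in large \<open>F\<close>, and
  \<open>F\<close> tends to infinity at the end. No cells are counted: the errors are dominated by
  Gaussian weights on the integer lattice of cell indices, and that sum factorises over the
  coordinates.\<close>

lemma space_unit_lborel [simp]: "space unit_lborel = {0..1}"
  by (simp add: space_restrict_space)

lemma prob_space_unit_lborel: "prob_space unit_lborel"
  by (rule prob_spaceI) (simp add: emeasure_restrict_space)

lemma borel_measurable_unit_lborelI:
  "f \<in> borel_measurable borel \<Longrightarrow> f \<in> borel_measurable unit_lborel"
  by (rule measurable_restrict_space1) simp

lemma unit_lborel_integrable:
  fixes f :: "real \<Rightarrow> real"
  assumes "f \<in> borel_measurable unit_lborel" "\<And>t. t \<in> {0..1} \<Longrightarrow> \<bar>f t\<bar> \<le> C"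
  shows "integrable unit_lborel f"
proof -
  interpret prob_space unit_lborel by (rule prob_space_unit_lborel)
  show ?thesis by (rule integrable_const_bound[of _ C]) (use assms in auto)
qed

text \<open>Random walk paths and sampled Brownian paths are step functions, so continuity would be
  too narrow. This class is closed under the algebraic operations and under restriction to a block,
  and all its members are integrable on the unit interval.\<close>

definition bounded_measurable :: "(real \<Rightarrow> real) \<Rightarrow> bool" where
  "bounded_measurable f \<longleftrightarrow>
     f \<in> borel_measurable unit_lborel \<and> (\<exists>C. \<forall>t\<in>{0..1}. \<bar>f t\<bar> \<le> C)"

lemma bounded_measurable_integrable:
  "bounded_measurable f \<Longrightarrow> integrable unit_lborel f"
  unfolding bounded_measurable_def using unit_lborel_integrable by blast

lemma bounded_measurable_continuous:
  assumes "continuous_on {0..1} f"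
  shows "bounded_measurable f"
proof -
  have "bounded (f ` {0..1})"
    using assms compact_continuous_image compact_imp_bounded by blast
  then have "\<exists>C. \<forall>t\<in>{0..1}. \<bar>f t\<bar> \<le> C"
    unfolding bounded_iff by (metis image_eqI real_norm_def)
  moreover have "f \<in> borel_measurable unit_lborel"
    using borel_measurable_continuous_on_restrict[OF assms]
    by (simp add: measurable_cong_sets[OF sets_restrict_space_cong[of lborel borel]])
  ultimately show ?thesis by (simp add: bounded_measurable_def)
qed

lemma poly_unit_lborel_integrable: "integrable unit_lborel (\<lambda>s. poly p s)"
  by (intro bounded_measurable_integrable bounded_measurable_continuous continuous_intros)

lemma poly_mult_unit_lborel_integrable: "integrable unit_lborel (\<lambda>s. poly p s * poly q s)"
  using poly_unit_lborel_integrable[of "p * q"] by simp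

text \<open>The zeros form a finite, hence null, set. Definiteness of the L2 form on polynomials
  permits the normalisation in the next construction.\<close>

lemma poly_square_integral_pos:
  fixes p :: "real poly"
  assumes "p \<noteq> 0"
  shows "0 < (LINT s|unit_lborel. poly p s * poly p s)"
proof -
  interpret prob_space unit_lborel by (rule prob_space_unit_lborel)
  have fin: "finite {s. poly p s = 0}" using assms poly_roots_finite by blast
  have "AE s in lborel. s \<notin> {s. poly p s = 0}"
    using fin by (intro AE_not_in finite_imp_null_set_lborel)
  then have ne: "AE s in unit_lborel. poly p s \<noteq> 0"
    by (subst AE_restrict_space_iff) auto
  have "(LINT s|unit_lborel. poly p s * poly p s) \<noteq> 0"
  proof
    assume "(LINT s|unit_lborel. poly p s * poly p s) = 0"
    then have "AE s in unit_lborel. poly p s * poly p s = 0"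
      by (subst (asm) integral_nonneg_eq_0_iff_AE) (auto intro: poly_mult_unit_lborel_integrable)
    with ne have "AE s in unit_lborel. False" by eventually_elim auto
    then show False by simp
  qed
  moreover have "0 \<le> (LINT s|unit_lborel. poly p s * poly p s)"
    by (intro integral_nonneg_AE) auto
  ultimately show ?thesis by linarith
qed

text \<open>The next functional comes from projecting the next monomial off the space spanned so far.\<close>

lemma dual_polynomials_exist:
  "\<exists>\<psi> :: nat \<Rightarrow> real poly. (\<forall>l<m. degree (\<psi> l) < m) \<and>
     (\<forall>l<m. \<forall>k<m. (LINT s|unit_lborel. poly (\<psi> l) s * s ^ k) = (if k = l then 1 else 0))"
proof (induction m)
  case 0
  then show ?case by simp
next
  case (Suc m)
  then obtain \<psi> :: "nat \<Rightarrow> real poly" where deg: "\<And>l. l < m \<Longrightarrow> degree (\<psi> l) < m"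
    and dual: "\<And>l k. l < m \<Longrightarrow> k < m \<Longrightarrow>
      (LINT s|unit_lborel. poly (\<psi> l) s * s ^ k) = (if k = l then 1 else 0)"
    by blast
  define ip :: "real poly \<Rightarrow> real poly \<Rightarrow> real"
    where "ip p q = (LINT s|unit_lborel. poly p s * poly q s)" for p q
  have ip_add: "ip (p + q) r = ip p r + ip q r" for p q r
    unfolding ip_def
    by (simp add: distrib_right Bochner_Integration.integral_add poly_mult_unit_lborel_integrable)
  have ip_diff: "ip (p - q) r = ip p r - ip q r" for p q r
    unfolding ip_def
    by (simp add: left_diff_distrib Bochner_Integration.integral_diff poly_mult_unit_lborel_integrable)
  have ip_smult: "ip (smult a p) r = a * ip p r" for a p r
    unfolding ip_def by (simp add: mult.assoc)
  have ip_comm: "ip p q = ip q p" for p q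
    unfolding ip_def by (simp add: mult.commute)
  have ip_0: "ip 0 q = 0" for q
    unfolding ip_def by simp
  have ip_sum: "ip (\<Sum>i\<in>A. f i) r = (\<Sum>i\<in>A. ip (f i) r)" for f r and A :: "nat set"
    by (induction A rule: infinite_finite_induct) (auto simp: ip_0 ip_add)
  have dual': "l < m \<Longrightarrow> k < m \<Longrightarrow> ip (\<psi> l) (monom 1 k) = (if k = l then 1 else 0)" for l k
    unfolding ip_def using dual by (simp add: poly_monom)
  \<comment> \<open>By duality of the \<open>\<psi> k\<close>, this polynomial has the same inner
    products with the lower monomials as \<open>monom 1 m\<close>: it is the orthogonal projection
    of that monomial.\<close>
  define \<rho> where "\<rho> = (\<Sum>k<m. smult (ip (monom 1 m) (monom 1 k)) (\<psi> k))"
  define \<phi> where "\<phi> = monom 1 m - \<rho>"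
  \<comment> \<open>The alternative covers \<open>m = 0\<close>, where no degree lies below
    \<open>m\<close> but the sum is empty.\<close>
  have deg_rho: "degree \<rho> < m \<or> \<rho> = 0"
  proof (cases "m = 0")
    case True then show ?thesis by (simp add: \<rho>_def)
  next
    case False
    have "degree \<rho> \<le> m - 1"
      unfolding \<rho>_def
    proof (intro degree_sum_le)
      fix k assume "k \<in> {..<m}"
      then have "degree (\<psi> k) \<le> m - 1" using deg[of k] by simp
      then show "degree (smult (ip (monom 1 m) (monom 1 k)) (\<psi> k)) \<le> m - 1"
        using degree_smult_le order.trans by blast
    qed simp
    with False show ?thesis by linarith
  qed
  have coeff_rho: "coeff \<rho> m = 0"
    using deg_rho coeff_eq_0 by auto
  have phi_nz: "\<phi> \<noteq> 0"
  proof
    assume "\<phi> = 0"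
    then have "coeff \<phi> m = 0" by simp
    with coeff_rho show False by (simp add: \<phi>_def)
  qed
  have orth: "ip \<phi> (monom 1 k) = 0" if "k < m" for k
    using that by (simp add: \<phi>_def \<rho>_def ip_diff ip_sum ip_smult dual' if_distrib[of "\<lambda>x. _ * x"] sum.delta cong: if_cong)
  have orth': "ip \<phi> q = 0" if "degree q < m" for q
  proof -
    have "ip \<phi> q = ip (\<Sum>i\<le>degree q. smult (coeff q i) (monom 1 i)) \<phi>"
      by (subst ip_comm, subst poly_as_sum_of_monoms[symmetric]) (simp add: smult_monom)
    also have "\<dots> = (\<Sum>i\<le>degree q. coeff q i * ip \<phi> (monom 1 i))"
      unfolding ip_sum ip_smult ip_comm[of "monom 1 _" \<phi>] ..
    also have "\<dots> = 0"
      using that by (intro sum.neutral) (simp add: orth)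
    finally show ?thesis .
  qed
  have rho0: "ip \<rho> \<phi> = 0"
    using deg_rho
  proof
    assume "degree \<rho> < m"
    then have "ip \<phi> \<rho> = 0" by (rule orth')
    then show ?thesis by (simp only: ip_comm[of \<rho> \<phi>])
  next
    assume "\<rho> = 0"
    then show ?thesis by (simp only: ip_0)
  qed
  \<comment> \<open>The residual is orthogonal to the projection, so its pairing with the monomial
    equals its squared norm and is positive.\<close>
  have "ip \<phi> \<phi> = ip (monom 1 m) \<phi> - ip \<rho> \<phi>"
    using ip_diff[of "monom 1 m" \<rho> \<phi>] unfolding \<phi>_def[symmetric] .
  then have "ip \<phi> (monom 1 m) = ip \<phi> \<phi>"
    unfolding rho0 ip_comm[of \<phi> "monom 1 m"] by linarith
  also have "\<dots> > 0"
    unfolding ip_def by (rule poly_square_integral_pos[OF phi_nz])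
  finally have pos: "ip \<phi> (monom 1 m) > 0" .
  define \<psi>m where "\<psi>m = smult (1 / ip \<phi> (monom 1 m)) \<phi>"
  have psim: "ip \<psi>m (monom 1 k) = (if k = m then 1 else 0)" if "k \<le> m" for k
    using that pos orth[of k] by (auto simp: \<psi>m_def ip_smult)
  \<comment> \<open>The old functionals are corrected by a multiple of the new one to vanish on the
    new monomial. Since \<open>\<psi>m\<close> vanishes on the lower monomials, their old values are
    unchanged.\<close>
  define \<psi>' where "\<psi>' l = (if l = m then \<psi>m else \<psi> l - smult (ip (\<psi> l) (monom 1 m)) \<psi>m)" for l
  have deg_phi: "degree \<phi> < Suc m"
    using deg_rho unfolding \<phi>_def
    by (auto simp: less_Suc_eq_le degree_monom_eq intro!: degree_diff_le degree_monom_le)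
  have degm: "degree \<psi>m < Suc m"
    unfolding \<psi>m_def using deg_phi degree_smult_le[of _ \<phi>] by (metis order_le_less_trans)
  have "degree (\<psi>' l) < Suc m" if "l < Suc m" for l
  proof (cases "l = m")
    case True then show ?thesis using degm by (simp add: \<psi>'_def)
  next
    case False
    then have "degree (\<psi> l) < m" using that deg by simp
    then show ?thesis
      using False degm degree_smult_le[of "ip (\<psi> l) (monom 1 m)" \<psi>m]
      by (auto simp: \<psi>'_def less_Suc_eq_le intro!: degree_diff_le)
  qed
  moreover have "ip (\<psi>' l) (monom 1 k) = (if k = l then 1 else 0)" if "l < Suc m" "k < Suc m" for l k
    using that psim[of k] dual'[of l k]
    by (auto simp: \<psi>'_def ip_diff ip_smult less_Suc_eq split: if_splits)
  ultimately show ?case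
    by (intro exI[of _ \<psi>']) (simp add: ip_def poly_monom)
qed

section \<open>Iterated integrals\<close>

lemma measure_unit_lborel_01 [simp]: "measure unit_lborel {0..1} = 1"
  using prob_space.prob_space[OF prob_space_unit_lborel] by simp

lemma power_diff_has_derivative:
  fixes t :: real
  shows "((\<lambda>s. (t - s) ^ Suc q) has_real_derivative - (real (Suc q) * (t - s) ^ q)) (at s within A)"
proof -
  have "((\<lambda>s. t - s) has_real_derivative -1) (at s within A)"
    by (auto intro!: derivative_eq_intros)
  from DERIV_power[OF this, of "Suc q"] show ?thesis by simp
qed

section \<open>Closure properties of bounded measurable functions\<close>

lemma bounded_measurable_const: "bounded_measurable (\<lambda>_. c)"
  by (intro bounded_measurable_continuous continuous_intros)

lemma bounded_measurable_mult:
  assumes "bounded_measurable f" "bounded_measurable g"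
  shows "bounded_measurable (\<lambda>t. f t * g t)"
proof -
  obtain C D where C: "\<And>t. t \<in> {0..1} \<Longrightarrow> \<bar>f t\<bar> \<le> C" and D: "\<And>t. t \<in> {0..1} \<Longrightarrow> \<bar>g t\<bar> \<le> D"
    using assms unfolding bounded_measurable_def by blast
  have "\<bar>f t * g t\<bar> \<le> C * D" if "t \<in> {0..1}" for t
    unfolding abs_mult using C[OF that] D[OF that] by (intro mult_mono) auto
  moreover have "(\<lambda>t. f t * g t) \<in> borel_measurable unit_lborel"
    using assms unfolding bounded_measurable_def by auto
  ultimately show ?thesis unfolding bounded_measurable_def by blast
qed

lemma bounded_measurable_add:
  assumes "bounded_measurable f" "bounded_measurable g"
  shows "bounded_measurable (\<lambda>t. f t + g t)"
proof -
  obtain C D where C: "\<And>t. t \<in> {0..1} \<Longrightarrow> \<bar>f t\<bar> \<le> C" and D: "\<And>t. t \<in> {0..1} \<Longrightarrow> \<bar>g t\<bar> \<le> D"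
    using assms unfolding bounded_measurable_def by blast
  have "\<bar>f t + g t\<bar> \<le> C + D" if "t \<in> {0..1}" for t
    using C[OF that] D[OF that] by linarith
  moreover have "(\<lambda>t. f t + g t) \<in> borel_measurable unit_lborel"
    using assms unfolding bounded_measurable_def by auto
  ultimately show ?thesis unfolding bounded_measurable_def by blast
qed

lemma bounded_measurable_diff:
  assumes "bounded_measurable f" "bounded_measurable g"
  shows "bounded_measurable (\<lambda>t. f t - g t)"
  using bounded_measurable_add[OF assms(1) bounded_measurable_mult[OF bounded_measurable_const[of "-1"] assms(2)]]
  by simp

lemma bounded_measurable_sum:
  assumes "\<And>i. i \<in> A \<Longrightarrow> bounded_measurable (f i)"
  shows "bounded_measurable (\<lambda>t. \<Sum>i\<in>A. f i t)"
  using assms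
  by (induction A rule: infinite_finite_induct)
     (auto intro: bounded_measurable_const bounded_measurable_add)

lemma bounded_measurable_affine:
  assumes "bounded_measurable f" "0 \<le> a" "0 \<le> h" "a + h \<le> 1"
  shows "bounded_measurable (\<lambda>s. f (a + h * s))"
proof -
  have in01: "a + h * s \<in> {0..1}" if "s \<in> {0..1}" for s
  proof -
    have "h * s \<le> h" using that assms by (auto intro: mult_left_le)
    then show ?thesis using that assms by auto
  qed
  have "(\<lambda>s. a + h * s) \<in> measurable unit_lborel unit_lborel"
    by (rule measurable_restrict_space2)
       (use in01 in \<open>auto simp del: atLeastAtMost_iff intro!: borel_measurable_unit_lborelI\<close>)
  then have "(\<lambda>s. f (a + h * s)) \<in> borel_measurable unit_lborel"
    by (rule measurable_compose) (use assms in \<open>simp add: bounded_measurable_def\<close>)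
  then show ?thesis using assms(1) in01 unfolding bounded_measurable_def by blast
qed

lemma bounded_measurable_set_integrable:
  assumes "bounded_measurable f" "0 \<le> a" "t \<le> 1"
  shows "set_integrable lborel {a..t} f"
proof -
  have "set_integrable lborel {0..1} f"
    using bounded_measurable_integrable[OF assms(1)] integrable_restrict_space[of "{0..1}" lborel f]
    by (simp add: set_integrable_def)
  then show ?thesis by (rule set_integrable_subset) (use assms in auto)
qed

lemma unit_lborel_set_integral:
  "(LINT s|unit_lborel. f s) = (LBINT s:{0..1}. (f s :: real))"
  by (simp add: integral_restrict_space set_lebesgue_integral_def)

section \<open>Algebra, bounds and block expansion of iterated integrals\<close>

lemma iterated_integral_0 [simp]: "iterated_integral 0 b t = b t"
  by (simp add: iterated_integral_def)

lemma iterated_integral_Suc: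
  "iterated_integral (Suc q) b t = 1 / fact q * (LBINT s:{0..t}. (t - s) ^ q * b s)"
  by (simp add: iterated_integral_def)

lemma kernel_bounded_measurable:
  assumes "bounded_measurable b"
  shows "bounded_measurable (\<lambda>s. (t - s) ^ q * b s)"
  by (intro bounded_measurable_mult assms bounded_measurable_continuous continuous_intros)

lemma kernel_set_integrable:
  assumes "bounded_measurable b" "0 \<le> a" "t \<le> 1"
  shows "set_integrable lborel {a..t} (\<lambda>s. (c - s) ^ q * b s)"
  using assms by (intro bounded_measurable_set_integrable kernel_bounded_measurable)

lemma iterated_integral_diff:
  assumes "bounded_measurable f" "bounded_measurable g" "t \<le> 1"
  shows "iterated_integral q (\<lambda>s. f s - g s) t = iterated_integral q f t - iterated_integral q g t"
proof (cases q)
  case (Suc k)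
  have "(LBINT s:{0..t}. (t - s) ^ k * (f s - g s))
      = (LBINT s:{0..t}. (t - s) ^ k * f s - (t - s) ^ k * g s)"
    by (simp add: right_diff_distrib)
  also have "\<dots> = (LBINT s:{0..t}. (t - s) ^ k * f s) - (LBINT s:{0..t}. (t - s) ^ k * g s)"
    using assms by (intro set_integral_diff kernel_set_integrable) auto
  finally show ?thesis by (simp add: Suc iterated_integral_Suc right_diff_distrib diff_divide_distrib)
qed simp

lemma iterated_integral_mult:
  "iterated_integral q (\<lambda>s. c * f s) t = c * iterated_integral q f t"
proof (cases q)
  case (Suc k)
  have "(LBINT s:{0..t}. (t - s) ^ k * (c * f s)) = (LBINT s:{0..t}. c * ((t - s) ^ k * f s))"
    by (simp add: mult_ac)
  then show ?thesis by (simp add: Suc iterated_integral_Suc)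
qed simp

lemma iterated_integral_add:
  assumes "bounded_measurable f" "bounded_measurable g" "t \<le> 1"
  shows "iterated_integral q (\<lambda>s. f s + g s) t = iterated_integral q f t + iterated_integral q g t"
  using iterated_integral_diff[OF assms(1) bounded_measurable_mult[OF bounded_measurable_const[of "-1"] assms(2)] assms(3), of q]
    iterated_integral_mult[of q "-1" g t]
  by simp

lemma iterated_integral_sum:
  assumes "\<And>i. i \<in> A \<Longrightarrow> bounded_measurable (f i)" "t \<le> 1" "finite A"
  shows "iterated_integral q (\<lambda>s. \<Sum>i\<in>A. f i s) t = (\<Sum>i\<in>A. iterated_integral q (f i) t)"
  using assms(3,1)
proof (induction A)
  case empty
  then show ?case using iterated_integral_mult[of q 0 "\<lambda>_. 0" t] by simp
next
  case (insert x F)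
  then show ?case
    using assms(2) by (simp add: iterated_integral_add bounded_measurable_sum)
qed

lemma iterated_integral_cong:
  assumes "\<And>s. s \<in> {0..t} \<Longrightarrow> f s = g s" "0 \<le> t"
  shows "iterated_integral q f t = iterated_integral q g t"
proof (cases q)
  case (Suc k)
  have "(LBINT s:{0..t}. (t - s) ^ k * f s) = (LBINT s:{0..t}. (t - s) ^ k * g s)"
    by (rule set_lebesgue_integral_cong) (use assms in auto)
  then show ?thesis by (simp add: Suc iterated_integral_Suc)
qed (use assms in simp)

lemma kernel_integral:
  assumes "0 \<le> t"
  shows "(LBINT s:{0..t}. (t - s) ^ q) = t ^ Suc q / real (Suc q)"
proof -
  define G where "G s = - ((t - s) ^ Suc q / real (Suc q))" for s
  have "(LBINT s:{0..t}. (t - s) ^ q) = G t - G 0"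
    unfolding set_lebesgue_integral_def
  proof (rule integral_FTC_atLeastAtMost[OF assms])
    fix s :: real
    show "(G has_vector_derivative (t - s) ^ q) (at s within {0..t})"
      unfolding has_real_derivative_iff_has_vector_derivative[symmetric] G_def
      using DERIV_minus[OF DERIV_cdivide[OF power_diff_has_derivative[of t q s "{0..t}"], of "real (Suc q)"]]
      by (simp del: of_nat_Suc power_Suc)
  qed (intro continuous_intros)
  then show ?thesis by (simp add: G_def)
qed

lemma iterated_integral_const:
  assumes "0 \<le> t"
  shows "iterated_integral q (\<lambda>_. c) t = c * t ^ q / fact q"
proof (cases q)
  case (Suc k)
  have "(LBINT s:{0..t}. (t - s) ^ k * c) = c * (t ^ Suc k / real (Suc k))"
    using kernel_integral[OF assms, of k] by simp
  then show ?thesis by (simp add: Suc iterated_integral_Suc)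
qed simp

text \<open>The kernel is at most 1 on the unit interval, so a single integration turns an L1 bound
  into a uniform one. For \<open>m \<ge> 2\<close> this yields pointwise control of block remainders
  from their energy.\<close>

lemma iterated_integral_abs_le_integral:
  assumes "bounded_measurable b" "0 \<le> t" "t \<le> 1"
  shows "\<bar>iterated_integral (Suc q) b t\<bar> \<le> (LINT s|unit_lborel. \<bar>b s\<bar>)"
proof -
  have bm: "bounded_measurable (\<lambda>s. \<bar>b s\<bar>)"
    using assms(1) unfolding bounded_measurable_def by auto
  have "\<bar>LBINT s:{0..t}. (t - s) ^ q * b s\<bar> \<le> (LBINT s:{0..t}. \<bar>(t - s) ^ q * b s\<bar>)"
    using set_integral_norm_bound[OF kernel_set_integrable[OF assms(1) order.refl assms(3), of t q]] by simp
  also have "\<dots> \<le> (LBINT s:{0..t}. \<bar>b s\<bar>)"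
  proof (rule set_integral_mono)
    show "set_integrable lborel {0..t} (\<lambda>s. \<bar>(t - s) ^ q * b s\<bar>)"
      using set_integrable_abs[OF kernel_set_integrable[OF assms(1) order.refl assms(3), of t q]] .
    show "set_integrable lborel {0..t} (\<lambda>s. \<bar>b s\<bar>)"
      using bounded_measurable_set_integrable[OF bm order.refl assms(3)] .
    show "\<bar>(t - s) ^ q * b s\<bar> \<le> \<bar>b s\<bar>" if "s \<in> {0..t}" for s
      using that assms by (auto simp: abs_mult intro!: mult_left_le_one_le power_le_one)
  qed
  also have "\<dots> \<le> (LBINT s:{0..1}. \<bar>b s\<bar>)"
    unfolding set_lebesgue_integral_def
  proof (rule integral_mono)
    show "integrable lborel (\<lambda>x. indicat_real {0..t} x *\<^sub>R \<bar>b x\<bar>)"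
      using bounded_measurable_set_integrable[OF bm order.refl assms(3)] by (simp add: set_integrable_def)
    show "integrable lborel (\<lambda>x. indicat_real {0..1} x *\<^sub>R \<bar>b x\<bar>)"
      using bounded_measurable_set_integrable[OF bm order.refl order.refl] by (simp add: set_integrable_def)
    show "indicat_real {0..t} x *\<^sub>R \<bar>b x\<bar> \<le> indicat_real {0..1} x *\<^sub>R \<bar>b x\<bar>" for x
      using assms by (auto simp: indicator_def)
  qed
  finally have *: "\<bar>LBINT s:{0..t}. (t - s) ^ q * b s\<bar> \<le> (LINT s|unit_lborel. \<bar>b s\<bar>)"
    by (simp add: unit_lborel_set_integral)
  have "\<bar>iterated_integral (Suc q) b t\<bar> = (1 / fact q) * \<bar>LBINT s:{0..t}. (t - s) ^ q * b s\<bar>"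
    by (simp add: iterated_integral_Suc abs_mult)
  also have "\<dots> \<le> 1 * (LINT s|unit_lborel. \<bar>b s\<bar>)"
    by (rule mult_mono[OF _ *]) (auto simp: divide_le_eq fact_ge_1)
  finally show ?thesis by simp
qed

lemma iterated_integral_abs_le:
  assumes "bounded_measurable b" "\<And>s. s \<in> {0..1} \<Longrightarrow> \<bar>b s\<bar> \<le> C" "0 \<le> t" "t \<le> 1"
  shows "\<bar>iterated_integral q b t\<bar> \<le> C"
proof (cases q)
  case 0
  then show ?thesis using assms by simp
next
  case (Suc k)
  interpret prob_space unit_lborel by (rule prob_space_unit_lborel)
  have bm: "bounded_measurable (\<lambda>s. \<bar>b s\<bar>)"
    using assms(1) unfolding bounded_measurable_def by auto
  have "(LINT s|unit_lborel. \<bar>b s\<bar>) \<le> (LINT s|unit_lborel. C)"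
    using assms(2) by (intro integral_mono bounded_measurable_integrable bm) (auto simp: bounded_measurable_const)
  then have "(LINT s|unit_lborel. \<bar>b s\<bar>) \<le> C" by simp
  then show ?thesis
    using iterated_integral_abs_le_integral[OF assms(1,3,4), of k] Suc by simp
qed

text \<open>A Taylor expansion at the left end of a block. Before \<open>a\<close>, the binomial
  theorem for \<open>(h * s + (a - u)) ^ k\<close> produces the lower iterated integrals at
  \<open>a\<close> as coefficients; after \<open>a\<close>, rescaling produces \<open>h ^ q\<close>.
  Subtracting \<open>b a\<close> makes the remainder depend only on increments inside the
  block.\<close>

lemma iterated_integral_block:
  assumes b: "bounded_measurable b" and a: "0 \<le> a" and h: "0 < h" and s: "0 \<le> s" "s \<le> 1"
    and ah: "a + h \<le> 1"
  shows "iterated_integral q b (a + h * s) =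
    (\<Sum>l\<le>q. (h * s) ^ l / fact l * iterated_integral (q - l) b a)
    + h ^ q * iterated_integral q (\<lambda>x. b (a + h * x) - b a) s"
proof (cases q)
  case 0
  then show ?thesis by simp
next
  case (Suc k)
  let ?t = "a + h * s"
  have hs: "h * s \<le> h" using h s by (auto intro: mult_left_le)
  have t1: "?t \<le> 1" using hs ah by linarith
  have at: "a \<le> ?t" using h s by simp
  have int1: "set_integrable lborel {0..a} (\<lambda>u. (?t - u) ^ k * b u)"
    and int2: "set_integrable lborel {a..?t} (\<lambda>u. (?t - u) ^ k * b u)"
    using kernel_set_integrable[OF b] a at t1 by auto
  have "(LBINT u:{0..?t}. (?t - u) ^ k * b u)
      = (LBINT u:{0..a}. (?t - u) ^ k * b u) + (LBINT u:{a..?t}. (?t - u) ^ k * b u)"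
  proof -
    have "{0..?t} = {0..a} \<union> {a..?t}" using a at by auto
    moreover have "(LBINT u:{0..a} \<union> {a..?t}. (?t - u) ^ k * b u)
      = (LBINT u:{0..a}. (?t - u) ^ k * b u) + (LBINT u:{a..?t}. (?t - u) ^ k * b u)"
    proof (rule set_integral_Un_AE[OF _ _ _ int1 int2])
      have "AE x in lborel. x \<noteq> a" by (rule AE_lborel_singleton)
      then show "AE x in lborel. \<not> (x \<in> {0..a} \<and> x \<in> {a..?t})"
        by eventually_elim auto
    qed auto
    ultimately show ?thesis by simp
  qed
  moreover have "(LBINT u:{0..a}. (?t - u) ^ k * b u)
      = fact k * (\<Sum>l\<le>k. (h * s) ^ l / fact l * iterated_integral (Suc k - l) b a)"
  proof -
    have "(?t - u) ^ k * b u
        = (\<Sum>l\<le>k. (of_nat (k choose l) * (h * s) ^ l) * ((a - u) ^ (k - l) * b u))" for u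
    proof -
      have "(h * s + (a - u)) ^ k = (\<Sum>l\<le>k. of_nat (k choose l) * (h * s) ^ l * (a - u) ^ (k - l))"
        by (rule binomial_ring)
      moreover have "?t - u = h * s + (a - u)" by simp
      ultimately show ?thesis by (simp only: sum_distrib_right mult.assoc)
    qed
    then have "(LBINT u:{0..a}. (?t - u) ^ k * b u)
        = (LBINT u:{0..a}. (\<Sum>l\<le>k. (of_nat (k choose l) * (h * s) ^ l) * ((a - u) ^ (k - l) * b u)))"
      by (simp only:)
    also have "\<dots> = (\<Sum>l\<le>k. LBINT u:{0..a}. (of_nat (k choose l) * (h * s) ^ l) * ((a - u) ^ (k - l) * b u))"
      unfolding set_lebesgue_integral_def scaleR_sum_right
    proof (rule Bochner_Integration.integral_sum)
      fix l
      have "set_integrable lborel {0..a} (\<lambda>u. (a - u) ^ (k - l) * b u)"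
        using a ah h by (intro kernel_set_integrable b) auto
      then have "set_integrable lborel {0..a} (\<lambda>u. (of_nat (k choose l) * (h * s) ^ l) * ((a - u) ^ (k - l) * b u))"
        by (rule set_integrable_mult_right)
      then show "integrable lborel (\<lambda>u. indicator {0..a} u *\<^sub>R
          ((of_nat (k choose l) * (h * s) ^ l) * ((a - u) ^ (k - l) * b u)))"
        by (simp only: set_integrable_def)
    qed
    also have "\<dots> = (\<Sum>l\<le>k. (of_nat (k choose l) * (h * s) ^ l) * (fact (k - l) * iterated_integral (Suc (k - l)) b a))"
    proof (rule sum.cong[OF refl])
      fix l
      have "(LBINT u:{0..a}. (a - u) ^ (k - l) * b u) = fact (k - l) * iterated_integral (Suc (k - l)) b a"
        unfolding iterated_integral_Suc by simp
      then show "(LBINT u:{0..a}. (of_nat (k choose l) * (h * s) ^ l) * ((a - u) ^ (k - l) * b u))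
          = (of_nat (k choose l) * (h * s) ^ l) * (fact (k - l) * iterated_integral (Suc (k - l)) b a)"
        unfolding set_integral_mult_right by (simp only:)
    qed
    also have "\<dots> = (\<Sum>l\<le>k. fact k * ((h * s) ^ l / fact l * iterated_integral (Suc k - l) b a))"
    proof (rule sum.cong[OF refl])
      fix l assume "l \<in> {..k}"
      then have l: "l \<le> k" by simp
      have "of_nat (k choose l) * fact (k - l) = (fact k / fact l :: real)"
        using binomial_fact[OF l, where 'a = real] by (simp add: field_simps)
      then have "of_nat (k choose l) * fact (k - l) * ((h * s) ^ l * iterated_integral (Suc (k - l)) b a)
         = fact k / fact l * ((h * s) ^ l * iterated_integral (Suc (k - l)) b a)"
        by (simp only:)
      then show "(of_nat (k choose l) * (h * s) ^ l) * (fact (k - l) * iterated_integral (Suc (k - l)) b a)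
        = fact k * ((h * s) ^ l / fact l * iterated_integral (Suc k - l) b a)"
        unfolding Suc_diff_le[OF l] by (simp only: mult_ac times_divide_eq_left times_divide_eq_right)
    qed
    finally show ?thesis by (simp only: sum_distrib_left)
  qed
  \<comment> \<open>Substitution of \<open>a + h * x\<close>: \<open>h ^ k\<close> comes from the
    kernel and one more \<open>h\<close> from the Jacobian.\<close>
  moreover have "(LBINT u:{a..?t}. (?t - u) ^ k * b u) = h ^ Suc k * (LBINT x:{0..s}. (s - x) ^ k * b (a + h * x))"
  proof -
    have "(LBINT u:{a..?t}. (?t - u) ^ k * b u)
        = (\<integral>u. indicator {a..?t} u * ((?t - u) ^ k * b u) \<partial>lborel)"
      by (simp add: set_lebesgue_integral_def)
    also have "\<dots> = h * (\<integral>x. indicator {a..?t} (a + h * x) * ((?t - (a + h * x)) ^ k * b (a + h * x)) \<partial>lborel)"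
      using lborel_integral_real_affine[of h "\<lambda>u. indicator {a..?t} u * ((?t - u) ^ k * b u)" a] h by simp
    also have "\<dots> = h * (\<integral>x. h ^ k * (indicator {0..s} x * ((s - x) ^ k * b (a + h * x))) \<partial>lborel)"
    proof -
      have "indicator {a..?t} (a + h * x) * ((?t - (a + h * x)) ^ k * b (a + h * x))
        = h ^ k * (indicat_real {0..s} x * ((s - x) ^ k * b (a + h * x)))" for x
      proof -
        have "?t - (a + h * x) = h * (s - x)" by (simp add: algebra_simps)
        moreover have "indicator {a..?t} (a + h * x) = indicat_real {0..s} x"
          using h by (simp add: indicator_def zero_le_mult_iff)
        ultimately show ?thesis by (simp only: power_mult_distrib mult_ac)
      qed
      then show ?thesis by (simp only:)
    qed
    also have "\<dots> = h ^ Suc k * (\<integral>x. indicator {0..s} x * ((s - x) ^ k * b (a + h * x)) \<partial>lborel)"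
      by (simp only: integral_mult_right_zero power_Suc mult.assoc)
    finally show ?thesis by (simp only: set_lebesgue_integral_def real_scaleR_def)
  qed
  ultimately have eq: "iterated_integral (Suc k) b ?t =
      (\<Sum>l\<le>k. (h * s) ^ l / fact l * iterated_integral (Suc k - l) b a)
      + h ^ Suc k * iterated_integral (Suc k) (\<lambda>x. b (a + h * x)) s"
    unfolding iterated_integral_Suc[of k] by (simp add: distrib_left)
  \<comment> \<open>The constant taken out here is the missing term \<open>l = Suc k\<close> of the
    expansion.\<close>
  have "iterated_integral (Suc k) (\<lambda>x. b (a + h * x) - b a) s
      = iterated_integral (Suc k) (\<lambda>x. b (a + h * x)) s - b a * s ^ Suc k / fact (Suc k)"
    using iterated_integral_diff[OF bounded_measurable_affine[OF b a less_imp_le[OF h] ah]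
        bounded_measurable_const[of "b a"] s(2), of "Suc k"] iterated_integral_const[OF s(1), of "Suc k" "b a"]
    by simp
  then show ?thesis
    unfolding Suc eq by (simp add: right_diff_distrib power_mult_distrib)
qed

text \<open>With at least one integration, every term of the block expansion other than
  \<open>l = 0\<close> carries a factor \<open>h\<close>, which gives a Lipschitz bound.\<close>

lemma iterated_integral_continuous:
  assumes "continuous_on {0..1} b"
  shows "continuous_on {0..1} (iterated_integral q b)"
proof (cases q)
  case 0
  have "iterated_integral 0 b = b" by (rule ext) simp
  then show ?thesis using assms 0 by simp
next
  case (Suc k)
  note bm = bounded_measurable_continuous[OF assms]
  obtain C where C: "\<And>t. t \<in> {0..1} \<Longrightarrow> \<bar>b t\<bar> \<le> C"
    using bm unfolding bounded_measurable_def by blast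
  have C0: "0 \<le> C" using C[of 0] by simp
  define K where "K = (\<Sum>l\<in>{1..q}. C) + 2 * C"
  have K0: "0 \<le> K" using C0 by (simp add: K_def)
  have *: "\<bar>iterated_integral q b t - iterated_integral q b a\<bar> \<le> K * (t - a)"
    if "0 \<le> a" "a < t" "t \<le> 1" for a t
  proof -
    let ?h = "t - a"
    have eq: "iterated_integral q b t =
      (\<Sum>l\<le>q. ?h ^ l / fact l * iterated_integral (q - l) b a)
      + ?h ^ q * iterated_integral q (\<lambda>x. b (a + ?h * x) - b a) 1"
      using iterated_integral_block[OF bm that(1), of ?h 1 q] that by simp
    have "(\<Sum>l\<le>q. ?h ^ l / fact l * iterated_integral (q - l) b a)
      = iterated_integral q b a + (\<Sum>l\<in>{1..q}. ?h ^ l / fact l * iterated_integral (q - l) b a)"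
      by (simp add: atMost_atLeast0 sum.atLeast_Suc_atMost)
    moreover have "\<bar>\<Sum>l\<in>{1..q}. ?h ^ l / fact l * iterated_integral (q - l) b a\<bar> \<le> (\<Sum>l\<in>{1..q}. ?h * C)"
    proof (rule order.trans[OF sum_abs sum_mono])
      fix l assume "l \<in> {1..q}"
      then obtain j where j: "l = Suc j" by (cases l) auto
      have "?h ^ l / fact l \<le> ?h ^ l" using that by (simp add: divide_le_eq fact_ge_1 mult_le_cancel_left1)
      also have "\<dots> \<le> ?h" using that by (simp add: j mult_left_le power_le_one)
      finally have 1: "?h ^ l / fact l \<le> ?h" .
      have 2: "\<bar>iterated_integral (q - l) b a\<bar> \<le> C"
        using iterated_integral_abs_le[OF bm C] that by auto
      show "\<bar>?h ^ l / fact l * iterated_integral (q - l) b a\<bar> \<le> ?h * C"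
        unfolding abs_mult using 1 2 that by (intro mult_mono) auto
    qed
    moreover have "\<bar>?h ^ q * iterated_integral q (\<lambda>x. b (a + ?h * x) - b a) 1\<bar> \<le> ?h * (2 * C)"
      unfolding abs_mult
    proof (rule mult_mono)
      show "\<bar>?h ^ q\<bar> \<le> ?h" using that by (simp add: Suc mult_left_le power_le_one)
      show "\<bar>iterated_integral q (\<lambda>x. b (a + ?h * x) - b a) 1\<bar> \<le> 2 * C"
      proof (rule iterated_integral_abs_le)
        show "bounded_measurable (\<lambda>x. b (a + ?h * x) - b a)"
          by (rule bounded_measurable_diff[OF bounded_measurable_affine[OF bm] bounded_measurable_const])
             (use that in auto)
        fix s :: real assume s: "s \<in> {0..1}"
        have "?h * s \<le> ?h" "0 \<le> ?h * s" using s that by (auto intro: mult_left_le)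
        then have "a + ?h * s \<le> 1" "0 \<le> a + ?h * s" using that by linarith+
        then have "a + ?h * s \<in> {0..1}" by simp
        then show "\<bar>b (a + ?h * s) - b a\<bar> \<le> 2 * C"
          using C[of "a + ?h * s"] C[of a] that by auto
      qed auto
    qed (use that in auto)
    ultimately have "\<bar>iterated_integral q b t - iterated_integral q b a\<bar> \<le> (\<Sum>l\<in>{1..q}. ?h * C) + ?h * (2 * C)"
      unfolding eq by linarith
    then show ?thesis by (simp add: K_def algebra_simps)
  qed
  have "K-lipschitz_on {0..1} (iterated_integral q b)"
  proof (rule lipschitz_onI)
    fix x y :: real assume "x \<in> {0..1}" "y \<in> {0..1}"
    then show "dist (iterated_integral q b x) (iterated_integral q b y) \<le> K * dist x y"
      using *[of x y] *[of y x] by (cases x y rule: linorder_cases) (auto simp: dist_real_def abs_minus_commute)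
  qed (rule K0)
  then show ?thesis by (rule lipschitz_on_continuous_on)
qed

text \<open>Integration by parts.\<close>

lemma iterated_integral_poly_derivative:
  assumes "poly U 0 = 0"
  shows "iterated_integral k (poly U) 1 = (LINT s|unit_lborel. (1 - s) ^ k / fact k * poly (pderiv U) s)"
proof (cases k)
  case 0
  have "(LBINT s:{0..1}. poly (pderiv U) s) = poly U 1 - poly U 0"
    unfolding set_lebesgue_integral_def
    by (rule integral_FTC_atLeastAtMost)
       (auto intro!: poly_DERIV[THEN has_field_derivative_at_within] continuous_intros simp: has_real_derivative_iff_has_vector_derivative[symmetric])
  then show ?thesis using 0 assms by (simp add: unit_lborel_set_integral)
next
  case (Suc j)
  \<comment> \<open>This product vanishes at 0 because \<open>U\<close> does and at 1 because
    \<open>k > 0\<close>, so there are no boundary terms.\<close>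
  define G where "G s = (1 - s) ^ k / fact k * poly U s" for s :: real
  have "(LBINT s:{0..1}. (1 - s) ^ k / fact k * poly (pderiv U) s - (1 - s) ^ j / fact j * poly U s) = G 1 - G 0"
    unfolding set_lebesgue_integral_def
  proof (rule integral_FTC_atLeastAtMost)
    fix s :: real
    from DERIV_cdivide[OF power_diff_has_derivative[of 1 j s "{0..1}"], of "fact (Suc j)"]
    have "((\<lambda>s. (1 - s) ^ k / fact k) has_real_derivative - (real (Suc j) * (1 - s) ^ j) / fact k) (at s within {0..1})"
      unfolding Suc .
    from DERIV_mult[OF this has_field_derivative_at_within[OF poly_DERIV[of U s]]]
    have "(G has_real_derivative (- (real (Suc j) * (1 - s) ^ j) / fact k * poly U s + poly (pderiv U) s * ((1 - s) ^ k / fact k))) (at s within {0..1})"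
      unfolding G_def .
    moreover have "- (real (Suc j) * (1 - s) ^ j) / fact k = - ((1 - s) ^ j / fact j)"
      unfolding Suc by (simp del: of_nat_Suc)
    ultimately have "(G has_real_derivative (- ((1 - s) ^ j / fact j) * poly U s + poly (pderiv U) s * ((1 - s) ^ k / fact k))) (at s within {0..1})"
      by (simp only:)
    then show "(G has_vector_derivative ((1 - s) ^ k / fact k * poly (pderiv U) s - (1 - s) ^ j / fact j * poly U s)) (at s within {0..1})"
      by (simp add: has_real_derivative_iff_has_vector_derivative mult.commute)
  qed (auto intro!: continuous_intros)
  moreover have "G 1 - G 0 = 0" using assms by (simp add: G_def Suc)
  moreover have "(LBINT s:{0..1}. (1 - s) ^ k / fact k * poly (pderiv U) s - (1 - s) ^ j / fact j * poly U s)
     = (LBINT s:{0..1}. (1 - s) ^ k / fact k * poly (pderiv U) s) - (LBINT s:{0..1}. (1 - s) ^ j / fact j * poly U s)"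
    by (intro set_integral_diff bounded_measurable_set_integrable bounded_measurable_continuous continuous_intros) auto
  ultimately show ?thesis
    by (simp add: unit_lborel_set_integral Suc iterated_integral_Suc)
qed

section \<open>Logarithms of Hoelder densities\<close>

text \<open>A recursive form of the Hoelder space with fractional part 1/2, suited to inductive
  closure proofs for products, reciprocals and logarithms. Derivatives are one-sided at the end
  points.\<close>

fun holder_class :: "nat \<Rightarrow> (real \<Rightarrow> real) \<Rightarrow> bool" where
  "holder_class 0 f \<longleftrightarrow> (\<exists>L. \<forall>s\<in>{0..1}. \<forall>t\<in>{0..1}. \<bar>f s - f t\<bar> \<le> L * sqrt \<bar>s - t\<bar>)"
| "holder_class (Suc k) f \<longleftrightarrow>
     (\<exists>f'. (\<forall>t\<in>{0..1}. (f has_real_derivative f' t) (at t within {0..1})) \<and> holder_class k f')"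

lemma holder_class_SucD:
  "holder_class (Suc k) f \<Longrightarrow>
    \<exists>f'. (\<forall>t\<in>{0..1}. (f has_real_derivative f' t) (at t within {0..1})) \<and> holder_class k f'"
  by (rule holder_class.simps(2)[THEN iffD1])

lemma holder_class_SucI:
  assumes "\<And>t. t \<in> {0..1} \<Longrightarrow> (f has_real_derivative f' t) (at t within {0..1})" "holder_class k f'"
  shows "holder_class (Suc k) f"
  by (rule holder_class.simps(2)[THEN iffD2], rule exI[of _ f']) (use assms in auto)

lemma sqrt_holder_continuous:
  assumes "\<And>s t. s \<in> {0..1} \<Longrightarrow> t \<in> {0..1} \<Longrightarrow> \<bar>f s - f t\<bar> \<le> L * sqrt \<bar>s - t\<bar>"
  shows "continuous_on {0..1} (f :: real \<Rightarrow> real)"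
  unfolding continuous_on_def
proof (intro ballI)
  fix x :: real assume x: "x \<in> {0..1}"
  have "((\<lambda>s. L * sqrt \<bar>s - x\<bar>) \<longlongrightarrow> L * sqrt \<bar>x - x\<bar>) (at x within {0..1})"
    by (intro tendsto_intros)
  then have "((\<lambda>s. L * sqrt \<bar>s - x\<bar>) \<longlongrightarrow> 0) (at x within {0..1})" by simp
  then have "((\<lambda>s. f s - f x) \<longlongrightarrow> 0) (at x within {0..1})"
    by (rule Lim_null_comparison[rotated])
       (use assms x in \<open>auto simp: eventually_at_filter\<close>)
  then show "(f \<longlongrightarrow> f x) (at x within {0..1})"
    by (simp add: LIM_zero_iff)
qed

lemma holder_class_continuous: "holder_class k f \<Longrightarrow> continuous_on {0..1} f"
proof (cases k)
  case 0
  assume "holder_class k f"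
  then show ?thesis using 0 sqrt_holder_continuous by (metis holder_class.simps(1))
next
  case (Suc n)
  assume "holder_class k f"
  then have "holder_class (Suc n) f" using Suc by simp
  then obtain f' where "\<forall>t\<in>{0..1}. (f has_real_derivative f' t) (at t within {0..1})"
    by (elim holder_class_SucD[THEN exE] conjE)
  from bspec[OF this] show ?thesis by (rule DERIV_continuous_on)
qed

lemma holder_class_bounded:
  assumes "holder_class k f"
  obtains C where "0 \<le> C" "\<And>t. t \<in> {0..1} \<Longrightarrow> \<bar>f t\<bar> \<le> C"
proof -
  from bounded_measurable_continuous[OF holder_class_continuous[OF assms]]
  obtain C where C: "\<And>t. t \<in> {0..1} \<Longrightarrow> \<bar>f t\<bar> \<le> C" unfolding bounded_measurable_def by blast
  from C[of 0] have "0 \<le> C" by simp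
  with C that show thesis by blast
qed

lemma holder_class_cong:
  assumes "\<And>t. t \<in> {0..1} \<Longrightarrow> f t = g t"
  shows "holder_class k f \<longleftrightarrow> holder_class k g"
proof (cases k)
  case 0
  then show ?thesis using assms by simp
next
  case (Suc n)
  have "(f has_real_derivative D) (at t within {0..1}) \<longleftrightarrow> (g has_real_derivative D) (at t within {0..1})"
    if "t \<in> {0..1}" for t D
    using that assms by (intro has_field_derivative_cong_eventually) (auto simp: eventually_at_filter)
  then show ?thesis using Suc by simp
qed

text \<open>At the base a bounded derivative gives a Lipschitz bound, and a number in the unit
  interval is at most its square root.\<close>

lemma holder_class_Suc: "holder_class (Suc k) f \<Longrightarrow> holder_class k f"
proof (induction k arbitrary: f)
  case 0
  then obtain f' where d: "\<forall>t\<in>{0..1}. (f has_real_derivative f' t) (at t within {0..1})"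
    and h: "holder_class 0 f'" by (elim holder_class_SucD[THEN exE] conjE)
  from holder_class_bounded[OF h] obtain C where C: "0 \<le> C" "\<And>t. t \<in> {0..1} \<Longrightarrow> \<bar>f' t\<bar> \<le> C" by blast
  have "\<bar>f s - f t\<bar> \<le> C * sqrt \<bar>s - t\<bar>" if "s \<in> {0..1}" "t \<in> {0..1}" for s t
  proof -
    have "norm (f s - f t) \<le> C * norm (s - t)"
      by (rule field_differentiable_bound[of "{0..1}" f f']) (use bspec[OF d] C that in auto)
    also have "norm (s - t) \<le> sqrt \<bar>s - t\<bar>"
    proof (rule real_le_rsqrt)
      show "(norm (s - t))\<^sup>2 \<le> \<bar>s - t\<bar>"
      proof -
        have "\<bar>s - t\<bar> \<le> 1" using that by auto
        then have "\<bar>s - t\<bar> * \<bar>s - t\<bar> \<le> \<bar>s - t\<bar> * 1" by (intro mult_left_mono) auto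
        then show ?thesis by (simp add: power2_eq_square)
      qed
    qed
    finally show ?thesis using C(1) by (simp add: mult_left_mono)
  qed
  then show ?case unfolding holder_class.simps by blast
next
  case (Suc k)
  from holder_class_SucD[OF Suc.prems] obtain f'
    where "\<forall>t\<in>{0..1}. (f has_real_derivative f' t) (at t within {0..1})" "holder_class (Suc k) f'"
    by (elim exE conjE)
  with Suc.IH[of f'] show ?case by (intro holder_class_SucI[of f f']) auto
qed

lemma holder_class_add: "holder_class k f \<Longrightarrow> holder_class k g \<Longrightarrow> holder_class k (\<lambda>t. f t + g t)"
proof (induction k arbitrary: f g)
  case 0
  then obtain L L' where L: "\<And>s t. s\<in>{0..1} \<Longrightarrow> t\<in>{0..1} \<Longrightarrow> \<bar>f s - f t\<bar> \<le> L * sqrt \<bar>s - t\<bar>"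
    "\<And>s t. s\<in>{0..1} \<Longrightarrow> t\<in>{0..1} \<Longrightarrow> \<bar>g s - g t\<bar> \<le> L' * sqrt \<bar>s - t\<bar>"
    unfolding holder_class.simps by blast
  have "\<bar>(f s + g s) - (f t + g t)\<bar> \<le> (L + L') * sqrt \<bar>s - t\<bar>" if "s \<in> {0..1}" "t \<in> {0..1}" for s t
    using L(1)[OF that] L(2)[OF that] unfolding distrib_right by linarith
  then show ?case unfolding holder_class.simps by blast
next
  case (Suc k)
  from holder_class_SucD[OF Suc.prems(1)] obtain f'
    where f': "\<forall>t\<in>{0..1}. (f has_real_derivative f' t) (at t within {0..1})" "holder_class k f'"
    by (elim exE conjE)
  from holder_class_SucD[OF Suc.prems(2)] obtain g'
    where g': "\<forall>t\<in>{0..1}. (g has_real_derivative g' t) (at t within {0..1})" "holder_class k g'"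
    by (elim exE conjE)
  note * = bspec[OF f'(1)] f'(2) bspec[OF g'(1)] g'(2)
  have "((\<lambda>t. f t + g t) has_real_derivative f' t + g' t) (at t within {0..1})" if "t \<in> {0..1}" for t
    using DERIV_add[OF *(1)[OF that] *(3)[OF that]] .
  moreover have "holder_class k (\<lambda>t. f' t + g' t)" using Suc.IH * by blast
  ultimately show ?case by (rule holder_class_SucI)
qed

lemma holder_class_mult: "holder_class k f \<Longrightarrow> holder_class k g \<Longrightarrow> holder_class k (\<lambda>t. f t * g t)"
proof (induction k arbitrary: f g)
  case 0
  then obtain L L' where L: "\<And>s t. s\<in>{0..1} \<Longrightarrow> t\<in>{0..1} \<Longrightarrow> \<bar>f s - f t\<bar> \<le> L * sqrt \<bar>s - t\<bar>"
    "\<And>s t. s\<in>{0..1} \<Longrightarrow> t\<in>{0..1} \<Longrightarrow> \<bar>g s - g t\<bar> \<le> L' * sqrt \<bar>s - t\<bar>"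
    unfolding holder_class.simps by blast
  from holder_class_bounded[OF 0(1)] obtain C where C: "0 \<le> C" "\<And>t. t\<in>{0..1} \<Longrightarrow> \<bar>f t\<bar> \<le> C" by blast
  from holder_class_bounded[OF 0(2)] obtain C' where C': "0 \<le> C'" "\<And>t. t\<in>{0..1} \<Longrightarrow> \<bar>g t\<bar> \<le> C'" by blast
  have "\<bar>f s * g s - f t * g t\<bar> \<le> (C * L' + C' * L) * sqrt \<bar>s - t\<bar>" if st: "s \<in> {0..1}" "t \<in> {0..1}" for s t
  proof -
    have "f s * g s - f t * g t = f s * (g s - g t) + g t * (f s - f t)" by (simp add: algebra_simps)
    then have "\<bar>f s * g s - f t * g t\<bar> \<le> \<bar>f s\<bar> * \<bar>g s - g t\<bar> + \<bar>g t\<bar> * \<bar>f s - f t\<bar>"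
      by (metis abs_mult abs_triangle_ineq)
    also have "\<dots> \<le> C * (L' * sqrt \<bar>s - t\<bar>) + C' * (L * sqrt \<bar>s - t\<bar>)"
      using C C' L st by (intro add_mono mult_mono) auto
    finally show ?thesis by (simp add: algebra_simps)
  qed
  then show ?case unfolding holder_class.simps by blast
next
  case (Suc k)
  from holder_class_SucD[OF Suc.prems(1)] obtain f'
    where f': "\<forall>t\<in>{0..1}. (f has_real_derivative f' t) (at t within {0..1})" "holder_class k f'"
    by (elim exE conjE)
  from holder_class_SucD[OF Suc.prems(2)] obtain g'
    where g': "\<forall>t\<in>{0..1}. (g has_real_derivative g' t) (at t within {0..1})" "holder_class k g'"
    by (elim exE conjE)
  note * = bspec[OF f'(1)] f'(2) bspec[OF g'(1)] g'(2)
  have "((\<lambda>t. f t * g t) has_real_derivative f' t * g t + g' t * f t) (at t within {0..1})" if "t \<in> {0..1}" for t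
    using DERIV_mult[OF *(1)[OF that] *(3)[OF that]] .
  moreover have "holder_class k (\<lambda>t. f' t * g t + g' t * f t)"
    using Suc.IH * holder_class_Suc[OF Suc.prems(1)] holder_class_Suc[OF Suc.prems(2)]
    by (intro holder_class_add) auto
  ultimately show ?case by (rule holder_class_SucI)
qed

lemma holder_class_const: "holder_class k (\<lambda>_. c)"
proof (induction k arbitrary: c)
  case 0
  show ?case by (rule holder_class.simps(1)[THEN iffD2], rule exI[of _ 0]) simp
next
  case (Suc k)
  show ?case
    by (rule holder_class.simps(2)[THEN iffD2], rule exI[of _ "\<lambda>_. 0"])
       (intro conjI ballI DERIV_const Suc)
qed

text \<open>The derivative of the reciprocal contains the reciprocal again, but only one class
  lower, where the induction hypothesis applies.\<close>

lemma holder_class_inverse: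
  assumes "0 < a" "\<And>t. t \<in> {0..1} \<Longrightarrow> a \<le> f t"
  shows "holder_class k f \<Longrightarrow> holder_class k (\<lambda>t. 1 / f t)"
proof (induction k)
  case 0
  then obtain L where L: "\<And>s t. s\<in>{0..1} \<Longrightarrow> t\<in>{0..1} \<Longrightarrow> \<bar>f s - f t\<bar> \<le> L * sqrt \<bar>s - t\<bar>"
    unfolding holder_class.simps by blast
  have "\<bar>1 / f s - 1 / f t\<bar> \<le> (L / (a * a)) * sqrt \<bar>s - t\<bar>" if st: "s \<in> {0..1}" "t \<in> {0..1}" for s t
  proof -
    have pos: "0 < f s" "0 < f t" using less_le_trans[OF assms(1) assms(2)] st by auto
    then have "1 / f s - 1 / f t = (f t - f s) / (f s * f t)" by (simp add: field_simps)
    then have "\<bar>1 / f s - 1 / f t\<bar> = \<bar>f s - f t\<bar> / (f s * f t)" using pos by (simp add: abs_mult)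
    also have "\<dots> \<le> (L * sqrt \<bar>s - t\<bar>) / (a * a)"
      using L[OF st] assms st pos by (intro frac_le mult_mono mult_pos_pos) auto
    finally show ?thesis by simp
  qed
  then show ?case unfolding holder_class.simps by blast
next
  case (Suc k)
  from Suc.prems obtain f'
    where f': "\<forall>t\<in>{0..1}. (f has_real_derivative f' t) (at t within {0..1})" "holder_class k f'"
    by (elim holder_class_SucD[THEN exE] conjE)
  note * = bspec[OF f'(1)] f'(2)
  have IH: "holder_class k (\<lambda>t. 1 / f t)" using Suc holder_class_Suc by blast
  have "((\<lambda>t. 1 / f t) has_real_derivative -1 * (f' t * (1 / f t * (1 / f t)))) (at t within {0..1})" if "t \<in> {0..1}" for t
  proof -
    have "f t \<noteq> 0" using assms that by (metis not_le)
    from DERIV_inverse'[OF *(1)[OF that] this] show ?thesis by (simp add: divide_inverse mult_ac)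
  qed
  moreover have "holder_class k (\<lambda>t. -1 * (f' t * (1 / f t * (1 / f t))))"
    using * IH by (intro holder_class_mult holder_class_const) auto
  ultimately show ?case by (rule holder_class_SucI)
qed

text \<open>For \<open>k = 0\<close>, the inequality \<open>ln x \<le> x - 1\<close> at the quotient
  of two values transfers the modulus of continuity. For larger \<open>k\<close> the derivative
  \<open>f' / f\<close> is a product with a reciprocal, so no induction is involved.\<close>

lemma holder_class_ln:
  assumes "0 < a" "\<And>t. t \<in> {0..1} \<Longrightarrow> a \<le> f t" "holder_class k f"
  shows "holder_class k (\<lambda>t. ln (f t))"
proof -
  have pos: "0 < f t" if "t \<in> {0..1}" for t using less_le_trans[OF assms(1) assms(2)] that by auto
  show ?thesis
  proof (cases k)
    case 0
    with assms(3) have "holder_class 0 f" by simp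
    then obtain L where L: "\<And>s t. s\<in>{0..1} \<Longrightarrow> t\<in>{0..1} \<Longrightarrow> \<bar>f s - f t\<bar> \<le> L * sqrt \<bar>s - t\<bar>"
      unfolding holder_class.simps by blast
    have one: "ln (f s) - ln (f t) \<le> (L / a) * sqrt \<bar>s - t\<bar>" if st: "s \<in> {0..1}" "t \<in> {0..1}" for s t
    proof -
      have "ln (f s) - ln (f t) = ln (f s / f t)" using pos[OF st(1)] pos[OF st(2)] by (simp add: ln_div)
      also have "\<dots> \<le> f s / f t - 1" using pos[OF st(1)] pos[OF st(2)] by (intro ln_le_minus_one) auto
      also have "\<dots> = (f s - f t) / f t" using pos[OF st(2)] by (simp add: field_simps)
      also have "\<dots> \<le> \<bar>f s - f t\<bar> / f t" using pos[OF st(2)] by (intro divide_right_mono) auto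
      also have "\<dots> \<le> (L * sqrt \<bar>s - t\<bar>) / a"
        by (rule frac_le[OF _ L[OF st] assms(1) assms(2)[OF st(2)]])
           (use L[OF st] order.trans[OF abs_ge_zero L[OF st]] in simp)
      finally show ?thesis by simp
    qed
    have "\<bar>ln (f s) - ln (f t)\<bar> \<le> (L / a) * sqrt \<bar>s - t\<bar>" if st: "s \<in> {0..1}" "t \<in> {0..1}" for s t
      using one[OF st] one[OF st(2,1)] unfolding abs_le_iff abs_minus_commute[of t s] by linarith
    then show ?thesis unfolding 0 holder_class.simps by blast
  next
    case (Suc n)
    from assms(3) obtain f'
      where f': "\<forall>t\<in>{0..1}. (f has_real_derivative f' t) (at t within {0..1})" "holder_class n f'"
      unfolding Suc by (elim holder_class_SucD[THEN exE] conjE)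
    note * = bspec[OF f'(1)] f'(2)
    have "((\<lambda>t. ln (f t)) has_real_derivative 1 / f t * f' t) (at t within {0..1})" if "t \<in> {0..1}" for t
      using DERIV_chain2[OF DERIV_ln_divide[OF pos[OF that]] *(1)[OF that]] .
    moreover have "holder_class n (\<lambda>t. 1 / f t * f' t)"
    proof (rule holder_class_mult)
      have "holder_class n f" using assms(3) Suc holder_class_Suc[of n f] by simp
      then show "holder_class n (\<lambda>t. 1 / f t)"
        by (intro holder_class_inverse[of a f]) (use assms(1,2) in auto)
      show "holder_class n f'" by (rule f'(2))
    qed
    ultimately show ?thesis unfolding Suc by (rule holder_class_SucI)
  qed
qed

section \<open>Taylor representation of the log density\<close>

lemma holder_class_derivatives:
  assumes "holder_class k f"
  obtains D L where "D 0 = f"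
    "\<And>j t. j < k \<Longrightarrow> t \<in> {0..1} \<Longrightarrow> (D j has_real_derivative D (Suc j) t) (at t within {0..1})"
    "\<And>s t. s \<in> {0..1} \<Longrightarrow> t \<in> {0..1} \<Longrightarrow> \<bar>D k s - D k t\<bar> \<le> L * sqrt \<bar>s - t\<bar>"
  using assms
proof (induction k arbitrary: f thesis)
  case 0
  then obtain L where "\<And>s t. s\<in>{0..1} \<Longrightarrow> t\<in>{0..1} \<Longrightarrow> \<bar>f s - f t\<bar> \<le> L * sqrt \<bar>s - t\<bar>"
    unfolding holder_class.simps by blast
  then show ?case using 0(1)[of "\<lambda>_. f" L] by simp
next
  case (Suc k)
  from Suc.prems obtain f'
    where f': "\<forall>t\<in>{0..1}. (f has_real_derivative f' t) (at t within {0..1})" "holder_class k f'"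
    by (elim holder_class_SucD[THEN exE] conjE)
  note * = bspec[OF f'(1)] f'(2)
  from Suc.IH[OF _ *(2)] obtain D L where D: "D 0 = f'"
    "\<And>j t. j < k \<Longrightarrow> t \<in> {0..1} \<Longrightarrow> (D j has_real_derivative D (Suc j) t) (at t within {0..1})"
    "\<And>s t. s \<in> {0..1} \<Longrightarrow> t \<in> {0..1} \<Longrightarrow> \<bar>D k s - D k t\<bar> \<le> L * sqrt \<bar>s - t\<bar>" by metis
  show ?case
  proof (rule Suc.prems(1)[of "case_nat f D" L])
    fix j t assume "j < Suc k" "t \<in> {0..(1::real)}"
    then show "(case_nat f D j has_real_derivative case_nat f D (Suc j) t) (at t within {0..1})"
      using * D by (cases j) auto
  qed (use D in auto)
qed

lemma holder_class_of_derivatives: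
  assumes "\<And>j t. j < k \<Longrightarrow> t \<in> {0..1} \<Longrightarrow> (D j has_real_derivative D (Suc j) t) (at t within {0..1})"
    "\<And>s t. s \<in> {0..1} \<Longrightarrow> t \<in> {0..1} \<Longrightarrow> \<bar>D k s - D k t\<bar> \<le> L * sqrt \<bar>s - t\<bar>"
  shows "holder_class k (D 0)"
  using assms
proof (induction k arbitrary: D)
  case 0
  then show ?case unfolding holder_class.simps by blast
next
  case (Suc k)
  have "(D 0 has_real_derivative D (Suc 0) t) (at t within {0..1})" if "t \<in> {0..1}" for t
    using Suc.prems(1)[of 0 t] that by simp
  moreover have "holder_class k (D (Suc 0))"
    by (rule Suc.IH[of "\<lambda>j. D (Suc j)"]) (use Suc.prems in auto)
  ultimately show ?case by (rule holder_class_SucI)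
qed

text \<open>Taylor's formula with integral remainder, arranged so that the integrand starts at zero
  as Brownian motion does: the constant \<open>D k 0\<close> is moved into the polynomial as its
  term of degree \<open>k\<close>.\<close>

lemma Taylor_iterated_integral:
  assumes D: "\<And>j t. j < k \<Longrightarrow> t \<in> {0..1} \<Longrightarrow> (D j has_real_derivative D (Suc j) t) (at t within {0..1})"
    and cont: "continuous_on {0..1} (D k)" and t: "t \<in> {0..1}"
  shows "D 0 t = (\<Sum>i\<le>k. D i 0 * t ^ i / fact i) + iterated_integral k (\<lambda>s. D k s - D k 0) t"
proof (cases k)
  case 0
  then show ?thesis by simp
next
  case (Suc n)
  have "((\<lambda>x. ((t - x) ^ (k - 1) / fact (k - 1)) *\<^sub>R D k x) has_integral
      D 0 t - (\<Sum>i<k. ((t - 0) ^ i / fact i) *\<^sub>R D i 0)) {0..t}"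
  proof (rule Taylor_has_integral)
    fix m x assume "m < k" "0 \<le> x" "x \<le> t"
    then have "(D m has_real_derivative D (Suc m) x) (at x within {0..t})"
      using D[of m x] t by (auto intro: DERIV_subset)
    then show "(D m has_vector_derivative D (Suc m) x) (at x within {0..t})"
      by (simp add: has_real_derivative_iff_has_vector_derivative)
  qed (use Suc t in auto)
  moreover have "((\<lambda>x. (t - x) ^ n * D k x) has_integral (LBINT x:{0..t}. (t - x) ^ n * D k x)) {0..t}"
    using set_borel_integral_eq_integral[OF kernel_set_integrable[OF bounded_measurable_continuous[OF cont], of 0 t t n]] t
    by (simp add: has_integral_integral)
  then have "((\<lambda>x. ((t - x) ^ (k - 1) / fact (k - 1)) *\<^sub>R D k x) has_integral iterated_integral k (D k) t) {0..t}"
    using has_integral_mult_right[of "\<lambda>x. (t - x) ^ n * D k x" "LBINT x:{0..t}. (t - x) ^ n * D k x" "{0..t}" "1 / fact n"]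
    by (simp add: Suc iterated_integral_Suc)
  ultimately have eq: "iterated_integral k (D k) t = D 0 t - (\<Sum>i<k. (t ^ i / fact i) * D i 0)"
    using has_integral_unique[of "\<lambda>x. ((t - x) ^ (k - 1) / fact (k - 1)) *\<^sub>R D k x"] by simp
  have "iterated_integral k (\<lambda>s. D k s - D k 0) t = iterated_integral k (D k) t - D k 0 * t ^ k / fact k"
    using iterated_integral_diff[OF bounded_measurable_continuous[OF cont] bounded_measurable_const, of t k "D k 0"]
      iterated_integral_const[of t k "D k 0"] t by simp
  moreover have "(\<Sum>i\<le>k. D i 0 * t ^ i / fact i) = (\<Sum>i<k. D i 0 * t ^ i / fact i) + D k 0 * t ^ k / fact k"
    by (simp add: lessThan_Suc_atMost[symmetric])
  ultimately show ?thesis using eq by (simp add: mult.commute)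
qed

lemma half_integer_floor:
  assumes "1 \<le> m" "\<alpha> = real m - 1 / 2"
  shows "nat \<lfloor>\<alpha>\<rfloor> = m - 1" "frac \<alpha> = 1 / 2"
proof -
  have fl: "\<lfloor>\<alpha>\<rfloor> = int m - 1" using assms by (intro floor_unique) auto
  then show "nat \<lfloor>\<alpha>\<rfloor> = m - 1" by simp
  show "frac \<alpha> = 1 / 2" unfolding frac_def fl using assms by simp
qed

text \<open>Brings the log density into the shape of a path of the released process, with
  \<open>z\<close> in the role of the Gaussian coefficients and \<open>d\<close> in the role of the
  Brownian path.\<close>

lemma log_density_representation:
  assumes m: "1 \<le> m" "\<alpha> = real m - 1 / 2" and p: "p \<in> holder_space \<alpha>"
    and a: "0 < a" "\<And>t. t \<in> {0..1} \<Longrightarrow> a \<le> p t"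
  obtains z d L where "d 0 = 0"
    "\<And>s t. s \<in> {0..1} \<Longrightarrow> t \<in> {0..1} \<Longrightarrow> \<bar>d s - d t\<bar> \<le> L * sqrt \<bar>s - t\<bar>"
    "\<And>t. t \<in> {0..1} \<Longrightarrow>
      ln (p t) = (\<Sum>k\<le>m - 1. z k * t ^ k / fact k) + iterated_integral (m - 1) d t"
proof -
  note fl = half_integer_floor[OF m]
  from p obtain D L where D: "\<And>t. t \<in> {0..1} \<Longrightarrow> D 0 t = p t"
    "\<And>j t. j < m - 1 \<Longrightarrow> t \<in> {0..1} \<Longrightarrow> (D j has_real_derivative D (Suc j) t) (at t within {0..1})"
    "\<And>s t. s \<in> {0..1} \<Longrightarrow> t \<in> {0..1} \<Longrightarrow> \<bar>D (m - 1) s - D (m - 1) t\<bar> \<le> L * sqrt \<bar>s - t\<bar>"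
  proof -
    from p obtain D L where "\<forall>t\<in>{0..1}. D 0 t = p t"
      "\<forall>j<m - 1. \<forall>t\<in>{0..1}. (D j has_real_derivative D (Suc j) t) (at t within {0..1})"
      "\<forall>s\<in>{0..1}. \<forall>t\<in>{0..1}. \<bar>D (m - 1) s - D (m - 1) t\<bar> \<le> L * \<bar>s - t\<bar> powr (1 / 2)"
      unfolding holder_space_def fl mem_Collect_eq by blast
    then show thesis by (intro that[of D L]) (simp_all add: powr_half_sqrt)
  qed
  have "holder_class (m - 1) (D 0)" using D(2,3) by (rule holder_class_of_derivatives)
  then have "holder_class (m - 1) p" using holder_class_cong[of "D 0" p] D(1) by blast
  from holder_class_ln[OF a this] have "holder_class (m - 1) (\<lambda>t. ln (p t))" .
  then show thesis
  proof (rule holder_class_derivatives)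
    fix E L' assume E: "E 0 = (\<lambda>t. ln (p t))"
      "\<And>j t. j < m - 1 \<Longrightarrow> t \<in> {0..1} \<Longrightarrow> (E j has_real_derivative E (Suc j) t) (at t within {0..1})"
      "\<And>s t. s \<in> {0..1} \<Longrightarrow> t \<in> {0..1} \<Longrightarrow> \<bar>E (m - 1) s - E (m - 1) t\<bar> \<le> L' * sqrt \<bar>s - t\<bar>"
  show thesis
  proof (rule that[of "\<lambda>s. E (m - 1) s - E (m - 1) 0" L' "\<lambda>k. E k 0"])
    fix t :: real assume "t \<in> {0..1}"
    from Taylor_iterated_integral[OF E(2) sqrt_holder_continuous[OF E(3)] this]
    show "ln (p t) = (\<Sum>k\<le>m - 1. E k 0 * t ^ k / fact k)
        + iterated_integral (m - 1) (\<lambda>s. E (m - 1) s - E (m - 1) 0) t"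
      by (simp add: E(1))
  qed (use E in auto)
  qed
qed

section \<open>Gaussian vectors\<close>

abbreviation std_gauss :: "real measure"
  where "std_gauss \<equiv> density lborel (\<lambda>x. ennreal (std_normal_density x))"

abbreviation gauss_vec :: "nat \<Rightarrow> (nat \<Rightarrow> real) measure"
  where "gauss_vec n \<equiv> Pi\<^sub>M {..<n} (\<lambda>_. std_gauss)"

interpretation std_gauss: prob_space std_gauss
  by (rule prob_space_normal_density) simp

interpretation gauss_prod: product_prob_space "\<lambda>_::nat. std_gauss" UNIV
  by standard

lemma prob_space_gauss_vec: "prob_space (gauss_vec n)"
  by (intro prob_space_PiM std_gauss.prob_space_axioms)

lemma nn_integral_gauss_vec_Suc:
  assumes "f \<in> borel_measurable (gauss_vec (Suc n))"
  shows "(\<integral>\<^sup>+ x. f x \<partial>gauss_vec (Suc n)) = (\<integral>\<^sup>+ x. (\<integral>\<^sup>+ z. f (x(n := z)) \<partial>std_gauss) \<partial>gauss_vec n)"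
  using gauss_prod.product_nn_integral_insert[of "{..<n}" n f] assms
  by (simp add: lessThan_Suc)

lemma measurable_fun_upd_gauss_vec:
  "(\<lambda>p. (fst p)(n := snd p + c)) \<in> measurable (gauss_vec n \<Otimes>\<^sub>M std_gauss) (gauss_vec (Suc n))"
  by (rule measurable_fun_upd[where J = "{..<n}"]) auto

text \<open>The Cameron-Martin formula in dimension one: translate the Lebesgue integral and
  complete the square.\<close>

lemma std_gauss_shift:
  assumes [measurable]: "f \<in> borel_measurable borel"
  shows "(\<integral>\<^sup>+ z. f (z + c) \<partial>std_gauss) = (\<integral>\<^sup>+ z. f z * ennreal (exp (c * z - c\<^sup>2 / 2)) \<partial>std_gauss)"
proof -
  have "(\<integral>\<^sup>+ z. f z * ennreal (exp (c * z - c\<^sup>2 / 2)) \<partial>std_gauss)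
      = (\<integral>\<^sup>+ z. ennreal (std_normal_density z) * (f z * ennreal (exp (c * z - c\<^sup>2 / 2))) \<partial>lborel)"
    by (subst nn_integral_density) auto
  also have "\<dots> = (\<integral>\<^sup>+ z. ennreal (std_normal_density (z + c)) * (f (z + c) * ennreal (exp (c * (z + c) - c\<^sup>2 / 2))) \<partial>lborel)"
    using nn_integral_real_affine[of "\<lambda>z. ennreal (std_normal_density z) * (f z * ennreal (exp (c * z - c\<^sup>2 / 2)))" 1 c]
    by (simp add: add.commute)
  also have "\<dots> = (\<integral>\<^sup>+ z. ennreal (std_normal_density z) * f (z + c) \<partial>lborel)"
  proof (rule nn_integral_cong)
    fix z :: real
    have "std_normal_density (z + c) * exp (c * (z + c) - c\<^sup>2 / 2)
        = 1 / sqrt (2 * pi) * exp (- (z + c)\<^sup>2 / 2 + (c * (z + c) - c\<^sup>2 / 2))"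
      unfolding std_normal_density_def exp_add by simp
    also have "- (z + c)\<^sup>2 / 2 + (c * (z + c) - c\<^sup>2 / 2) = - z\<^sup>2 / 2"
      by (simp add: power2_eq_square field_simps)
    also have "1 / sqrt (2 * pi) * exp (- z\<^sup>2 / 2) = std_normal_density z"
      unfolding std_normal_density_def ..
    finally have eq: "std_normal_density (z + c) * exp (c * (z + c) - c\<^sup>2 / 2) = std_normal_density z" .
    have "ennreal (std_normal_density (z + c)) * (f (z + c) * ennreal (exp (c * (z + c) - c\<^sup>2 / 2)))
      = ennreal (std_normal_density (z + c) * exp (c * (z + c) - c\<^sup>2 / 2)) * f (z + c)"
      by (simp add: ennreal_mult mult_ac)
    then show "ennreal (std_normal_density (z + c)) * (f (z + c) * ennreal (exp (c * (z + c) - c\<^sup>2 / 2)))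
      = ennreal (std_normal_density z) * f (z + c)"
      unfolding eq .
  qed
  also have "\<dots> = (\<integral>\<^sup>+ z. f (z + c) \<partial>std_gauss)"
    by (subst nn_integral_density) auto
  finally show ?thesis by simp
qed

text \<open>The Cameron-Martin formula for vectors, by integrating out the last coordinate.\<close>

lemma gauss_vec_shift:
  assumes "f \<in> borel_measurable (gauss_vec n)"
  shows "(\<integral>\<^sup>+ x. f (\<lambda>j\<in>{..<n}. x j + a j) \<partial>gauss_vec n)
       = (\<integral>\<^sup>+ x. f x * ennreal (exp (\<Sum>j<n. a j * x j - (a j)\<^sup>2 / 2)) \<partial>gauss_vec n)"
  using assms
proof (induction n arbitrary: f)
  case 0
  then show ?case by (simp add: PiM_empty nn_integral_count_space_finite restrict_def)
next
  case (Suc n)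
  note f[measurable] = Suc.prems
  let ?G = "\<lambda>n x. ennreal (exp (\<Sum>j<n. a j * x j - (a j)\<^sup>2 / 2))"
  define f' where "f' x = (\<integral>\<^sup>+ z. f (x(n := z + a n)) \<partial>std_gauss)" for x
  have upd: "(\<lambda>p. f ((fst p)(n := snd p + c))) \<in> borel_measurable (gauss_vec n \<Otimes>\<^sub>M std_gauss)" for c
    using measurable_compose[OF measurable_fun_upd_gauss_vec[of n c] f] .
  have f'[measurable]: "f' \<in> borel_measurable (gauss_vec n)"
    unfolding f'_def using upd[of "a n"]
    by (intro std_gauss.borel_measurable_nn_integral) (simp add: case_prod_beta')
  have [measurable]: "(\<lambda>x. \<lambda>j\<in>{..<n}. x j + a j) \<in> measurable (gauss_vec n) (gauss_vec n)" for n
    by (rule measurable_restrict) (auto intro!: borel_measurable_add measurable_component_singleton)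
  have sec: "(\<lambda>z. f (x(n := z))) \<in> borel_measurable borel" if "x \<in> space (gauss_vec n)" for x
    using measurable_compose[OF measurable_Pair1'[OF that, of std_gauss] upd[of 0]] by simp
  have "(\<integral>\<^sup>+ x. f (\<lambda>j\<in>{..<Suc n}. x j + a j) \<partial>gauss_vec (Suc n))
      = (\<integral>\<^sup>+ x. (\<integral>\<^sup>+ z. f (\<lambda>j\<in>{..<Suc n}. (x(n := z)) j + a j) \<partial>std_gauss) \<partial>gauss_vec n)"
    by (rule nn_integral_gauss_vec_Suc) measurable
  also have "\<dots> = (\<integral>\<^sup>+ x. f' (\<lambda>j\<in>{..<n}. x j + a j) \<partial>gauss_vec n)"
  proof -
    have "(\<lambda>j\<in>{..<Suc n}. (x(n := z)) j + a j) = (\<lambda>j\<in>{..<n}. x j + a j)(n := z + a n)" for x z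
      by (auto simp: fun_eq_iff)
    then show ?thesis by (simp only: f'_def)
  qed
  also have "\<dots> = (\<integral>\<^sup>+ x. f' x * ?G n x \<partial>gauss_vec n)"
    by (rule Suc.IH[OF f'])
  also have "\<dots> = (\<integral>\<^sup>+ x. (\<integral>\<^sup>+ z. f (x(n := z)) * ?G (Suc n) (x(n := z)) \<partial>std_gauss) \<partial>gauss_vec n)"
  proof (rule nn_integral_cong)
    fix x assume x: "x \<in> space (gauss_vec n)"
    have "f' x = (\<integral>\<^sup>+ z. f (x(n := z)) * ennreal (exp (a n * z - (a n)\<^sup>2 / 2)) \<partial>std_gauss)"
      unfolding f'_def by (rule std_gauss_shift[OF sec[OF x]])
    then have "f' x * ?G n x = (\<integral>\<^sup>+ z. f (x(n := z)) * ennreal (exp (a n * z - (a n)\<^sup>2 / 2)) * ?G n x \<partial>std_gauss)"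
      by (subst nn_integral_multc) (use sec[OF x] in auto)
    also have "\<dots> = (\<integral>\<^sup>+ z. f (x(n := z)) * ?G (Suc n) (x(n := z)) \<partial>std_gauss)"
    proof (rule nn_integral_cong)
      fix z
      have "?G (Suc n) (x(n := z)) = ennreal (exp (a n * z - (a n)\<^sup>2 / 2)) * ?G n x"
        by (simp add: ennreal_mult[symmetric] exp_add[symmetric] add.commute)
      then show "f (x(n := z)) * ennreal (exp (a n * z - (a n)\<^sup>2 / 2)) * ?G n x = f (x(n := z)) * ?G (Suc n) (x(n := z))"
        by (simp only: mult.assoc)
    qed
    finally show "f' x * ?G n x = (\<integral>\<^sup>+ z. f (x(n := z)) * ?G (Suc n) (x(n := z)) \<partial>std_gauss)" .
  qed
  also have "\<dots> = (\<integral>\<^sup>+ x. f x * ?G (Suc n) x \<partial>gauss_vec (Suc n))"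
    by (rule nn_integral_gauss_vec_Suc[symmetric]) measurable
  finally show ?case .
qed

text \<open>Cauchy--Schwarz against the density of the shifted measure.\<close>

lemma gauss_vec_shifted_set:
  assumes S: "S \<in> sets (gauss_vec n)"
  shows "measure (gauss_vec n) {x \<in> space (gauss_vec n). (\<lambda>j\<in>{..<n}. x j - a j) \<in> S}
    \<ge> exp (- (\<Sum>j<n. (a j)\<^sup>2)) * (measure (gauss_vec n) S)\<^sup>2"
proof -
  interpret Q: prob_space "gauss_vec n" by (rule prob_space_gauss_vec)
  note S[measurable]
  define A where "A = (\<Sum>j<n. (a j)\<^sup>2)"
  \<comment> \<open>\<open>exp (G 1 x)\<close> and \<open>exp (G (-1) x)\<close> are the densities
    of the shifts by \<open>a\<close> and \<open>- a\<close>. The relation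
    \<open>- G (-1) x = G 1 x + A\<close> evaluates the second Cauchy-Schwarz factor as
    \<open>exp A\<close>.\<close>
  define G where "G c x = (\<Sum>j<n. c * a j * x j - (a j)\<^sup>2 / 2)" for c :: real and x
  have G[measurable]: "G c \<in> borel_measurable (gauss_vec n)" for c
    unfolding G_def by measurable
  have [measurable]: "(\<lambda>x. \<lambda>j\<in>{..<n}. x j - a j) \<in> measurable (gauss_vec n) (gauss_vec n)"
    by (rule measurable_restrict) (auto intro!: borel_measurable_diff measurable_component_singleton)
  let ?T = "{x \<in> space (gauss_vec n). (\<lambda>j\<in>{..<n}. x j - a j) \<in> S}"
  have T: "emeasure (gauss_vec n) ?T = (\<integral>\<^sup>+ x. indicator S x * ennreal (exp (G (-1) x)) \<partial>gauss_vec n)"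
  proof -
    have "emeasure (gauss_vec n) ?T = (\<integral>\<^sup>+ x. indicator S (\<lambda>j\<in>{..<n}. x j + - a j) \<partial>gauss_vec n)"
    proof (subst nn_integral_indicator[symmetric])
      show "(\<integral>\<^sup>+ x. indicator ?T x \<partial>gauss_vec n) = (\<integral>\<^sup>+ x. indicator S (\<lambda>j\<in>{..<n}. x j + - a j) \<partial>gauss_vec n)"
        by (rule nn_integral_cong) (simp add: indicator_def)
    qed measurable
    also have "\<dots> = (\<integral>\<^sup>+ x. indicator S x * ennreal (exp (\<Sum>j<n. (- a j) * x j - (- a j)\<^sup>2 / 2)) \<partial>gauss_vec n)"
      by (rule gauss_vec_shift) measurable
    finally show ?thesis by (simp add: G_def)
  qed
  have one: "(\<integral>\<^sup>+ x. ennreal (exp (G 1 x)) \<partial>gauss_vec n) = 1"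
    using gauss_vec_shift[of "\<lambda>_. 1" n a] by (simp add: G_def Q.emeasure_space_1)
  have eq: "- G (-1) x = G 1 x + A" for x
    by (simp add: G_def A_def sum.distrib[symmetric] sum_negf[symmetric])
  have "(\<integral>\<^sup>+ x. (ennreal (exp (- G (-1) x / 2)))\<^sup>2 \<partial>gauss_vec n) = (\<integral>\<^sup>+ x. ennreal (exp A) * ennreal (exp (G 1 x)) \<partial>gauss_vec n)"
  proof (rule nn_integral_cong)
    fix x
    have "(exp (- G (-1) x / 2))\<^sup>2 = exp (- G (-1) x)" by (simp add: power2_eq_square exp_add[symmetric])
    then show "(ennreal (exp (- G (-1) x / 2)))\<^sup>2 = ennreal (exp A) * ennreal (exp (G 1 x))"
      by (simp add: ennreal_power eq exp_add ennreal_mult[symmetric] mult.commute)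
  qed
  also have "\<dots> = ennreal (exp A)"
    by (subst nn_integral_cmult) (auto simp: one)
  finally have 2: "(\<integral>\<^sup>+ x. (ennreal (exp (- G (-1) x / 2)))\<^sup>2 \<partial>gauss_vec n) = ennreal (exp A)" .
  have 1: "(\<integral>\<^sup>+ x. (indicator S x * ennreal (exp (G (-1) x / 2)))\<^sup>2 \<partial>gauss_vec n) = emeasure (gauss_vec n) ?T"
    unfolding T
  proof (rule nn_integral_cong)
    fix x
    have "(exp (G (-1) x / 2))\<^sup>2 = exp (G (-1) x)" by (simp add: power2_eq_square exp_add[symmetric])
    then show "(indicator S x * ennreal (exp (G (-1) x / 2)))\<^sup>2 = indicator S x * ennreal (exp (G (-1) x))"
      by (simp add: power_mult_distrib ennreal_power indicator_def)
  qed
  have "(emeasure (gauss_vec n) S)\<^sup>2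
      = (\<integral>\<^sup>+ x. (indicator S x * ennreal (exp (G (-1) x / 2))) * ennreal (exp (- G (-1) x / 2)) \<partial>gauss_vec n)\<^sup>2"
  proof -
    have "(indicator S x * ennreal (exp (G (-1) x / 2))) * ennreal (exp (- G (-1) x / 2)) = indicator S x" for x
      by (simp add: mult.assoc ennreal_mult[symmetric] exp_add[symmetric])
    then show ?thesis by simp
  qed
  also have "\<dots> \<le> emeasure (gauss_vec n) ?T * ennreal (exp A)"
    unfolding 1[symmetric] 2[symmetric] by (rule Cauchy_Schwarz_nn_integral) measurable
  finally have "ennreal ((measure (gauss_vec n) S)\<^sup>2) \<le> ennreal (measure (gauss_vec n) ?T * exp A)"
    by (simp add: Q.emeasure_eq_measure ennreal_power ennreal_mult[symmetric])
  then have "(measure (gauss_vec n) S)\<^sup>2 \<le> measure (gauss_vec n) ?T * exp A"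
    by (subst (asm) ennreal_le_iff) auto
  then have "exp (- A) * (measure (gauss_vec n) S)\<^sup>2 \<le> exp (- A) * (measure (gauss_vec n) ?T * exp A)"
    by (intro mult_left_mono) auto
  also have "\<dots> = measure (gauss_vec n) ?T"
    by (simp add: exp_minus field_simps)
  finally show ?thesis unfolding A_def .
qed

lemma std_gauss_second_moment:
  "(\<integral>\<^sup>+ z. ennreal ((s + z)\<^sup>2) \<partial>std_gauss) = ennreal (s\<^sup>2 + 1)"
proof -
  have b0: "has_bochner_integral lborel (\<lambda>x. std_normal_density x) 1"
    using std_normal_moment_even[of 0] by simp
  have b1: "has_bochner_integral lborel (\<lambda>x. std_normal_density x * x) 0"
    using std_normal_moment_odd[of 0] by simp
  have b2: "has_bochner_integral lborel (\<lambda>x. std_normal_density x * x\<^sup>2) 1"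
    using std_normal_moment_even[of 1] by simp
  have "has_bochner_integral lborel (\<lambda>x. s\<^sup>2 * std_normal_density x + 2 * s * (std_normal_density x * x) + std_normal_density x * x\<^sup>2)
     (s\<^sup>2 * 1 + 2 * s * 0 + 1)"
    by (intro has_bochner_integral_add has_bochner_integral_mult_right b0 b1 b2)
  also have "(\<lambda>x. s\<^sup>2 * std_normal_density x + 2 * s * (std_normal_density x * x) + std_normal_density x * x\<^sup>2)
     = (\<lambda>x. std_normal_density x * (s + x)\<^sup>2)"
    by (auto simp: power2_eq_square algebra_simps)
  finally have hb: "has_bochner_integral lborel (\<lambda>x. std_normal_density x * (s + x)\<^sup>2) (s\<^sup>2 + 1)"
    by simp
  have "(\<integral>\<^sup>+ z. ennreal ((s + z)\<^sup>2) \<partial>std_gauss) = (\<integral>\<^sup>+ z. ennreal (std_normal_density z * (s + z)\<^sup>2) \<partial>lborel)"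
    by (subst nn_integral_density) (auto simp: ennreal_mult)
  also have "\<dots> = ennreal (s\<^sup>2 + 1)"
    using nn_integral_eq_integral[OF integrable.intros[OF hb]] has_bochner_integral_integral_eq[OF hb] by simp
  finally show ?thesis .
qed

text \<open>Kolmogorov's maximal inequality; the integrand is a supermartingale up to its drift.\<close>

lemma gauss_vec_maximal:
  assumes K: "0 < K"
  shows "measure (gauss_vec n) {x \<in> space (gauss_vec n). \<exists>k\<le>n. K < \<bar>\<Sum>j<k. x j\<bar>} \<le> real n / K\<^sup>2"
proof -
  define hit where "hit n x \<longleftrightarrow> (\<exists>k\<le>n. K < \<bar>\<Sum>j<k. x j\<bar>)" for n :: nat and x :: "nat \<Rightarrow> real"
  \<comment> \<open>Frozen at 1 after the first passage. Before it, one more step adds its variance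
    \<open>1 / K\<^sup>2\<close> in the mean, and at the passage itself the squared sum already
    exceeds \<open>K\<^sup>2\<close>, so freezing only lowers the value.\<close>
  define \<Phi> where "\<Phi> n x = (if hit n x then 1 else ennreal ((\<Sum>j<n. x j)\<^sup>2 / K\<^sup>2))" for n x
  have S[measurable]: "(\<lambda>x. \<Sum>j<k. x j) \<in> borel_measurable (gauss_vec n)" if "k \<le> n" for k n
    using that by (intro borel_measurable_sum) (auto intro!: measurable_component_singleton)
  have hit[measurable]: "{x \<in> space (gauss_vec n). hit n x} \<in> sets (gauss_vec n)" for n
  proof -
    have "{x \<in> space (gauss_vec n). hit n x}
        = (\<Union>k\<in>{..n}. {x \<in> space (gauss_vec n). K < \<bar>\<Sum>j<k. x j\<bar>})"
      unfolding hit_def by auto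
    also have "\<dots> \<in> sets (gauss_vec n)"
      using S by (intro sets.finite_UN) auto
    finally show ?thesis .
  qed
  have [measurable]: "\<Phi> n \<in> borel_measurable (gauss_vec n)" for n
    unfolding \<Phi>_def using hit[of n] S[of n n] by (intro measurable_If) (auto simp: pred_def)
  have main: "(\<integral>\<^sup>+ x. \<Phi> n x \<partial>gauss_vec n) \<le> ennreal (real n / K\<^sup>2)"
  proof (induction n)
    case 0
    have "\<not> hit 0 x" for x using K by (simp add: hit_def)
    then show ?case by (simp add: \<Phi>_def)
  next
    case (Suc n)
    interpret Q: prob_space "gauss_vec n" by (rule prob_space_gauss_vec)
    have "(\<integral>\<^sup>+ x. \<Phi> (Suc n) x \<partial>gauss_vec (Suc n)) = (\<integral>\<^sup>+ x. (\<integral>\<^sup>+ z. \<Phi> (Suc n) (x(n := z)) \<partial>std_gauss) \<partial>gauss_vec n)"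
      by (rule nn_integral_gauss_vec_Suc) measurable
    also have "\<dots> \<le> (\<integral>\<^sup>+ x. \<Phi> n x + ennreal (1 / K\<^sup>2) \<partial>gauss_vec n)"
    proof (rule nn_integral_mono)
      fix x :: "nat \<Rightarrow> real"
      define s where "s = (\<Sum>j<n. x j)"
      have sums: "(\<Sum>j<k. (x(n := z)) j) = (\<Sum>j<k. x j)" if "k \<le> n" for k z
        using that by (intro sum.cong) auto
      have sumS: "(\<Sum>j<Suc n. (x(n := z)) j) = s + z" for z
        using sums[of n z] by (simp add: s_def)
      show "(\<integral>\<^sup>+ z. \<Phi> (Suc n) (x(n := z)) \<partial>std_gauss) \<le> \<Phi> n x + ennreal (1 / K\<^sup>2)"
      proof (cases "hit n x")
        case True
        have "(\<integral>\<^sup>+ z. \<Phi> (Suc n) (x(n := z)) \<partial>std_gauss) \<le> (\<integral>\<^sup>+ z. 1 \<partial>std_gauss)"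
        proof (rule nn_integral_mono)
          fix z
          have "hit (Suc n) (x(n := z))" using True sums unfolding hit_def by (metis le_SucI)
          then show "\<Phi> (Suc n) (x(n := z)) \<le> 1" by (simp add: \<Phi>_def)
        qed
        also have "\<dots> = 1" using std_gauss.emeasure_space_1 by simp
        finally show ?thesis using True by (simp add: \<Phi>_def add_increasing2)
      next
        case False
        have "(\<integral>\<^sup>+ z. \<Phi> (Suc n) (x(n := z)) \<partial>std_gauss) \<le> (\<integral>\<^sup>+ z. ennreal (1 / K\<^sup>2) * ennreal ((s + z)\<^sup>2) \<partial>std_gauss)"
        proof (rule nn_integral_mono)
          fix z
          show "\<Phi> (Suc n) (x(n := z)) \<le> ennreal (1 / K\<^sup>2) * ennreal ((s + z)\<^sup>2)"
          proof (cases "hit (Suc n) (x(n := z))")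
            case True
            then obtain k where k: "k \<le> Suc n" "K < \<bar>\<Sum>j<k. (x(n := z)) j\<bar>" unfolding hit_def by blast
            have "k = Suc n"
            proof (rule ccontr)
              assume "k \<noteq> Suc n"
              then have "k \<le> n" using k by simp
              with k(2) sums[OF this] False show False unfolding hit_def by auto
            qed
            with k(2) have "K < \<bar>s + z\<bar>" by (simp only: sumS)
            then have "K\<^sup>2 \<le> (s + z)\<^sup>2" using K by (simp add: abs_le_square_iff[symmetric])
            then have "1 \<le> (s + z)\<^sup>2 / K\<^sup>2" using K by simp
            then show ?thesis using True by (simp add: \<Phi>_def ennreal_mult[symmetric])
          next
            case False
            then show ?thesis by (simp add: \<Phi>_def sumS ennreal_mult[symmetric] del: sum.lessThan_Suc fun_upd_apply)
          qed
        qed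
        also have "\<dots> = ennreal (1 / K\<^sup>2) * ennreal (s\<^sup>2 + 1)"
          by (subst nn_integral_cmult) (auto simp: std_gauss_second_moment)
        also have "\<dots> = ennreal (s\<^sup>2 / K\<^sup>2) + ennreal (1 / K\<^sup>2)"
          by (simp add: ennreal_mult[symmetric] ennreal_plus[symmetric] add_divide_distrib del: ennreal_plus)
        finally show ?thesis using False by (simp add: \<Phi>_def s_def)
      qed
    qed
    also have "\<dots> = (\<integral>\<^sup>+ x. \<Phi> n x \<partial>gauss_vec n) + ennreal (1 / K\<^sup>2)"
      by (subst nn_integral_add) (auto simp: Q.emeasure_space_1)
    also have "\<dots> \<le> ennreal (real n / K\<^sup>2) + ennreal (1 / K\<^sup>2)"
      using Suc by (rule add_right_mono)
    also have "\<dots> = ennreal (real (Suc n) / K\<^sup>2)"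
      by (simp add: ennreal_plus[symmetric] add_divide_distrib del: ennreal_plus)
    finally show ?case .
  qed
  interpret Q: prob_space "gauss_vec n" by (rule prob_space_gauss_vec)
  have "emeasure (gauss_vec n) {x \<in> space (gauss_vec n). hit n x}
      = (\<integral>\<^sup>+ x. indicator {x \<in> space (gauss_vec n). hit n x} x \<partial>gauss_vec n)"
    by (rule nn_integral_indicator[symmetric, OF hit])
  also have "\<dots> \<le> (\<integral>\<^sup>+ x. \<Phi> n x \<partial>gauss_vec n)"
    by (rule nn_integral_mono) (auto simp: \<Phi>_def indicator_def)
  also have "\<dots> \<le> ennreal (real n / K\<^sup>2)" by (rule main)
  finally show ?thesis
    unfolding Q.emeasure_eq_measure hit_def by (subst (asm) ennreal_le_iff) auto
qed

text \<open>Fubini in the last coordinate: a success probability that holds conditionally on every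
  good history multiplies up, although the good set for the next coordinate depends on that
  history.\<close>

lemma steering_lower_bound:
  fixes Q :: "'a measure" and G :: "nat \<Rightarrow> (nat \<Rightarrow> 'a) set"
  assumes Q: "prob_space Q"
    and G: "\<And>n. G n \<in> sets (Pi\<^sub>M {..<n} (\<lambda>_. Q))"
    and G0: "G 0 = space (Pi\<^sub>M {..<0} (\<lambda>_. Q))"
    and step: "\<And>n x. x \<in> G n \<Longrightarrow> \<kappa> \<le> emeasure Q {y \<in> space Q. x(n := y) \<in> G (Suc n)}"
  shows "\<kappa> ^ n \<le> emeasure (Pi\<^sub>M {..<n} (\<lambda>_. Q)) (G n)"
proof (induction n)
  case 0
  interpret P: prob_space "Pi\<^sub>M {..<0::nat} (\<lambda>_. Q)" by (intro prob_space_PiM Q)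
  show ?case using G0 P.emeasure_space_1 by simp
next
  case (Suc n)
  interpret Q: prob_space Q by (rule Q)
  interpret QQ: product_prob_space "\<lambda>_::nat. Q" UNIV by standard
  have GS: "G (Suc n) \<in> sets (Pi\<^sub>M (insert n {..<n}) (\<lambda>_. Q))" using G[of "Suc n"] by (simp add: lessThan_Suc)
  have "\<kappa> ^ Suc n = \<kappa> * \<kappa> ^ n" by simp
  also have "\<dots> \<le> \<kappa> * emeasure (Pi\<^sub>M {..<n} (\<lambda>_. Q)) (G n)"
    using Suc by (intro mult_left_mono) auto
  also have "\<dots> = (\<integral>\<^sup>+ x. \<kappa> * indicator (G n) x \<partial>Pi\<^sub>M {..<n} (\<lambda>_. Q))"
    using G[of n] by (subst nn_integral_cmult_indicator) auto
  also have "\<dots> \<le> (\<integral>\<^sup>+ x. (\<integral>\<^sup>+ y. indicator (G (Suc n)) (x(n := y)) \<partial>Q) \<partial>Pi\<^sub>M {..<n} (\<lambda>_. Q))"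
  proof (rule nn_integral_mono)
    fix x assume x: "x \<in> space (Pi\<^sub>M {..<n} (\<lambda>_. Q))"
    have meas: "(\<lambda>y. x(n := y)) \<in> measurable Q (Pi\<^sub>M (insert n {..<n}) (\<lambda>_. Q))"
      using x by (intro measurable_fun_upd[where J = "{..<n}"]) auto
    show "\<kappa> * indicator (G n) x \<le> (\<integral>\<^sup>+ y. indicator (G (Suc n)) (x(n := y)) \<partial>Q)"
    proof (cases "x \<in> G n")
      case True
      have "(\<integral>\<^sup>+ y. indicator (G (Suc n)) (x(n := y)) \<partial>Q) = (\<integral>\<^sup>+ y. indicator {y \<in> space Q. x(n := y) \<in> G (Suc n)} y \<partial>Q)"
        by (rule nn_integral_cong) (auto simp: indicator_def)
      also have "\<dots> = emeasure Q {y \<in> space Q. x(n := y) \<in> G (Suc n)}"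
        using measurable_sets[OF meas GS]
        by (intro nn_integral_indicator) (simp add: vimage_def Int_def conj_commute)
      finally show ?thesis using step[OF True] True by simp
    qed simp
  qed
  also have "\<dots> = (\<integral>\<^sup>+ x. indicator (G (Suc n)) x \<partial>Pi\<^sub>M (insert n {..<n}) (\<lambda>_. Q))"
    by (rule QQ.product_nn_integral_insert[symmetric]) (use GS in auto)
  also have "\<dots> = emeasure (Pi\<^sub>M {..<Suc n} (\<lambda>_. Q)) (G (Suc n))"
    using GS by (simp add: lessThan_Suc)
  finally show ?case .
qed

section \<open>Steering a random walk\<close>

lemma poly_antiderivative_exists:
  fixes p :: "real poly"
  shows "\<exists>P. pderiv P = p \<and> poly P 0 = 0"
proof -
  define P where "P = (\<Sum>i\<le>degree p. monom (coeff p i / real (Suc i)) (Suc i))"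
  have "coeff (pderiv P) n = coeff p n" for n
  proof -
    have "coeff P (Suc n) = (\<Sum>i\<le>degree p. if i = n then coeff p n / real (Suc n) else 0)"
      unfolding P_def coeff_sum by (intro sum.cong) auto
    also have "\<dots> = coeff p n / real (Suc n)"
      by (cases "n \<le> degree p") (auto simp: coeff_eq_0)
    finally show ?thesis by (simp add: coeff_pderiv del: of_nat_Suc)
  qed
  then have "pderiv P = p" by (rule poly_eqI)
  moreover have "poly P 0 = 0" by (simp add: P_def poly_sum poly_monom)
  ultimately show ?thesis by blast
qed

lemma unit_lborel_integral_reflect:
  "(LINT s|unit_lborel. f (1 - s)) = (LINT s|unit_lborel. (f s :: real))"
proof -
  have "(LINT s|unit_lborel. f s) = (\<integral>s. indicator {0..1} s * f s \<partial>lborel)"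
    by (simp add: integral_restrict_space)
  also have "\<dots> = (\<integral>s. indicator {0..1} (1 + (-1) * s) * f (1 + (-1) * s) \<partial>lborel)"
    using lborel_integral_real_affine[of "-1" "\<lambda>s. indicator {0..1} s * f s" 1] by simp
  also have "\<dots> = (\<integral>s. indicator {0..1} s * f (1 - s) \<partial>lborel)"
    by (intro Bochner_Integration.integral_cong) (auto simp: indicator_def)
  finally show ?thesis by (simp add: integral_restrict_space)
qed

text \<open>Integration by parts turns the \<open>l\<close>-fold integral at 1 into the integral of
  the derivative against \<open>(1 - s) ^ l / fact l\<close>. The derivative is therefore chosen as
  the reflected dual polynomial \<open>\<psi> k\<close>, scaled by \<open>fact k\<close>.\<close>

lemma control_polynomials_exist:
  "\<exists>\<Theta> :: nat \<Rightarrow> real poly. (\<forall>k<m. poly (\<Theta> k) 0 = 0) \<and>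
     (\<forall>k<m. \<forall>l<m. iterated_integral l (poly (\<Theta> k)) 1 = (if l = k then 1 else 0))"
proof -
  obtain \<psi> :: "nat \<Rightarrow> real poly" where \<psi>: "\<And>l k. l < m \<Longrightarrow> k < m \<Longrightarrow>
      (LINT s|unit_lborel. poly (\<psi> l) s * s ^ k) = (if k = l then 1 else 0)"
    using dual_polynomials_exist[of m] by blast
  have "\<forall>k. \<exists>P. pderiv P = smult (fact k) (pcompose (\<psi> k) [:1, -1:]) \<and> poly P 0 = 0"
    using poly_antiderivative_exists by blast
  then obtain \<Theta> where \<Theta>: "\<And>k. pderiv (\<Theta> k) = smult (fact k) (pcompose (\<psi> k) [:1, -1:])" "\<And>k. poly (\<Theta> k) 0 = 0"
    by metis
  have "iterated_integral l (poly (\<Theta> k)) 1 = (if l = k then 1 else 0)" if "k < m" "l < m" for k l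
  proof -
    have "iterated_integral l (poly (\<Theta> k)) 1 = (LINT s|unit_lborel. (1 - s) ^ l / fact l * (fact k * poly (\<psi> k) (1 - s)))"
      using iterated_integral_poly_derivative[OF \<Theta>(2), of l k] by (simp add: \<Theta>(1) poly_pcompose)
    also have "\<dots> = (LINT s|unit_lborel. s ^ l / fact l * (fact k * poly (\<psi> k) s))"
      using unit_lborel_integral_reflect[of "\<lambda>s. s ^ l / fact l * (fact k * poly (\<psi> k) s)"] by simp
    also have "\<dots> = (LINT s|unit_lborel. (fact k / fact l) * (poly (\<psi> k) s * s ^ l))"
      by (intro Bochner_Integration.integral_cong) auto
    also have "\<dots> = (fact k / fact l) * (if l = k then 1 else 0)"
      using \<psi>[OF that] by simp
    finally show ?thesis by simp
  qed
  with \<Theta>(2) show ?thesis by blast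
qed

lemma poly_lipschitz_01:
  fixes p :: "real poly"
  shows "\<exists>C\<ge>0. \<forall>s\<in>{0..1}. \<forall>t\<in>{0..1}. \<bar>poly p s - poly p t\<bar> \<le> C * \<bar>s - t\<bar>"
proof -
  have "bounded_measurable (poly (pderiv p))"
    by (intro bounded_measurable_continuous continuous_intros)
  then obtain C where C: "\<And>t. t \<in> {0..1} \<Longrightarrow> \<bar>poly (pderiv p) t\<bar> \<le> C"
    unfolding bounded_measurable_def by blast
  have "norm (poly p s - poly p t) \<le> C * norm (s - t)" if "s \<in> {0..1}" "t \<in> {0..1}" for s t
    by (rule field_differentiable_bound[of "{0..1}" "poly p" "poly (pderiv p)"])
       (use C that in \<open>auto intro: poly_DERIV[THEN has_field_derivative_at_within]\<close>)
  moreover have "0 \<le> C" using C[of 0] by simp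
  ultimately show ?thesis by (intro exI[of _ C]) auto
qed

text \<open>The Donsker path on a block of \<open>F\<close> steps, constant between grid points, so
  that it matches Brownian motion sampled on the grid exactly.\<close>

definition scaled_walk :: "nat \<Rightarrow> (nat \<Rightarrow> real) \<Rightarrow> real \<Rightarrow> real" where
  "scaled_walk F y \<sigma> = (\<Sum>j<nat \<lfloor>\<sigma> * F\<rfloor>. y j) / sqrt F"

lemma floor_step_le: "\<sigma> \<in> {0..1} \<Longrightarrow> nat \<lfloor>\<sigma> * real F\<rfloor> \<le> F"
proof -
  assume "\<sigma> \<in> {0..1}"
  then have "\<sigma> * real F \<le> real F" by (auto intro: mult_left_le_one_le)
  then have "\<lfloor>\<sigma> * real F\<rfloor> \<le> int F" by (simp add: floor_le_iff)
  then show ?thesis by simp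
qed

lemma scaled_walk_bounded_measurable: "bounded_measurable (scaled_walk F y)"
  unfolding bounded_measurable_def
proof (intro conjI exI ballI)
  have "(\<lambda>\<sigma>. nat \<lfloor>\<sigma> * real F\<rfloor>) \<in> measurable borel (count_space UNIV)" by measurable
  then have "(\<lambda>\<sigma>. (\<lambda>n. (\<Sum>j<n. y j) / sqrt F) (nat \<lfloor>\<sigma> * real F\<rfloor>)) \<in> borel_measurable borel"
    by (rule measurable_compose) simp
  then show "scaled_walk F y \<in> borel_measurable unit_lborel"
    unfolding scaled_walk_def[abs_def] by (rule borel_measurable_unit_lborelI)
  fix \<sigma> :: real assume "\<sigma> \<in> {0..1}"
  then have "{..<nat \<lfloor>\<sigma> * F\<rfloor>} \<subseteq> {..<F}" using floor_step_le[of \<sigma> F] by auto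
  then have "\<bar>\<Sum>j<nat \<lfloor>\<sigma> * F\<rfloor>. y j\<bar> \<le> (\<Sum>j<F. \<bar>y j\<bar>)"
    by (intro order.trans[OF sum_abs] sum_mono2) auto
  then show "\<bar>scaled_walk F y \<sigma>\<bar> \<le> (\<Sum>j<F. \<bar>y j\<bar>) / sqrt F"
    by (simp add: scaled_walk_def divide_right_mono)
qed

lemma scaled_walk_add: "scaled_walk F (\<lambda>j. y j + a j) \<sigma> = scaled_walk F y \<sigma> + scaled_walk F a \<sigma>"
  by (simp add: scaled_walk_def sum.distrib add_divide_distrib)

definition walk_moment :: "nat \<Rightarrow> nat \<Rightarrow> (nat \<Rightarrow> real) \<Rightarrow> real" where
  "walk_moment F k y = iterated_integral k (scaled_walk F y) 1"

text \<open>A finite linear form in the steps; this makes the states below measurable functions of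
  the noise.\<close>

lemma walk_moment_linear:
  "\<exists>c. \<forall>y. walk_moment F k y = (\<Sum>j<F. y j * c j)"
proof -
  define u where "u j = (\<lambda>i::nat. if i = j then 1 else 0 :: real)" for j
  have "walk_moment F k y = (\<Sum>j<F. y j * walk_moment F k (u j))" for y
  proof -
    have "walk_moment F k y = iterated_integral k (\<lambda>\<sigma>. \<Sum>j<F. y j * scaled_walk F (u j) \<sigma>) 1"
      unfolding walk_moment_def
    proof (rule iterated_integral_cong)
      fix \<sigma> :: real assume "\<sigma> \<in> {0..1}"
      then have le: "nat \<lfloor>\<sigma> * F\<rfloor> \<le> F" by (rule floor_step_le)
      have "scaled_walk F (u j) \<sigma> = (if j < nat \<lfloor>\<sigma> * F\<rfloor> then 1 / sqrt F else 0)" for j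
        by (simp add: scaled_walk_def u_def sum.delta)
      then have "(\<Sum>j<F. y j * scaled_walk F (u j) \<sigma>) = (\<Sum>j<F. if j < nat \<lfloor>\<sigma> * F\<rfloor> then y j / sqrt F else 0)"
        by (intro sum.cong) auto
      also have "\<dots> = (\<Sum>j\<in>{..<F} \<inter> {j. j < nat \<lfloor>\<sigma> * F\<rfloor>}. y j / sqrt F)"
        by (simp add: sum.If_cases)
      also have "{..<F} \<inter> {j. j < nat \<lfloor>\<sigma> * F\<rfloor>} = {..<nat \<lfloor>\<sigma> * F\<rfloor>}" using le by auto
      finally show "scaled_walk F y \<sigma> = (\<Sum>j<F. y j * scaled_walk F (u j) \<sigma>)"
        by (simp add: scaled_walk_def sum_divide_distrib)
    qed simp
    also have "\<dots> = (\<Sum>j<F. iterated_integral k (\<lambda>\<sigma>. y j * scaled_walk F (u j) \<sigma>) 1)"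
      by (rule iterated_integral_sum) (auto intro: bounded_measurable_mult bounded_measurable_const scaled_walk_bounded_measurable)
    finally show ?thesis by (simp add: iterated_integral_mult walk_moment_def)
  qed
  then show ?thesis by (intro exI[of _ "\<lambda>j. walk_moment F k (u j)"]) blast
qed

text \<open>
  \<open>walk_state F e i x k\<close> is the \<open>k\<close>-fold integral of the deviation at the left end of block \<open>i\<close>,
  in units of the block length to the power \<open>k + 1/2\<close>; the path noise on block \<open>i\<close> is the random
  walk with steps \<open>x i\<close>, and \<open>e i k\<close> is the contribution of the target function.
\<close>

fun walk_state :: "nat \<Rightarrow> (nat \<Rightarrow> nat \<Rightarrow> real) \<Rightarrow> nat \<Rightarrow> (nat \<Rightarrow> nat \<Rightarrow> real) \<Rightarrow> nat \<Rightarrow> real" where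
  "walk_state F e 0 x k = 0"
| "walk_state F e (Suc i) x k =
     (\<Sum>l\<le>k. walk_state F e i x (k - l) / fact l) + walk_moment F k (x i) - e i k"

text \<open>The value of \<open>walk_moment F k (x i)\<close> that would make the next state
  vanish.\<close>

definition control_target :: "nat \<Rightarrow> (nat \<Rightarrow> nat \<Rightarrow> real) \<Rightarrow> nat \<Rightarrow> (nat \<Rightarrow> nat \<Rightarrow> real) \<Rightarrow> nat \<Rightarrow> real" where
  "control_target F e i x k = e i k - (\<Sum>l\<le>k. walk_state F e i x (k - l) / fact l)"

text \<open>Grid increments of the polynomial path with prescribed moments \<open>g\<close>; the
  factor \<open>sqrt F\<close> undoes the normalisation in \<open>scaled_walk\<close>.\<close>

definition control_shift ::
    "(nat \<Rightarrow> real poly) \<Rightarrow> nat \<Rightarrow> nat \<Rightarrow> (nat \<Rightarrow> real) \<Rightarrow> nat \<Rightarrow> real" where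
  "control_shift \<Theta> m F g j =
     sqrt F * (\<Sum>k<m. g k * (poly (\<Theta> k) (real (Suc j) / F) - poly (\<Theta> k) (real j / F)))"

text \<open>On every block the noise follows its control within a tube. The control is a feedback:
  its target is computed from the states reached in the earlier blocks. Radius
  \<open>2 * sqrt F\<close> is large enough for Kolmogorov's inequality to give a fixed success
  probability.\<close>

definition steered :: "(nat \<Rightarrow> real poly) \<Rightarrow> nat \<Rightarrow> nat \<Rightarrow> (nat \<Rightarrow> nat \<Rightarrow> real) \<Rightarrow> nat \<Rightarrow> (nat \<Rightarrow> nat \<Rightarrow> real) set" where
  "steered \<Theta> m F e n = {x \<in> space (Pi\<^sub>M {..<n} (\<lambda>_. gauss_vec F)).
     \<forall>i<n. \<forall>k\<le>F. \<bar>\<Sum>j<k. x i j - control_shift \<Theta> m F (control_target F e i x) j\<bar> \<le> 2 * sqrt F}"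

text \<open>The state at block \<open>i\<close> depends on the earlier blocks only, so the control
  of a block is fixed before its noise is drawn.\<close>

lemma walk_state_upd: "i \<le> n \<Longrightarrow> walk_state F e i (x(n := y)) k = walk_state F e i x k"
  by (induction i arbitrary: k) auto

lemma control_target_upd: "i \<le> n \<Longrightarrow> control_target F e i (x(n := y)) = control_target F e i x"
  by (rule ext) (simp add: control_target_def walk_state_upd)

lemma walk_state_measurable:
  "i \<le> n \<Longrightarrow> (\<lambda>x. walk_state F e i x k) \<in> borel_measurable (Pi\<^sub>M {..<n} (\<lambda>_. gauss_vec F))"
proof (induction i arbitrary: k)
  case (Suc i)
  obtain c where c: "\<And>y. walk_moment F k y = (\<Sum>j<F. y j * c j)"
    using walk_moment_linear[of F k] by blast
  have comp: "(\<lambda>x. x i j) \<in> borel_measurable (Pi\<^sub>M {..<n} (\<lambda>_. gauss_vec F))" if "j < F" for j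
  proof -
    have "(\<lambda>x. x i) \<in> measurable (Pi\<^sub>M {..<n} (\<lambda>_. gauss_vec F)) (gauss_vec F)"
      using Suc.prems by (intro measurable_component_singleton) auto
    moreover have "(\<lambda>y. y j) \<in> borel_measurable (gauss_vec F)"
      using measurable_component_singleton[of j "{..<F}" "\<lambda>_. std_gauss"] that by simp
    ultimately show ?thesis by (rule measurable_compose)
  qed
  show ?case unfolding walk_state.simps c
    by (intro borel_measurable_diff borel_measurable_add borel_measurable_sum borel_measurable_times
        borel_measurable_divide borel_measurable_const comp Suc.IH)
       (use Suc.prems in auto)
qed simp

lemma steered_sets: "steered \<Theta> m F e n \<in> sets (Pi\<^sub>M {..<n} (\<lambda>_. gauss_vec F))"
proof -
  let ?P = "Pi\<^sub>M {..<n} (\<lambda>_. gauss_vec F)"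
  let ?f = "\<lambda>i k x. \<Sum>j<k. x i j - control_shift \<Theta> m F (control_target F e i x) j"
  have meas: "?f i k \<in> borel_measurable ?P" if "i < n" "k \<le> F" for i k
  proof -
    have comp: "(\<lambda>x. x i j) \<in> borel_measurable ?P" if "j < F" for j
    proof -
      have "(\<lambda>x. x i) \<in> measurable ?P (gauss_vec F)"
        using \<open>i < n\<close> by (intro measurable_component_singleton) auto
      moreover have "(\<lambda>y. y j) \<in> borel_measurable (gauss_vec F)"
        using measurable_component_singleton[of j "{..<F}" "\<lambda>_. std_gauss"] that by simp
      ultimately show ?thesis by (rule measurable_compose)
    qed
    show ?thesis
      unfolding control_shift_def control_target_def
      by (intro borel_measurable_diff borel_measurable_sum borel_measurable_times
          borel_measurable_divide borel_measurable_const comp walk_state_measurable)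
         (use that in auto)
  qed
  have "steered \<Theta> m F e n = (\<Inter>i\<in>{..<n}. \<Inter>k\<in>{..F}. {x \<in> space ?P. \<bar>?f i k x\<bar> \<le> 2 * sqrt F}) \<inter> space ?P"
    unfolding steered_def by auto
  also have "\<dots> \<in> sets ?P"
  proof (cases "n = 0")
    case False
    then show ?thesis using meas by (intro sets.Int sets.finite_INT) auto
  qed simp
  finally show ?thesis .
qed

text \<open>The increments telescope to the polynomial path at the grid point to the left of
  \<open>\<sigma>\<close>; the values at 0 vanish.\<close>

lemma control_shift_walk:
  assumes F: "0 < F" and zero: "\<And>k. k < m \<Longrightarrow> poly (\<Theta> k) 0 = 0"
  shows "scaled_walk F (control_shift \<Theta> m F g) \<sigma> = (\<Sum>k<m. g k * poly (\<Theta> k) (real (nat \<lfloor>\<sigma> * F\<rfloor>) / F))"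
proof -
  define n where "n = nat \<lfloor>\<sigma> * F\<rfloor>"
  have "scaled_walk F (control_shift \<Theta> m F g) \<sigma>
      = (\<Sum>j<n. \<Sum>k<m. g k * (poly (\<Theta> k) (real (Suc j) / F) - poly (\<Theta> k) (real j / F)))"
    using F by (simp add: scaled_walk_def control_shift_def n_def sum_distrib_left[symmetric])
  also have "\<dots> = (\<Sum>k<m. g k * (\<Sum>j<n. poly (\<Theta> k) (real (Suc j) / F) - poly (\<Theta> k) (real j / F)))"
    by (subst sum.swap) (simp add: sum_distrib_left)
  also have "\<dots> = (\<Sum>k<m. g k * poly (\<Theta> k) (real n / F))"
  proof (rule sum.cong[OF refl])
    fix k assume "k \<in> {..<m}"
    then show "g k * (\<Sum>j<n. poly (\<Theta> k) (real (Suc j) / F) - poly (\<Theta> k) (real j / F)) = g k * poly (\<Theta> k) (real n / F)"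
      using sum_lessThan_telescope[of "\<lambda>j. poly (\<Theta> k) (real j / F)" n] zero by simp
  qed
  finally show ?thesis by (simp add: n_def)
qed

lemma block_coordinates:
  fixes t :: real and N :: nat
  assumes t: "t \<in> {0..1}" and N: "0 < N"
  obtains i s where "i < N" "s \<in> {0..1}" "t = real i / N + 1 / N * s"
proof (cases "t = 1")
  case True
  \<comment> \<open>The right end point is assigned to the last block, with local coordinate
    1.\<close>
  show thesis by (rule that[of "N - 1" 1]) (use N True in \<open>auto simp: field_simps of_nat_diff\<close>)
next
  case False
  define i where "i = nat \<lfloor>t * N\<rfloor>"
  have tN: "0 \<le> t * N" "t * N < N" using t False N by auto
  then have i: "real i \<le> t * N" "t * N < real i + 1" by (auto simp: i_def)
  with tN have "real i < real N" by linarith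
  then have "i < N" by simp
  then show thesis
    by (rule that[of i "t * N - real i"]) (use i N in \<open>auto simp: field_simps\<close>)
qed

locale control_polynomials =
  fixes \<Theta> :: "nat \<Rightarrow> real poly" and m :: nat and C :: real
  assumes zero: "k < m \<Longrightarrow> poly (\<Theta> k) 0 = 0"
    and dual: "k < m \<Longrightarrow> l < m \<Longrightarrow> iterated_integral l (poly (\<Theta> k)) 1 = (if l = k then 1 else 0)"
    and lipschitz: "k < m \<Longrightarrow> s \<in> {0..1} \<Longrightarrow> t \<in> {0..1} \<Longrightarrow> \<bar>poly (\<Theta> k) s - poly (\<Theta> k) t\<bar> \<le> C * \<bar>s - t\<bar>"
    and C_nonneg: "0 \<le> C"
begin

lemma combination_lipschitz:
  assumes g: "\<And>k. k < m \<Longrightarrow> \<bar>g k\<bar> \<le> A" and A: "0 \<le> A" and st: "s \<in> {0..1}" "t \<in> {0..1}"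
  shows "\<bar>(\<Sum>k<m. g k * (poly (\<Theta> k) s - poly (\<Theta> k) t))\<bar> \<le> real m * A * C * \<bar>s - t\<bar>"
proof -
  have "\<bar>(\<Sum>k<m. g k * (poly (\<Theta> k) s - poly (\<Theta> k) t))\<bar> \<le> (\<Sum>k<m. A * (C * \<bar>s - t\<bar>))"
  proof (rule order.trans[OF sum_abs sum_mono])
    fix k assume "k \<in> {..<m}"
    then show "\<bar>g k * (poly (\<Theta> k) s - poly (\<Theta> k) t)\<bar> \<le> A * (C * \<bar>s - t\<bar>)"
      unfolding abs_mult using g A lipschitz[OF _ st] by (intro mult_mono) auto
  qed
  then show ?thesis by (simp add: mult.assoc)
qed

lemma control_shift_bound:
  assumes F: "0 < F" and g: "\<And>k. k < m \<Longrightarrow> \<bar>g k\<bar> \<le> A" and A: "0 \<le> A" and j: "j < F"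
  shows "\<bar>control_shift \<Theta> m F g j\<bar> \<le> real m * A * C / sqrt F"
proof -
  have st: "real (Suc j) / F \<in> {0..1}" "real j / F \<in> {0..1}" using j by auto
  have "\<bar>control_shift \<Theta> m F g j\<bar> = sqrt F * \<bar>(\<Sum>k<m. g k * (poly (\<Theta> k) (real (Suc j) / F) - poly (\<Theta> k) (real j / F)))\<bar>"
    by (simp add: control_shift_def abs_mult)
  also have "\<dots> \<le> sqrt F * (real m * A * C * \<bar>real (Suc j) / F - real j / F\<bar>)"
    by (intro mult_left_mono combination_lipschitz g A st) auto
  also have "\<bar>real (Suc j) / F - real j / F\<bar> = 1 / F"
    by (simp add: diff_divide_distrib[symmetric])
  also have "sqrt F * (real m * A * C * (1 / F)) = real m * A * C / sqrt F"
    using F real_div_sqrt[of "real F"] by (simp add: field_simps)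
  finally show ?thesis .
qed

text \<open>Each of the \<open>F\<close> increments is of order \<open>1 / sqrt F\<close>, so the
  cost of a shift does not depend on the fineness of the grid.\<close>

lemma control_shift_energy:
  assumes F: "0 < F" and g: "\<And>k. k < m \<Longrightarrow> \<bar>g k\<bar> \<le> A" and A: "0 \<le> A"
  shows "(\<Sum>j<F. (control_shift \<Theta> m F g j)\<^sup>2) \<le> (real m * A * C)\<^sup>2"
proof -
  have "(\<Sum>j<F. (control_shift \<Theta> m F g j)\<^sup>2) \<le> (\<Sum>j<F. (real m * A * C)\<^sup>2 / F)"
  proof (rule sum_mono)
    fix j assume "j \<in> {..<F}"
    then have "\<bar>control_shift \<Theta> m F g j\<bar> \<le> real m * A * C / sqrt F"
      by (intro control_shift_bound F g A) auto
    then have "(control_shift \<Theta> m F g j)\<^sup>2 \<le> (real m * A * C / sqrt F)\<^sup>2"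
      using abs_le_square_iff[of "control_shift \<Theta> m F g j" "real m * A * C / sqrt F"] by linarith
    then show "(control_shift \<Theta> m F g j)\<^sup>2 \<le> (real m * A * C)\<^sup>2 / F"
      by (simp add: power_divide)
  qed
  then show ?thesis using F by simp
qed

lemma control_walk_close:
  assumes F: "0 < F" and g: "\<And>k. k < m \<Longrightarrow> \<bar>g k\<bar> \<le> A" and A: "0 \<le> A" and \<sigma>: "\<sigma> \<in> {0..1}"
  shows "\<bar>scaled_walk F (control_shift \<Theta> m F g) \<sigma> - (\<Sum>k<m. g k * poly (\<Theta> k) \<sigma>)\<bar> \<le> real m * A * C / F"
    "\<bar>scaled_walk F (control_shift \<Theta> m F g) \<sigma>\<bar> \<le> real m * A * C"
proof -
  define t where "t = real (nat \<lfloor>\<sigma> * F\<rfloor>) / F"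
  have t: "t \<in> {0..1}" using floor_step_le[OF \<sigma>, of F] F by (simp add: t_def)
  have eq: "scaled_walk F (control_shift \<Theta> m F g) \<sigma> = (\<Sum>k<m. g k * poly (\<Theta> k) t)"
    unfolding t_def by (rule control_shift_walk[OF F]) (rule zero)
  have mAC: "0 \<le> real m * A * C" using A C_nonneg by simp
  have "scaled_walk F (control_shift \<Theta> m F g) \<sigma> - (\<Sum>k<m. g k * poly (\<Theta> k) \<sigma>)
      = (\<Sum>k<m. g k * (poly (\<Theta> k) t - poly (\<Theta> k) \<sigma>))"
    unfolding eq by (simp add: right_diff_distrib sum_subtractf)
  moreover have "\<bar>(\<Sum>k<m. g k * (poly (\<Theta> k) t - poly (\<Theta> k) \<sigma>))\<bar> \<le> real m * A * C * \<bar>t - \<sigma>\<bar>"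
    by (intro combination_lipschitz g A t \<sigma>)
  moreover have "real m * A * C * \<bar>t - \<sigma>\<bar> \<le> real m * A * C * (1 / F)"
  proof (rule mult_left_mono[OF _ mAC])
    have "0 \<le> \<sigma> * F" using \<sigma> by simp
    then have fl: "real (nat \<lfloor>\<sigma> * F\<rfloor>) \<le> \<sigma> * F" "\<sigma> * F \<le> real (nat \<lfloor>\<sigma> * F\<rfloor>) + 1"
      by linarith+
    then have "t \<le> \<sigma>" "\<sigma> \<le> t + 1 / F" using F by (auto simp: t_def field_simps)
    then show "\<bar>t - \<sigma>\<bar> \<le> 1 / F" by linarith
  qed
  ultimately show "\<bar>scaled_walk F (control_shift \<Theta> m F g) \<sigma> - (\<Sum>k<m. g k * poly (\<Theta> k) \<sigma>)\<bar> \<le> real m * A * C / F"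
    by simp
  have "(\<Sum>k<m. g k * poly (\<Theta> k) t) = (\<Sum>k<m. g k * (poly (\<Theta> k) t - poly (\<Theta> k) 0))"
    using zero by (intro sum.cong) auto
  moreover have "\<bar>(\<Sum>k<m. g k * (poly (\<Theta> k) t - poly (\<Theta> k) 0))\<bar> \<le> real m * A * C * \<bar>t - 0\<bar>"
    by (intro combination_lipschitz g A t) auto
  moreover have "real m * A * C * \<bar>t - 0\<bar> \<le> real m * A * C * 1"
    using t by (intro mult_left_mono[OF _ mAC]) auto
  ultimately show "\<bar>scaled_walk F (control_shift \<Theta> m F g) \<sigma>\<bar> \<le> real m * A * C"
    unfolding eq by linarith
qed

lemma steered_walk_bound:
  assumes F: "0 < F" and x: "x \<in> steered \<Theta> m F e n" and i: "i < n" and \<sigma>: "\<sigma> \<in> {0..1}"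
  shows "\<bar>scaled_walk F (\<lambda>j. x i j - control_shift \<Theta> m F (control_target F e i x) j) \<sigma>\<bar> \<le> 2"
proof -
  have "\<bar>\<Sum>j<nat \<lfloor>\<sigma> * F\<rfloor>. x i j - control_shift \<Theta> m F (control_target F e i x) j\<bar> \<le> 2 * sqrt F"
    using x i floor_step_le[OF \<sigma>, of F] unfolding steered_def by blast
  then show ?thesis using F by (simp add: scaled_walk_def divide_le_eq)
qed

lemma control_target_bound:
  fixes L :: real
  assumes "\<And>l. l < m \<Longrightarrow> \<bar>walk_state F e i x l\<bar> \<le> 3" "\<And>k. k < m \<Longrightarrow> \<bar>e i k\<bar> \<le> L" "k < m"
  shows "\<bar>control_target F e i x k\<bar> \<le> 3 * real m + L"
proof -
  have "\<bar>\<Sum>l\<le>k. walk_state F e i x (k - l) / fact l\<bar> \<le> (\<Sum>l\<le>k. 3)"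
  proof (rule order.trans[OF sum_abs sum_mono])
    fix l assume "l \<in> {..k}"
    then have "\<bar>walk_state F e i x (k - l)\<bar> \<le> 3" using assms(1)[of "k - l"] assms(3) by simp
    moreover have "\<bar>walk_state F e i x (k - l)\<bar> / fact l \<le> \<bar>walk_state F e i x (k - l)\<bar>"
      by (simp add: divide_le_eq fact_ge_1 mult_le_cancel_left1)
    ultimately show "\<bar>walk_state F e i x (k - l) / fact l\<bar> \<le> 3" by simp
  qed
  also have "(\<Sum>l\<le>k. 3) \<le> 3 * real m" using assms(3) by simp
  finally show ?thesis using assms(2)[OF assms(3)] unfolding control_target_def by linarith
qed

text \<open>The polynomial control has exactly the target moments, so the next state is an iterated
  integral of the residual alone. The residual is at most 3: 2 from the tube and 1 from the
  discretisation, by \<open>FA\<close>. Hence the bound 3 reproduces itself from block to block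
  instead of accumulating.\<close>

lemma steered_state_bound:
  fixes L :: real
  assumes F: "0 < F" and FA: "real m * (3 * real m + L) * C \<le> F"
    and e: "\<And>i k. i < n \<Longrightarrow> k < m \<Longrightarrow> \<bar>e i k\<bar> \<le> L" and L: "0 \<le> L"
    and x: "x \<in> steered \<Theta> m F e n"
  shows "i \<le> n \<Longrightarrow> k < m \<Longrightarrow> \<bar>walk_state F e i x k\<bar> \<le> 3"
proof (induction i arbitrary: k)
  case 0
  then show ?case by simp
next
  case (Suc i)
  let ?A = "3 * real m + L"
  let ?g = "control_target F e i x"
  let ?a = "control_shift \<Theta> m F ?g"
  have g: "\<bar>?g k\<bar> \<le> ?A" if "k < m" for k
    using Suc e that by (intro control_target_bound) auto
  have A: "0 \<le> ?A" using L by simp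
  define U where "U \<sigma> = (\<Sum>k<m. ?g k * poly (\<Theta> k) \<sigma>)" for \<sigma>
  have bmU: "bounded_measurable U"
    unfolding U_def by (intro bounded_measurable_continuous continuous_intros)
  have IU: "iterated_integral k U 1 = ?g k"
  proof -
    have "iterated_integral k U 1 = (\<Sum>l<m. iterated_integral k (\<lambda>\<sigma>. ?g l * poly (\<Theta> l) \<sigma>) 1)"
      unfolding U_def by (rule iterated_integral_sum) (auto intro!: bounded_measurable_continuous continuous_intros)
    also have "\<dots> = (\<Sum>l<m. if l = k then ?g l else 0)"
      using Suc.prems dual by (intro sum.cong) (auto simp: iterated_integral_mult)
    finally show ?thesis using Suc.prems by simp
  qed
  define R where "R \<sigma> = scaled_walk F (\<lambda>j. x i j - ?a j) \<sigma> + (scaled_walk F ?a \<sigma> - U \<sigma>)" for \<sigma>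
  have bmR: "bounded_measurable R"
    unfolding R_def by (intro bounded_measurable_add bounded_measurable_diff scaled_walk_bounded_measurable bmU)
  have R: "\<bar>R \<sigma>\<bar> \<le> 3" if "\<sigma> \<in> {0..1}" for \<sigma>
  proof -
    have "\<bar>scaled_walk F ?a \<sigma> - U \<sigma>\<bar> \<le> real m * ?A * C / F"
      unfolding U_def by (intro control_walk_close(1) F g A that)
    also have "\<dots> \<le> 1" using FA F by simp
    finally show ?thesis
      using steered_walk_bound[OF F x _ that, of i] Suc.prems unfolding R_def by linarith
  qed
  have "scaled_walk F (x i) \<sigma> = U \<sigma> + R \<sigma>" for \<sigma>
    using scaled_walk_add[of F "\<lambda>j. x i j - ?a j" ?a \<sigma>] by (simp add: R_def)
  then have "walk_moment F k (x i) = iterated_integral k (\<lambda>\<sigma>. U \<sigma> + R \<sigma>) 1"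
    unfolding walk_moment_def by (metis ext)
  also have "\<dots> = ?g k + iterated_integral k R 1"
    using iterated_integral_add[OF bmU bmR, of 1 k] IU by simp
  finally have "walk_state F e (Suc i) x k = iterated_integral k R 1"
    by (simp add: control_target_def)
  then show ?case using iterated_integral_abs_le[OF bmR R, of 1 k] by simp
qed

text \<open>At level \<open>2 * sqrt F\<close> Kolmogorov's inequality leaves the uncontrolled walk
  in the tube with probability at least 3/4. Translating the tube along the control squares this to
  9/16 and costs the exponential of the control energy.\<close>

lemma steered_measure:
  fixes L :: real
  assumes F: "0 < F" and FA: "real m * (3 * real m + L) * C \<le> F"
    and e: "\<And>i k. k < m \<Longrightarrow> \<bar>e i k\<bar> \<le> L" and L: "0 \<le> L"
  shows "ennreal (exp (- (real m * (3 * real m + L) * C)\<^sup>2) * (9 / 16)) ^ n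
    \<le> emeasure (Pi\<^sub>M {..<n} (\<lambda>_. gauss_vec F)) (steered \<Theta> m F e n)"
proof (rule steering_lower_bound[OF prob_space_gauss_vec steered_sets])
  show "steered \<Theta> m F e 0 = space (Pi\<^sub>M {..<0} (\<lambda>_. gauss_vec F))"
    by (simp add: steered_def)
  fix n x assume x: "x \<in> steered \<Theta> m F e n"
  interpret Q: prob_space "gauss_vec F" by (rule prob_space_gauss_vec)
  let ?A = "3 * real m + L"
  define a where "a = control_shift \<Theta> m F (control_target F e n x)"
  define S where "S = {y \<in> space (gauss_vec F). \<forall>k\<le>F. \<bar>\<Sum>j<k. y j\<bar> \<le> 2 * sqrt F}"
  have comp: "(\<lambda>y. y j) \<in> borel_measurable (gauss_vec F)" if "j < F" for j
    using measurable_component_singleton[of j "{..<F}" "\<lambda>_. std_gauss"] that by simp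
  have sums: "(\<lambda>y. \<Sum>j<k. y j) \<in> borel_measurable (gauss_vec F)" if "k \<le> F" for k
    using that by (intro borel_measurable_sum comp) auto
  have S: "S \<in> sets (gauss_vec F)"
  proof -
    have "S = (\<Inter>k\<in>{..F}. {y \<in> space (gauss_vec F). \<bar>\<Sum>j<k. y j\<bar> \<le> 2 * sqrt F})"
      unfolding S_def by auto
    also have "\<dots> \<in> sets (gauss_vec F)" using sums by (intro sets.finite_INT) auto
    finally show ?thesis .
  qed
  have "measure (gauss_vec F) {y \<in> space (gauss_vec F). \<exists>k\<le>F. 2 * sqrt F < \<bar>\<Sum>j<k. y j\<bar>} \<le> real F / (2 * sqrt F)\<^sup>2"
    using F by (intro gauss_vec_maximal) auto
  also have "real F / (2 * sqrt F)\<^sup>2 = 1 / 4" using F by (simp add: power_mult_distrib)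
  finally have "measure (gauss_vec F) (space (gauss_vec F) - S) \<le> 1 / 4"
  proof (rule order.trans[rotated])
    have "space (gauss_vec F) - S = {y \<in> space (gauss_vec F). \<exists>k\<le>F. 2 * sqrt F < \<bar>\<Sum>j<k. y j\<bar>}"
      unfolding S_def by (auto simp: not_le)
    then show "measure (gauss_vec F) (space (gauss_vec F) - S)
      \<le> measure (gauss_vec F) {y \<in> space (gauss_vec F). \<exists>k\<le>F. 2 * sqrt F < \<bar>\<Sum>j<k. y j\<bar>}" by simp
  qed
  then have PS: "3 / 4 \<le> measure (gauss_vec F) S"
    using Q.prob_compl[OF S] by simp
  have "\<bar>control_target F e n x k\<bar> \<le> ?A" if "k < m" for k
  proof (rule control_target_bound[OF _ _ that])
    fix l assume "l < m"
    then show "\<bar>walk_state F e n x l\<bar> \<le> 3"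
      by (intro steered_state_bound[OF F FA _ L x order.refl]) (use e in auto)
  qed (use e in auto)
  then have energy: "(\<Sum>j<F. (a j)\<^sup>2) \<le> (real m * ?A * C)\<^sup>2"
    unfolding a_def using L by (intro control_shift_energy F) auto
  have "exp (- (real m * ?A * C)\<^sup>2) * (9 / 16) \<le> exp (- (\<Sum>j<F. (a j)\<^sup>2)) * (measure (gauss_vec F) S)\<^sup>2"
  proof (rule mult_mono)
    have "(3 / 4)\<^sup>2 \<le> (measure (gauss_vec F) S)\<^sup>2" using PS by (intro power_mono) auto
    then show "9 / 16 \<le> (measure (gauss_vec F) S)\<^sup>2" by (simp add: power2_eq_square)
  qed (use energy in auto)
  also have "\<dots> \<le> measure (gauss_vec F) {y \<in> space (gauss_vec F). (\<lambda>j\<in>{..<F}. y j - a j) \<in> S}"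
    by (rule gauss_vec_shifted_set[OF S])
  also have "{y \<in> space (gauss_vec F). (\<lambda>j\<in>{..<F}. y j - a j) \<in> S}
      = {y \<in> space (gauss_vec F). x(n := y) \<in> steered \<Theta> m F e (Suc n)}"
  proof (rule Collect_cong, rule conj_cong[OF refl])
    fix y assume y: "y \<in> space (gauss_vec F)"
    have sp: "x(n := y) \<in> space (Pi\<^sub>M {..<Suc n} (\<lambda>_. gauss_vec F))"
      using x y by (auto simp: steered_def space_PiM PiE_iff extensional_def less_Suc_eq)
    have "(\<lambda>j\<in>{..<F}. y j - a j) \<in> S \<longleftrightarrow> (\<forall>k\<le>F. \<bar>\<Sum>j<k. y j - a j\<bar> \<le> 2 * sqrt F)"
    proof -
      have "(\<Sum>j<k. (\<lambda>j\<in>{..<F}. y j - a j) j) = (\<Sum>j<k. y j - a j)" if "k \<le> F" for k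
        using that by (intro sum.cong) auto
      moreover have "(\<lambda>j\<in>{..<F}. y j - a j) \<in> space (gauss_vec F)"
        by (auto simp: space_PiM)
      ultimately show ?thesis unfolding S_def by (auto simp del: restrict_apply)
    qed
    also have "\<dots> \<longleftrightarrow> x(n := y) \<in> steered \<Theta> m F e (Suc n)"
    proof -
      have "(\<forall>i<Suc n. \<forall>k\<le>F. \<bar>\<Sum>j<k. (x(n := y)) i j - control_shift \<Theta> m F (control_target F e i (x(n := y))) j\<bar> \<le> 2 * sqrt F)
         \<longleftrightarrow> (\<forall>i<n. \<forall>k\<le>F. \<bar>\<Sum>j<k. x i j - control_shift \<Theta> m F (control_target F e i x) j\<bar> \<le> 2 * sqrt F)
            \<and> (\<forall>k\<le>F. \<bar>\<Sum>j<k. y j - a j\<bar> \<le> 2 * sqrt F)"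
        unfolding a_def by (auto simp: less_Suc_eq control_target_upd)
      then show ?thesis using x sp unfolding steered_def by simp
    qed
    finally show "(\<lambda>j\<in>{..<F}. y j - a j) \<in> S \<longleftrightarrow> x(n := y) \<in> steered \<Theta> m F e (Suc n)" .
  qed
  finally show "ennreal (exp (- (real m * ?A * C)\<^sup>2) * (9 / 16))
      \<le> emeasure (gauss_vec F) {y \<in> space (gauss_vec F). x(n := y) \<in> steered \<Theta> m F e (Suc n)}"
    unfolding Q.emeasure_eq_measure by (rule ennreal_leI)
qed

text \<open>Undoes the scaling: at the end of block \<open>i\<close> the \<open>k\<close>-fold
  integral of the deviation is \<open>h ^ k * sqrt h\<close> times the state. Inside a block the
  Taylor expansion adds \<open>m\<close> terms of size 3 and one remainder, which explains the
  constant.\<close>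

lemma steered_path_bound:
  fixes L :: real
  assumes m: "1 \<le> m" and F: "0 < F" and FA: "real m * (3 * real m + L) * C \<le> F"
    and N: "0 < N" and \<eta>: "bounded_measurable \<eta>" and \<eta>0: "\<eta> 0 = 0"
    and blk: "\<And>i \<sigma>. i < N \<Longrightarrow> \<sigma> \<in> {0..1} \<Longrightarrow>
      \<eta> (real i / N + 1 / N * \<sigma>) - \<eta> (real i / N) = sqrt (1 / N) * (scaled_walk F (x i) \<sigma> - \<delta> i \<sigma>)"
    and \<delta>: "\<And>i. i < N \<Longrightarrow> bounded_measurable (\<delta> i)" "\<And>i \<sigma>. i < N \<Longrightarrow> \<sigma> \<in> {0..1} \<Longrightarrow> \<bar>\<delta> i \<sigma>\<bar> \<le> L"
    and e: "\<And>i k. i < N \<Longrightarrow> k < m \<Longrightarrow> e i k = iterated_integral k (\<delta> i) 1" and L: "0 \<le> L"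
    and x: "x \<in> steered \<Theta> m F e N" and t: "t \<in> {0..1}"
  shows "\<bar>iterated_integral (m - 1) \<eta> t\<bar>
    \<le> (3 * real m + 2 + real m * (3 * real m + L) * C + L) * ((1 / N) ^ (m - 1) * sqrt (1 / N))"
proof -
  define h where "h = 1 / real N"
  have h: "0 < h" "h \<le> 1" using N by (auto simp: h_def)
  have eb: "\<bar>e i k\<bar> \<le> L" if "i < N" "k < m" for i k
    using iterated_integral_abs_le[OF \<delta>(1)[OF that(1)] \<delta>(2)[OF that(1)], of 1 k] e[OF that] by simp
  have state: "\<bar>walk_state F e i x k\<bar> \<le> 3" if "i \<le> N" "k < m" for i k
    by (rule steered_state_bound[OF F FA eb L x that])
  define \<beta> where "\<beta> i \<sigma> = scaled_walk F (x i) \<sigma> - \<delta> i \<sigma>" for i \<sigma>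
  have bm\<beta>: "bounded_measurable (\<beta> i)" if "i < N" for i
    unfolding \<beta>_def[abs_def] by (rule bounded_measurable_diff[OF scaled_walk_bounded_measurable \<delta>(1)[OF that]])
  have ih: "real i * h + h \<le> 1" "0 \<le> real i * h" if "i < N" for i
    using that by (auto simp: h_def field_simps)
  have block: "iterated_integral k \<eta> (real i * h + h * s)
      = (\<Sum>l\<le>k. (h * s) ^ l / fact l * iterated_integral (k - l) \<eta> (real i * h))
        + h ^ k * (sqrt h * iterated_integral k (\<beta> i) s)"
    if "i < N" "s \<in> {0..1}" for i s k
  proof -
    have "iterated_integral k (\<lambda>\<sigma>. \<eta> (real i * h + h * \<sigma>) - \<eta> (real i * h)) s
        = iterated_integral k (\<lambda>\<sigma>. sqrt h * \<beta> i \<sigma>) s"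
    proof (rule iterated_integral_cong)
      fix \<sigma> assume "\<sigma> \<in> {0..s}"
      then have "\<sigma> \<in> {0..1}" using that by auto
      from blk[OF that(1) this] show "\<eta> (real i * h + h * \<sigma>) - \<eta> (real i * h) = sqrt h * \<beta> i \<sigma>"
        by (simp add: h_def \<beta>_def)
    qed (use that in auto)
    then show ?thesis
      using iterated_integral_block[OF \<eta> ih(2)[OF that(1)] h(1), of s k] that ih(1)[OF that(1)]
      by (simp add: iterated_integral_mult)
  qed
  have moments: "iterated_integral k \<eta> (real i * h) = h ^ k * (sqrt h * walk_state F e i x k)"
    if "i \<le> N" "k < m" for i k
    using that
  proof (induction i arbitrary: k)
    case 0
    have "iterated_integral k \<eta> 0 = 0"
    proof (cases k)
      case (Suc q)
      have "iterated_integral k \<eta> 0 = iterated_integral k (\<lambda>_. 0) 0"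
        by (rule iterated_integral_cong) (auto simp: \<eta>0)
      then show ?thesis using iterated_integral_const[of 0 k 0] by simp
    qed (simp add: \<eta>0)
    then show ?case by simp
  next
    case (Suc i)
    then have i: "i < N" by simp
    have "iterated_integral k \<eta> (real (Suc i) * h) = iterated_integral k \<eta> (real i * h + h * 1)"
      by (simp add: algebra_simps)
    also have "\<dots> = (\<Sum>l\<le>k. h ^ l / fact l * iterated_integral (k - l) \<eta> (real i * h))
        + h ^ k * (sqrt h * iterated_integral k (\<beta> i) 1)"
      using block[OF i, of 1 k] by simp
    also have "(\<Sum>l\<le>k. h ^ l / fact l * iterated_integral (k - l) \<eta> (real i * h))
       = (\<Sum>l\<le>k. h ^ k * (sqrt h * (walk_state F e i x (k - l) / fact l)))"
    proof (rule sum.cong[OF refl])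
      fix l assume l: "l \<in> {..k}"
      then have "h ^ k = h ^ l * h ^ (k - l)" by (simp add: power_add[symmetric])
      moreover have "iterated_integral (k - l) \<eta> (real i * h) = h ^ (k - l) * (sqrt h * walk_state F e i x (k - l))"
        using Suc.prems by (intro Suc.IH) auto
      ultimately show "h ^ l / fact l * iterated_integral (k - l) \<eta> (real i * h)
          = h ^ k * (sqrt h * (walk_state F e i x (k - l) / fact l))" by simp
    qed
    also have "iterated_integral k (\<beta> i) 1 = walk_moment F k (x i) - e i k"
      using iterated_integral_diff[OF scaled_walk_bounded_measurable \<delta>(1)[OF i], of 1 k F "x i"] e[OF i] Suc.prems
      by (simp add: walk_moment_def \<beta>_def[abs_def])
    finally have "iterated_integral k \<eta> (real (Suc i) * h)
        = (\<Sum>l\<le>k. h ^ k * (sqrt h * (walk_state F e i x (k - l) / fact l)))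
          + h ^ k * (sqrt h * (walk_moment F k (x i) - e i k))" .
    then have "iterated_integral k \<eta> (real (Suc i) * h)
        = h ^ k * (sqrt h * (\<Sum>l\<le>k. walk_state F e i x (k - l) / fact l))
          + h ^ k * (sqrt h * (walk_moment F k (x i) - e i k))"
      by (simp only: sum_distrib_left)
    then show ?case by (simp only: walk_state.simps distrib_left right_diff_distrib add_diff_eq)
  qed
  obtain i s where "i < N" "s \<in> {0..1}" "t = real i / N + 1 / N * s"
    using block_coordinates[OF t N] .
  then have dec: "i < N" "s \<in> {0..1}" "t = real i * h + h * s"
    by (simp_all add: h_def)
  let ?B = "real m * (3 * real m + L) * C"
  \<comment> \<open>The contributions are 2 from the tube, \<open>?B\<close> from the control and
    \<open>L\<close> from the target.\<close>
  have \<beta>b: "\<bar>\<beta> i \<sigma>\<bar> \<le> 2 + ?B + L" if "\<sigma> \<in> {0..1}" for \<sigma>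
  proof -
    let ?a = "control_shift \<Theta> m F (control_target F e i x)"
    have "\<bar>control_target F e i x k\<bar> \<le> 3 * real m + L" if "k < m" for k
      by (rule control_target_bound[OF _ _ that]) (use state eb dec in auto)
    then have "\<bar>scaled_walk F ?a \<sigma>\<bar> \<le> ?B"
      using L by (intro control_walk_close(2) F \<open>\<sigma> \<in> {0..1}\<close>) auto
    moreover have "scaled_walk F (x i) \<sigma> = scaled_walk F (\<lambda>j. x i j - ?a j) \<sigma> + scaled_walk F ?a \<sigma>"
      using scaled_walk_add[of F "\<lambda>j. x i j - ?a j" ?a \<sigma>] by simp
    ultimately show ?thesis
      using steered_walk_bound[OF F x dec(1) that] \<delta>(2)[OF dec(1) that] unfolding \<beta>_def by linarith
  qed
  have "iterated_integral (m - 1) \<eta> t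
     = (\<Sum>l\<le>m - 1. (h * s) ^ l / fact l * iterated_integral (m - 1 - l) \<eta> (real i * h))
        + h ^ (m - 1) * (sqrt h * iterated_integral (m - 1) (\<beta> i) s)"
    unfolding dec(3) by (rule block[OF dec(1,2)])
  also have "\<bar>\<dots>\<bar> \<le> (\<Sum>l\<le>m - 1. h ^ (m - 1) * (sqrt h * 3)) + h ^ (m - 1) * (sqrt h * (2 + ?B + L))"
  proof (rule order.trans[OF abs_triangle_ineq add_mono])
    show "\<bar>\<Sum>l\<le>m - 1. (h * s) ^ l / fact l * iterated_integral (m - 1 - l) \<eta> (real i * h)\<bar>
        \<le> (\<Sum>l\<le>m - 1. h ^ (m - 1) * (sqrt h * 3))"
    proof (rule order.trans[OF sum_abs sum_mono])
      fix l assume l: "l \<in> {..m - 1}"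
      have 1: "\<bar>(h * s) ^ l / fact l\<bar> \<le> h ^ l"
      proof -
        have "0 \<le> h * s" "h * s \<le> h" using h dec by (auto intro: mult_left_le)
        then have "0 \<le> (h * s) ^ l" "(h * s) ^ l \<le> h ^ l" by (auto intro: power_mono)
        moreover have "(h * s) ^ l / fact l \<le> (h * s) ^ l"
          using mult_left_mono[OF fact_ge_1[of l, where 'a = real] \<open>0 \<le> (h * s) ^ l\<close>]
          by (simp add: divide_le_eq)
        ultimately show ?thesis by simp
      qed
      have 2: "\<bar>iterated_integral (m - 1 - l) \<eta> (real i * h)\<bar> \<le> h ^ (m - 1 - l) * (sqrt h * 3)"
      proof -
        have "iterated_integral (m - 1 - l) \<eta> (real i * h) = h ^ (m - 1 - l) * (sqrt h * walk_state F e i x (m - 1 - l))"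
          using dec m by (intro moments) auto
        moreover have "\<bar>walk_state F e i x (m - 1 - l)\<bar> \<le> 3" using dec m by (intro state) auto
        ultimately show ?thesis using h by (simp add: abs_mult mult_left_mono)
      qed
      have "\<bar>(h * s) ^ l / fact l * iterated_integral (m - 1 - l) \<eta> (real i * h)\<bar> \<le> h ^ l * (h ^ (m - 1 - l) * (sqrt h * 3))"
        unfolding abs_mult using 1 2 h by (intro mult_mono) auto
      also have "\<dots> = h ^ (m - 1) * (sqrt h * 3)"
      proof -
        have "h ^ l * h ^ (m - 1 - l) = h ^ (m - 1)"
          unfolding power_add[symmetric] using le_add_diff_inverse[of l "m - 1"] l by (simp only: atMost_iff)
        then show ?thesis by (simp only: mult.assoc[symmetric])
      qed
      finally show "\<bar>(h * s) ^ l / fact l * iterated_integral (m - 1 - l) \<eta> (real i * h)\<bar> \<le> h ^ (m - 1) * (sqrt h * 3)" .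
    qed
    have "\<bar>iterated_integral (m - 1) (\<beta> i) s\<bar> \<le> 2 + ?B + L"
      using iterated_integral_abs_le[OF bm\<beta>[OF dec(1)] \<beta>b, of s "m - 1"] dec by simp
    then show "\<bar>h ^ (m - 1) * (sqrt h * iterated_integral (m - 1) (\<beta> i) s)\<bar> \<le> h ^ (m - 1) * (sqrt h * (2 + ?B + L))"
      using h by (simp add: abs_mult mult_left_mono)
  qed
  also have "\<dots> = (3 * real m + 2 + ?B + L) * (h ^ (m - 1) * sqrt h)"
    using m by (simp add: algebra_simps of_nat_diff)
  finally show ?thesis by (simp add: h_def)
qed

end

section \<open>Energy of Brownian increments\<close>

lemma floor_grid_mem:
  assumes "t \<in> {0..1}"
  shows "real (nat \<lfloor>t * real (Suc k)\<rfloor>) / real (Suc k) \<in> {0..1} \<inter> \<rat>"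
  using floor_step_le[OF assms, of "Suc k"] by (simp del: of_nat_Suc)

lemma floor_grid_tendsto:
  assumes t: "t \<in> {0..1}"
  shows "(\<lambda>k. real (nat \<lfloor>t * real (Suc k)\<rfloor>) / real (Suc k)) \<longlonglongrightarrow> t"
proof (rule LIM_zero_cancel, rule Lim_null_comparison)
  have "norm (real (nat \<lfloor>t * real (Suc k)\<rfloor>) / real (Suc k) - t) \<le> inverse (real (Suc k))" for k
  proof -
    have "0 \<le> t * real (Suc k)" using t by simp
    then have "real (nat \<lfloor>t * real (Suc k)\<rfloor>) \<le> t * real (Suc k)"
      "t * real (Suc k) \<le> real (nat \<lfloor>t * real (Suc k)\<rfloor>) + 1" by linarith+
    then have "real (nat \<lfloor>t * real (Suc k)\<rfloor>) / real (Suc k) \<le> t"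
      "t \<le> real (nat \<lfloor>t * real (Suc k)\<rfloor>) / real (Suc k) + inverse (real (Suc k))"
      by (auto simp: field_simps simp del: of_nat_Suc)
    then show ?thesis unfolding real_norm_def by linarith
  qed
  then show "\<forall>\<^sub>F k in sequentially. norm (real (nat \<lfloor>t * real (Suc k)\<rfloor>) / real (Suc k) - t) \<le> inverse (real (Suc k))"
    by simp
qed (rule LIMSEQ_inverse_real_of_nat)

text \<open>The process sampled at the grid point to the left of \<open>t\<close> takes only
  countably many times, so it is jointly measurable; it converges pointwise by continuity of the
  paths.\<close>

lemma process_joint_measurable:
  fixes X :: "real \<Rightarrow> 'w \<Rightarrow> real"
  assumes X: "\<And>t. t \<in> {0..1} \<Longrightarrow> X t \<in> borel_measurable M"
    and cont: "\<And>\<omega>. \<omega> \<in> space M \<Longrightarrow> continuous_on {0..1} (\<lambda>t. X t \<omega>)"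
  shows "(\<lambda>(\<omega>, t). X t \<omega>) \<in> borel_measurable (M \<Otimes>\<^sub>M unit_lborel)"
proof (rule borel_measurable_LIMSEQ_real)
  define q where "q k t = real (nat \<lfloor>t * real (Suc k)\<rfloor>) / real (Suc k)" for k t
  have q01: "q k t \<in> {0..1}" if "t \<in> {0..1}" for k t
    using floor_grid_mem[OF that, of k] unfolding q_def by blast
  show "(\<lambda>k. X (q k (snd p)) (fst p)) \<longlonglongrightarrow> (case p of (\<omega>, t) \<Rightarrow> X t \<omega>)"
    if p: "p \<in> space (M \<Otimes>\<^sub>M unit_lborel)" for p
  proof -
    obtain \<omega> t where \<omega>: "p = (\<omega>, t)" "\<omega> \<in> space M" "t \<in> {0..1}"
      using p by (auto simp: space_pair_measure)
    have "(\<lambda>k. q k t) \<longlonglongrightarrow> t" unfolding q_def by (rule floor_grid_tendsto[OF \<omega>(3)])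
    then have "(\<lambda>k. X (q k t) \<omega>) \<longlonglongrightarrow> X t \<omega>"
      by (rule continuous_on_tendsto_compose[OF cont[OF \<omega>(2)]]) (use q01 \<omega> in auto)
    then show ?thesis by (simp add: \<omega>)
  qed
  fix k
  let ?g = "\<lambda>p. nat \<lfloor>snd p * real (Suc k)\<rfloor>"
  have "(\<lambda>t::real. t) \<in> borel_measurable unit_lborel" by (rule borel_measurable_unit_lborelI) simp
  then have [measurable]: "snd \<in> borel_measurable (M \<Otimes>\<^sub>M unit_lborel)"
    using measurable_compose[OF measurable_snd[of M unit_lborel]] by simp
  \<comment> \<open>The index \<open>n\<close> ranges over all naturals here; times outside the unit
    interval get the value 0, since measurability of \<open>X\<close> is known only inside.\<close>
  have "(\<lambda>p. (\<lambda>n p. if real n / real (Suc k) \<in> {0..1} then X (real n / real (Suc k)) (fst p) else 0) (?g p) p)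
      \<in> borel_measurable (M \<Otimes>\<^sub>M unit_lborel)"
  proof (rule measurable_compose_countable[where g = ?g and
        f = "\<lambda>n p. if real n / real (Suc k) \<in> {0..1} then X (real n / real (Suc k)) (fst p) else 0"])
    fix n :: nat
    show "(\<lambda>p. if real n / real (Suc k) \<in> {0..1} then X (real n / real (Suc k)) (fst p) else 0)
        \<in> borel_measurable (M \<Otimes>\<^sub>M unit_lborel)"
    proof (cases "real n / real (Suc k) \<in> {0..1}")
      case True
      then show ?thesis
        using measurable_compose[OF measurable_fst X[OF True]] by (simp only: if_True)
    next
      case False
      then show ?thesis by (simp only: if_False borel_measurable_const)
    qed
  next
    show "?g \<in> measurable (M \<Otimes>\<^sub>M unit_lborel) (count_space UNIV)" by measurable
  qed
  then show "(\<lambda>p. X (q k (snd p)) (fst p)) \<in> borel_measurable (M \<Otimes>\<^sub>M unit_lborel)"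
  proof (rule measurable_cong[THEN iffD1, rotated])
    fix p assume "p \<in> space (M \<Otimes>\<^sub>M unit_lborel)"
    then have "snd p \<in> {0..1}" by (auto simp: space_pair_measure)
    from q01[OF this, of k] show "(if real (?g p) / real (Suc k) \<in> {0..1} then X (real (?g p) / real (Suc k)) (fst p) else 0)
       = X (q k (snd p)) (fst p)"
      by (simp add: q_def)
  qed
qed

text \<open>Tilting by \<open>exp (z\<^sup>2 / 4)\<close> gives, up to the factor
  \<open>sqrt 2\<close>, the normal density of variance 2.\<close>

lemma std_gauss_exp_square: "(\<integral>\<^sup>+ z. ennreal (exp (z\<^sup>2 / 4)) \<partial>std_gauss) = ennreal (sqrt 2)"
proof -
  have "(\<integral>\<^sup>+ z. ennreal (exp (z\<^sup>2 / 4)) \<partial>std_gauss)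
      = (\<integral>\<^sup>+ z. ennreal (sqrt 2) * ennreal (normal_density 0 (sqrt 2) z) \<partial>lborel)"
  proof (subst nn_integral_density)
    have "std_normal_density z * exp (z\<^sup>2 / 4) = sqrt 2 * normal_density 0 (sqrt 2) z" for z :: real
    proof -
      have "exp (- z\<^sup>2 / 2) * exp (z\<^sup>2 / 4) = exp (- z\<^sup>2 / 4)" by (simp add: exp_add[symmetric])
      then show ?thesis
        by (simp add: normal_density_def real_sqrt_mult field_simps)
    qed
    then show "(\<integral>\<^sup>+ z. ennreal (std_normal_density z) * ennreal (exp (z\<^sup>2 / 4)) \<partial>lborel)
       = (\<integral>\<^sup>+ z. ennreal (sqrt 2) * ennreal (normal_density 0 (sqrt 2) z) \<partial>lborel)"
      by (simp add: ennreal_mult[symmetric])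
  qed auto
  also have "\<dots> = ennreal (sqrt 2)"
    by (subst nn_integral_cmult) (auto simp: nn_integral_eq_integral integral_normal_density)
  finally show ?thesis .
qed

lemma prod_lessThan_double:
  fixes N :: nat
  shows "(\<Prod>k<2 * N. f k) = (\<Prod>i<N. f (2 * i) * (f (2 * i + 1) :: 'a :: comm_monoid_mult))"
  by (induction N) (auto simp: mult_ac)

context brownian_motion01
begin

lemma increment_measurable:
  "s \<in> {0..1} \<Longrightarrow> t \<in> {0..1} \<Longrightarrow> (\<lambda>\<omega>. B t \<omega> - B s \<omega>) \<in> borel_measurable M"
  using random_variable by (intro borel_measurable_diff) auto

lemma normalised_increment_distr:
  assumes "0 \<le> s" "s < t" "t \<le> 1"
  shows "distr M borel (\<lambda>\<omega>. (B t \<omega> - B s \<omega>) / sqrt (t - s)) = std_gauss"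
proof -
  have "distributed M lborel (\<lambda>\<omega>. 0 + (1 / sqrt (t - s)) * (B t \<omega> - B s \<omega>))
     (normal_density (0 + (1 / sqrt (t - s)) * 0) (\<bar>1 / sqrt (t - s)\<bar> * sqrt (t - s)))"
    using assms by (intro normal_density_affine increments_normal) auto
  then have "distributed M lborel (\<lambda>\<omega>. (B t \<omega> - B s \<omega>) / sqrt (t - s)) std_normal_density"
    using assms by simp
  then have "distr M lborel (\<lambda>\<omega>. (B t \<omega> - B s \<omega>) / sqrt (t - s)) = std_gauss"
    by (rule distributed_distr_eq_density)
  moreover have "distr M lborel (\<lambda>\<omega>. (B t \<omega> - B s \<omega>) / sqrt (t - s)) = distr M borel (\<lambda>\<omega>. (B t \<omega> - B s \<omega>) / sqrt (t - s))"
    by (rule distr_cong) auto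
  ultimately show ?thesis by simp
qed

lemma increment_exp_square:
  assumes "0 \<le> s" "s \<le> t" "t \<le> 1" "t - s \<le> w" "0 < w"
  shows "(\<integral>\<^sup>+ \<omega>. ennreal (exp ((B t \<omega> - B s \<omega>)\<^sup>2 / (4 * w))) \<partial>M) \<le> ennreal (sqrt 2)"
proof (cases "s = t")
  case True
  then show ?thesis by (simp add: emeasure_space_1)
next
  case False
  then have st: "s < t" using assms by simp
  let ?X = "\<lambda>\<omega>. (B t \<omega> - B s \<omega>) / sqrt (t - s)"
  have [measurable]: "?X \<in> borel_measurable M"
    using increment_measurable[of s t] assms by auto
  have "(\<integral>\<^sup>+ \<omega>. ennreal (exp ((B t \<omega> - B s \<omega>)\<^sup>2 / (4 * w))) \<partial>M) \<le> (\<integral>\<^sup>+ \<omega>. ennreal (exp ((?X \<omega>)\<^sup>2 / 4)) \<partial>M)"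
  proof (rule nn_integral_mono, rule ennreal_leI, subst exp_le_cancel_iff)
    fix \<omega>
    have "(B t \<omega> - B s \<omega>)\<^sup>2 / (4 * w) \<le> (B t \<omega> - B s \<omega>)\<^sup>2 / (4 * (t - s))"
      using assms st by (intro divide_left_mono) auto
    also have "\<dots> = (?X \<omega>)\<^sup>2 / 4" using st by (simp add: power_divide)
    finally show "(B t \<omega> - B s \<omega>)\<^sup>2 / (4 * w) \<le> (?X \<omega>)\<^sup>2 / 4" .
  qed
  also have "\<dots> = (\<integral>\<^sup>+ z. ennreal (exp (z\<^sup>2 / 4)) \<partial>distr M borel ?X)"
    by (subst nn_integral_distr) auto
  also have "\<dots> = ennreal (sqrt 2)"
    unfolding normalised_increment_distr[OF assms(1) st assms(3)] by (rule std_gauss_exp_square)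
  finally show ?thesis .
qed

text \<open>Each summand has mean \<open>1 / (2 * N)\<close> for \<open>N > 0\<close>, so the
  unweighted sum stays of order one however many blocks there are.\<close>

definition block_energy :: "nat \<Rightarrow> 'w \<Rightarrow> real" where
  "block_energy N \<omega> =
     (\<Sum>i<N. LINT s|unit_lborel. (B (real i / N + 1 / N * s) \<omega> - B (real i / N) \<omega>)\<^sup>2)"

lemma block_time:
  fixes N :: nat
  shows "i < N \<Longrightarrow> s \<in> {0..1} \<Longrightarrow> real i / N + 1 / N * s \<in> {0..1}"
proof -
  assume *: "i < N" "s \<in> {0..1}"
  then have "real i + s \<le> real N" by auto
  then have "(real i + s) / N \<le> 1" using * by simp
  then show ?thesis using * by (simp add: add_divide_distrib)
qed

lemma block_increment_continuous:
  fixes N :: nat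
  assumes "i < N" "\<omega> \<in> space M"
  shows "continuous_on {0..1} (\<lambda>s. B (real i / N + 1 / N * s) \<omega> - B (real i / N) \<omega>)"
  by (intro continuous_intros continuous_on_compose2[OF sample_continuous[OF assms(2)]])
     (use block_time[OF assms(1)] in auto)

lemma block_increment_joint:
  fixes N :: nat
  assumes i: "i < N"
  shows "(\<lambda>(\<omega>, s). B (real i / N + 1 / N * s) \<omega> - B (real i / N) \<omega>) \<in> borel_measurable (M \<Otimes>\<^sub>M unit_lborel)"
proof (rule process_joint_measurable)
  fix t :: real assume "t \<in> {0..1}"
  then show "(\<lambda>\<omega>. B (real i / N + 1 / N * t) \<omega> - B (real i / N) \<omega>) \<in> borel_measurable M"
    using block_time[OF i, of t] block_time[OF i, of 0] by (intro increment_measurable) auto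
qed (rule block_increment_continuous[OF i])

lemma block_energy_measurable: "block_energy N \<in> borel_measurable M"
proof -
  interpret U: prob_space unit_lborel by (rule prob_space_unit_lborel)
  have "(\<lambda>\<omega>. LINT s|unit_lborel. (B (real i / N + 1 / N * s) \<omega> - B (real i / N) \<omega>)\<^sup>2) \<in> borel_measurable M"
    if "i < N" for i
    using block_increment_joint[OF that]
    by (intro U.borel_measurable_lebesgue_integral) (auto simp: case_prod_beta')
  then show ?thesis unfolding block_energy_def[abs_def] by (intro borel_measurable_sum) auto
qed

text \<open>For a fixed position \<open>s\<close> inside the blocks the increments are independent
  with variance at most \<open>1 / N\<close>, and the moment factorises.\<close>

lemma block_increments_exp_moment:
  assumes N: "0 < N" and s: "s \<in> {0..1}"
  shows "(\<integral>\<^sup>+ \<omega>. ennreal (exp (real N / 4 * (\<Sum>i<N. (B (real i / N + 1 / N * s) \<omega> - B (real i / N) \<omega>)\<^sup>2))) \<partial>M)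
    \<le> ennreal (sqrt 2) ^ N"
proof -
  \<comment> \<open>The block ends and the inner points interleave: even increments run from a block
    end to its inner point, odd ones from there to the next block. Clipping at 1 keeps the sequence
    monotone and in range for all indices.\<close>
  define u where "u k = min (real (k div 2) / N + (if even k then 0 else 1 / N * s)) 1" for k :: nat
  have "mono u"
  proof (rule incseq_SucI)
    fix k
    have "1 / N * s \<le> 1 / N" using s by (simp add: divide_right_mono)
    moreover have "0 \<le> 1 / N * s" using s by simp
    ultimately show "u k \<le> u (Suc k)"
      by (cases "even k") (auto simp: u_def add_divide_distrib min_le_iff_disj elim!: oddE)
  qed
  moreover have "range u \<subseteq> {0..1}" using s by (auto simp: u_def)
  ultimately have ind: "indep_vars (\<lambda>_. borel) (\<lambda>k \<omega>. B (u (Suc k)) \<omega> - B (u k) \<omega>) {..<2 * N}"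
    by (rule increments_indep)
  \<comment> \<open>The odd increments enter with the neutral factor 1.\<close>
  define Y where "Y k x = (if even k then ennreal (exp (x\<^sup>2 / (4 * (1 / N)))) else 1)" for k :: nat and x :: real
  have ind': "indep_vars (\<lambda>_. borel) (\<lambda>k \<omega>. Y k (B (u (Suc k)) \<omega> - B (u k) \<omega>)) {..<2 * N}"
    by (rule indep_vars_compose2[OF ind]) (auto simp: Y_def[abs_def])
  have ev: "u (2 * i) = real i / N" "u (Suc (2 * i)) = real i / N + 1 / N * s" if "i < N" for i
    using block_time[OF that s] block_time[OF that, of 0] by (auto simp: u_def)
  have "ennreal (exp (real N / 4 * (\<Sum>i<N. (B (real i / N + 1 / N * s) \<omega> - B (real i / N) \<omega>)\<^sup>2)))
      = (\<Prod>k<2 * N. Y k (B (u (Suc k)) \<omega> - B (u k) \<omega>))" for \<omega>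
  proof -
    have "(\<Prod>k<2 * N. Y k (B (u (Suc k)) \<omega> - B (u k) \<omega>))
        = (\<Prod>i<N. ennreal (exp (real N / 4 * (B (real i / N + 1 / N * s) \<omega> - B (real i / N) \<omega>)\<^sup>2)))"
      unfolding prod_lessThan_double by (intro prod.cong refl) (simp add: Y_def ev)
    also have "\<dots> = ennreal (\<Prod>i<N. exp (real N / 4 * (B (real i / N + 1 / N * s) \<omega> - B (real i / N) \<omega>)\<^sup>2))"
      by (rule prod_ennreal) auto
    finally show ?thesis by (simp only: exp_sum[OF finite_lessThan, symmetric] sum_distrib_left)
  qed
  then have "(\<integral>\<^sup>+ \<omega>. ennreal (exp (real N / 4 * (\<Sum>i<N. (B (real i / N + 1 / N * s) \<omega> - B (real i / N) \<omega>)\<^sup>2))) \<partial>M)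
     = (\<integral>\<^sup>+ \<omega>. (\<Prod>k<2 * N. Y k (B (u (Suc k)) \<omega> - B (u k) \<omega>)) \<partial>M)" by (simp only:)
  also have "\<dots> = (\<Prod>k<2 * N. \<integral>\<^sup>+ \<omega>. Y k (B (u (Suc k)) \<omega> - B (u k) \<omega>) \<partial>M)"
    by (rule indep_vars_nn_integral[OF finite_lessThan ind']) auto
  also have "\<dots> \<le> (\<Prod>i<N. ennreal (sqrt 2))"
    unfolding prod_lessThan_double
  proof (rule prod_mono_ennreal)
    fix i assume "i \<in> {..<N}"
    then have i: "i < N" by simp
    have "(\<integral>\<^sup>+ \<omega>. Y (2 * i + 1) (B (u (Suc (2 * i + 1))) \<omega> - B (u (2 * i + 1)) \<omega>) \<partial>M) = 1"
      by (simp add: Y_def emeasure_space_1)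
    moreover have "(\<integral>\<^sup>+ \<omega>. Y (2 * i) (B (u (Suc (2 * i))) \<omega> - B (u (2 * i)) \<omega>) \<partial>M) \<le> ennreal (sqrt 2)"
      unfolding Y_def ev[OF i] if_P[OF dvd_triv_left]
      using i s block_time[OF i s] N
      by (intro increment_exp_square) (auto simp: divide_right_mono)
    ultimately show "(\<integral>\<^sup>+ \<omega>. Y (2 * i) (B (u (Suc (2 * i))) \<omega> - B (u (2 * i)) \<omega>) \<partial>M)
       * (\<integral>\<^sup>+ \<omega>. Y (2 * i + 1) (B (u (Suc (2 * i + 1))) \<omega> - B (u (2 * i + 1)) \<omega>) \<partial>M) \<le> ennreal (sqrt 2)"
      by simp
  qed
  finally show ?thesis by simp
qed

text \<open>Jensen's inequality in the position inside a block reduces to independent increments.\<close>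

lemma block_energy_exp_moment:
  assumes N: "0 < N"
  shows "(\<integral>\<^sup>+ \<omega>. ennreal (exp (real N / 4 * block_energy N \<omega>)) \<partial>M) \<le> ennreal (sqrt 2) ^ N"
proof -
  interpret U: prob_space unit_lborel by (rule prob_space_unit_lborel)
  interpret MU: pair_sigma_finite M unit_lborel ..
  define D where "D \<omega> s = real N / 4 * (\<Sum>i<N. (B (real i / N + 1 / N * s) \<omega> - B (real i / N) \<omega>)\<^sup>2)" for \<omega> s
  have D[measurable]: "(\<lambda>(\<omega>, s). D \<omega> s) \<in> borel_measurable (M \<Otimes>\<^sub>M unit_lborel)"
    using block_increment_joint unfolding D_def case_prod_beta'
    by (intro borel_measurable_times borel_measurable_const borel_measurable_sum borel_measurable_power) auto
  have "ennreal (exp (real N / 4 * block_energy N \<omega>)) \<le> (\<integral>\<^sup>+ s. ennreal (exp (D \<omega> s)) \<partial>unit_lborel)"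
    if \<omega>: "\<omega> \<in> space M" for \<omega>
  proof -
    have cont: "continuous_on {0..1} (D \<omega>)"
      unfolding D_def[abs_def]
      by (intro continuous_on_mult_left continuous_on_sum continuous_on_power block_increment_continuous \<omega>) auto
    have int: "integrable unit_lborel (D \<omega>)" "integrable unit_lborel (\<lambda>s. exp (D \<omega> s))"
      by (intro bounded_measurable_integrable bounded_measurable_continuous continuous_intros cont)+
    have "real N / 4 * block_energy N \<omega> = (LINT s|unit_lborel. D \<omega> s)"
    proof -
      have "integrable unit_lborel (\<lambda>s. (B (real i / N + 1 / N * s) \<omega> - B (real i / N) \<omega>)\<^sup>2)" if "i < N" for i
        by (intro bounded_measurable_integrable bounded_measurable_continuous continuous_on_power
            block_increment_continuous that \<omega>)
      then show ?thesis
        unfolding D_def block_energy_def by (simp add: Bochner_Integration.integral_sum)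
    qed
    then have "exp (real N / 4 * block_energy N \<omega>) \<le> (LINT s|unit_lborel. exp (D \<omega> s))"
      using U.jensens_inequality[where X = "D \<omega>" and I = UNIV and q = exp] int exp_convex by simp
    also have "ennreal \<dots> = (\<integral>\<^sup>+ s. ennreal (exp (D \<omega> s)) \<partial>unit_lborel)"
      by (rule nn_integral_eq_integral[symmetric, OF int(2)]) auto
    finally show ?thesis by (simp add: ennreal_leI)
  qed
  then have "(\<integral>\<^sup>+ \<omega>. ennreal (exp (real N / 4 * block_energy N \<omega>)) \<partial>M)
      \<le> (\<integral>\<^sup>+ \<omega>. (\<integral>\<^sup>+ s. ennreal (exp (D \<omega> s)) \<partial>unit_lborel) \<partial>M)"
    by (rule nn_integral_mono)
  also have "\<dots> = (\<integral>\<^sup>+ s. (\<integral>\<^sup>+ \<omega>. ennreal (exp (D \<omega> s)) \<partial>M) \<partial>unit_lborel)"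
    by (rule MU.Fubini'[symmetric]) measurable
  also have "\<dots> \<le> (\<integral>\<^sup>+ s. ennreal (sqrt 2) ^ N \<partial>unit_lborel)"
    unfolding D_def by (intro nn_integral_mono block_increments_exp_moment N) auto
  also have "\<dots> = ennreal (sqrt 2) ^ N"
    using U.emeasure_space_1 by simp
  finally show ?thesis .
qed

text \<open>Exponential Markov inequality with parameter \<open>real N / 4\<close>; the term 1/2
  comes from \<open>sqrt 2 \<le> exp (1 / 2)\<close>. A large \<open>c\<close> yields any desired
  exponential rate in \<open>N\<close>.\<close>

lemma block_energy_tail:
  assumes N: "0 < N"
  shows "prob {\<omega> \<in> space M. c < block_energy N \<omega>} \<le> exp (real N * (1 / 2 - c / 4))"
proof -
  note [measurable] = block_energy_measurable
  let ?A = "{\<omega> \<in> space M. c < block_energy N \<omega>}"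
  have "ennreal (exp (real N * c / 4)) * emeasure M ?A = (\<integral>\<^sup>+ \<omega>. ennreal (exp (real N * c / 4)) * indicator ?A \<omega> \<partial>M)"
    by (rule nn_integral_cmult_indicator[symmetric]) measurable
  also have "\<dots> \<le> (\<integral>\<^sup>+ \<omega>. ennreal (exp (real N / 4 * block_energy N \<omega>)) \<partial>M)"
    by (intro nn_integral_mono) (auto simp: indicator_def mult_left_mono)
  also have "\<dots> \<le> ennreal (sqrt 2) ^ N" by (rule block_energy_exp_moment[OF N])
  also have "\<dots> = ennreal (sqrt 2 ^ N)" by (simp add: ennreal_power)
  finally have "exp (real N * c / 4) * prob ?A \<le> sqrt 2 ^ N"
    by (simp add: emeasure_eq_measure ennreal_mult[symmetric])
  also have "sqrt 2 ^ N \<le> exp (1 / 2) ^ N"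
  proof (rule power_mono)
    have "2 \<le> exp (1::real)" using exp_ge_add_one_self[of 1] by simp
    then have "sqrt 2 \<le> sqrt (exp 1)" by simp
    also have "sqrt (exp (1::real)) = exp (1 / 2)"
      by (rule real_sqrt_unique) (auto simp: power2_eq_square exp_add[symmetric])
    finally show "sqrt 2 \<le> exp (1 / 2 :: real)" .
  qed simp
  also have "exp (1 / 2 :: real) ^ N = exp (real N / 2)" by (simp add: exp_of_nat_mult[symmetric])
  finally have "prob ?A \<le> exp (real N / 2) / exp (real N * c / 4)"
    by (simp add: field_simps)
  also have "\<dots> = exp (real N * (1 / 2 - c / 4))"
    by (simp add: exp_diff[symmetric] algebra_simps)
  finally show ?thesis .
qed

end

section \<open>Small balls of integrated Brownian motion\<close>

context brownian_motion01
begin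

definition fine_step :: "nat \<Rightarrow> nat \<Rightarrow> 'w \<Rightarrow> real" where
  "fine_step K k \<omega> = sqrt K * (B (real (Suc k) / K) \<omega> - B (real k / K) \<omega>)"

definition step_vec :: "nat \<Rightarrow> nat \<Rightarrow> nat \<Rightarrow> 'w \<Rightarrow> nat \<Rightarrow> real" where
  "step_vec N F i \<omega> = (\<lambda>j\<in>{..<F}. fine_step (N * F) (i * F + j) \<omega>)"

text \<open>The path sampled at the left grid point. On a block of \<open>F\<close> grid intervals
  its increments are exactly a scaled walk.\<close>

definition step_path :: "nat \<Rightarrow> 'w \<Rightarrow> real \<Rightarrow> real" where
  "step_path K \<omega> t = B (real (nat \<lfloor>t * K\<rfloor>) / K) \<omega> - B 0 \<omega>"

lemma fine_step_measurable: "k < K \<Longrightarrow> fine_step K k \<in> borel_measurable M"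
  unfolding fine_step_def[abs_def] by (intro borel_measurable_times borel_measurable_const increment_measurable) auto

lemma fine_step_distr:
  assumes "k < K"
  shows "distr M borel (fine_step K k) = std_gauss"
proof -
  have eq: "real (Suc k) / K - real k / K = 1 / K" by (simp add: diff_divide_distrib[symmetric])
  have "distr M borel (\<lambda>\<omega>. (B (real (Suc k) / K) \<omega> - B (real k / K) \<omega>) / sqrt (real (Suc k) / K - real k / K)) = std_gauss"
    using assms by (intro normalised_increment_distr) (auto simp: divide_strict_right_mono)
  moreover have "(\<lambda>\<omega>. (B (real (Suc k) / K) \<omega> - B (real k / K) \<omega>) / sqrt (real (Suc k) / K - real k / K)) = fine_step K k"
    unfolding eq fine_step_def[abs_def] by (simp add: real_sqrt_divide mult.commute)
  ultimately show ?thesis by simp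
qed

lemma fine_steps_indep:
  assumes "a + n \<le> K" "0 < K"
  shows "indep_vars (\<lambda>_. borel) (\<lambda>j. fine_step K (a + j)) {..<n}"
proof -
  define u where "u j = min (real (a + j) / K) 1" for j
  have "mono u" by (rule incseq_SucI) (auto simp: u_def min_le_iff_disj divide_right_mono)
  moreover have "range u \<subseteq> {0..1}" by (auto simp: u_def)
  ultimately have "indep_vars (\<lambda>_. borel) (\<lambda>i \<omega>. B (u (Suc i)) \<omega> - B (u i) \<omega>) {..<n}"
    by (rule increments_indep)
  then have "indep_vars (\<lambda>_. borel) (\<lambda>i \<omega>. sqrt K * (B (u (Suc i)) \<omega> - B (u i) \<omega>)) {..<n}"
    by (rule indep_vars_compose2) auto
  moreover have "(\<lambda>\<omega>. sqrt K * (B (u (Suc i)) \<omega> - B (u i) \<omega>)) = fine_step K (a + i)" if "i < n" for i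
  proof -
    have "u i = real (a + i) / K" "u (Suc i) = real (Suc (a + i)) / K"
      using assms that by (auto simp: u_def)
    then show ?thesis by (simp add: fine_step_def[abs_def])
  qed
  ultimately show ?thesis
    by (subst indep_vars_cong[where J = "{..<n}" and N' = "\<lambda>_. borel"]) auto
qed

lemma block_index: "i < N \<Longrightarrow> j < F \<Longrightarrow> i * F + j < N * (F :: nat)"
proof -
  assume "i < N" "j < F"
  then have "i * F + j < Suc i * F" by simp
  also have "\<dots> \<le> N * F" using \<open>i < N\<close> by (intro mult_le_mono1) simp
  finally show ?thesis .
qed

lemma step_vec_distr:
  assumes i: "i < N" and F: "0 < F"
  shows "distr M (gauss_vec F) (step_vec N F i) = gauss_vec F"
proof -
  have le: "i * F + F \<le> N * F"
    using mult_le_mono1[of "Suc i" N F] i by simp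
  have ind: "indep_vars (\<lambda>_. borel) (\<lambda>j. fine_step (N * F) (i * F + j)) {..<F}"
    by (rule fine_steps_indep[OF le]) (use i F in auto)
  have rv: "random_variable borel (fine_step (N * F) (i * F + j))" if "j \<in> {..<F}" for j
    using that i by (intro fine_step_measurable block_index) auto
  have "distr M (Pi\<^sub>M {..<F} (\<lambda>_. borel)) (\<lambda>\<omega>. \<lambda>j\<in>{..<F}. fine_step (N * F) (i * F + j) \<omega>)
      = Pi\<^sub>M {..<F} (\<lambda>j. distr M borel (fine_step (N * F) (i * F + j)))"
    using indep_vars_iff_distr_eq_PiM'[where I = "{..<F}" and M' = "\<lambda>_. borel" and
        X = "\<lambda>j. fine_step (N * F) (i * F + j)"] rv ind F by auto
  also have "\<dots> = gauss_vec F"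
    using i by (intro PiM_cong refl fine_step_distr block_index) auto
  also have "distr M (Pi\<^sub>M {..<F} (\<lambda>_. borel)) (\<lambda>\<omega>. \<lambda>j\<in>{..<F}. fine_step (N * F) (i * F + j) \<omega>)
      = distr M (gauss_vec F) (step_vec N F i)"
    by (intro distr_cong refl sets_PiM_cong) (auto simp: step_vec_def)
  finally show ?thesis .
qed

lemma step_vec_indep:
  assumes N: "0 < N" and F: "0 < F"
  shows "indep_vars (\<lambda>_. gauss_vec F) (step_vec N F) {..<N}"
proof -
  define K where "K i = {i * F..<i * F + F}" for i
  have ind: "indep_vars (\<lambda>_. borel) (fine_step (N * F)) {..<N * F}"
    using fine_steps_indep[of 0 "N * F" "N * F"] N F by simp
  have sub: "K i \<subseteq> {..<N * F}" if "i \<in> {..<N}" for i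
  proof
    fix k assume "k \<in> K i"
    then have "k = i * F + (k - i * F)" "k - i * F < F" by (auto simp: K_def)
    then show "k \<in> {..<N * F}" using block_index[of i N "k - i * F" F] that by simp
  qed
  have disj: "disjoint_family_on K {..<N}"
    unfolding disjoint_family_on_def
  proof (intro ballI impI)
    fix i j assume "i \<noteq> (j :: nat)"
    have *: "K i \<inter> K j = {}" if "i < j" for i j
    proof -
      have "i * F + F \<le> j * F" using mult_le_mono1[of "Suc i" j F] that by simp
      then show ?thesis by (auto simp: K_def)
    qed
    then show "K i \<inter> K j = {}" using \<open>i \<noteq> j\<close> *[of i j] *[of j i] by (cases "i < j") (auto simp: Int_commute[of "K i"])
  qed
  have "indep_vars (\<lambda>i. Pi\<^sub>M (K i) (\<lambda>_. borel)) (\<lambda>i \<omega>. restrict (\<lambda>k. fine_step (N * F) k \<omega>) (K i)) {..<N}"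
    by (rule indep_vars_restrict[OF ind sub disj])
  then have "indep_vars (\<lambda>_. gauss_vec F)
      (\<lambda>i \<omega>. (\<lambda>y. \<lambda>j\<in>{..<F}. y (i * F + j)) (restrict (\<lambda>k. fine_step (N * F) k \<omega>) (K i))) {..<N}"
  proof (rule indep_vars_compose2)
    fix i
    show "(\<lambda>y. \<lambda>j\<in>{..<F}. y (i * F + j)) \<in> measurable (Pi\<^sub>M (K i) (\<lambda>_. borel)) (gauss_vec F)"
    proof (rule measurable_restrict)
      fix j assume "j \<in> {..<F}"
      then have "i * F + j \<in> K i" by (simp add: K_def)
      from measurable_component_singleton[OF this, of "\<lambda>_. borel"]
      show "(\<lambda>y. y (i * F + j)) \<in> measurable (Pi\<^sub>M (K i) (\<lambda>_. borel)) std_gauss"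
        by simp
    qed
  qed
  moreover have "(\<lambda>j\<in>{..<F}. (restrict (\<lambda>k. fine_step (N * F) k \<omega>) (K i)) (i * F + j)) = step_vec N F i \<omega>" for i \<omega>
    by (auto simp: step_vec_def K_def fun_eq_iff)
  ultimately show ?thesis by simp
qed

lemma step_vec_measurable: "i < N \<Longrightarrow> step_vec N F i \<in> measurable M (gauss_vec F)"
  unfolding step_vec_def[abs_def]
  by (rule measurable_restrict) (auto intro!: fine_step_measurable block_index)

lemma blocks_distr:
  assumes N: "0 < N" and F: "0 < F"
  shows "distr M (Pi\<^sub>M {..<N} (\<lambda>_. gauss_vec F)) (\<lambda>\<omega>. \<lambda>i\<in>{..<N}. step_vec N F i \<omega>)
    = Pi\<^sub>M {..<N} (\<lambda>_. gauss_vec F)"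
proof -
  have "distr M (Pi\<^sub>M {..<N} (\<lambda>_. gauss_vec F)) (\<lambda>\<omega>. \<lambda>i\<in>{..<N}. step_vec N F i \<omega>)
    = Pi\<^sub>M {..<N} (\<lambda>i. distr M (gauss_vec F) (step_vec N F i))"
    using indep_vars_iff_distr_eq_PiM'[where I = "{..<N}" and M' = "\<lambda>_. gauss_vec F" and X = "step_vec N F"]
      step_vec_indep[OF N F] step_vec_measurable N by auto
  also have "\<dots> = Pi\<^sub>M {..<N} (\<lambda>_. gauss_vec F)"
    using F by (intro PiM_cong refl step_vec_distr) auto
  finally show ?thesis .
qed

lemma step_path_block:
  assumes i: "i < N" and F: "0 < F" and \<sigma>: "\<sigma> \<in> {0..1}"
  shows "step_path (N * F) \<omega> (real i / N + 1 / N * \<sigma>) - step_path (N * F) \<omega> (real i / N)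
    = sqrt (1 / N) * scaled_walk F (step_vec N F i \<omega>) \<sigma>"
proof -
  define n where "n = nat \<lfloor>\<sigma> * F\<rfloor>"
  have n: "n \<le> F" unfolding n_def by (rule floor_step_le[OF \<sigma>])
  have N: "0 < N" using i by simp
  have "(real i / N + 1 / N * \<sigma>) * real (N * F) = of_nat (i * F) + \<sigma> * F"
    using N by (simp add: field_simps)
  then have e1: "nat \<lfloor>(real i / N + 1 / N * \<sigma>) * real (N * F)\<rfloor> = i * F + n"
    using \<sigma> by (simp add: n_def nat_add_distrib floor_add_int[symmetric] del: of_nat_mult)
  have "real i / N * real (N * F) = real (i * F)" using N by simp
  then have e2: "nat \<lfloor>real i / N * real (N * F)\<rfloor> = i * F" by (simp del: of_nat_mult)
  have "(\<Sum>j<n. step_vec N F i \<omega> j) = (\<Sum>j<n. fine_step (N * F) (i * F + j) \<omega>)"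
    using n by (intro sum.cong) (auto simp: step_vec_def)
  also have "\<dots> = sqrt (N * F) * (\<Sum>j<n. B (real (i * F + Suc j) / real (N * F)) \<omega> - B (real (i * F + j) / real (N * F)) \<omega>)"
    by (simp add: fine_step_def sum_distrib_left)
  also have "\<dots> = sqrt (N * F) * (B (real (i * F + n) / real (N * F)) \<omega> - B (real (i * F + 0) / real (N * F)) \<omega>)"
    by (subst sum_lessThan_telescope) simp
  finally have "sqrt (1 / N) * scaled_walk F (step_vec N F i \<omega>) \<sigma>
     = (sqrt (N * F) / (sqrt N * sqrt F)) * (B (real (i * F + n) / real (N * F)) \<omega> - B (real (i * F) / real (N * F)) \<omega>)"
    by (simp add: scaled_walk_def n_def[symmetric] real_sqrt_divide)
  also have "sqrt (N * F) / (sqrt N * sqrt F) = 1"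
    using N F by (simp add: real_sqrt_mult)
  finally show ?thesis
    unfolding step_path_def e1 e2 by simp
qed

lemma step_path_bounded_measurable:
  assumes K: "0 < K" and \<omega>: "\<omega> \<in> space M"
  shows "bounded_measurable (step_path K \<omega>)"
  unfolding bounded_measurable_def
proof (intro conjI)
  have "(\<lambda>t. nat \<lfloor>t * real K\<rfloor>) \<in> measurable borel (count_space UNIV)" by measurable
  then have "(\<lambda>t. (\<lambda>n. B (real n / K) \<omega> - B 0 \<omega>) (nat \<lfloor>t * real K\<rfloor>)) \<in> borel_measurable borel"
    by (rule measurable_compose) simp
  then show "step_path K \<omega> \<in> borel_measurable unit_lborel"
    unfolding step_path_def[abs_def] by (rule borel_measurable_unit_lborelI)
  from bounded_measurable_continuous[OF sample_continuous[OF \<omega>]]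
  obtain C where C: "\<And>t. t \<in> {0..1} \<Longrightarrow> \<bar>B t \<omega>\<bar> \<le> C" unfolding bounded_measurable_def by blast
  have "\<bar>step_path K \<omega> t\<bar> \<le> 2 * C" if t: "t \<in> {0..1}" for t
  proof -
    have "real (nat \<lfloor>t * K\<rfloor>) / K \<in> {0..1}" using floor_step_le[OF t, of K] K by simp
    from C[OF this] C[of 0] show ?thesis unfolding step_path_def by simp
  qed
  then show "\<exists>C. \<forall>t\<in>{0..1}. \<bar>step_path K \<omega> t\<bar> \<le> C" by blast
qed

lemma step_path_uniform:
  assumes \<omega>: "\<omega> \<in> space M" and \<epsilon>: "0 < \<epsilon>"
  shows "\<exists>n0. \<forall>K\<ge>n0. 0 < K \<longrightarrow> (\<forall>t\<in>{0..1}. \<bar>step_path K \<omega> t - (B t \<omega> - B 0 \<omega>)\<bar> \<le> \<epsilon>)"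
proof -
  have "uniformly_continuous_on {0..1} (\<lambda>t. B t \<omega>)"
    by (intro compact_uniformly_continuous sample_continuous \<omega>) auto
  then obtain \<delta> where \<delta>: "0 < \<delta>" "\<And>s t. s \<in> {0..1} \<Longrightarrow> t \<in> {0..1} \<Longrightarrow> dist s t < \<delta> \<Longrightarrow> dist (B s \<omega>) (B t \<omega>) < \<epsilon>"
    unfolding uniformly_continuous_on_def using \<epsilon> by metis
  obtain n0 where n0: "inverse (real (Suc n0)) < \<delta>" using reals_Archimedean[OF \<delta>(1)] by blast
  have "\<bar>step_path K \<omega> t - (B t \<omega> - B 0 \<omega>)\<bar> \<le> \<epsilon>" if K: "Suc n0 \<le> K" and t: "t \<in> {0..1}" for K t
  proof -
    define q where "q = real (nat \<lfloor>t * K\<rfloor>) / K"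
    have q: "q \<in> {0..1}" using floor_step_le[OF t, of K] K by (simp add: q_def)
    have "0 \<le> t * K" using t by simp
    then have "real (nat \<lfloor>t * K\<rfloor>) \<le> t * K" "t * K \<le> real (nat \<lfloor>t * K\<rfloor>) + 1" by linarith+
    then have "q \<le> t" "t \<le> q + 1 / K" using K by (auto simp: q_def field_simps)
    moreover have "1 / K \<le> inverse (real (Suc n0))" using K by (simp add: field_simps)
    ultimately have "dist q t < \<delta>" using n0 by (simp add: dist_real_def)
    from \<delta>(2)[OF q t this] show ?thesis by (simp add: step_path_def q_def dist_real_def)
  qed
  then show ?thesis by (intro exI[of _ "Suc n0"]) blast
qed

lemma sqrt_holder_nonneg:
  assumes "\<And>s t. s \<in> {0..1} \<Longrightarrow> t \<in> {0..1} \<Longrightarrow> \<bar>d s - d t\<bar> \<le> L * sqrt \<bar>s - t\<bar>"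
  shows "0 \<le> (L :: real)"
  using order.trans[OF abs_ge_zero assms[of 0 1]] by simp

text \<open>The good events for the different grids all have probability at least
  \<open>\<kappa> ^ N\<close>, and so does their limit superior. On that event the bound holds along
  infinitely many refinements and passes to the Brownian path, since the sampled paths converge
  uniformly.\<close>

lemma steering_small_ball:
  fixes d :: "real \<Rightarrow> real"
  assumes m: "1 \<le> m" and d0: "d 0 = 0"
    and d: "\<And>s t. s \<in> {0..1} \<Longrightarrow> t \<in> {0..1} \<Longrightarrow> \<bar>d s - d t\<bar> \<le> L * sqrt \<bar>s - t\<bar>"
  obtains \<kappa> C where "0 < \<kappa>" "0 \<le> C"
    "\<And>N. 0 < N \<Longrightarrow> \<exists>A\<in>events. \<kappa> ^ N \<le> prob A \<and>
       (\<forall>\<omega>\<in>A. \<forall>t\<in>{0..1}. \<bar>iterated_integral (m - 1) (\<lambda>s. B s \<omega> - B 0 \<omega> - d s) t\<bar>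
          \<le> C * ((1 / real N) ^ (m - 1) * sqrt (1 / real N)))"
proof -
  have L: "0 \<le> L" by (rule sqrt_holder_nonneg[OF d])
  obtain \<Theta> :: "nat \<Rightarrow> real poly" where \<Theta>0: "\<And>k. k < m \<Longrightarrow> poly (\<Theta> k) 0 = 0"
    and \<Theta>d: "\<And>k l. k < m \<Longrightarrow> l < m \<Longrightarrow> iterated_integral l (poly (\<Theta> k)) 1 = (if l = k then 1 else 0)"
    using control_polynomials_exist[of m] by blast
  have "\<forall>k. \<exists>C\<ge>0. \<forall>s\<in>{0..1}. \<forall>t\<in>{0..1}. \<bar>poly (\<Theta> k) s - poly (\<Theta> k) t\<bar> \<le> C * \<bar>s - t\<bar>"
    using poly_lipschitz_01 by blast
  then obtain c where c: "\<And>k. 0 \<le> c k"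
    "\<And>k s t. s \<in> {0..1} \<Longrightarrow> t \<in> {0..1} \<Longrightarrow> \<bar>poly (\<Theta> k) s - poly (\<Theta> k) t\<bar> \<le> c k * \<bar>s - t\<bar>"
    by metis
  define C where "C = (\<Sum>k<m. c k)"
  interpret control_polynomials \<Theta> m C
  proof
    fix k and s t :: real assume k: "k < m" and st: "s \<in> {0..1}" "t \<in> {0..(1::real)}"
    have "c k \<le> C" unfolding C_def using k c(1) by (intro member_le_sum) auto
    then have "c k * \<bar>s - t\<bar> \<le> C * \<bar>s - t\<bar>" by (intro mult_right_mono) auto
    with c(2)[OF st] show "\<bar>poly (\<Theta> k) s - poly (\<Theta> k) t\<bar> \<le> C * \<bar>s - t\<bar>" by (meson order.trans)
  next
    show "0 \<le> C" unfolding C_def using c(1) by (intro sum_nonneg) auto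
  qed (use \<Theta>0 \<Theta>d in auto)
  define R where "R = real m * (3 * real m + L) * C"
  have R: "0 \<le> R" unfolding R_def using L C_nonneg by simp
  define \<kappa> where "\<kappa> = exp (- R\<^sup>2) * (9 / 16)"
  define C' where "C' = 3 * real m + 2 + R + L"
  \<comment> \<open>From this fineness on, the discretisation error of a control path is at most
    1.\<close>
  obtain F0 :: nat where F0: "0 < F0" "R \<le> F0"
  proof -
    obtain n :: nat where "R \<le> n" using real_arch_simple by blast
    then show thesis using that[of "Suc n"] by simp
  qed
  show thesis
  proof (rule that[of \<kappa> C'])
    show "0 < \<kappa>" by (simp add: \<kappa>_def)
    show "0 \<le> C'" using R L by (simp add: C'_def)
    fix N :: nat assume N: "0 < N"
    let ?r = "(1 / real N) ^ (m - 1) * sqrt (1 / real N)"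
    have bmd: "bounded_measurable d"
      by (intro bounded_measurable_continuous sqrt_holder_continuous[OF d])
    \<comment> \<open>Increments of the target in units of the Brownian scale of a block; the square
      root modulus of \<open>d\<close> bounds them by \<open>L\<close> for every
      \<open>N\<close>.\<close>
    define \<delta> where "\<delta> i \<sigma> = sqrt N * (d (real i / N + 1 / N * \<sigma>) - d (real i / N))" for i \<sigma>
    \<comment> \<open>Set to 0 beyond the last block, so that the bound by \<open>L\<close> holds
      for every index, as \<open>steered_measure\<close> demands.\<close>
    define e where "e i k = (if i < N then iterated_integral k (\<delta> i) 1 else 0)" for i k
    have bm\<delta>: "bounded_measurable (\<delta> i)" if "i < N" for i
      unfolding \<delta>_def[abs_def]
      by (rule bounded_measurable_mult[OF bounded_measurable_const
            bounded_measurable_diff[OF bounded_measurable_affine[OF bmd] bounded_measurable_const]])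
         (use block_time[OF that, of 1] in auto)
    have \<delta>b: "\<bar>\<delta> i \<sigma>\<bar> \<le> L" if i: "i < N" and \<sigma>: "\<sigma> \<in> {0..1}" for i \<sigma>
    proof -
      have "\<bar>d (real i / N + 1 / N * \<sigma>) - d (real i / N)\<bar> \<le> L * sqrt \<bar>real i / N + 1 / N * \<sigma> - real i / N\<bar>"
        using block_time[OF i \<sigma>] block_time[OF i, of 0] by (intro d) auto
      also have "sqrt \<bar>real i / N + 1 / N * \<sigma> - real i / N\<bar> \<le> sqrt (1 / N)"
        using \<sigma> by (intro real_sqrt_le_mono) (simp add: divide_right_mono)
      finally have "\<bar>d (real i / N + 1 / N * \<sigma>) - d (real i / N)\<bar> \<le> L * sqrt (1 / N)"
        using L by (simp add: mult_left_mono)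
      then have "sqrt N * \<bar>d (real i / N + 1 / N * \<sigma>) - d (real i / N)\<bar> \<le> sqrt N * (L * sqrt (1 / N))"
        by (intro mult_left_mono) auto
      also have "sqrt N * (L * sqrt (1 / N)) = L" using N by (simp add: real_sqrt_divide)
      finally show ?thesis by (simp add: \<delta>_def abs_mult)
    qed
    have eb: "\<bar>e i k\<bar> \<le> L" for i k
      using iterated_integral_abs_le[OF bm\<delta> \<delta>b, of i 1 k] L by (auto simp: e_def)
    define blocks where "blocks F \<omega> = (\<lambda>i\<in>{..<N}. step_vec N F i \<omega>)" for F \<omega>
    have blocks_meas: "blocks F \<in> measurable M (Pi\<^sub>M {..<N} (\<lambda>_. gauss_vec F))" for F
      unfolding blocks_def[abs_def] by (rule measurable_restrict) (auto intro: step_vec_measurable)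
    define E where "E n = {\<omega> \<in> space M. blocks (F0 + n) \<omega> \<in> steered \<Theta> m (F0 + n) e N}" for n
    have E_vim: "E n = blocks (F0 + n) -` steered \<Theta> m (F0 + n) e N \<inter> space M" for n
      by (auto simp: E_def)
    have E_ev: "E n \<in> events" for n
      unfolding E_vim by (rule measurable_sets[OF blocks_meas steered_sets])
    have PE: "\<kappa> ^ N \<le> prob (E n)" for n
    proof -
      have F: "0 < F0 + n" "R \<le> real (F0 + n)" using F0 by auto
      have "ennreal (\<kappa> ^ N) = ennreal (exp (- (real m * (3 * real m + L) * C)\<^sup>2) * (9 / 16)) ^ N"
        unfolding R_def[symmetric] \<kappa>_def[symmetric] by (simp add: ennreal_power \<kappa>_def)
      also have "\<dots> \<le> emeasure (Pi\<^sub>M {..<N} (\<lambda>_. gauss_vec (F0 + n))) (steered \<Theta> m (F0 + n) e N)"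
        by (rule steered_measure[OF F(1) _ eb L]) (use F(2) R_def in auto)
      also have "\<dots> = emeasure (distr M (Pi\<^sub>M {..<N} (\<lambda>_. gauss_vec (F0 + n))) (blocks (F0 + n))) (steered \<Theta> m (F0 + n) e N)"
        unfolding blocks_def[abs_def] blocks_distr[OF N F(1)] ..
      also have "\<dots> = emeasure M (E n)"
        unfolding E_vim by (rule emeasure_distr[OF blocks_meas steered_sets])
      finally show ?thesis by (simp add: emeasure_eq_measure \<kappa>_def)
    qed
    have bound: "\<bar>iterated_integral (m - 1) (\<lambda>s. step_path (N * (F0 + n)) \<omega> s - d s) t\<bar> \<le> C' * ?r"
      if \<omega>: "\<omega> \<in> E n" and t: "t \<in> {0..1}" for \<omega> n t
    proof -
      have F: "0 < F0 + n" "R \<le> real (F0 + n)" and sp: "\<omega> \<in> space M"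
        and st: "blocks (F0 + n) \<omega> \<in> steered \<Theta> m (F0 + n) e N"
        using F0 \<omega> by (auto simp: E_def)
      have K: "0 < N * (F0 + n)" using N F by simp
      have bm: "bounded_measurable (\<lambda>s. step_path (N * (F0 + n)) \<omega> s - d s)"
        by (rule bounded_measurable_diff[OF step_path_bounded_measurable[OF K sp] bmd])
      have "\<bar>iterated_integral (m - 1) (\<lambda>s. step_path (N * (F0 + n)) \<omega> s - d s) t\<bar>
        \<le> (3 * real m + 2 + real m * (3 * real m + L) * C + L) * ((1 / N) ^ (m - 1) * sqrt (1 / N))"
      proof (rule steered_path_bound[OF m F(1) _ N bm _ _ bm\<delta> \<delta>b _ L st t])
        show "real m * (3 * real m + L) * C \<le> real (F0 + n)" using F(2) by (simp add: R_def)
        show "step_path (N * (F0 + n)) \<omega> 0 - d 0 = 0" by (simp add: step_path_def d0)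
        fix i \<sigma> assume i: "i < N" and \<sigma>: "\<sigma> \<in> {0..(1::real)}"
        have "d (real i / N + 1 / N * \<sigma>) - d (real i / N) = sqrt (1 / N) * \<delta> i \<sigma>"
          using N by (simp add: \<delta>_def real_sqrt_divide)
        then show "step_path (N * (F0 + n)) \<omega> (real i / N + 1 / N * \<sigma>) - d (real i / N + 1 / N * \<sigma>)
            - (step_path (N * (F0 + n)) \<omega> (real i / N) - d (real i / N))
          = sqrt (1 / N) * (scaled_walk (F0 + n) (blocks (F0 + n) \<omega> i) \<sigma> - \<delta> i \<sigma>)"
          using step_path_block[OF i F(1) \<sigma>, of \<omega>] i by (simp add: blocks_def right_diff_distrib)
      next
        fix i k assume "i < N" then show "e i k = iterated_integral k (\<delta> i) 1" by (simp add: e_def)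
      qed
      then show ?thesis by (simp add: C'_def R_def)
    qed
    \<comment> \<open>The limit superior of the events \<open>E n\<close>.\<close>
    define A where "A = (\<Inter>n. \<Union>k\<in>{n..}. E k)"
    have dec: "decseq (\<lambda>n. \<Union>k\<in>{n..}. E k)"
      unfolding decseq_def by (intro allI impI UN_mono) auto
    have UE: "(\<Union>k\<in>{n..}. E k) \<in> events" for n using E_ev by (intro sets.countable_UN) auto
    have lim: "(\<lambda>n. prob (\<Union>k\<in>{n..}. E k)) \<longlonglongrightarrow> prob A"
      unfolding A_def by (rule finite_Lim_measure_decseq[OF _ dec]) (use UE in auto)
    have "\<kappa> ^ N \<le> prob A"
    proof (rule LIMSEQ_le_const[OF lim], intro exI[of _ 0] allI impI)
      fix n :: nat
      have "prob (E n) \<le> prob (\<Union>k\<in>{n..}. E k)" by (intro finite_measure_mono UE) auto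
      then show "\<kappa> ^ N \<le> prob (\<Union>k\<in>{n..}. E k)" using PE[of n] by linarith
    qed
    moreover have "A \<in> events" unfolding A_def using UE by (intro sets.countable_INT) auto
    moreover have "\<bar>iterated_integral (m - 1) (\<lambda>s. B s \<omega> - B 0 \<omega> - d s) t\<bar> \<le> C' * ?r"
      if \<omega>: "\<omega> \<in> A" and t: "t \<in> {0..1}" for \<omega> t
    proof (rule field_le_epsilon)
      fix \<epsilon> :: real assume \<epsilon>: "0 < \<epsilon>"
      have sp: "\<omega> \<in> space M" using \<omega> unfolding A_def E_def by auto
      obtain n0 where n0: "\<And>K t. n0 \<le> K \<Longrightarrow> 0 < K \<Longrightarrow> t \<in> {0..1} \<Longrightarrow> \<bar>step_path K \<omega> t - (B t \<omega> - B 0 \<omega>)\<bar> \<le> \<epsilon>"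
        using step_path_uniform[OF sp \<epsilon>] by blast
      from \<omega> obtain n where n: "n0 \<le> n" "\<omega> \<in> E n" unfolding A_def by blast
      let ?K = "N * (F0 + n)"
      have "1 * n \<le> ?K" using N by (intro mult_le_mono) auto
      then have K: "n0 \<le> ?K" "0 < ?K" using n N F0 by auto
      have bmB: "bounded_measurable (\<lambda>s. B s \<omega> - B 0 \<omega>)"
        by (intro bounded_measurable_continuous continuous_intros sample_continuous sp)
      have bmS: "bounded_measurable (step_path ?K \<omega>)" by (rule step_path_bounded_measurable[OF K(2) sp])
      have "\<bar>iterated_integral (m - 1) (\<lambda>s. step_path ?K \<omega> s - (B s \<omega> - B 0 \<omega>)) t\<bar> \<le> \<epsilon>"
        using t by (intro iterated_integral_abs_le bounded_measurable_diff bmB bmS n0 K) auto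
      moreover have "iterated_integral (m - 1) (\<lambda>s. step_path ?K \<omega> s - (B s \<omega> - B 0 \<omega>)) t
         = iterated_integral (m - 1) (\<lambda>s. step_path ?K \<omega> s - d s) t - iterated_integral (m - 1) (\<lambda>s. B s \<omega> - B 0 \<omega> - d s) t"
      proof -
        have eq: "(\<lambda>s. step_path ?K \<omega> s - (B s \<omega> - B 0 \<omega>))
            = (\<lambda>s. (step_path ?K \<omega> s - d s) - (B s \<omega> - B 0 \<omega> - d s))"
          by (rule ext) simp
        show ?thesis unfolding eq using t
          by (intro iterated_integral_diff bounded_measurable_diff bmS bmB bmd) auto
      qed
      ultimately show "\<bar>iterated_integral (m - 1) (\<lambda>s. B s \<omega> - B 0 \<omega> - d s) t\<bar> \<le> C' * ?r + \<epsilon>"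
        using bound[OF n(2) t] by linarith
    qed
    ultimately show "\<exists>A\<in>events. \<kappa> ^ N \<le> prob A \<and>
       (\<forall>\<omega>\<in>A. \<forall>t\<in>{0..1}. \<bar>iterated_integral (m - 1) (\<lambda>s. B s \<omega> - B 0 \<omega> - d s) t\<bar> \<le> C' * ?r)"
      by blast
  qed
qed

end

section \<open>The released process\<close>

lemma continuous_le_iff_rational:
  assumes "continuous_on {0..1} (f :: real \<Rightarrow> real)"
  shows "(\<forall>t\<in>{0..1}. f t \<le> c) \<longleftrightarrow> (\<forall>t\<in>{0..1} \<inter> \<rat>. f t \<le> c)"
proof (intro iffI ballI)
  fix t :: real assume H: "\<forall>t\<in>{0..1} \<inter> \<rat>. f t \<le> c" and t: "t \<in> {0..1}"
  have "(\<lambda>k. f (real (nat \<lfloor>t * real (Suc k)\<rfloor>) / real (Suc k))) \<longlonglongrightarrow> f t"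
    by (rule continuous_on_tendsto_compose[OF assms floor_grid_tendsto[OF t] t]) (use floor_grid_mem[OF t] in \<open>auto simp del: of_nat_Suc\<close>)
  then show "f t \<le> c"
    by (rule LIMSEQ_le_const2) (use H floor_grid_mem[OF t] in blast)
qed auto

lemma countable_rational_01: "countable ({0..(1::real)} \<inter> \<rat>)"
  by (rule countable_subset[OF _ countable_rat]) auto

lemma rational_01_nonempty: "{0..(1::real)} \<inter> \<rat> \<noteq> {}"
proof -
  have "0 \<in> {0..(1::real)} \<inter> \<rat>" by simp
  then show ?thesis by blast
qed

lemma Collect_Ball_eq_INT:
  "S \<noteq> {} \<Longrightarrow> {x \<in> \<Omega>. \<forall>t\<in>S. P t x} = (\<Inter>t\<in>S. {x \<in> \<Omega>. P t x})"
  by auto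

lemma poly_block_coefficients:
  fixes a h :: real
  assumes m: "1 \<le> m"
  shows "\<exists>c. \<forall>s. (\<Sum>k\<le>m - 1. z k * (a + h * s) ^ k / fact k) = (\<Sum>l<m. c l * s ^ l)"
proof -
  define P where "P = (\<Sum>k\<le>m - 1. monom (z k / fact k) k)"
  define Q where "Q = pcompose P [:a, h:]"
  have "degree P \<le> m - 1"
    unfolding P_def by (intro degree_sum_le) (auto intro: order.trans[OF degree_monom_le])
  then have "degree Q \<le> (m - 1) * 1"
    unfolding Q_def by (intro order.trans[OF degree_pcompose_le] mult_le_mono) auto
  then have dQ: "degree Q < m" using m by simp
  have "(\<Sum>k\<le>m - 1. z k * (a + h * s) ^ k / fact k) = (\<Sum>l<m. coeff Q l * s ^ l)" for s
  proof -
    have "(\<Sum>k\<le>m - 1. z k * (a + h * s) ^ k / fact k) = poly Q s"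
      by (simp add: Q_def P_def poly_pcompose poly_sum poly_monom mult.commute[of s])
    also have "\<dots> = (\<Sum>l\<le>degree Q. coeff Q l * s ^ l)" by (rule poly_altdef)
    also have "\<dots> = (\<Sum>l<m. coeff Q l * s ^ l)"
      using dQ by (intro sum.mono_neutral_left) (auto simp: coeff_eq_0)
    finally show ?thesis .
  qed
  then show ?thesis by blast
qed

text \<open>The polynomial of the release and the Taylor part of the integral merge into one
  polynomial of degree below \<open>m\<close> in the local coordinate.\<close>

lemma block_polynomial_remainder:
  fixes i N :: nat
  assumes m: "1 \<le> m" and b: "bounded_measurable b" and i: "i < N"
  obtains c where "\<And>s. s \<in> {0..1} \<Longrightarrow>
    (\<Sum>k\<le>m - 1. z k * (real i / N + 1 / N * s) ^ k / fact k)
      + iterated_integral (m - 1) b (real i / N + 1 / N * s)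
    = (\<Sum>l<m. c l * s ^ l)
      + (1 / N) ^ (m - 1) * iterated_integral (m - 1) (\<lambda>x. b (real i / N + 1 / N * x) - b (real i / N)) s"
proof -
  let ?a = "real i / N" and ?h = "1 / real N"
  obtain c where c: "\<And>s. (\<Sum>k\<le>m - 1. z k * (?a + ?h * s) ^ k / fact k) = (\<Sum>l<m. c l * s ^ l)"
    using poly_block_coefficients[OF m, of z ?a ?h] by blast
  have ah: "?a + ?h \<le> 1" "0 < ?h" using i by (auto simp: field_simps)
  define c' where "c' l = c l + ?h ^ l / fact l * iterated_integral (m - 1 - l) b ?a" for l
  have "(\<Sum>k\<le>m - 1. z k * (?a + ?h * s) ^ k / fact k) + iterated_integral (m - 1) b (?a + ?h * s)
    = (\<Sum>l<m. c' l * s ^ l) + ?h ^ (m - 1) * iterated_integral (m - 1) (\<lambda>x. b (?a + ?h * x) - b ?a) s"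
    if s: "s \<in> {0..1}" for s
  proof -
    have "iterated_integral (m - 1) b (?a + ?h * s) =
        (\<Sum>l\<le>m - 1. (?h * s) ^ l / fact l * iterated_integral (m - 1 - l) b ?a)
        + ?h ^ (m - 1) * iterated_integral (m - 1) (\<lambda>x. b (?a + ?h * x) - b ?a) s"
      using s ah by (intro iterated_integral_block b) auto
    moreover have "(\<Sum>l\<le>m - 1. (?h * s) ^ l / fact l * iterated_integral (m - 1 - l) b ?a)
        = (\<Sum>l<m. ?h ^ l / fact l * iterated_integral (m - 1 - l) b ?a * s ^ l)"
    proof (rule sum.cong)
      show "{..m - 1} = {..<m}" using m by auto
    qed (simp add: power_mult_distrib power_divide mult_ac)
    ultimately show ?thesis
      unfolding c by (simp add: c'_def distrib_right sum.distrib)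
  qed
  then show thesis by (rule that)
qed

locale half_integer_released_bm = released_integrated_bm M B \<alpha> Z
  for M :: "'w measure" and B \<alpha> Z +
  fixes m :: nat
  assumes m: "1 \<le> m" and \<alpha>: "\<alpha> = real m - 1 / 2"
begin

abbreviation W where "W \<equiv> released_bm \<alpha> B Z"

lemma floor_\<alpha>: "nat \<lfloor>\<alpha>\<rfloor> = m - 1"
  using half_integer_floor[OF m \<alpha>] by simp

lemma integrated_bm_eq: "integrated_bm \<alpha> B t \<omega> = iterated_integral (m - 1) (\<lambda>s. B s \<omega>) t"
  by (simp add: integrated_bm_def floor_\<alpha>)

lemma W_eq: "W t \<omega> = (\<Sum>k\<le>m - 1. Z k \<omega> * t ^ k / fact k) + iterated_integral (m - 1) (\<lambda>s. B s \<omega>) t"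
  by (simp add: released_bm_def floor_\<alpha> integrated_bm_eq)

lemma integrated_bm_continuous:
  "\<omega> \<in> space M \<Longrightarrow> continuous_on {0..1} (\<lambda>t. integrated_bm \<alpha> B t \<omega>)"
  unfolding integrated_bm_eq by (intro iterated_integral_continuous sample_continuous)

lemma W_continuous: "\<omega> \<in> space M \<Longrightarrow> continuous_on {0..1} (\<lambda>t. W t \<omega>)"
  unfolding W_eq by (intro continuous_intros iterated_integral_continuous sample_continuous) auto

lemma process_event:
  assumes "A \<in> sets (\<Pi>\<^sub>M t\<in>{0..1}. borel)"
  shows "(\<lambda>\<omega>. \<lambda>t\<in>{0..1}. integrated_bm \<alpha> B t \<omega>) -` A \<inter> space M \<in>
    sets (vimage_algebra (space M) (\<lambda>\<omega>. \<lambda>t\<in>{0..1}. integrated_bm \<alpha> B t \<omega>) (\<Pi>\<^sub>M t\<in>{0..1}. borel))"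
  by (rule in_vimage_algebra[OF assms])

lemma process_event_events:
  "A \<in> sets (vimage_algebra (space M) (\<lambda>\<omega>. \<lambda>t\<in>{0..1}. integrated_bm \<alpha> B t \<omega>) (\<Pi>\<^sub>M t\<in>{0..1}. borel))
    \<Longrightarrow> A \<in> events"
  using Z_indep_process unfolding indep_set_def indep_sets_def by (auto split: bool.splits)

text \<open>The independence hypothesis includes that the sigma-algebra generated by the process
  consists of events; evaluation at \<open>t\<close> is measurable for it.\<close>

lemma integrated_bm_measurable:
  assumes t: "t \<in> {0..1}"
  shows "integrated_bm \<alpha> B t \<in> borel_measurable M"
proof (rule measurableI)
  fix S :: "real set" assume S: "S \<in> sets borel"
  let ?A = "(\<lambda>f. f t) -` S \<inter> space (\<Pi>\<^sub>M t\<in>{0..(1::real)}. (borel :: real measure))"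
  have "?A \<in> sets (\<Pi>\<^sub>M t\<in>{0..1}. borel)"
    using measurable_sets[OF measurable_component_singleton[of t "{0..1}" "\<lambda>_. borel"] S] t by simp
  from process_event_events[OF process_event[OF this]]
  have "(\<lambda>\<omega>. \<lambda>t\<in>{0..1}. integrated_bm \<alpha> B t \<omega>) -` ?A \<inter> space M \<in> events" .
  also have "(\<lambda>\<omega>. \<lambda>t\<in>{0..1}. integrated_bm \<alpha> B t \<omega>) -` ?A \<inter> space M = integrated_bm \<alpha> B t -` S \<inter> space M"
    using t by (auto simp: space_PiM)
  finally show "integrated_bm \<alpha> B t -` S \<inter> space M \<in> events" .
qed simp

lemma Z_measurable: "k \<le> m - 1 \<Longrightarrow> Z k \<in> borel_measurable M"
  using distributed_measurable[OF Z_normal[of k]] by (simp add: floor_\<alpha>)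

lemma W_measurable: "t \<in> {0..1} \<Longrightarrow> W t \<in> borel_measurable M"
  unfolding released_bm_def[abs_def] floor_\<alpha>
  by (intro borel_measurable_add borel_measurable_sum borel_measurable_divide borel_measurable_times
      borel_measurable_const integrated_bm_measurable Z_measurable) auto

lemma sup_event_measurable:
  assumes "continuous_on {0..1} v"
  shows "{\<omega> \<in> space M. \<forall>t\<in>{0..1}. \<bar>W t \<omega> - v t\<bar> \<le> c} \<in> events"
proof -
  have "{\<omega> \<in> space M. \<forall>t\<in>{0..1}. \<bar>W t \<omega> - v t\<bar> \<le> c}
      = {\<omega> \<in> space M. \<forall>t\<in>{0..1} \<inter> \<rat>. \<bar>W t \<omega> - v t\<bar> \<le> c}"
    by (rule Collect_cong, rule conj_cong[OF refl], rule continuous_le_iff_rational)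
       (intro continuous_intros W_continuous assms)
  also have "\<dots> = (\<Inter>t\<in>{0..1} \<inter> \<rat>. {\<omega> \<in> space M. \<bar>W t \<omega> - v t\<bar> \<le> c})"
    by (rule Collect_Ball_eq_INT[OF rational_01_nonempty])
  also have "\<dots> \<in> events"
  proof (rule sets.countable_INT')
    show "{0..1} \<inter> \<rat> \<noteq> ({} :: real set)" by (rule rational_01_nonempty)
    show "(\<lambda>t. {\<omega> \<in> space M. \<bar>W t \<omega> - v t\<bar> \<le> c}) ` ({0..1} \<inter> \<rat>) \<subseteq> events"
      using W_measurable by auto
  qed (rule countable_rational_01)
  finally show ?thesis .
qed

text \<open>The windows are given as sets of the sigma-algebra generated by \<open>Z\<close>,
  because this is the form in which independence from the integrated process can be applied.\<close>

lemma Z_window: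
  obtains \<delta> where "0 < \<delta>" "\<delta> \<le> 1"
    "\<And>\<rho>. 0 < \<rho> \<Longrightarrow> \<rho> \<le> 1 \<Longrightarrow>
      {\<omega> \<in> space M. \<forall>k\<le>m - 1. \<bar>Z k \<omega> - z k\<bar> \<le> \<rho>} \<in>
        sets (vimage_algebra (space M) (\<lambda>\<omega>. \<lambda>k\<in>{..nat \<lfloor>\<alpha>\<rfloor>}. Z k \<omega>) (\<Pi>\<^sub>M k\<in>{..nat \<lfloor>\<alpha>\<rfloor>}. borel)) \<and>
      (\<delta> * \<rho>) ^ m \<le> prob {\<omega> \<in> space M. \<forall>k\<le>m - 1. \<bar>Z k \<omega> - z k\<bar> \<le> \<rho>}"
proof -
  \<comment> \<open>Every window of radius at most 1 about some \<open>z k\<close> lies between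
    \<open>- R\<close> and \<open>R\<close>, where the normal density is at least its value at
    \<open>R\<close>.\<close>
  define R where "R = (\<Sum>k\<le>m - 1. \<bar>z k\<bar>) + 1"
  define \<delta> where "\<delta> = min 1 (std_normal_density R)"
  have R: "0 \<le> R" unfolding R_def by (intro add_nonneg_nonneg sum_nonneg) auto
  have \<delta>: "0 < \<delta>" "\<delta> \<le> 1" unfolding \<delta>_def by (auto simp: normal_density_pos)
  show thesis
  proof (rule that[OF \<delta>], intro conjI)
    fix \<rho> :: real assume \<rho>: "0 < \<rho>" "\<rho> \<le> 1"
    let ?E = "{\<omega> \<in> space M. \<forall>k\<le>m - 1. \<bar>Z k \<omega> - z k\<bar> \<le> \<rho>}"
    let ?A = "Pi\<^sub>E {..nat \<lfloor>\<alpha>\<rfloor>} (\<lambda>k. {z k - \<rho>..z k + \<rho>})"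
    have "?A \<in> sets (\<Pi>\<^sub>M k\<in>{..nat \<lfloor>\<alpha>\<rfloor>}. borel)" by (intro sets_PiM_I_finite) auto
    from in_vimage_algebra[OF this, of "\<lambda>\<omega>. \<lambda>k\<in>{..nat \<lfloor>\<alpha>\<rfloor>}. Z k \<omega>" "space M"]
    have "(\<lambda>\<omega>. \<lambda>k\<in>{..nat \<lfloor>\<alpha>\<rfloor>}. Z k \<omega>) -` ?A \<inter> space M \<in>
        sets (vimage_algebra (space M) (\<lambda>\<omega>. \<lambda>k\<in>{..nat \<lfloor>\<alpha>\<rfloor>}. Z k \<omega>) (\<Pi>\<^sub>M k\<in>{..nat \<lfloor>\<alpha>\<rfloor>}. borel))" .
    also have "(\<lambda>\<omega>. \<lambda>k\<in>{..nat \<lfloor>\<alpha>\<rfloor>}. Z k \<omega>) -` ?A \<inter> space M = ?E"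
      by (auto simp: floor_\<alpha> PiE_iff abs_le_iff) (auto simp: algebra_simps)
    finally show "?E \<in> sets (vimage_algebra (space M) (\<lambda>\<omega>. \<lambda>k\<in>{..nat \<lfloor>\<alpha>\<rfloor>}. Z k \<omega>) (\<Pi>\<^sub>M k\<in>{..nat \<lfloor>\<alpha>\<rfloor>}. borel))" .
    have one: "\<delta> * \<rho> \<le> prob (Z k -` {z k - \<rho>..z k + \<rho>} \<inter> space M)" if k: "k \<le> m - 1" for k
    proof -
      have "emeasure M (Z k -` {z k - \<rho>..z k + \<rho>} \<inter> space M)
          = (\<integral>\<^sup>+ x. ennreal (std_normal_density x) * indicator {z k - \<rho>..z k + \<rho>} x \<partial>lborel)"
        using distributed_emeasure[OF Z_normal[of k], of "{z k - \<rho>..z k + \<rho>}"] k by (simp add: floor_\<alpha>)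
      also have "\<dots> \<ge> (\<integral>\<^sup>+ x. ennreal \<delta> * indicator {z k - \<rho>..z k + \<rho>} x \<partial>lborel)"
      proof (rule nn_integral_mono)
        fix x :: real
        show "ennreal \<delta> * indicator {z k - \<rho>..z k + \<rho>} x \<le> ennreal (std_normal_density x) * indicator {z k - \<rho>..z k + \<rho>} x"
        proof (cases "x \<in> {z k - \<rho>..z k + \<rho>}")
          case True
          have "\<bar>z k\<bar> \<le> (\<Sum>k\<le>m - 1. \<bar>z k\<bar>)" using k by (intro member_le_sum) auto
          then have "\<bar>x\<bar> \<le> R" using True \<rho> unfolding R_def by auto
          then have "x\<^sup>2 \<le> R\<^sup>2" using abs_le_square_iff[of x R] R by simp
          then have "std_normal_density R \<le> std_normal_density x"
            unfolding std_normal_density_def by (intro mult_left_mono) auto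
          then show ?thesis using True by (simp add: \<delta>_def ennreal_leI min.coboundedI2)
        qed simp
      qed
      moreover have "(\<integral>\<^sup>+ x. ennreal \<delta> * indicator {z k - \<rho>..z k + \<rho>} x \<partial>lborel) = ennreal (\<delta> * (2 * \<rho>))"
        using \<rho> \<delta> by (subst nn_integral_cmult_indicator) (auto simp: ennreal_mult)
      ultimately have "ennreal (\<delta> * (2 * \<rho>)) \<le> ennreal (prob (Z k -` {z k - \<rho>..z k + \<rho>} \<inter> space M))"
        by (simp add: emeasure_eq_measure)
      then have "\<delta> * (2 * \<rho>) \<le> prob (Z k -` {z k - \<rho>..z k + \<rho>} \<inter> space M)"
        by (subst (asm) ennreal_le_iff) auto
      then show ?thesis using \<delta> \<rho> by (auto elim!: order.trans[rotated])
    qed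
    have "(\<delta> * \<rho>) ^ m = (\<Prod>k\<in>{..m - 1}. \<delta> * \<rho>)" using m by simp
    also have "\<dots> \<le> (\<Prod>k\<in>{..m - 1}. prob (Z k -` {z k - \<rho>..z k + \<rho>} \<inter> space M))"
      using one \<delta> \<rho> by (intro prod_mono) auto
    also have "\<dots> = prob (\<Inter>k\<in>{..m - 1}. Z k -` {z k - \<rho>..z k + \<rho>} \<inter> space M)"
      using Z_indep by (intro indep_varsD[symmetric]) (auto simp: floor_\<alpha>)
    also have "(\<Inter>k\<in>{..m - 1}. Z k -` {z k - \<rho>..z k + \<rho>} \<inter> space M) = ?E"
      by (auto simp: abs_le_iff)
    finally show "(\<delta> * \<rho>) ^ m \<le> prob ?E" .
  qed
qed

text \<open>For \<open>N > 0\<close> this is \<open>real N powr (- \<alpha>)\<close>, written with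
  an integer power and a square root.\<close>

definition block_radius :: "nat \<Rightarrow> real" where
  "block_radius N = (1 / N) ^ (m - 1) * sqrt (1 / N)"

lemma block_radius_bounds: "0 < N \<Longrightarrow> 0 < block_radius N" "0 < N \<Longrightarrow> block_radius N \<le> 1"
proof -
  assume N: "0 < N"
  show "0 < block_radius N" using N by (simp add: block_radius_def)
  have "(1 / real N) ^ (m - 1) \<le> 1" "sqrt (1 / real N) \<le> 1"
    using N by (auto intro!: power_le_one)
  then show "block_radius N \<le> 1" unfolding block_radius_def using mult_mono[of _ 1 _ 1] by fastforce
qed

text \<open>The Gaussian coefficients cost only a power of \<open>N\<close>;
  \<open>N \<le> exp N\<close> absorbs it into the exponential rate of the small ball.\<close>

lemma block_radius_lower:
  assumes N: "0 < N"
  shows "exp (- real m) ^ N \<le> block_radius N"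
proof -
  have "1 / real N \<le> sqrt (1 / real N)"
  proof (rule real_le_rsqrt)
    have "1 / real N * (1 / real N) \<le> 1 / real N * 1" using N by (intro mult_left_mono) auto
    then show "(1 / real N)\<^sup>2 \<le> 1 / real N" by (simp add: power2_eq_square)
  qed
  then have "(1 / real N) ^ (m - 1) * (1 / real N) \<le> block_radius N"
    unfolding block_radius_def by (intro mult_left_mono) auto
  moreover have "(1 / real N) ^ (m - 1) * (1 / real N) = (1 / real N) ^ m"
    using m by (cases m) auto
  moreover have "exp (- real m) ^ N \<le> (1 / real N) ^ m"
  proof -
    have "real N \<le> exp (real N)" using exp_ge_add_one_self[of "real N"] by linarith
    then have "exp (- real N) \<le> 1 / real N" using N by (simp add: exp_minus field_simps)
    then have "exp (- real N) ^ m \<le> (1 / real N) ^ m" by (intro power_mono) auto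
    moreover have "exp (- real N) ^ m = exp (- real m) ^ N"
      by (simp add: exp_of_nat_mult[symmetric] mult.commute)
    ultimately show ?thesis by simp
  qed
  ultimately show ?thesis by linarith
qed

text \<open>The coefficients and the integrated process approach their targets independently, so the
  two probabilities multiply.\<close>

lemma released_small_ball:
  fixes d :: "real \<Rightarrow> real" and z :: "nat \<Rightarrow> real"
  assumes d0: "d 0 = 0"
    and d: "\<And>s t. s \<in> {0..1} \<Longrightarrow> t \<in> {0..1} \<Longrightarrow> \<bar>d s - d t\<bar> \<le> L * sqrt \<bar>s - t\<bar>"
    and v: "\<And>t. t \<in> {0..1} \<Longrightarrow> v t = (\<Sum>k\<le>m - 1. z k * t ^ k / fact k) + iterated_integral (m - 1) d t"
  obtains \<kappa> C where "0 < \<kappa>" "0 \<le> C"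
    "\<And>N. 0 < N \<Longrightarrow> \<kappa> ^ N \<le> prob {\<omega> \<in> space M. \<forall>t\<in>{0..1}. \<bar>W t \<omega> - v t\<bar> \<le> C * block_radius N}"
proof -
  have dcont: "continuous_on {0..1} d" by (rule sqrt_holder_continuous[OF d])
  note bmd = bounded_measurable_continuous[OF dcont]
  show thesis
  proof (rule steering_small_ball[where d = d and L = L, OF m d0], fact d)
    fix \<kappa> C assume \<kappa>: "0 < \<kappa>" "0 \<le> C"
      "\<And>N. 0 < N \<Longrightarrow> \<exists>A\<in>events. \<kappa> ^ N \<le> prob A \<and>
         (\<forall>\<omega>\<in>A. \<forall>t\<in>{0..1}. \<bar>iterated_integral (m - 1) (\<lambda>s. B s \<omega> - B 0 \<omega> - d s) t\<bar>
            \<le> C * ((1 / real N) ^ (m - 1) * sqrt (1 / real N)))"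
  show thesis
  proof (rule Z_window[of z])
    fix \<delta> assume \<delta>: "0 < \<delta>" "\<delta> \<le> 1"
      "\<And>\<rho>. 0 < \<rho> \<Longrightarrow> \<rho> \<le> 1 \<Longrightarrow>
        {\<omega> \<in> space M. \<forall>k\<le>m - 1. \<bar>Z k \<omega> - z k\<bar> \<le> \<rho>} \<in>
          sets (vimage_algebra (space M) (\<lambda>\<omega>. \<lambda>k\<in>{..nat \<lfloor>\<alpha>\<rfloor>}. Z k \<omega>) (\<Pi>\<^sub>M k\<in>{..nat \<lfloor>\<alpha>\<rfloor>}. borel)) \<and>
        (\<delta> * \<rho>) ^ m \<le> prob {\<omega> \<in> space M. \<forall>k\<le>m - 1. \<bar>Z k \<omega> - z k\<bar> \<le> \<rho>}"
  \<comment> \<open>Since \<open>\<delta> \<le> 1\<close> and \<open>N \<ge> 1\<close>, the window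
    factor \<open>\<delta> * block_radius N\<close> is at least
    \<open>(\<delta> * exp (- real m)) ^ N\<close>; it occurs \<open>m\<close> times, and
    \<open>\<kappa>\<close> comes from steering.\<close>
  define \<kappa>' where "\<kappa>' = (\<delta> * exp (- real m)) ^ m * \<kappa>"
  show thesis
  proof (rule that[of \<kappa>' "real m + C"])
    show "0 < \<kappa>'" using \<delta>(1,2) \<kappa>(1,2) by (simp add: \<kappa>'_def)
    show "0 \<le> real m + C" using \<kappa>(1,2) by simp
    fix N :: nat assume N: "0 < N"
    let ?r = "block_radius N"
    have r: "0 < ?r" "?r \<le> 1" using block_radius_bounds[OF N] by auto
    let ?ZE = "{\<omega> \<in> space M. \<forall>k\<le>m - 1. \<bar>Z k \<omega> - z k\<bar> \<le> ?r}"
    let ?D = "{\<omega> \<in> space M. \<forall>t\<in>{0..1}. \<bar>integrated_bm \<alpha> B t \<omega> - iterated_integral (m - 1) d t\<bar> \<le> C * ?r}"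
    let ?E = "{\<omega> \<in> space M. \<forall>t\<in>{0..1}. \<bar>W t \<omega> - v t\<bar> \<le> (real m + C) * ?r}"
    \<comment> \<open>Independence applies only to sets generated by the process, so the uniform
      bound is first expressed through countably many rational times.\<close>
    have D_vim: "?D \<in> sets (vimage_algebra (space M) (\<lambda>\<omega>. \<lambda>t\<in>{0..1}. integrated_bm \<alpha> B t \<omega>) (\<Pi>\<^sub>M t\<in>{0..1}. borel))"
    proof -
      let ?P = "\<Pi>\<^sub>M t\<in>{0..(1::real)}. (borel :: real measure)"
      let ?A = "{f \<in> space ?P. \<forall>t\<in>{0..1} \<inter> \<rat>. \<bar>f t - iterated_integral (m - 1) d t\<bar> \<le> C * ?r}"
      have "?A \<in> sets ?P"
        unfolding Collect_Ball_eq_INT[OF rational_01_nonempty]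
      proof (rule sets.countable_INT')
        show "{0..1} \<inter> \<rat> \<noteq> ({} :: real set)" by (rule rational_01_nonempty)
        show "(\<lambda>t. {f \<in> space ?P. \<bar>f t - iterated_integral (m - 1) d t\<bar> \<le> C * ?r}) ` ({0..1} \<inter> \<rat>) \<subseteq> sets ?P"
        proof (intro image_subsetI)
          fix t :: real assume "t \<in> {0..1} \<inter> \<rat>"
          then have "(\<lambda>f. f t) \<in> borel_measurable ?P" by (intro measurable_component_singleton) auto
          then show "{f \<in> space ?P. \<bar>f t - iterated_integral (m - 1) d t\<bar> \<le> C * ?r} \<in> sets ?P" by measurable
        qed
      qed (rule countable_rational_01)
      moreover have "(\<lambda>\<omega>. \<lambda>t\<in>{0..1}. integrated_bm \<alpha> B t \<omega>) -` ?A \<inter> space M = ?D"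
      proof -
        have "(\<lambda>\<omega>. \<lambda>t\<in>{0..1}. integrated_bm \<alpha> B t \<omega>) -` ?A \<inter> space M
          = {\<omega> \<in> space M. \<forall>t\<in>{0..1} \<inter> \<rat>. \<bar>integrated_bm \<alpha> B t \<omega> - iterated_integral (m - 1) d t\<bar> \<le> C * ?r}"
          by (auto simp: space_PiM)
        also have "\<dots> = ?D"
          by (rule Collect_cong, rule conj_cong[OF refl], rule continuous_le_iff_rational[symmetric])
             (intro continuous_intros integrated_bm_continuous iterated_integral_continuous dcont)
        finally show ?thesis .
      qed
      ultimately show ?thesis using process_event[of ?A] by (simp only:)
    qed
    have D_ev: "?D \<in> events" by (rule process_event_events[OF D_vim])
    obtain A where A: "A \<in> events" "\<kappa> ^ N \<le> prob A"
      "\<And>\<omega> t. \<omega> \<in> A \<Longrightarrow> t \<in> {0..1} \<Longrightarrow> \<bar>iterated_integral (m - 1) (\<lambda>s. B s \<omega> - B 0 \<omega> - d s) t\<bar> \<le> C * ?r"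
      using \<kappa>(3)[OF N] unfolding block_radius_def by blast
    have "prob A \<le> prob ?D"
    \<comment> \<open>The steering bound concerns \<open>B s \<omega> - B 0 \<omega>\<close>, and
      the start at zero holds only almost surely.\<close>
    proof (rule finite_measure_mono_AE[OF _ D_ev])
      show "AE \<omega> in M. \<omega> \<in> A \<longrightarrow> \<omega> \<in> ?D"
        using start_zero
      proof eventually_elim
        case (elim \<omega>)
        show ?case
        proof
          assume \<omega>: "\<omega> \<in> A"
          then have sp: "\<omega> \<in> space M" using A(1) sets.sets_into_space by blast
          have "\<bar>integrated_bm \<alpha> B t \<omega> - iterated_integral (m - 1) d t\<bar> \<le> C * ?r" if t: "t \<in> {0..1}" for t
            using A(3)[OF \<omega> t] iterated_integral_diff[OF bounded_measurable_continuous[OF sample_continuous[OF sp]] bmd, of t "m - 1"] t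
            by (simp add: integrated_bm_eq elim)
          then show "\<omega> \<in> ?D" using sp by blast
        qed
      qed
    qed
    with A have PD: "\<kappa> ^ N \<le> prob ?D" by linarith
    note ZE = conjunct1[OF \<delta>(3)[OF r]] and PZ = conjunct2[OF \<delta>(3)[OF r]]
    have "(\<delta> * exp (- real m)) ^ N \<le> \<delta> * ?r"
    proof -
      have "\<delta> ^ N \<le> \<delta> ^ 1" using \<delta>(1,2) N by (intro power_decreasing) auto
      then have "\<delta> ^ N * exp (- real m) ^ N \<le> \<delta> * ?r"
        using block_radius_lower[OF N] \<delta>(1) by (intro mult_mono) auto
      then show ?thesis by (simp only: power_mult_distrib)
    qed
    then have "((\<delta> * exp (- real m)) ^ N) ^ m \<le> (\<delta> * ?r) ^ m"
      using \<delta>(1,2) by (intro power_mono) auto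
    then have PZ': "((\<delta> * exp (- real m)) ^ m) ^ N \<le> prob ?ZE"
      using PZ by (simp add: power_mult[symmetric] mult.commute)
    have "\<kappa>' ^ N = ((\<delta> * exp (- real m)) ^ m) ^ N * \<kappa> ^ N" by (simp add: \<kappa>'_def power_mult_distrib)
    also have "\<dots> \<le> prob ?ZE * prob ?D"
      using PZ' PD \<kappa>(1,2) by (intro mult_mono) auto
    also have "\<dots> = prob (?ZE \<inter> ?D)"
      by (rule indep_setD[OF Z_indep_process ZE D_vim, symmetric])
    also have "\<dots> \<le> prob ?E"
    proof (rule finite_measure_mono)
      have "continuous_on {0..1} v \<longleftrightarrow> continuous_on {0..1} (\<lambda>t. (\<Sum>k\<le>m - 1. z k * t ^ k / fact k) + iterated_integral (m - 1) d t)"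
        by (rule continuous_on_cong) (auto simp: v)
      then have "continuous_on {0..1} v"
        by (auto intro!: continuous_intros iterated_integral_continuous dcont)
      then show "?E \<in> events" by (rule sup_event_measurable)
      show "?ZE \<inter> ?D \<subseteq> ?E"
      proof
        fix \<omega> assume \<omega>: "\<omega> \<in> ?ZE \<inter> ?D"
        have "\<bar>W t \<omega> - v t\<bar> \<le> (real m + C) * ?r" if t: "t \<in> {0..1}" for t
        proof -
          have "W t \<omega> - v t = (\<Sum>k\<le>m - 1. (Z k \<omega> - z k) * t ^ k / fact k)
             + (integrated_bm \<alpha> B t \<omega> - iterated_integral (m - 1) d t)"
            unfolding v[OF t] W_eq integrated_bm_eq
            by (simp add: sum_subtractf left_diff_distrib diff_divide_distrib)
          moreover have "\<bar>\<Sum>k\<le>m - 1. (Z k \<omega> - z k) * t ^ k / fact k\<bar> \<le> (\<Sum>k\<le>m - 1. ?r)"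
          proof (rule order.trans[OF sum_abs sum_mono])
            fix k assume "k \<in> {..m - 1}"
            then have "\<bar>Z k \<omega> - z k\<bar> \<le> ?r" using \<omega> by auto
            moreover have "t ^ k / fact k \<le> 1"
              using t order.trans[OF power_le_one[of t k] fact_ge_1[of k]] by (simp add: divide_le_eq)
            ultimately have "\<bar>Z k \<omega> - z k\<bar> * (t ^ k / fact k) \<le> ?r * 1"
              using t by (intro mult_mono) auto
            then show "\<bar>(Z k \<omega> - z k) * t ^ k / fact k\<bar> \<le> ?r" using t by (simp add: abs_mult)
          qed
          moreover have "(\<Sum>k\<le>m - 1. ?r) = real m * ?r" using m by simp
          moreover have "\<bar>integrated_bm \<alpha> B t \<omega> - iterated_integral (m - 1) d t\<bar> \<le> C * ?r"
            using \<omega> t by auto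
          ultimately show ?thesis unfolding distrib_right by linarith
        qed
        then show "\<omega> \<in> ?E" using \<omega> by auto
      qed
    qed
    finally show "\<kappa>' ^ N \<le> prob ?E" .
  qed
  qed
  qed
qed

end

section \<open>Blockwise polynomial approximation\<close>

lemma set_integral_block:
  assumes f: "bounded_measurable f" and a: "0 \<le> a" and h: "0 < h" and ah: "a + h \<le> 1"
  shows "(LBINT u:{a..a + h}. f u) = h * (LINT s|unit_lborel. f (a + h * s))"
proof -
  have "(LBINT u:{a..a + h}. f u) = (\<integral>u. indicator {a..a + h} u * f u \<partial>lborel)"
    by (simp add: set_lebesgue_integral_def)
  also have "\<dots> = h * (\<integral>x. indicator {a..a + h} (a + h * x) * f (a + h * x) \<partial>lborel)"
    using lborel_integral_real_affine[of h "\<lambda>u. indicator {a..a + h} u * f u" a] h by simp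
  also have "(\<lambda>x. indicator {a..a + h} (a + h * x) * f (a + h * x)) = (\<lambda>x. indicator {0..1} x * f (a + h * x))"
    using h by (auto simp: indicator_def zero_le_mult_iff fun_eq_iff)
  also have "(\<integral>x. indicator {0..1} x * f (a + h * x) \<partial>lborel) = (LINT s|unit_lborel. f (a + h * s))"
    by (simp add: integral_restrict_space)
  finally show ?thesis .
qed

lemma integral_blocks:
  assumes f: "bounded_measurable f" and N: "0 < N"
  shows "(LINT s|unit_lborel. f s) = (1 / real N) * (\<Sum>i<N. LINT s|unit_lborel. f (real i / N + 1 / N * s))"
proof -
  have "(LBINT u:{0..real k / N}. f u) = (1 / real N) * (\<Sum>i<k. LINT s|unit_lborel. f (real i / N + 1 / N * s))"
    if "k \<le> N" for k
    using that
  proof (induction k)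
    case 0
    have "(LBINT u:{0..0}. f u) = 0"
      unfolding set_lebesgue_integral_def
      by (rule integral_eq_zero_AE, rule eventually_mono[OF AE_lborel_singleton[of 0]]) (auto simp: indicator_def)
    then show ?case by simp
  next
    case (Suc k)
    let ?a = "real k / N" and ?h = "1 / real N"
    have ah: "0 \<le> ?a" "0 < ?h" "?a + ?h \<le> 1" using Suc.prems N by (auto simp: field_simps)
    have e: "real (Suc k) / N = ?a + ?h" by (simp add: add_divide_distrib)
    have "?a \<le> ?a + ?h" using ah(2) by linarith
    from ivl_disj_un_two_touch(4)[OF ah(1) this]
    have "{0..?a + ?h} = {0..?a} \<union> {?a..?a + ?h}" by (rule sym)
    then have "(LBINT u:{0..?a + ?h}. f u) = (LBINT u:{0..?a} \<union> {?a..?a + ?h}. f u)" by (simp only:)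
    also have "\<dots> = (LBINT u:{0..?a}. f u) + (LBINT u:{?a..?a + ?h}. f u)"
    proof (rule set_integral_Un_AE)
      have "AE x in lborel. x \<noteq> ?a" by (rule AE_lborel_singleton)
      then show "AE x in lborel. \<not> (x \<in> {0..?a} \<and> x \<in> {?a..?a + ?h})"
        by eventually_elim auto
    qed (use ah Suc.prems in \<open>auto intro!: bounded_measurable_set_integrable f\<close>)
    also have "\<dots> = ?h * (\<Sum>i<k. LINT s|unit_lborel. f (real i / N + 1 / N * s)) + ?h * (LINT s|unit_lborel. f (?a + ?h * s))"
      using Suc set_integral_block[OF f ah] by simp
    finally show ?case unfolding e by (simp only: sum.lessThan_Suc distrib_left)
  qed
  from this[of N] show ?thesis using N by (simp add: unit_lborel_set_integral)
qed

lemma unit_integral_square_le: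
  assumes "bounded_measurable f"
  shows "(LINT s|unit_lborel. \<bar>f s\<bar>)\<^sup>2 \<le> (LINT s|unit_lborel. (f s)\<^sup>2)"
proof -
  interpret U: prob_space unit_lborel by (rule prob_space_unit_lborel)
  have bm: "bounded_measurable (\<lambda>s. \<bar>f s\<bar>)" using assms unfolding bounded_measurable_def by auto
  have int: "integrable unit_lborel (\<lambda>s. \<bar>f s\<bar>)" "integrable unit_lborel (\<lambda>s. \<bar>f s\<bar>\<^sup>2)"
    using bounded_measurable_integrable[OF bm] bounded_measurable_integrable[OF bounded_measurable_mult[OF bm bm]]
    by (auto simp: power2_eq_square)
  have "0 \<le> U.variance (\<lambda>s. \<bar>f s\<bar>)" by (rule U.variance_positive)
  also have "\<dots> = (LINT s|unit_lborel. \<bar>f s\<bar>\<^sup>2) - (LINT s|unit_lborel. \<bar>f s\<bar>)\<^sup>2"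
    by (rule U.variance_eq[OF int])
  finally show ?thesis by simp
qed

lemma bounded_measurable_square: "bounded_measurable f \<Longrightarrow> bounded_measurable (\<lambda>s. (f s)\<^sup>2)"
  unfolding power2_eq_square by (rule bounded_measurable_mult)

lemma integral_mono_bounded:
  assumes "bounded_measurable f" "bounded_measurable g" "\<And>s. s \<in> {0..1} \<Longrightarrow> f s \<le> g s"
  shows "(LINT s|unit_lborel. f s) \<le> (LINT s|unit_lborel. g s)"
  using assms by (intro integral_mono bounded_measurable_integrable) auto

lemma unit_integral_const [simp]: "(LINT s|unit_lborel. (c :: real)) = c"
  by simp

text \<open>After division by \<open>N\<close> the squared remainder is \<open>K\<close> times the
  squared block radius. A pointwise bound is included only for \<open>2 \<le> m\<close>: for
  \<open>m = 1\<close> the remainder is an increment of the path itself, and its energy does not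
  control its supremum.\<close>

definition block_poly_approx :: "nat \<Rightarrow> nat \<Rightarrow> real \<Rightarrow> (real \<Rightarrow> real) \<Rightarrow> bool" where
  "block_poly_approx m N K f \<longleftrightarrow> bounded_measurable f \<and> (\<exists>c \<rho>.
     (\<forall>i<N. bounded_measurable (\<rho> i)) \<and>
     (\<forall>i<N. \<forall>s\<in>{0..1}. f (real i / N + 1 / N * s) = (\<Sum>l<m. c i l * s ^ l) + \<rho> i s) \<and>
     (\<Sum>i<N. LINT s|unit_lborel. (\<rho> i s)\<^sup>2) \<le> K * (1 / real N) ^ (2 * (m - 1)) \<and>
     (2 \<le> m \<longrightarrow> (\<forall>i<N. \<forall>s\<in>{0..1}. \<bar>\<rho> i s\<bar> \<le> sqrt K * (1 / real N) ^ (m - 1))))"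

lemma block_poly_approxE:
  assumes "block_poly_approx m N K f"
  shows "\<exists>c \<rho>. (\<forall>i<N. bounded_measurable (\<rho> i)) \<and>
     (\<forall>i<N. \<forall>s\<in>{0..1}. f (real i / N + 1 / N * s) = (\<Sum>l<m. c i l * s ^ l) + \<rho> i s) \<and>
     (\<Sum>i<N. LINT s|unit_lborel. (\<rho> i s)\<^sup>2) \<le> K * (1 / real N) ^ (2 * (m - 1)) \<and>
     (2 \<le> m \<longrightarrow> (\<forall>i<N. \<forall>s\<in>{0..1}. \<bar>\<rho> i s\<bar> \<le> sqrt K * (1 / real N) ^ (m - 1)))"
  using assms unfolding block_poly_approx_def by (rule conjunct2)

text \<open>The remainder on a block is \<open>(1 / N) ^ (m - 1)\<close> times the iterated integral
  of the increment of \<open>b\<close>. Its L2 norm is governed by the energy of that increment, and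
  for \<open>m \<ge> 2\<close> so is its supremum.\<close>

lemma block_poly_approx_of_integral:
  assumes m: "1 \<le> m" and b: "continuous_on {0..1} b" and K: "0 \<le> K"
    and f: "\<And>t. t \<in> {0..1} \<Longrightarrow> f t = (\<Sum>k\<le>m - 1. z k * t ^ k / fact k) + iterated_integral (m - 1) b t"
    and J: "(\<Sum>i<N. LINT s|unit_lborel. (b (real i / N + 1 / N * s) - b (real i / N))\<^sup>2) \<le> K"
  shows "block_poly_approx m N K f"
proof -
  note bm = bounded_measurable_continuous[OF b]
  define \<beta> where "\<beta> i x = b (real i / N + 1 / N * x) - b (real i / N)" for i x
  define \<rho> where "\<rho> i s = (1 / real N) ^ (m - 1) * iterated_integral (m - 1) (\<beta> i) s" for i s
  have time: "real i / N + 1 / N * s \<in> {0..1}" if "i < N" "s \<in> {0..1}" for i s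
  proof -
    have "real i + s \<le> real N" using that by auto
    then have "(real i + s) / N \<le> 1" using that by simp
    then show ?thesis using that by (simp add: add_divide_distrib)
  qed
  have \<beta>c: "continuous_on {0..1} (\<beta> i)" if "i < N" for i
    unfolding \<beta>_def[abs_def]
    by (intro continuous_intros continuous_on_compose2[OF b]) (use time[OF that] in auto)
  note bm\<beta> = bounded_measurable_continuous[OF \<beta>c]
  have bm\<rho>: "bounded_measurable (\<rho> i)" if "i < N" for i
    unfolding \<rho>_def[abs_def]
    by (intro bounded_measurable_continuous continuous_intros iterated_integral_continuous \<beta>c that)
  have "\<forall>i. \<exists>c. i < N \<longrightarrow> (\<forall>s\<in>{0..1}. f (real i / N + 1 / N * s) = (\<Sum>l<m. c l * s ^ l) + \<rho> i s)"
  proof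
    fix i
    show "\<exists>c. i < N \<longrightarrow> (\<forall>s\<in>{0..1}. f (real i / N + 1 / N * s) = (\<Sum>l<m. c l * s ^ l) + \<rho> i s)"
    proof (cases "i < N")
      case True
      obtain c where "\<And>s. s \<in> {0..1} \<Longrightarrow>
        (\<Sum>k\<le>m - 1. z k * (real i / N + 1 / N * s) ^ k / fact k)
          + iterated_integral (m - 1) b (real i / N + 1 / N * s)
        = (\<Sum>l<m. c l * s ^ l)
          + (1 / N) ^ (m - 1) * iterated_integral (m - 1) (\<lambda>x. b (real i / N + 1 / N * x) - b (real i / N)) s"
        using block_polynomial_remainder[OF m bm True, of z] by blast
      then have "\<forall>s\<in>{0..1}. f (real i / N + 1 / N * s) = (\<Sum>l<m. c l * s ^ l) + \<rho> i s"
        using f time[OF True] by (simp add: \<rho>_def \<beta>_def[abs_def])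
      then show ?thesis by blast
    qed blast
  qed
  then obtain c where c: "\<forall>i. i < N \<longrightarrow> (\<forall>s\<in>{0..1}. f (real i / N + 1 / N * s) = (\<Sum>l<m. c i l * s ^ l) + \<rho> i s)"
    using choice[of "\<lambda>i c. i < N \<longrightarrow> (\<forall>s\<in>{0..1}. f (real i / N + 1 / N * s) = (\<Sum>l<m. c l * s ^ l) + \<rho> i s)"]
    by blast
  define J where "J i = (LINT s|unit_lborel. (\<beta> i s)\<^sup>2)" for i
  have J0: "0 \<le> J i" for i unfolding J_def by (intro integral_nonneg_AE) auto
  have JK: "(\<Sum>i<N. J i) \<le> K" using J unfolding J_def \<beta>_def .
  have sq: "(LINT s|unit_lborel. (\<rho> i s)\<^sup>2) \<le> (1 / real N) ^ (2 * (m - 1)) * J i"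
    and ptw: "2 \<le> m \<longrightarrow> (\<forall>s\<in>{0..1}. \<bar>\<rho> i s\<bar> \<le> sqrt (J i) * (1 / real N) ^ (m - 1))" if i: "i < N" for i
  proof -
    have iter: "\<bar>iterated_integral (m - 1) (\<beta> i) s\<bar> \<le> sqrt (J i)" if "2 \<le> m" "s \<in> {0..1}" for s
    proof -
      obtain q where q: "m - 1 = Suc q" using \<open>2 \<le> m\<close> by (cases "m - 1") auto
      have "\<bar>iterated_integral (Suc q) (\<beta> i) s\<bar> \<le> (LINT s|unit_lborel. \<bar>\<beta> i s\<bar>)"
        using that by (intro iterated_integral_abs_le_integral bm\<beta> i) auto
      also have "\<dots> \<le> sqrt (J i)"
        unfolding J_def by (rule real_le_rsqrt[OF unit_integral_square_le[OF bm\<beta>[OF i]]])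
      finally show ?thesis unfolding q .
    qed
    show "2 \<le> m \<longrightarrow> (\<forall>s\<in>{0..1}. \<bar>\<rho> i s\<bar> \<le> sqrt (J i) * (1 / real N) ^ (m - 1))"
    proof (intro impI ballI)
      fix s :: real assume "2 \<le> m" "s \<in> {0..1}"
      from mult_left_mono[OF iter[OF this], of "(1 / real N) ^ (m - 1)"]
      show "\<bar>\<rho> i s\<bar> \<le> sqrt (J i) * (1 / real N) ^ (m - 1)"
        by (simp add: \<rho>_def abs_mult mult.commute)
    qed
    have sqr: "(\<rho> i s)\<^sup>2 = (1 / real N) ^ (2 * (m - 1)) * (iterated_integral (m - 1) (\<beta> i) s)\<^sup>2" for s
      unfolding \<rho>_def power_mult_distrib power_mult[symmetric] by (simp only: mult.commute[of 2])
    have "(LINT s|unit_lborel. (iterated_integral (m - 1) (\<beta> i) s)\<^sup>2) \<le> J i"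
    proof (cases "m = 1")
      case True
      then show ?thesis by (simp add: J_def)
    next
      case False
      then have m2: "2 \<le> m" using m by simp
      have "(LINT s|unit_lborel. (iterated_integral (m - 1) (\<beta> i) s)\<^sup>2) \<le> (LINT s|unit_lborel. J i)"
      proof (rule integral_mono_bounded)
        show "bounded_measurable (\<lambda>s. (iterated_integral (m - 1) (\<beta> i) s)\<^sup>2)"
          by (intro bounded_measurable_square bounded_measurable_continuous iterated_integral_continuous \<beta>c i)
        fix s :: real assume "s \<in> {0..1}"
        from power_mono[OF iter[OF m2 this], of 2] show "(iterated_integral (m - 1) (\<beta> i) s)\<^sup>2 \<le> J i"
          using J0 by simp
      qed (rule bounded_measurable_const)
      then show ?thesis by simp
    qed
    then show "(LINT s|unit_lborel. (\<rho> i s)\<^sup>2) \<le> (1 / real N) ^ (2 * (m - 1)) * J i"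
      unfolding sqr by (simp add: mult_left_mono)
  qed
  have tot: "(\<Sum>i<N. LINT s|unit_lborel. (\<rho> i s)\<^sup>2) \<le> K * (1 / real N) ^ (2 * (m - 1))"
  proof -
    have "(\<Sum>i<N. LINT s|unit_lborel. (\<rho> i s)\<^sup>2) \<le> (\<Sum>i<N. (1 / real N) ^ (2 * (m - 1)) * J i)"
      by (rule sum_mono) (use sq in auto)
    also have "\<dots> = (1 / real N) ^ (2 * (m - 1)) * (\<Sum>i<N. J i)" by (rule sum_distrib_left[symmetric])
    also have "\<dots> \<le> (1 / real N) ^ (2 * (m - 1)) * K" using JK by (intro mult_left_mono) auto
    finally show ?thesis by (simp only: mult.commute)
  qed
  have sup: "2 \<le> m \<longrightarrow> (\<forall>i<N. \<forall>s\<in>{0..1}. \<bar>\<rho> i s\<bar> \<le> sqrt K * (1 / real N) ^ (m - 1))"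
  proof (intro impI allI ballI)
    fix i s assume "2 \<le> m" and i: "i < N" and "s \<in> {0..(1::real)}"
    then have "\<bar>\<rho> i s\<bar> \<le> sqrt (J i) * (1 / real N) ^ (m - 1)" using ptw[OF i] by blast
    also have "\<dots> \<le> sqrt K * (1 / real N) ^ (m - 1)"
    proof -
      have "J i \<le> (\<Sum>i<N. J i)" using i J0 by (intro member_le_sum) auto
      then have "J i \<le> K" using JK by linarith
      then show ?thesis by (intro mult_right_mono real_sqrt_le_mono) auto
    qed
    finally show "\<bar>\<rho> i s\<bar> \<le> sqrt K * (1 / real N) ^ (m - 1)" .
  qed
  have bmf: "bounded_measurable f"
  proof (rule bounded_measurable_continuous)
    have "continuous_on {0..1} f \<longleftrightarrow> continuous_on {0..1} (\<lambda>t. (\<Sum>k\<le>m - 1. z k * t ^ k / fact k) + iterated_integral (m - 1) b t)"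
      by (rule continuous_on_cong) (auto simp: f)
    then show "continuous_on {0..1} f"
      by (auto intro!: continuous_intros iterated_integral_continuous b)
  qed
  show ?thesis
    unfolding block_poly_approx_def
    by (intro conjI bmf exI[of _ c] exI[of _ \<rho>] tot sup) (use bm\<rho> c in auto)
qed

lemma block_poly_approx_add_const:
  assumes m: "1 \<le> m" and f: "block_poly_approx m N K f"
  shows "block_poly_approx m N K (\<lambda>t. f t + a)"
proof -
  obtain c \<rho> where c: "\<forall>i<N. bounded_measurable (\<rho> i)"
     "\<forall>i<N. \<forall>s\<in>{0..1}. f (real i / N + 1 / N * s) = (\<Sum>l<m. c i l * s ^ l) + \<rho> i s"
     "(\<Sum>i<N. LINT s|unit_lborel. (\<rho> i s)\<^sup>2) \<le> K * (1 / real N) ^ (2 * (m - 1))"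
     "2 \<le> m \<longrightarrow> (\<forall>i<N. \<forall>s\<in>{0..1}. \<bar>\<rho> i s\<bar> \<le> sqrt K * (1 / real N) ^ (m - 1))"
    using block_poly_approxE[OF f] by (elim exE conjE)
  define c' where "c' i l = c i l + (if l = 0 then a else 0)" for i l
  have "(\<Sum>l<m. c' i l * s ^ l) = (\<Sum>l<m. c i l * s ^ l) + a" for i s
  proof -
    have "(\<Sum>l<m. (if l = 0 then a else 0) * s ^ l) = (\<Sum>l<m. if l = 0 then a else 0)"
      by (intro sum.cong) auto
    also have "\<dots> = a" using m by simp
    finally show ?thesis by (simp add: c'_def distrib_right sum.distrib)
  qed
  then have "\<forall>i<N. \<forall>s\<in>{0..1}. f (real i / N + 1 / N * s) + a = (\<Sum>l<m. c' i l * s ^ l) + \<rho> i s"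
    using c(2) by simp
  moreover have "bounded_measurable (\<lambda>t. f t + a)"
    using f unfolding block_poly_approx_def by (intro bounded_measurable_add bounded_measurable_const) auto
  ultimately show ?thesis
    unfolding block_poly_approx_def using c(1,3,4) by (intro conjI exI[of _ c'] exI[of _ \<rho>])
qed

lemma block_poly_approx_diff:
  assumes f: "block_poly_approx m N K f" and g: "block_poly_approx m N K' g" and K: "0 \<le> K" "0 \<le> K'"
  shows "block_poly_approx m N (2 * (K + K')) (\<lambda>t. f t - g t)"
proof -
  let ?H = "(1 / real N) ^ (m - 1)"
  obtain c \<rho> where c: "\<forall>i<N. bounded_measurable (\<rho> i)"
     "\<forall>i<N. \<forall>s\<in>{0..1}. f (real i / N + 1 / N * s) = (\<Sum>l<m. c i l * s ^ l) + \<rho> i s"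
     "(\<Sum>i<N. LINT s|unit_lborel. (\<rho> i s)\<^sup>2) \<le> K * (1 / real N) ^ (2 * (m - 1))"
     "2 \<le> m \<longrightarrow> (\<forall>i<N. \<forall>s\<in>{0..1}. \<bar>\<rho> i s\<bar> \<le> sqrt K * ?H)"
    using block_poly_approxE[OF f] by (elim exE conjE)
  obtain c' \<rho>' where c': "\<forall>i<N. bounded_measurable (\<rho>' i)"
     "\<forall>i<N. \<forall>s\<in>{0..1}. g (real i / N + 1 / N * s) = (\<Sum>l<m. c' i l * s ^ l) + \<rho>' i s"
     "(\<Sum>i<N. LINT s|unit_lborel. (\<rho>' i s)\<^sup>2) \<le> K' * (1 / real N) ^ (2 * (m - 1))"
     "2 \<le> m \<longrightarrow> (\<forall>i<N. \<forall>s\<in>{0..1}. \<bar>\<rho>' i s\<bar> \<le> sqrt K' * ?H)"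
    using block_poly_approxE[OF g] by (elim exE conjE)
  have "\<forall>i<N. bounded_measurable (\<lambda>s. \<rho> i s - \<rho>' i s)"
    using c(1) c'(1) by (auto intro: bounded_measurable_diff)
  moreover have "\<forall>i<N. \<forall>s\<in>{0..1}. f (real i / N + 1 / N * s) - g (real i / N + 1 / N * s)
      = (\<Sum>l<m. (c i l - c' i l) * s ^ l) + (\<rho> i s - \<rho>' i s)"
    using c(2) c'(2) by (simp add: left_diff_distrib sum_subtractf)
  moreover have "(\<Sum>i<N. LINT s|unit_lborel. (\<rho> i s - \<rho>' i s)\<^sup>2) \<le> 2 * (K + K') * (1 / real N) ^ (2 * (m - 1))"
  proof -
    have "(\<Sum>i<N. LINT s|unit_lborel. (\<rho> i s - \<rho>' i s)\<^sup>2)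
        \<le> (\<Sum>i<N. 2 * (LINT s|unit_lborel. (\<rho> i s)\<^sup>2) + 2 * (LINT s|unit_lborel. (\<rho>' i s)\<^sup>2))"
    proof (rule sum_mono)
      fix i assume "i \<in> {..<N}"
      then have bm: "bounded_measurable (\<rho> i)" "bounded_measurable (\<rho>' i)" using c(1) c'(1) by auto
      have "(LINT s|unit_lborel. (\<rho> i s - \<rho>' i s)\<^sup>2) \<le> (LINT s|unit_lborel. 2 * (\<rho> i s)\<^sup>2 + 2 * (\<rho>' i s)\<^sup>2)"
      proof (rule integral_mono_bounded)
        fix s
        have "0 \<le> (\<rho> i s + \<rho>' i s)\<^sup>2" by simp
        then show "(\<rho> i s - \<rho>' i s)\<^sup>2 \<le> 2 * (\<rho> i s)\<^sup>2 + 2 * (\<rho>' i s)\<^sup>2"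
          by (simp add: power2_eq_square algebra_simps)
      qed (intro bounded_measurable_square bounded_measurable_diff bounded_measurable_add
          bounded_measurable_mult bounded_measurable_const bm)+
      also have "\<dots> = 2 * (LINT s|unit_lborel. (\<rho> i s)\<^sup>2) + 2 * (LINT s|unit_lborel. (\<rho>' i s)\<^sup>2)"
        using bounded_measurable_integrable[OF bounded_measurable_square[OF bm(1)]]
          bounded_measurable_integrable[OF bounded_measurable_square[OF bm(2)]] by simp
      finally show "(LINT s|unit_lborel. (\<rho> i s - \<rho>' i s)\<^sup>2)
        \<le> 2 * (LINT s|unit_lborel. (\<rho> i s)\<^sup>2) + 2 * (LINT s|unit_lborel. (\<rho>' i s)\<^sup>2)" .
    qed
    also have "\<dots> = 2 * (\<Sum>i<N. LINT s|unit_lborel. (\<rho> i s)\<^sup>2) + 2 * (\<Sum>i<N. LINT s|unit_lborel. (\<rho>' i s)\<^sup>2)"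
      by (simp add: sum.distrib sum_distrib_left)
    also have "\<dots> \<le> 2 * (K * (1 / real N) ^ (2 * (m - 1))) + 2 * (K' * (1 / real N) ^ (2 * (m - 1)))"
      using c(3) c'(3) by linarith
    finally show ?thesis by (simp only: distrib_left distrib_right mult.assoc)
  qed
  moreover have "2 \<le> m \<longrightarrow> (\<forall>i<N. \<forall>s\<in>{0..1}. \<bar>\<rho> i s - \<rho>' i s\<bar> \<le> sqrt (2 * (K + K')) * ?H)"
  proof (intro impI allI ballI)
    fix i s assume A: "2 \<le> m" "i < N" "s \<in> {0..(1::real)}"
    have "sqrt K + sqrt K' \<le> sqrt (2 * (K + K'))"
    proof (rule real_le_rsqrt)
      have "0 \<le> (sqrt K - sqrt K')\<^sup>2" by simp
      then show "(sqrt K + sqrt K')\<^sup>2 \<le> 2 * (K + K')"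
        using K by (simp add: power2_eq_square algebra_simps)
    qed
    then have "sqrt K * ?H + sqrt K' * ?H \<le> sqrt (2 * (K + K')) * ?H"
      unfolding distrib_right[symmetric] by (intro mult_right_mono) auto
    moreover have "\<bar>\<rho> i s\<bar> \<le> sqrt K * ?H" "\<bar>\<rho>' i s\<bar> \<le> sqrt K' * ?H"
      using c(4) c'(4) A by blast+
    ultimately show "\<bar>\<rho> i s - \<rho>' i s\<bar> \<le> sqrt (2 * (K + K')) * ?H" by linarith
  qed
  moreover have "bounded_measurable (\<lambda>t. f t - g t)"
    using f g unfolding block_poly_approx_def by (intro bounded_measurable_diff) auto
  ultimately show ?thesis
    unfolding block_poly_approx_def
    by (intro conjI exI[of _ "\<lambda>i l. c i l - c' i l"] exI[of _ "\<lambda>i s. \<rho> i s - \<rho>' i s"])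
qed

section \<open>Recovering block coefficients from dual functionals\<close>

locale dual_polynomials =
  fixes \<psi> :: "nat \<Rightarrow> real poly" and m :: nat and \<Psi> :: real
  assumes dual: "l < m \<Longrightarrow> k < m \<Longrightarrow> (LINT s|unit_lborel. poly (\<psi> l) s * s ^ k) = (if k = l then 1 else 0)"
    and bound: "l < m \<Longrightarrow> s \<in> {0..1} \<Longrightarrow> \<bar>poly (\<psi> l) s\<bar> \<le> \<Psi>"
    and \<Psi>_nonneg: "0 \<le> \<Psi>"
begin

text \<open>For a function that is a polynomial of degree below \<open>m\<close> on block
  \<open>i\<close> this is its coefficient of degree \<open>l\<close> in the local variable. As a
  bounded linear functional it applies to every bounded measurable function.\<close>

definition coord :: "nat \<Rightarrow> (real \<Rightarrow> real) \<Rightarrow> nat \<Rightarrow> nat \<Rightarrow> real" where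
  "coord N f i l = (LINT s|unit_lborel. poly (\<psi> l) s * f (real i / N + 1 / N * s))"

lemma poly_bm: "bounded_measurable (poly p)"
  by (intro bounded_measurable_continuous continuous_intros)

lemma dual_functional_le:
  assumes "bounded_measurable e" "l < m"
  shows "\<bar>LINT s|unit_lborel. poly (\<psi> l) s * e s\<bar> \<le> \<Psi> * (LINT s|unit_lborel. \<bar>e s\<bar>)"
proof -
  have bm: "bounded_measurable (\<lambda>s. \<bar>e s\<bar>)" using assms(1) unfolding bounded_measurable_def by auto
  have bmp: "bounded_measurable (\<lambda>s. poly (\<psi> l) s * e s)" by (intro bounded_measurable_mult poly_bm assms)
  then have bma: "bounded_measurable (\<lambda>s. \<bar>poly (\<psi> l) s * e s\<bar>)" unfolding bounded_measurable_def by auto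
  have "\<bar>LINT s|unit_lborel. poly (\<psi> l) s * e s\<bar> \<le> (LINT s|unit_lborel. \<bar>poly (\<psi> l) s * e s\<bar>)"
    by (rule integral_abs_bound)
  also have "\<dots> \<le> (LINT s|unit_lborel. \<Psi> * \<bar>e s\<bar>)"
    by (rule integral_mono_bounded[OF bma bounded_measurable_mult[OF bounded_measurable_const bm]])
       (use bound[OF assms(2)] in \<open>auto simp: abs_mult intro!: mult_right_mono\<close>)
  finally show ?thesis by simp
qed

lemma dual_functional_square_le:
  assumes e: "bounded_measurable e" and l: "l < m"
  shows "(LINT s|unit_lborel. poly (\<psi> l) s * e s)\<^sup>2 \<le> \<Psi>\<^sup>2 * (LINT s|unit_lborel. (e s)\<^sup>2)"
proof -
  have "(LINT s|unit_lborel. poly (\<psi> l) s * e s)\<^sup>2 \<le> (\<Psi> * (LINT s|unit_lborel. \<bar>e s\<bar>))\<^sup>2"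
    using power_mono[OF dual_functional_le[OF assms] abs_ge_zero, of 2] by simp
  also have "\<dots> \<le> \<Psi>\<^sup>2 * (LINT s|unit_lborel. (e s)\<^sup>2)"
    unfolding power_mult_distrib by (intro mult_left_mono unit_integral_square_le e) auto
  finally show ?thesis .
qed

text \<open>The dual functionals return each coefficient up to an error of \<open>\<Psi>\<close>
  times the L1 norm of the remainder.\<close>

lemma block_pointwise:
  assumes e: "bounded_measurable e" and D: "\<And>s. s \<in> {0..1} \<Longrightarrow> D s = (\<Sum>l<m. \<gamma> l * s ^ l) + e s"
    and s: "s \<in> {0..1}"
  shows "\<bar>D s\<bar> \<le> (\<Sum>l<m. \<bar>LINT s|unit_lborel. poly (\<psi> l) s * D s\<bar>)
    + real m * \<Psi> * (LINT s|unit_lborel. \<bar>e s\<bar>) + \<bar>e s\<bar>"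
proof -
  let ?a = "\<lambda>l. LINT s|unit_lborel. poly (\<psi> l) s * D s"
  let ?E = "LINT s|unit_lborel. \<bar>e s\<bar>"
  have \<gamma>: "\<bar>\<gamma> l\<bar> \<le> \<bar>?a l\<bar> + \<Psi> * ?E" if l: "l < m" for l
  proof -
    have "?a l = (LINT s|unit_lborel. (\<Sum>k<m. \<gamma> k * (poly (\<psi> l) s * s ^ k)) + poly (\<psi> l) s * e s)"
      by (rule Bochner_Integration.integral_cong)
         (auto simp: D distrib_left sum_distrib_left mult_ac)
    also have "\<dots> = (LINT s|unit_lborel. (\<Sum>k<m. \<gamma> k * (poly (\<psi> l) s * s ^ k))) + (LINT s|unit_lborel. poly (\<psi> l) s * e s)"
      by (intro Bochner_Integration.integral_add bounded_measurable_integrable bounded_measurable_mult poly_bm e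
          bounded_measurable_continuous continuous_intros)
    also have "(LINT s|unit_lborel. (\<Sum>k<m. \<gamma> k * (poly (\<psi> l) s * s ^ k))) = (\<Sum>k<m. LINT s|unit_lborel. \<gamma> k * (poly (\<psi> l) s * s ^ k))"
      by (intro Bochner_Integration.integral_sum bounded_measurable_integrable
          bounded_measurable_continuous continuous_intros)
    also have "\<dots> = (\<Sum>k<m. if k = l then \<gamma> k else 0)"
      using dual[OF l] by (intro sum.cong) auto
    finally have "?a l = \<gamma> l + (LINT s|unit_lborel. poly (\<psi> l) s * e s)" using l by simp
    then show ?thesis using dual_functional_le[OF e l] by linarith
  qed
  have "\<bar>\<Sum>l<m. \<gamma> l * s ^ l\<bar> \<le> (\<Sum>l<m. \<bar>?a l\<bar> + \<Psi> * ?E)"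
  proof (rule order.trans[OF sum_abs sum_mono])
    fix l assume "l \<in> {..<m}"
    then have "\<bar>\<gamma> l\<bar> * \<bar>s ^ l\<bar> \<le> (\<bar>?a l\<bar> + \<Psi> * ?E) * 1"
      using \<gamma>[of l] s power_le_one[of s l] by (intro mult_mono) auto
    then show "\<bar>\<gamma> l * s ^ l\<bar> \<le> \<bar>?a l\<bar> + \<Psi> * ?E" by (simp add: abs_mult)
  qed
  also have "\<dots> = (\<Sum>l<m. \<bar>?a l\<bar>) + real m * \<Psi> * ?E" by (simp add: sum.distrib)
  finally show ?thesis using D[OF s] by linarith
qed

lemma block_square:
  assumes e: "bounded_measurable e" and bD: "bounded_measurable D"
    and D: "\<And>s. s \<in> {0..1} \<Longrightarrow> D s = (\<Sum>l<m. \<gamma> l * s ^ l) + e s"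
  shows "(LINT s|unit_lborel. (D s)\<^sup>2)
    \<le> (real m + 2) * ((\<Sum>l<m. (LINT s|unit_lborel. poly (\<psi> l) s * D s)\<^sup>2)
       + ((real m * \<Psi>)\<^sup>2 + 1) * (LINT s|unit_lborel. (e s)\<^sup>2))"
proof -
  let ?a = "\<lambda>l. LINT s|unit_lborel. poly (\<psi> l) s * D s"
  let ?E = "LINT s|unit_lborel. \<bar>e s\<bar>"
  let ?A = "\<Sum>l<m. (?a l)\<^sup>2"
  have ptw: "(D s)\<^sup>2 \<le> (real m + 2) * (?A + (real m * \<Psi> * ?E)\<^sup>2 + (e s)\<^sup>2)" if s: "s \<in> {0..1}" for s
  proof -
    \<comment> \<open>The bound has \<open>m + 2\<close> summands: \<open>m\<close> coordinates, the
      coefficient error and the remainder. Cauchy-Schwarz over them gives the factor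
      \<open>real m + 2\<close>.\<close>
    define v where "v l = (if l < m then \<bar>?a l\<bar> else if l = m then real m * \<Psi> * ?E else \<bar>e s\<bar>)" for l
    have v1: "(\<Sum>l<m + 2. v l) = (\<Sum>l<m. \<bar>?a l\<bar>) + real m * \<Psi> * ?E + \<bar>e s\<bar>"
      by (simp add: v_def)
    have v2: "(\<Sum>l<m + 2. (v l)\<^sup>2) = ?A + (real m * \<Psi> * ?E)\<^sup>2 + (e s)\<^sup>2"
      by (simp add: v_def)
    have "\<bar>D s\<bar> \<le> (\<Sum>l<m + 2. v l)" unfolding v1 by (rule block_pointwise[OF e D s])
    then have "(D s)\<^sup>2 \<le> (\<Sum>l<m + 2. v l * 1)\<^sup>2" using power_mono[of "\<bar>D s\<bar>" _ 2] by simp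
    also have "\<dots> \<le> (\<Sum>l<m + 2. (v l)\<^sup>2) * (\<Sum>l<m + 2. 1\<^sup>2)" by (rule Cauchy_Schwarz_ineq_sum)
    finally show ?thesis unfolding v2 by (simp add: mult.commute algebra_simps)
  qed
  have bme: "bounded_measurable (\<lambda>s. (e s)\<^sup>2)" by (rule bounded_measurable_square[OF e])
  have "(LINT s|unit_lborel. (D s)\<^sup>2) \<le> (LINT s|unit_lborel. (real m + 2) * (?A + (real m * \<Psi> * ?E)\<^sup>2 + (e s)\<^sup>2))"
    by (rule integral_mono_bounded[OF bounded_measurable_square[OF bD]
          bounded_measurable_mult[OF bounded_measurable_const bounded_measurable_add[OF bounded_measurable_const bme]] ptw])
  also have "\<dots> = (real m + 2) * (?A + (real m * \<Psi> * ?E)\<^sup>2 + (LINT s|unit_lborel. (e s)\<^sup>2))"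
  proof -
    have int: "integrable unit_lborel (\<lambda>s. (e s)\<^sup>2)" by (rule bounded_measurable_integrable[OF bme])
    have "(LINT s|unit_lborel. (?A + (real m * \<Psi> * ?E)\<^sup>2) + (e s)\<^sup>2)
       = (LINT s|unit_lborel. ?A + (real m * \<Psi> * ?E)\<^sup>2) + (LINT s|unit_lborel. (e s)\<^sup>2)"
      by (rule Bochner_Integration.integral_add[OF bounded_measurable_integrable[OF bounded_measurable_const] int])
    then show ?thesis by simp
  qed
  also have "\<dots> \<le> (real m + 2) * (?A + ((real m * \<Psi>)\<^sup>2 + 1) * (LINT s|unit_lborel. (e s)\<^sup>2))"
  proof (rule mult_left_mono)
    have "(real m * \<Psi> * ?E)\<^sup>2 \<le> (real m * \<Psi>)\<^sup>2 * (LINT s|unit_lborel. (e s)\<^sup>2)"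
      unfolding power_mult_distrib[of _ ?E] by (intro mult_left_mono unit_integral_square_le e) auto
    then show "?A + (real m * \<Psi> * ?E)\<^sup>2 + (LINT s|unit_lborel. (e s)\<^sup>2)
      \<le> ?A + ((real m * \<Psi>)\<^sup>2 + 1) * (LINT s|unit_lborel. (e s)\<^sup>2)" by (simp add: distrib_right)
  qed simp
  finally show ?thesis .
qed

lemma block_fun_bm:
  fixes N :: nat
  assumes "bounded_measurable f" "i < N"
  shows "bounded_measurable (\<lambda>s. f (real i / N + 1 / N * s))"
  by (rule bounded_measurable_affine[OF assms(1)]) (use assms(2) in \<open>auto simp: field_simps\<close>)

text \<open>Together with \<open>coords_le_square_integral\<close> this compares the L2 norm with
  the averaged squared coordinates in both directions, up to an error of the order of the squared
  block radius.\<close>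

lemma square_integral_le_coords:
  assumes N: "0 < N" and f: "block_poly_approx m N K f"
  shows "(LINT s|unit_lborel. (f s)\<^sup>2)
    \<le> (real m + 2) * ((\<Sum>i<N. \<Sum>l<m. (coord N f i l)\<^sup>2) / N
       + ((real m * \<Psi>)\<^sup>2 + 1) * K * ((1 / real N) ^ (2 * (m - 1)) / N))"
proof -
  obtain c \<rho> where c: "\<forall>i<N. bounded_measurable (\<rho> i)"
     "\<forall>i<N. \<forall>s\<in>{0..1}. f (real i / N + 1 / N * s) = (\<Sum>l<m. c i l * s ^ l) + \<rho> i s"
     "(\<Sum>i<N. LINT s|unit_lborel. (\<rho> i s)\<^sup>2) \<le> K * (1 / real N) ^ (2 * (m - 1))"
     "2 \<le> m \<longrightarrow> (\<forall>i<N. \<forall>s\<in>{0..1}. \<bar>\<rho> i s\<bar> \<le> sqrt K * (1 / real N) ^ (m - 1))"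
    using block_poly_approxE[OF f] by (elim exE conjE)
  have bf: "bounded_measurable f" using f unfolding block_poly_approx_def by (rule conjunct1)
  let ?C = "(real m * \<Psi>)\<^sup>2 + 1"
  have "(LINT s|unit_lborel. (f s)\<^sup>2) = (1 / real N) * (\<Sum>i<N. LINT s|unit_lborel. (f (real i / N + 1 / N * s))\<^sup>2)"
    by (rule integral_blocks[OF bounded_measurable_square[OF bf] N])
  also have "\<dots> \<le> (1 / real N) * (\<Sum>i<N. (real m + 2) * ((\<Sum>l<m. (coord N f i l)\<^sup>2) + ?C * (LINT s|unit_lborel. (\<rho> i s)\<^sup>2)))"
  proof (intro mult_left_mono sum_mono)
    fix i assume "i \<in> {..<N}"
    then have i: "i < N" by simp
    show "(LINT s|unit_lborel. (f (real i / N + 1 / N * s))\<^sup>2)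
        \<le> (real m + 2) * ((\<Sum>l<m. (coord N f i l)\<^sup>2) + ?C * (LINT s|unit_lborel. (\<rho> i s)\<^sup>2))"
      unfolding coord_def by (rule block_square[where \<gamma> = "c i", OF c(1)[rule_format, OF i] block_fun_bm[OF bf i]])
        (use c(2) i in blast)
  qed simp
  also have "\<dots> = (real m + 2) * ((\<Sum>i<N. \<Sum>l<m. (coord N f i l)\<^sup>2) / N + ?C * (\<Sum>i<N. LINT s|unit_lborel. (\<rho> i s)\<^sup>2) / N)"
    by (simp add: sum_distrib_left[symmetric] sum.distrib add_divide_distrib distrib_left)
  also have "\<dots> \<le> (real m + 2) * ((\<Sum>i<N. \<Sum>l<m. (coord N f i l)\<^sup>2) / N + ?C * (K * (1 / real N) ^ (2 * (m - 1))) / N)"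
    using c(3) by (intro mult_left_mono add_left_mono divide_right_mono) auto
  finally show ?thesis by (simp add: mult.assoc)
qed

lemma coords_le_square_integral:
  assumes N: "0 < N" and f: "bounded_measurable f"
  shows "(\<Sum>i<N. \<Sum>l<m. (coord N f i l)\<^sup>2) \<le> real N * (real m * \<Psi>\<^sup>2 * (LINT s|unit_lborel. (f s)\<^sup>2))"
proof -
  have "(\<Sum>i<N. \<Sum>l<m. (coord N f i l)\<^sup>2) \<le> (\<Sum>i<N. \<Sum>l<m. \<Psi>\<^sup>2 * (LINT s|unit_lborel. (f (real i / N + 1 / N * s))\<^sup>2))"
    unfolding coord_def by (intro sum_mono dual_functional_square_le block_fun_bm f) auto
  also have "\<dots> = real m * \<Psi>\<^sup>2 * (\<Sum>i<N. LINT s|unit_lborel. (f (real i / N + 1 / N * s))\<^sup>2)"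
    by (simp add: sum_distrib_left mult.assoc)
  also have "(\<Sum>i<N. LINT s|unit_lborel. (f (real i / N + 1 / N * s))\<^sup>2) = real N * (LINT s|unit_lborel. (f s)\<^sup>2)"
    using integral_blocks[OF bounded_measurable_square[OF f] N] N by simp
  finally show ?thesis by (simp add: mult_ac)
qed

text \<open>Rescaling one block to unit length multiplies its share of the squared norm by
  \<open>N\<close>. This is the origin of the loss \<open>sqrt N\<close> in passing from L2 to the
  supremum.\<close>

lemma sup_le_square_integral:
  assumes m2: "2 \<le> m" and N: "0 < N" and f: "block_poly_approx m N K f" and t: "t \<in> {0..1}" and K: "0 \<le> K"
  shows "\<bar>f t\<bar> \<le> real m * \<Psi> * sqrt (real N * (LINT s|unit_lborel. (f s)\<^sup>2))
    + (real m * \<Psi> + 1) * (sqrt K * (1 / real N) ^ (m - 1))"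
proof -
  obtain c \<rho> where c: "\<forall>i<N. bounded_measurable (\<rho> i)"
     "\<forall>i<N. \<forall>s\<in>{0..1}. f (real i / N + 1 / N * s) = (\<Sum>l<m. c i l * s ^ l) + \<rho> i s"
     "(\<Sum>i<N. LINT s|unit_lborel. (\<rho> i s)\<^sup>2) \<le> K * (1 / real N) ^ (2 * (m - 1))"
     "2 \<le> m \<longrightarrow> (\<forall>i<N. \<forall>s\<in>{0..1}. \<bar>\<rho> i s\<bar> \<le> sqrt K * (1 / real N) ^ (m - 1))"
    using block_poly_approxE[OF f] by (elim exE conjE)
  have bf: "bounded_measurable f" using f unfolding block_poly_approx_def by (rule conjunct1)
  obtain i s where is': "i < N" "s \<in> {0..1}" "t = real i / N + 1 / N * s"
    using block_coordinates[OF t N] .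
  let ?R = "sqrt K * (1 / real N) ^ (m - 1)"
  have \<rho>: "\<bar>\<rho> i s\<bar> \<le> ?R" if "s \<in> {0..1}" for s using c(4) m2 is'(1) that by blast
  let ?g = "\<lambda>s. f (real i / N + 1 / N * s)"
  have "\<bar>?g s\<bar> \<le> (\<Sum>l<m. \<bar>coord N f i l\<bar>) + real m * \<Psi> * (LINT s|unit_lborel. \<bar>\<rho> i s\<bar>) + \<bar>\<rho> i s\<bar>"
    unfolding coord_def
    by (rule block_pointwise[of "\<rho> i" ?g "c i" s]) (use c is' in blast)+
  moreover have "(\<Sum>l<m. \<bar>coord N f i l\<bar>) \<le> (\<Sum>l<m. \<Psi> * sqrt (real N * (LINT s|unit_lborel. (f s)\<^sup>2)))"
  proof (rule sum_mono)
    fix l assume "l \<in> {..<m}"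
    then have "(coord N f i l)\<^sup>2 \<le> \<Psi>\<^sup>2 * (LINT s|unit_lborel. (?g s)\<^sup>2)"
      unfolding coord_def using is'(1) by (intro dual_functional_square_le block_fun_bm bf) auto
    also have "(LINT s|unit_lborel. (?g s)\<^sup>2) \<le> (\<Sum>i<N. LINT s|unit_lborel. (f (real i / N + 1 / N * s))\<^sup>2)"
      using is'(1) by (intro member_le_sum[of i "{..<N}" "\<lambda>i. LINT s|unit_lborel. (f (real i / N + 1 / N * s))\<^sup>2"] integral_nonneg_AE) auto
    also have "\<dots> = real N * (LINT s|unit_lborel. (f s)\<^sup>2)"
      using integral_blocks[OF bounded_measurable_square[OF bf] N] N by simp
    finally have "(coord N f i l)\<^sup>2 \<le> \<Psi>\<^sup>2 * (real N * (LINT s|unit_lborel. (f s)\<^sup>2))"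
      by (simp add: mult_left_mono)
    then have "sqrt ((coord N f i l)\<^sup>2) \<le> sqrt (\<Psi>\<^sup>2 * (real N * (LINT s|unit_lborel. (f s)\<^sup>2)))"
      by (rule real_sqrt_le_mono)
    then show "\<bar>coord N f i l\<bar> \<le> \<Psi> * sqrt (real N * (LINT s|unit_lborel. (f s)\<^sup>2))"
      using \<Psi>_nonneg by (simp add: real_sqrt_mult)
  qed
  moreover have "(LINT s|unit_lborel. \<bar>\<rho> i s\<bar>) \<le> ?R"
  proof -
    have "(LINT s|unit_lborel. \<bar>\<rho> i s\<bar>) \<le> (LINT s|unit_lborel. ?R)"
      by (rule integral_mono_bounded[OF _ bounded_measurable_const \<rho>])
         (use c(1) is'(1) in \<open>auto simp: bounded_measurable_def\<close>)
    then show ?thesis by simp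
  qed
  then have "real m * \<Psi> * (LINT s|unit_lborel. \<bar>\<rho> i s\<bar>) \<le> real m * \<Psi> * ?R"
    using \<Psi>_nonneg by (intro mult_left_mono) auto
  ultimately show ?thesis using \<rho>[OF is'(2)] unfolding is'(3) by (simp add: algebra_simps)
qed

end

section \<open>Evidence and tests\<close>

text \<open>For \<open>y = - u < 0\<close> it suffices that
  \<open>(1 - u + u\<^sup>2) * (1 + u + u\<^sup>2 / 2) \<ge> 1\<close>, as the second factor is at
  most \<open>exp u\<close>.\<close>

lemma exp_quadratic_bound:
  fixes y :: real
  assumes "\<bar>y\<bar> \<le> 1"
  shows "exp y \<le> 1 + y + y\<^sup>2"
proof (cases "0 \<le> y")
  case True
  then show ?thesis using assms by (intro exp_bound) auto
next
  case False
  define u where "u = - y"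
  have u: "0 \<le> u" using False by (simp add: u_def)
  have "1 \<le> (1 - u + u\<^sup>2) * (1 + u + u\<^sup>2 / 2)"
  proof -
    have "(1 - u + u\<^sup>2) * (1 + u + u\<^sup>2 / 2) = 1 + (u\<^sup>2 + u\<^sup>2 * u + u\<^sup>2 * u\<^sup>2) / 2"
      by (simp add: power2_eq_square field_simps)
    then show ?thesis using u by simp
  qed
  also have "\<dots> \<le> (1 - u + u\<^sup>2) * exp u"
  proof (rule mult_left_mono)
    show "1 + u + u\<^sup>2 / 2 \<le> exp u" by (rule exp_lower_Taylor_quadratic[OF u])
    have "0 \<le> (1 - u / 2)\<^sup>2 + 3 / 4 * u\<^sup>2" by simp
    then show "0 \<le> 1 - u + u\<^sup>2" by (simp add: power2_eq_square algebra_simps)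
  qed
  finally have "exp (- u) * 1 \<le> exp (- u) * ((1 - u + u\<^sup>2) * exp u)" by (intro mult_left_mono) auto
  also have "\<dots> = 1 - u + u\<^sup>2" by (simp add: exp_minus)
  finally show ?thesis by (simp add: u_def)
qed

text \<open>A Bernstein bound: centring at the mean removes the linear term, the second moment under
  \<open>p\<close> is at most \<open>b\<close> times the squared L2 norm, and the condition on
  \<open>r\<close> keeps the centred exponent within the range of the quadratic bound.\<close>

lemma bounded_measurable_exp_integral:
  assumes p: "bounded_measurable p" "\<And>t. t \<in> {0..1} \<Longrightarrow> 0 \<le> p t" "\<And>t. t \<in> {0..1} \<Longrightarrow> p t \<le> b"
      "(LINT t|unit_lborel. p t) = 1"
    and f: "bounded_measurable f" "\<And>t. t \<in> {0..1} \<Longrightarrow> \<bar>f t\<bar> \<le> b"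
    and l: "\<bar>r\<bar> * (2 * b) \<le> 1"
  shows "(\<integral>\<^sup>+ t. ennreal (p t * exp (r * (f t - \<tau>))) \<partial>unit_lborel)
    \<le> ennreal (exp (r\<^sup>2 * b * (LINT t|unit_lborel. (f t)\<^sup>2) + r * ((LINT t|unit_lborel. f t * p t) - \<tau>)))"
proof -
  have b: "0 \<le> b" using f(2)[of 0] by simp
  define \<mu> where "\<mu> = (LINT t|unit_lborel. f t * p t)"
  have int: "integrable unit_lborel (\<lambda>t. g t * p t)" if "bounded_measurable g" for g
    by (intro bounded_measurable_integrable bounded_measurable_mult that p)
  note intp = bounded_measurable_integrable[OF p(1)]
  have \<mu>: "\<bar>\<mu>\<bar> \<le> b"
  proof -
    have "\<bar>\<mu>\<bar> \<le> (LINT t|unit_lborel. \<bar>f t * p t\<bar>)" unfolding \<mu>_def by (rule integral_abs_bound)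
    also have "\<dots> \<le> (LINT t|unit_lborel. b * p t)"
    proof (rule integral_mono)
      show "integrable unit_lborel (\<lambda>t. \<bar>f t * p t\<bar>)" using int[OF f(1)] by (rule integrable_abs)
      show "integrable unit_lborel (\<lambda>t. b * p t)" using intp by simp
      fix t assume "t \<in> space unit_lborel"
      then have t: "t \<in> {0..1}" by simp
      show "\<bar>f t * p t\<bar> \<le> b * p t"
        using f(2)[OF t] p(2)[OF t] by (simp add: abs_mult mult_right_mono)
    qed
    finally show ?thesis using p(4) by simp
  qed
  define y where "y t = r * (f t - \<mu>)" for t
  have bmy: "bounded_measurable y"
    unfolding y_def[abs_def]
    by (rule bounded_measurable_mult[OF bounded_measurable_const bounded_measurable_diff[OF f(1) bounded_measurable_const]])
  have y1: "\<bar>y t\<bar> \<le> 1" if t: "t \<in> {0..1}" for t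
  proof -
    have "\<bar>f t - \<mu>\<bar> \<le> 2 * b" using f(2)[OF t] \<mu> by linarith
    then have "\<bar>r\<bar> * \<bar>f t - \<mu>\<bar> \<le> \<bar>r\<bar> * (2 * b)" by (intro mult_left_mono) auto
    then show ?thesis using l by (simp add: y_def abs_mult)
  qed
  have Ey: "(LINT t|unit_lborel. y t * p t) = 0"
  proof -
    have "(LINT t|unit_lborel. y t * p t) = (LINT t|unit_lborel. r * (f t * p t) - r * \<mu> * p t)"
      by (rule Bochner_Integration.integral_cong) (auto simp: y_def algebra_simps)
    also have "\<dots> = r * \<mu> - r * \<mu> * 1"
      using int[OF f(1)] intp by (simp add: \<mu>_def p(4))
    finally show ?thesis by simp
  qed
  have Ey2: "(LINT t|unit_lborel. (y t)\<^sup>2 * p t) \<le> r\<^sup>2 * b * (LINT t|unit_lborel. (f t)\<^sup>2)"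
  proof -
    have i1: "integrable unit_lborel (\<lambda>t. (f t)\<^sup>2 * p t)" by (rule int[OF bounded_measurable_square[OF f(1)]])
    have "(LINT t|unit_lborel. (y t)\<^sup>2 * p t)
        = (LINT t|unit_lborel. r\<^sup>2 * ((f t)\<^sup>2 * p t) - (2 * r\<^sup>2 * \<mu>) * (f t * p t) + (r\<^sup>2 * \<mu>\<^sup>2) * p t)"
      by (rule Bochner_Integration.integral_cong) (auto simp: y_def power2_eq_square algebra_simps)
    also have "\<dots> = r\<^sup>2 * (LINT t|unit_lborel. (f t)\<^sup>2 * p t) - (2 * r\<^sup>2 * \<mu>) * \<mu> + (r\<^sup>2 * \<mu>\<^sup>2) * 1"
      using i1 int[OF f(1)] intp by (simp add: \<mu>_def p(4))
    also have "\<dots> \<le> r\<^sup>2 * (LINT t|unit_lborel. (f t)\<^sup>2 * p t)"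
    proof -
      have "0 \<le> r\<^sup>2 * (\<mu> * \<mu>)" by simp
      then show ?thesis by (simp add: power2_eq_square algebra_simps)
    qed
    also have "(LINT t|unit_lborel. (f t)\<^sup>2 * p t) \<le> (LINT t|unit_lborel. b * (f t)\<^sup>2)"
    proof (rule integral_mono_bounded)
      fix t :: real assume "t \<in> {0..1}"
      then show "(f t)\<^sup>2 * p t \<le> b * (f t)\<^sup>2"
        using mult_left_mono[OF p(3)[of t], of "(f t)\<^sup>2"] by (simp add: mult.commute)
    qed (intro bounded_measurable_mult bounded_measurable_square bounded_measurable_const f p)+
    then have "r\<^sup>2 * (LINT t|unit_lborel. (f t)\<^sup>2 * p t) \<le> r\<^sup>2 * (b * (LINT t|unit_lborel. (f t)\<^sup>2))"
      by (intro mult_left_mono) auto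
    finally show ?thesis by (simp add: mult.assoc)
  qed
  have bme: "bounded_measurable (\<lambda>t. p t + y t * p t + (y t)\<^sup>2 * p t)"
    by (intro bounded_measurable_add bounded_measurable_mult bounded_measurable_square bmy p)
  have "(\<integral>\<^sup>+ t. ennreal (p t * exp (r * (f t - \<tau>))) \<partial>unit_lborel)
     = (\<integral>\<^sup>+ t. ennreal (exp (r * (\<mu> - \<tau>))) * ennreal (p t * exp (y t)) \<partial>unit_lborel)"
  proof (rule nn_integral_cong)
    fix t
    have "exp (r * (f t - \<tau>)) = exp (r * (\<mu> - \<tau>)) * exp (y t)"
      by (simp add: y_def exp_add[symmetric] algebra_simps)
    then have e: "p t * exp (r * (f t - \<tau>)) = exp (r * (\<mu> - \<tau>)) * (p t * exp (y t))"
      by (simp only: mult.left_commute)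
    show "ennreal (p t * exp (r * (f t - \<tau>))) = ennreal (exp (r * (\<mu> - \<tau>))) * ennreal (p t * exp (y t))"
      unfolding e by (rule ennreal_mult'[OF exp_ge_zero])
  qed
  also have "\<dots> \<le> (\<integral>\<^sup>+ t. ennreal (exp (r * (\<mu> - \<tau>))) * ennreal (p t + y t * p t + (y t)\<^sup>2 * p t) \<partial>unit_lborel)"
  proof (intro nn_integral_mono mult_left_mono ennreal_leI)
    fix t assume "t \<in> space unit_lborel"
    then have t: "t \<in> {0..1}" by simp
    have "p t * exp (y t) \<le> p t * (1 + y t + (y t)\<^sup>2)"
      by (rule mult_left_mono[OF exp_quadratic_bound[OF y1[OF t]] p(2)[OF t]])
    then show "p t * exp (y t) \<le> p t + y t * p t + (y t)\<^sup>2 * p t" by (simp add: algebra_simps)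
  qed simp
  also have "\<dots> = ennreal (exp (r * (\<mu> - \<tau>))) * (\<integral>\<^sup>+ t. ennreal (p t + y t * p t + (y t)\<^sup>2 * p t) \<partial>unit_lborel)"
  proof (rule nn_integral_cmult)
    have "(\<lambda>t. p t + y t * p t + (y t)\<^sup>2 * p t) \<in> borel_measurable unit_lborel"
      using bme unfolding bounded_measurable_def by (rule conjunct1)
    then show "(\<lambda>t. ennreal (p t + y t * p t + (y t)\<^sup>2 * p t)) \<in> borel_measurable unit_lborel"
      by (rule measurable_compose[OF _ measurable_ennreal])
  qed
  also have "(\<integral>\<^sup>+ t. ennreal (p t + y t * p t + (y t)\<^sup>2 * p t) \<partial>unit_lborel)
     = ennreal (LINT t|unit_lborel. p t + y t * p t + (y t)\<^sup>2 * p t)"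
  proof (rule nn_integral_eq_integral[OF bounded_measurable_integrable[OF bme]], rule AE_I2)
    fix t assume "t \<in> space unit_lborel"
    then have t: "t \<in> {0..1}" by simp
    have "0 \<le> p t * (1 + y t + (y t)\<^sup>2)"
      by (rule mult_nonneg_nonneg[OF p(2)[OF t] order.trans[OF exp_ge_zero exp_quadratic_bound[OF y1[OF t]]]])
    then show "0 \<le> p t + y t * p t + (y t)\<^sup>2 * p t" by (simp add: algebra_simps)
  qed
  also have "(LINT t|unit_lborel. p t + y t * p t + (y t)\<^sup>2 * p t) = 1 + (LINT t|unit_lborel. (y t)\<^sup>2 * p t)"
    unfolding Bochner_Integration.integral_add[OF Bochner_Integration.integrable_add[OF intp int[OF bmy]]
        int[OF bounded_measurable_square[OF bmy]]] Bochner_Integration.integral_add[OF intp int[OF bmy]] Ey p(4)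
    by simp
  also have "ennreal (exp (r * (\<mu> - \<tau>))) * ennreal (1 + (LINT t|unit_lborel. (y t)\<^sup>2 * p t))
     \<le> ennreal (exp (r * (\<mu> - \<tau>))) * ennreal (exp (r\<^sup>2 * b * (LINT t|unit_lborel. (f t)\<^sup>2)))"
    by (intro mult_left_mono ennreal_leI order.trans[OF add_left_mono[OF Ey2, of 1] exp_ge_add_one_self]) simp
  also have "\<dots> = ennreal (exp (r\<^sup>2 * b * (LINT t|unit_lborel. (f t)\<^sup>2) + r * (\<mu> - \<tau>)))"
    by (simp add: ennreal_mult'[symmetric] exp_add[symmetric] add.commute)
  finally show ?thesis unfolding \<mu>_def .
qed

text \<open>The prior sits on an abstract probability space that indexes the densities, so that
  Fubini arguments only require joint measurability in the index and the argument.\<close>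

locale density_family = prob_space \<mu> for \<mu> :: "'w measure" +
  fixes p :: "'w \<Rightarrow> real \<Rightarrow> real" and p0 :: "real \<Rightarrow> real" and a b :: real
  assumes joint: "(\<lambda>(\<omega>, t). p \<omega> t) \<in> borel_measurable (\<mu> \<Otimes>\<^sub>M unit_lborel)"
    and a_pos: "0 < a"
    and lower: "\<omega> \<in> space \<mu> \<Longrightarrow> t \<in> {0..1} \<Longrightarrow> a \<le> p \<omega> t"
    and upper: "\<omega> \<in> space \<mu> \<Longrightarrow> t \<in> {0..1} \<Longrightarrow> p \<omega> t \<le> b"
    and mass: "\<omega> \<in> space \<mu> \<Longrightarrow> (LINT t|unit_lborel. p \<omega> t) = 1"
    and p0_bm: "bounded_measurable p0"
    and p0_lower: "t \<in> {0..1} \<Longrightarrow> a \<le> p0 t"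
    and p0_upper: "t \<in> {0..1} \<Longrightarrow> p0 t \<le> b"
    and p0_mass: "(LINT t|unit_lborel. p0 t) = 1"
begin

section \<open>Observations and likelihood ratios\<close>

abbreviation P where "P \<equiv> iid_dist p0"

lemma b_pos: "0 < b"
  using a_pos p0_lower[of 0] p0_upper[of 0] by simp

lemma p0_pos: "t \<in> {0..1} \<Longrightarrow> 0 < p0 t"
  using a_pos p0_lower[of t] by linarith

lemma p_pos: "\<omega> \<in> space \<mu> \<Longrightarrow> t \<in> {0..1} \<Longrightarrow> 0 < p \<omega> t"
  using a_pos lower[of \<omega> t] by linarith

lemma p_bm: "\<omega> \<in> space \<mu> \<Longrightarrow> bounded_measurable (p \<omega>)"
  unfolding bounded_measurable_def
proof (intro conjI exI[of _ b] ballI)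
  assume \<omega>: "\<omega> \<in> space \<mu>"
  show "p \<omega> \<in> borel_measurable unit_lborel"
    using measurable_compose[OF measurable_Pair1'[OF \<omega>] joint] by simp
  show "\<bar>p \<omega> t\<bar> \<le> b" if "t \<in> {0..1}" for t
    using upper[OF \<omega> that] p_pos[OF \<omega> that] by simp
qed

lemma p0_measurable [measurable]: "p0 \<in> borel_measurable unit_lborel"
  using p0_bm by (simp add: bounded_measurable_def)

lemma sets_sampling [measurable_cong, simp]: "sets (sampling_dist p0) = sets unit_lborel"
  by (simp add: sampling_dist_def)

lemma space_sampling [simp]: "space (sampling_dist p0) = {0..1}"
  by (simp add: sampling_dist_def)

lemma p0_nonneg: "t \<in> {0..1} \<Longrightarrow> 0 \<le> p0 t"
  by (rule less_imp_le[OF p0_pos])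

lemma p_nonneg: "\<omega> \<in> space \<mu> \<Longrightarrow> t \<in> {0..1} \<Longrightarrow> 0 \<le> p \<omega> t"
  by (rule less_imp_le[OF p_pos])

lemma prob_space_sampling: "prob_space (sampling_dist p0)"
proof (rule prob_spaceI)
  have "{0..1} \<in> sets unit_lborel" using sets.top[of unit_lborel] by simp
  note [simp] = this
  have "emeasure (sampling_dist p0) (space (sampling_dist p0)) = (\<integral>\<^sup>+ t. ennreal (p0 t) \<partial>unit_lborel)"
    unfolding sampling_dist_def by (subst emeasure_density) (auto intro!: nn_integral_cong simp: indicator_def)
  also have "\<dots> = ennreal (LINT t|unit_lborel. p0 t)"
    using p0_pos by (intro nn_integral_eq_integral bounded_measurable_integrable p0_bm AE_I2) (auto intro: less_imp_le)
  finally show "emeasure (sampling_dist p0) (space (sampling_dist p0)) = 1" by (simp add: p0_mass)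
qed

lemma product_prob_space_sampling: "product_prob_space (\<lambda>_::nat. sampling_dist p0)"
  using prob_space_sampling
  by (simp add: product_prob_space_def product_prob_space_axioms_def product_sigma_finite_def
      prob_space_imp_sigma_finite)

lemma prob_space_P: "prob_space P"
  unfolding iid_dist_def by (intro prob_space_PiM prob_space_sampling)

lemma observation_range: "x \<in> space P \<Longrightarrow> x i \<in> {0..1}"
  by (auto simp: iid_dist_def space_PiM)

lemma observation_measurable: "(\<lambda>x. x i) \<in> measurable P unit_lborel"
proof -
  have "(\<lambda>x. x i) \<in> measurable P (sampling_dist p0)"
    unfolding iid_dist_def by (rule measurable_component_singleton) simp
  then show ?thesis by (simp cong: measurable_cong_sets)
qed

lemma nn_integral_product:
  assumes g: "g \<in> borel_measurable unit_lborel"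
  shows "(\<integral>\<^sup>+ x. (\<Prod>i<n. g (x i)) \<partial>P) = (\<integral>\<^sup>+ t. ennreal (p0 t) * g t \<partial>unit_lborel) ^ n"
proof -
  interpret S: product_prob_space "\<lambda>_::nat. sampling_dist p0" UNIV
    by (rule product_prob_space_sampling)
  let ?J = "Pi\<^sub>M {..<n} (\<lambda>_. sampling_dist p0)"
  have gs: "g \<in> borel_measurable (sampling_dist p0)" using g by (simp cong: measurable_cong_sets)
  have meas: "(\<lambda>x. \<Prod>i<n. g (x i)) \<in> borel_measurable ?J"
    by (intro borel_measurable_prod_ennreal measurable_compose[OF _ gs] measurable_component_singleton) auto
  have "(\<integral>\<^sup>+ x. (\<Prod>i<n. g (x i)) \<partial>P) = (\<integral>\<^sup>+ x. (\<Prod>i<n. g (restrict x {..<n} i)) \<partial>P)"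
    by simp
  also have "\<dots> = (\<integral>\<^sup>+ x. (\<Prod>i<n. g (x i)) \<partial>distr P ?J (\<lambda>x. restrict x {..<n}))"
    unfolding iid_dist_def by (rule nn_integral_distr[symmetric, OF measurable_restrict_subset[OF subset_UNIV]]) (use meas in simp)
  also have "distr P ?J (\<lambda>x. restrict x {..<n}) = ?J"
    unfolding iid_dist_def by (rule S.distr_PiM_restrict_finite) auto
  also have "(\<integral>\<^sup>+ x. (\<Prod>i<n. g (x i)) \<partial>?J) = (\<Prod>i<n. \<integral>\<^sup>+ t. g t \<partial>sampling_dist p0)"
    by (rule S.product_nn_integral_prod) (use gs in auto)
  also have "(\<integral>\<^sup>+ t. g t \<partial>sampling_dist p0) = (\<integral>\<^sup>+ t. ennreal (p0 t) * g t \<partial>unit_lborel)"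
    unfolding sampling_dist_def using g by (intro nn_integral_density) auto
  finally show ?thesis by simp
qed

definition lr :: "nat \<Rightarrow> 'w \<Rightarrow> (nat \<Rightarrow> real) \<Rightarrow> real" where
  "lr n \<omega> x = (\<Prod>i<n. p \<omega> (x i) / p0 (x i))"

lemma lr_pos: "\<omega> \<in> space \<mu> \<Longrightarrow> x \<in> space P \<Longrightarrow> 0 < lr n \<omega> x"
  unfolding lr_def by (intro prod_pos divide_pos_pos p_pos p0_pos observation_range) auto

lemma lr_joint: "(\<lambda>(\<omega>, x). lr n \<omega> x) \<in> borel_measurable (\<mu> \<Otimes>\<^sub>M P)"
proof -
  have 1: "(\<lambda>z. snd z i) \<in> measurable (\<mu> \<Otimes>\<^sub>M P) unit_lborel" for i
    by (rule measurable_compose[OF measurable_snd observation_measurable])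
  have "(\<lambda>z. (fst z, snd z i)) \<in> measurable (\<mu> \<Otimes>\<^sub>M P) (\<mu> \<Otimes>\<^sub>M unit_lborel)" for i
    by (rule measurable_Pair[OF measurable_fst 1])
  from measurable_compose[OF this joint]
  have 2: "(\<lambda>z. p (fst z) (snd z i)) \<in> borel_measurable (\<mu> \<Otimes>\<^sub>M P)" for i
    by (simp add: case_prod_beta')
  have 3: "(\<lambda>z. p0 (snd z i)) \<in> borel_measurable (\<mu> \<Otimes>\<^sub>M P)" for i
    by (rule measurable_compose[OF 1 p0_measurable])
  show ?thesis
    unfolding lr_def case_prod_beta' by (intro borel_measurable_prod borel_measurable_divide 2 3)
qed

lemma lr_measurable_\<omega>: "x \<in> space P \<Longrightarrow> (\<lambda>\<omega>. lr n \<omega> x) \<in> borel_measurable \<mu>"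
  using measurable_compose[OF measurable_Pair2' lr_joint] by simp

text \<open>Change of measure: in each factor the weight replaces the true density by
  \<open>p \<omega>\<close>.\<close>

lemma lr_integral:
  assumes \<omega>: "\<omega> \<in> space \<mu>" and h: "h \<in> borel_measurable unit_lborel"
    and h0: "\<And>t. t \<in> {0..1} \<Longrightarrow> 0 \<le> h t"
  shows "(\<integral>\<^sup>+ x. ennreal (lr n \<omega> x * (\<Prod>i<n. h (x i))) \<partial>P) = (\<integral>\<^sup>+ t. ennreal (p \<omega> t * h t) \<partial>unit_lborel) ^ n"
proof -
  have [measurable]: "p \<omega> \<in> borel_measurable unit_lborel" using p_bm[OF \<omega>] by (simp add: bounded_measurable_def)
  note [measurable] = h
  have "(\<integral>\<^sup>+ x. ennreal (lr n \<omega> x * (\<Prod>i<n. h (x i))) \<partial>P) = (\<integral>\<^sup>+ x. (\<Prod>i<n. ennreal (p \<omega> (x i) / p0 (x i) * h (x i))) \<partial>P)"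
  proof (rule nn_integral_cong)
    fix x assume x: "x \<in> space P"
    have "lr n \<omega> x * (\<Prod>i<n. h (x i)) = (\<Prod>i<n. p \<omega> (x i) / p0 (x i) * h (x i))"
      unfolding lr_def prod.distrib ..
    moreover have "(\<Prod>i<n. ennreal (p \<omega> (x i) / p0 (x i) * h (x i))) = ennreal (\<Prod>i<n. p \<omega> (x i) / p0 (x i) * h (x i))"
    proof (rule prod_ennreal)
      fix i
      have "x i \<in> {0..1}" by (rule observation_range[OF x])
      then show "0 \<le> p \<omega> (x i) / p0 (x i) * h (x i)"
        by (intro mult_nonneg_nonneg divide_nonneg_nonneg p_nonneg \<omega> p0_nonneg h0)
    qed
    ultimately show "ennreal (lr n \<omega> x * (\<Prod>i<n. h (x i))) = (\<Prod>i<n. ennreal (p \<omega> (x i) / p0 (x i) * h (x i)))"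
      by (simp only:)
  qed
  also have "\<dots> = (\<integral>\<^sup>+ t. ennreal (p0 t) * ennreal (p \<omega> t / p0 t * h t) \<partial>unit_lborel) ^ n"
    by (rule nn_integral_product) measurable
  also have "(\<integral>\<^sup>+ t. ennreal (p0 t) * ennreal (p \<omega> t / p0 t * h t) \<partial>unit_lborel) = (\<integral>\<^sup>+ t. ennreal (p \<omega> t * h t) \<partial>unit_lborel)"
  proof (rule nn_integral_cong)
    fix t assume "t \<in> space unit_lborel"
    then have t: "t \<in> {0..1}" by simp
    have "0 < p0 t" by (rule p0_pos[OF t])
    then show "ennreal (p0 t) * ennreal (p \<omega> t / p0 t * h t) = ennreal (p \<omega> t * h t)"
      by (simp add: ennreal_mult'[symmetric])
  qed
  finally show ?thesis .
qed

lemma lr_integral_1: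
  assumes \<omega>: "\<omega> \<in> space \<mu>"
  shows "(\<integral>\<^sup>+ x. ennreal (lr n \<omega> x) \<partial>P) = 1"
proof -
  have "(\<integral>\<^sup>+ t. ennreal (p \<omega> t) \<partial>unit_lborel) = ennreal (LINT t|unit_lborel. p \<omega> t)"
    using p_pos[OF \<omega>] by (intro nn_integral_eq_integral bounded_measurable_integrable p_bm \<omega> AE_I2) (auto intro: less_imp_le)
  then show ?thesis using lr_integral[OF \<omega>, of "\<lambda>_. 1" n] by (simp add: mass[OF \<omega>])
qed

definition partial_evidence :: "nat \<Rightarrow> 'w set \<Rightarrow> (nat \<Rightarrow> real) \<Rightarrow> ennreal" where
  "partial_evidence n V x = (\<integral>\<^sup>+ \<omega>. ennreal (lr n \<omega> x) * indicator V \<omega> \<partial>\<mu>)"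

lemma partial_evidence_measurable:
  assumes V: "V \<in> sets \<mu>"
  shows "partial_evidence n V \<in> borel_measurable P"
proof -
  note [measurable] = lr_joint V
  have "(\<lambda>(x, \<omega>). ennreal (lr n \<omega> x) * indicator V \<omega>) \<in> borel_measurable (P \<Otimes>\<^sub>M \<mu>)"
    using measurable_compose[OF measurable_pair_swap' lr_joint]
    by (simp add: case_prod_beta')
  then show ?thesis unfolding partial_evidence_def[abs_def]
    by (rule borel_measurable_nn_integral)
qed

text \<open>Markov's inequality and Fubini reduce the bound to the expectation under each single
  \<open>p \<omega>\<close>. The set \<open>T\<close> serves to keep only those samples that the
  tests accept.\<close>

lemma partial_evidence_upper:
  assumes V: "V \<in> sets \<mu>" and T: "T \<in> sets P"
    and \<eta>: "\<And>\<omega>. \<omega> \<in> V \<Longrightarrow> (\<integral>\<^sup>+ x. ennreal (lr n \<omega> x) * indicator T x \<partial>P) \<le> \<eta>"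
  shows "emeasure P {x \<in> T. 1 \<le> c * partial_evidence n V x} \<le> c * (\<eta> * emeasure \<mu> V)"
proof -
  interpret P: prob_space P by (rule prob_space_P)
  interpret MP: pair_sigma_finite \<mu> P ..
  note [measurable] = lr_joint V T partial_evidence_measurable[OF V]
  have lr2[measurable]: "(\<lambda>z. lr n (fst z) (snd z)) \<in> borel_measurable (\<mu> \<Otimes>\<^sub>M P)"
    using lr_joint by (simp add: case_prod_beta')
  have "emeasure P {x \<in> T. 1 \<le> c * partial_evidence n V x} \<le> c * (\<integral>\<^sup>+ x. partial_evidence n V x * indicator T x \<partial>P)"
    by (rule nn_integral_Markov_inequality) measurable
  also have "(\<integral>\<^sup>+ x. partial_evidence n V x * indicator T x \<partial>P)
     = (\<integral>\<^sup>+ x. (\<integral>\<^sup>+ \<omega>. ennreal (lr n \<omega> x) * indicator V \<omega> * indicator T x \<partial>\<mu>) \<partial>P)"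
  proof (rule nn_integral_cong)
    fix x assume x: "x \<in> space P"
    note [measurable] = lr_measurable_\<omega>[OF x]
    show "partial_evidence n V x * indicator T x = (\<integral>\<^sup>+ \<omega>. ennreal (lr n \<omega> x) * indicator V \<omega> * indicator T x \<partial>\<mu>)"
      unfolding partial_evidence_def by (rule nn_integral_multc[symmetric]) measurable
  qed
  also have "\<dots> = (\<integral>\<^sup>+ \<omega>. (\<integral>\<^sup>+ x. ennreal (lr n \<omega> x) * indicator V \<omega> * indicator T x \<partial>P) \<partial>\<mu>)"
    by (rule MP.Fubini') (simp add: case_prod_beta')
  also have "\<dots> \<le> (\<integral>\<^sup>+ \<omega>. \<eta> * indicator V \<omega> \<partial>\<mu>)"
  proof (rule nn_integral_mono)
    fix \<omega> assume "\<omega> \<in> space \<mu>"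
    show "(\<integral>\<^sup>+ x. ennreal (lr n \<omega> x) * indicator V \<omega> * indicator T x \<partial>P) \<le> \<eta> * indicator V \<omega>"
      using \<eta>[of \<omega>] by (cases "\<omega> \<in> V") auto
  qed
  also have "\<dots> = \<eta> * emeasure \<mu> V" by (rule nn_integral_cmult_indicator[OF V])
  finally show ?thesis by (simp add: mult_left_mono)
qed

text \<open>Cauchy--Schwarz between the likelihood ratio and its inverse replaces Jensen's inequality.\<close>

lemma partial_evidence_lower:
  assumes U: "U \<in> sets \<mu>" and u: "0 < measure \<mu> U" and ch: "0 \<le> ch"
    and chi2: "\<And>\<omega>. \<omega> \<in> U \<Longrightarrow> (\<integral>\<^sup>+ t. ennreal (p0 t * (p0 t / p \<omega> t)) \<partial>unit_lborel) \<le> ennreal (1 + ch)"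
  shows "emeasure P {x \<in> space P. partial_evidence n U x \<le> ennreal (measure \<mu> U * exp (- (real n * ch + D)))}
    \<le> ennreal (exp (- D))"
proof -
  interpret P: prob_space P by (rule prob_space_P)
  interpret MP: pair_sigma_finite \<mu> P ..
  define u where "u = measure \<mu> U"
  define K where "K = real n * ch + D"
  have u0: "0 < u" using u by (simp add: u_def)
  note [measurable] = lr_joint U
  have lr2[measurable]: "(\<lambda>z. lr n (fst z) (snd z)) \<in> borel_measurable (\<mu> \<Otimes>\<^sub>M P)"
    using lr_joint by (simp add: case_prod_beta')
  define R where "R x = (\<integral>\<^sup>+ \<omega>. ennreal (1 / lr n \<omega> x) * indicator U \<omega> \<partial>\<mu>)" for x
  have "(\<lambda>(x, \<omega>). ennreal (1 / lr n \<omega> x) * indicator U \<omega>) \<in> borel_measurable (P \<Otimes>\<^sub>M \<mu>)"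
    using measurable_compose[OF measurable_pair_swap' lr_joint]
    by (simp add: case_prod_beta')
  then have R[measurable]: "R \<in> borel_measurable P" unfolding R_def[abs_def]
    by (rule borel_measurable_nn_integral)
  \<comment> \<open>Cauchy-Schwarz gives
    \<open>u\<^sup>2 \<le> partial_evidence n U x * R x\<close>. If the evidence is at most
    \<open>u * exp (- K)\<close>, dividing by \<open>u\<^sup>2\<close> yields
    \<open>1 \<le> c * R x\<close>, to which Markov's inequality applies.\<close>
  define c where "c = ennreal (exp (- K) / u)"
  have sub: "1 \<le> c * R x" if x: "x \<in> space P" "partial_evidence n U x \<le> ennreal (u * exp (- K))" for x
  proof -
    note [measurable] = lr_measurable_\<omega>[OF x(1)]
    have "(emeasure \<mu> U)\<^sup>2 = (\<integral>\<^sup>+ \<omega>. (ennreal (sqrt (lr n \<omega> x)) * indicator U \<omega>) * (ennreal (sqrt (1 / lr n \<omega> x)) * indicator U \<omega>) \<partial>\<mu>)\<^sup>2"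
    proof -
      have "(\<integral>\<^sup>+ \<omega>. (ennreal (sqrt (lr n \<omega> x)) * indicator U \<omega>) * (ennreal (sqrt (1 / lr n \<omega> x)) * indicator U \<omega>) \<partial>\<mu>)
         = (\<integral>\<^sup>+ \<omega>. indicator U \<omega> \<partial>\<mu>)"
      proof (rule nn_integral_cong)
        fix \<omega> assume "\<omega> \<in> space \<mu>"
        then have "0 < lr n \<omega> x" using x by (intro lr_pos)
        then have "sqrt (lr n \<omega> x) * sqrt (1 / lr n \<omega> x) = 1" by (simp add: real_sqrt_mult[symmetric])
        then have "ennreal (sqrt (lr n \<omega> x)) * ennreal (sqrt (1 / lr n \<omega> x)) = 1"
          using \<open>0 < lr n \<omega> x\<close> by (simp add: ennreal_mult[symmetric])
        then show "(ennreal (sqrt (lr n \<omega> x)) * indicator U \<omega>) * (ennreal (sqrt (1 / lr n \<omega> x)) * indicator U \<omega>)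
            = (indicator U \<omega> :: ennreal)" by (auto simp: indicator_def)
      qed
      then show ?thesis by simp
    qed
    also have "\<dots> \<le> (\<integral>\<^sup>+ \<omega>. (ennreal (sqrt (lr n \<omega> x)) * indicator U \<omega>)\<^sup>2 \<partial>\<mu>) * (\<integral>\<^sup>+ \<omega>. (ennreal (sqrt (1 / lr n \<omega> x)) * indicator U \<omega>)\<^sup>2 \<partial>\<mu>)"
      by (rule Cauchy_Schwarz_nn_integral) measurable
    also have "(\<integral>\<^sup>+ \<omega>. (ennreal (sqrt (lr n \<omega> x)) * indicator U \<omega>)\<^sup>2 \<partial>\<mu>) = partial_evidence n U x"
      unfolding partial_evidence_def
    proof (rule nn_integral_cong)
      fix \<omega> assume "\<omega> \<in> space \<mu>"
      then have "0 < lr n \<omega> x" using x by (intro lr_pos)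
      then show "(ennreal (sqrt (lr n \<omega> x)) * indicator U \<omega>)\<^sup>2 = ennreal (lr n \<omega> x) * indicator U \<omega>"
        by (auto simp: indicator_def ennreal_power)
    qed
    also have "(\<integral>\<^sup>+ \<omega>. (ennreal (sqrt (1 / lr n \<omega> x)) * indicator U \<omega>)\<^sup>2 \<partial>\<mu>) = R x"
      unfolding R_def
    proof (rule nn_integral_cong)
      fix \<omega> assume "\<omega> \<in> space \<mu>"
      then have "0 < lr n \<omega> x" using x by (intro lr_pos)
      then show "(ennreal (sqrt (1 / lr n \<omega> x)) * indicator U \<omega>)\<^sup>2 = ennreal (1 / lr n \<omega> x) * indicator U \<omega>"
        by (auto simp: indicator_def ennreal_power)
    qed
    also have "partial_evidence n U x * R x \<le> ennreal (u * exp (- K)) * R x"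
      by (rule mult_right_mono[OF x(2)]) simp
    finally have "ennreal (1 / u\<^sup>2) * ennreal (u\<^sup>2) \<le> ennreal (1 / u\<^sup>2) * (ennreal (u * exp (- K)) * R x)"
      by (intro mult_left_mono) (auto simp: emeasure_eq_measure u_def ennreal_power)
    moreover have "ennreal (1 / u\<^sup>2) * ennreal (u\<^sup>2) = 1" using u0 by (simp add: ennreal_mult[symmetric])
    moreover have "ennreal (1 / u\<^sup>2) * (ennreal (u * exp (- K)) * R x) = c * R x"
      unfolding mult.assoc[symmetric] c_def using u0
      by (simp add: ennreal_mult[symmetric] power2_eq_square)
    ultimately show ?thesis by simp
  qed
  have "emeasure P {x \<in> space P. partial_evidence n U x \<le> ennreal (u * exp (- K))}
     \<le> emeasure P {x \<in> space P. 1 \<le> c * R x}"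
  proof (rule emeasure_mono)
    show "{x \<in> space P. 1 \<le> c * R x} \<in> sets P" by measurable
  qed (use sub in blast)
  also have "\<dots> \<le> c * (\<integral>\<^sup>+ x. R x * indicator (space P) x \<partial>P)"
    by (rule nn_integral_Markov_inequality) measurable
  also have "(\<integral>\<^sup>+ x. R x * indicator (space P) x \<partial>P) = (\<integral>\<^sup>+ x. R x \<partial>P)"
    by (rule nn_integral_cong) simp
  also have "\<dots> = (\<integral>\<^sup>+ \<omega>. (\<integral>\<^sup>+ x. ennreal (1 / lr n \<omega> x) * indicator U \<omega> \<partial>P) \<partial>\<mu>)"
    unfolding R_def by (rule MP.Fubini') (simp add: case_prod_beta')
  also have "\<dots> \<le> (\<integral>\<^sup>+ \<omega>. ennreal (exp (real n * ch)) * indicator U \<omega> \<partial>\<mu>)"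
  proof (rule nn_integral_mono)
    fix \<omega> assume \<omega>: "\<omega> \<in> space \<mu>"
    show "(\<integral>\<^sup>+ x. ennreal (1 / lr n \<omega> x) * indicator U \<omega> \<partial>P) \<le> ennreal (exp (real n * ch)) * indicator U \<omega>"
    proof (cases "\<omega> \<in> U")
      case True
      have [measurable]: "p \<omega> \<in> borel_measurable unit_lborel" using p_bm[OF \<omega>] by (simp add: bounded_measurable_def)
      have "(\<integral>\<^sup>+ x. ennreal (1 / lr n \<omega> x) \<partial>P) = (\<integral>\<^sup>+ x. (\<Prod>i<n. ennreal (p0 (x i) / p \<omega> (x i))) \<partial>P)"
      proof (rule nn_integral_cong)
        fix x assume x: "x \<in> space P"
        have "1 / lr n \<omega> x = (\<Prod>i<n. p0 (x i) / p \<omega> (x i))" by (simp add: lr_def prod_dividef)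
        moreover have "(\<Prod>i<n. ennreal (p0 (x i) / p \<omega> (x i))) = ennreal (\<Prod>i<n. p0 (x i) / p \<omega> (x i))"
          using p_pos[OF \<omega> observation_range[OF x]] p0_pos[OF observation_range[OF x]]
          by (intro prod_ennreal) (simp add: less_imp_le)
        ultimately show "ennreal (1 / lr n \<omega> x) = (\<Prod>i<n. ennreal (p0 (x i) / p \<omega> (x i)))" by simp
      qed
      also have "\<dots> = (\<integral>\<^sup>+ t. ennreal (p0 t) * ennreal (p0 t / p \<omega> t) \<partial>unit_lborel) ^ n"
        by (rule nn_integral_product) measurable
      also have "(\<integral>\<^sup>+ t. ennreal (p0 t) * ennreal (p0 t / p \<omega> t) \<partial>unit_lborel)
          = (\<integral>\<^sup>+ t. ennreal (p0 t * (p0 t / p \<omega> t)) \<partial>unit_lborel)"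
        using p0_pos by (intro nn_integral_cong) (simp add: ennreal_mult'[symmetric] less_imp_le)
      also have "\<dots> ^ n \<le> ennreal (1 + ch) ^ n" by (rule power_mono[OF chi2[OF True]]) simp
      also have "\<dots> = ennreal ((1 + ch) ^ n)" using ch by (intro ennreal_power) auto
      also have "\<dots> \<le> ennreal (exp (real n * ch))"
      proof (rule ennreal_leI)
        have "(1 + ch) ^ n \<le> exp ch ^ n" using ch by (intro power_mono exp_ge_add_one_self) auto
        then show "(1 + ch) ^ n \<le> exp (real n * ch)" by (simp add: exp_of_nat_mult)
      qed
      finally show ?thesis using True by simp
    qed simp
  qed
  also have "\<dots> = ennreal (exp (real n * ch)) * emeasure \<mu> U" by (rule nn_integral_cmult_indicator[OF U])
  also have "c * \<dots> = ennreal (exp (- D))"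
  proof -
    have "exp (- K) / u * (exp (real n * ch) * u) = exp (- D)"
      using u0 by (simp add: K_def exp_add[symmetric])
    then show ?thesis using u0
      by (simp add: c_def emeasure_eq_measure u_def[symmetric] ennreal_mult[symmetric])
  qed
  finally show ?thesis unfolding u_def K_def by (simp add: mult_left_mono)
qed

text \<open>Rejects for a large linear statistic. Relative to its mean under \<open>p0\<close>, the
  mean under a density near \<open>q\<close> is larger by at least 3/4 of the squared distance of
  \<open>q\<close> from \<open>p0\<close>; the threshold 3/8 lies halfway.\<close>

definition test_set :: "nat \<Rightarrow> (real \<Rightarrow> real) \<Rightarrow> (nat \<Rightarrow> real) set" where
  "test_set n q = {x \<in> space P. 0 \<le> (\<Sum>i<n. (q (x i) - p0 (x i))
     - ((LINT t|unit_lborel. (q t - p0 t) * p0 t) + 3 / 8 * (LINT t|unit_lborel. (q t - p0 t)\<^sup>2)))}"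

lemma test_set_sets:
  assumes q: "bounded_measurable q"
  shows "test_set n q \<in> sets P"
proof -
  have qm: "q \<in> borel_measurable unit_lborel" using q unfolding bounded_measurable_def by (rule conjunct1)
  have *: "(\<lambda>x. q (x i) - p0 (x i)) \<in> borel_measurable P" for i
    by (rule borel_measurable_diff[OF measurable_compose[OF observation_measurable qm]
          measurable_compose[OF observation_measurable p0_measurable]])
  have [measurable]: "(\<lambda>x. (\<Sum>i<n. (q (x i) - p0 (x i)) - \<tau>)) \<in> borel_measurable P" for \<tau>
    by (rule borel_measurable_sum, rule borel_measurable_diff[OF * borel_measurable_const])
  show ?thesis unfolding test_set_def by measurable
qed

lemma test_errors:
  assumes q: "bounded_measurable q" "\<And>t. t \<in> {0..1} \<Longrightarrow> a \<le> q t" "\<And>t. t \<in> {0..1} \<Longrightarrow> q t \<le> b"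
  shows "emeasure P (test_set n q) \<le> ennreal (exp (- (9 / (256 * b)) * real n * (LINT t|unit_lborel. (q t - p0 t)\<^sup>2)))"
    and "\<omega> \<in> space \<mu> \<Longrightarrow> 16 * (LINT t|unit_lborel. (p \<omega> t - q t)\<^sup>2) \<le> (LINT t|unit_lborel. (q t - p0 t)\<^sup>2) \<Longrightarrow>
      (\<integral>\<^sup>+ x. ennreal (lr n \<omega> x) * indicator (space P - test_set n q) x \<partial>P)
        \<le> ennreal (exp (- (9 / (256 * b)) * real n * (LINT t|unit_lborel. (q t - p0 t)\<^sup>2)))"
proof -
  define f where "f t = q t - p0 t" for t
  define \<Delta>2 where "\<Delta>2 = (LINT t|unit_lborel. (f t)\<^sup>2)"
  define m0 where "m0 = (LINT t|unit_lborel. f t * p0 t)"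
  define \<tau> where "\<tau> = m0 + 3 / 8 * \<Delta>2"
  \<comment> \<open>Minimiser of \<open>l\<^sup>2 * b - 3 / 8 * l\<close>; the minimum
    \<open>- 9 / (256 * b)\<close> is the error exponent.\<close>
  define l where "l = 3 / (16 * b)"
  have l0: "0 < l" using b_pos by (simp add: l_def)
  have lb: "\<bar>l\<bar> * (2 * b) \<le> 1" "\<bar>- l\<bar> * (2 * b) \<le> 1" using b_pos by (auto simp: l_def)
  have bmf: "bounded_measurable f" unfolding f_def[abs_def] by (rule bounded_measurable_diff[OF q(1) p0_bm])
  have fb: "\<bar>f t\<bar> \<le> b" if "t \<in> {0..1}" for t
    using q(2,3)[OF that] p0_lower[OF that] p0_upper[OF that] a_pos unfolding f_def by linarith
  have T: "test_set n q = {x \<in> space P. 0 \<le> (\<Sum>i<n. f (x i) - \<tau>)}"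
    unfolding test_set_def \<tau>_def m0_def \<Delta>2_def f_def ..
  have fm: "f \<in> borel_measurable unit_lborel" using bmf by (simp add: bounded_measurable_def)
  have hm: "(\<lambda>t. exp (r * (f t - \<tau>))) \<in> borel_measurable unit_lborel" for r
    using fm by measurable
  have \<Delta>0: "0 \<le> \<Delta>2" unfolding \<Delta>2_def by (intro integral_nonneg_AE) auto
  have prod: "(\<Prod>i<n. exp (r * (f (x i) - \<tau>))) = exp (r * (\<Sum>i<n. f (x i) - \<tau>))" for r x
    by (simp only: exp_sum[OF finite_lessThan, symmetric] sum_distrib_left)
  have rate: "l\<^sup>2 * b * \<Delta>2 - l * (3 / 8 * \<Delta>2) = - (9 / (256 * b)) * \<Delta>2"
    using b_pos by (simp add: l_def power2_eq_square field_simps)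
  have pow: "ennreal (exp z) ^ n = ennreal (exp (real n * z))" for z
    by (simp add: ennreal_power exp_of_nat_mult)
  have "emeasure P (test_set n q) = (\<integral>\<^sup>+ x. indicator (test_set n q) x \<partial>P)"
    by (rule nn_integral_indicator[symmetric, OF test_set_sets[OF q(1)]])
  also have "\<dots> \<le> (\<integral>\<^sup>+ x. (\<Prod>i<n. ennreal (exp (l * (f (x i) - \<tau>)))) \<partial>P)"
  proof (rule nn_integral_mono)
    fix x
    have "(\<Prod>i<n. ennreal (exp (l * (f (x i) - \<tau>)))) = ennreal (exp (l * (\<Sum>i<n. f (x i) - \<tau>)))"
      by (subst prod_ennreal) (auto simp: prod)
    then show "indicator (test_set n q) x \<le> (\<Prod>i<n. ennreal (exp (l * (f (x i) - \<tau>))))"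
      using l0 by (auto simp: T indicator_def)
  qed
  also have "\<dots> = (\<integral>\<^sup>+ t. ennreal (p0 t) * ennreal (exp (l * (f t - \<tau>))) \<partial>unit_lborel) ^ n"
    by (rule nn_integral_product) (use hm in measurable)
  also have "(\<integral>\<^sup>+ t. ennreal (p0 t) * ennreal (exp (l * (f t - \<tau>))) \<partial>unit_lborel)
     = (\<integral>\<^sup>+ t. ennreal (p0 t * exp (l * (f t - \<tau>))) \<partial>unit_lborel)"
    using p0_pos by (intro nn_integral_cong) (simp add: ennreal_mult'[symmetric] less_imp_le)
  also have "\<dots> ^ n \<le> ennreal (exp (l\<^sup>2 * b * \<Delta>2 + l * (m0 - \<tau>))) ^ n"
    unfolding \<Delta>2_def m0_def
    by (intro power_mono bounded_measurable_exp_integral p0_bm p0_nonneg p0_upper p0_mass bmf fb lb) auto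
  also have "\<dots> = ennreal (exp (real n * (l\<^sup>2 * b * \<Delta>2 + l * (m0 - \<tau>))))" by (rule pow)
  also have "l\<^sup>2 * b * \<Delta>2 + l * (m0 - \<tau>) = - (9 / (256 * b)) * \<Delta>2"
    using rate by (simp add: \<tau>_def)
  finally show "emeasure P (test_set n q) \<le> ennreal (exp (- (9 / (256 * b)) * real n * (LINT t|unit_lborel. (q t - p0 t)\<^sup>2)))"
    unfolding \<Delta>2_def f_def by (simp only: mult_ac)
  assume \<omega>: "\<omega> \<in> space \<mu>" and close: "16 * (LINT t|unit_lborel. (p \<omega> t - q t)\<^sup>2) \<le> (LINT t|unit_lborel. (q t - p0 t)\<^sup>2)"
  define mp where "mp = (LINT t|unit_lborel. f t * p \<omega> t)"
  \<comment> \<open>With \<open>d = p \<omega> t - q t\<close>, the square of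
    \<open>f t + 4 * d\<close> bounds the cross term \<open>f t * d\<close> below by
    \<open>- (f t)\<^sup>2 / 8 - 2 * d\<^sup>2\<close>. The closeness hypothesis makes the last part
    cost another 1/8, which leaves 3/4.\<close>
  have sep: "3 / 4 * \<Delta>2 \<le> mp - m0"
  proof -
    have bmd: "bounded_measurable (\<lambda>t. p \<omega> t - q t)" by (rule bounded_measurable_diff[OF p_bm[OF \<omega>] q(1)])
    have "mp - m0 = (LINT t|unit_lborel. f t * p \<omega> t - f t * p0 t)"
      unfolding mp_def m0_def
      by (intro Bochner_Integration.integral_diff[symmetric] bounded_measurable_integrable bounded_measurable_mult bmf p_bm \<omega> p0_bm)
    also have "\<dots> \<ge> (LINT t|unit_lborel. 7 / 8 * (f t)\<^sup>2 - 2 * (p \<omega> t - q t)\<^sup>2)"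
    proof (rule integral_mono_bounded)
      fix t
      have "0 \<le> (f t + 4 * (p \<omega> t - q t))\<^sup>2 / 8" by simp
      moreover have "f t * p \<omega> t - f t * p0 t = (f t)\<^sup>2 + f t * (p \<omega> t - q t)"
        by (simp add: f_def power2_eq_square algebra_simps)
      ultimately show "7 / 8 * (f t)\<^sup>2 - 2 * (p \<omega> t - q t)\<^sup>2 \<le> f t * p \<omega> t - f t * p0 t"
        by (simp add: power2_eq_square algebra_simps)
    qed (intro bounded_measurable_diff bounded_measurable_mult bounded_measurable_square bounded_measurable_const bmf q(1) p_bm \<omega> p0_bm)+
    also have "(LINT t|unit_lborel. 7 / 8 * (f t)\<^sup>2 - 2 * (p \<omega> t - q t)\<^sup>2) = 7 / 8 * \<Delta>2 - 2 * (LINT t|unit_lborel. (p \<omega> t - q t)\<^sup>2)"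
      using bounded_measurable_integrable[OF bounded_measurable_square[OF bmf]]
        bounded_measurable_integrable[OF bounded_measurable_square[OF bmd]] by (simp add: \<Delta>2_def)
    finally show ?thesis using close unfolding \<Delta>2_def f_def by linarith
  qed
  have "(\<integral>\<^sup>+ x. ennreal (lr n \<omega> x) * indicator (space P - test_set n q) x \<partial>P)
     \<le> (\<integral>\<^sup>+ x. ennreal (lr n \<omega> x * (\<Prod>i<n. exp (- l * (f (x i) - \<tau>)))) \<partial>P)"
  proof (rule nn_integral_mono)
    fix x assume x: "x \<in> space P"
    show "ennreal (lr n \<omega> x) * indicator (space P - test_set n q) x \<le> ennreal (lr n \<omega> x * (\<Prod>i<n. exp (- l * (f (x i) - \<tau>))))"
    proof (cases "x \<in> test_set n q")
      case False
      then have "(\<Sum>i<n. f (x i) - \<tau>) < 0" using x by (auto simp: T)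
      then have "1 \<le> exp (- l * (\<Sum>i<n. f (x i) - \<tau>))" using l0 by (simp add: mult_le_0_iff)
      then have "lr n \<omega> x * 1 \<le> lr n \<omega> x * exp (- l * (\<Sum>i<n. f (x i) - \<tau>))"
        using lr_pos[OF \<omega> x, of n] by (intro mult_left_mono) auto
      then show ?thesis using False x unfolding prod[of "- l"] by (simp add: ennreal_leI)
    qed simp
  qed
  also have "\<dots> = (\<integral>\<^sup>+ t. ennreal (p \<omega> t * exp (- l * (f t - \<tau>))) \<partial>unit_lborel) ^ n"
    by (rule lr_integral[OF \<omega> hm]) simp
  also have "\<dots> \<le> ennreal (exp ((- l)\<^sup>2 * b * \<Delta>2 + (- l) * (mp - \<tau>))) ^ n"
    unfolding \<Delta>2_def mp_def
    by (intro power_mono bounded_measurable_exp_integral p_bm p_nonneg upper mass \<omega> bmf fb lb) auto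
  also have "\<dots> = ennreal (exp (real n * ((- l)\<^sup>2 * b * \<Delta>2 + (- l) * (mp - \<tau>))))" by (rule pow)
  also have "\<dots> \<le> ennreal (exp (real n * (- (9 / (256 * b)) * \<Delta>2)))"
  proof -
    have "l * (3 / 8 * \<Delta>2) \<le> l * (mp - \<tau>)"
      using sep l0 unfolding \<tau>_def by (intro mult_left_mono) auto
    then have "(- l)\<^sup>2 * b * \<Delta>2 + (- l) * (mp - \<tau>) \<le> - (9 / (256 * b)) * \<Delta>2"
      using rate by simp
    then have "real n * ((- l)\<^sup>2 * b * \<Delta>2 + (- l) * (mp - \<tau>)) \<le> real n * (- (9 / (256 * b)) * \<Delta>2)"
      by (rule mult_left_mono) simp
    then show ?thesis by (intro ennreal_leI) (simp only: exp_le_cancel_iff)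
  qed
  finally show "(\<integral>\<^sup>+ x. ennreal (lr n \<omega> x) * indicator (space P - test_set n q) x \<partial>P)
        \<le> ennreal (exp (- (9 / (256 * b)) * real n * (LINT t|unit_lborel. (q t - p0 t)\<^sup>2)))"
    unfolding \<Delta>2_def f_def by (simp only: mult_ac)
qed

end

section \<open>Borel measurability in the space of continuous functions\<close>

lemma Lr_norm_infinity: "Lr_norm \<infinity> f = (SUP t\<in>{0..1}. ennreal \<bar>f t\<bar>)"
  by (simp add: Lr_norm_def)

lemma Lr_norm_infinity_le_iff:
  "0 \<le> c \<Longrightarrow> Lr_norm \<infinity> f \<le> ennreal c \<longleftrightarrow> (\<forall>t\<in>{0..1}. \<bar>f t\<bar> \<le> c)"
  unfolding Lr_norm_infinity SUP_le_iff by (simp add: ennreal_le_iff)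

lemma space_C01_borel [simp]: "space C01_borel = C01"
  unfolding C01_borel_def by (rule space_measure_of) auto

lemma sets_C01_borel: "sets C01_borel = sigma_sets C01
     {U. U \<subseteq> C01 \<and>
         (\<forall>f\<in>U. \<exists>e>0. \<forall>g\<in>C01. Lr_norm \<infinity> (\<lambda>t. g t - f t) < ennreal e \<longrightarrow> g \<in> U)}"
  unfolding C01_borel_def by (rule sets_measure_of) auto

lemma C01_evaluation_measurable:
  assumes t: "t \<in> {0..1}"
  shows "(\<lambda>p. p t) \<in> borel_measurable C01_borel"
proof (rule borel_measurableI)
  fix S :: "real set" assume S: "open S"
  let ?U = "(\<lambda>p. p t) -` S \<inter> space C01_borel"
  have "\<exists>e>0. \<forall>g\<in>C01. Lr_norm \<infinity> (\<lambda>t. g t - f t) < ennreal e \<longrightarrow> g \<in> ?U" if f: "f \<in> ?U" for f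
  proof -
    obtain e where e: "0 < e" "ball (f t) e \<subseteq> S" using S f by (auto simp: open_contains_ball)
    have "g \<in> ?U" if g: "g \<in> C01" "Lr_norm \<infinity> (\<lambda>t. g t - f t) < ennreal e" for g
    proof -
      have "ennreal \<bar>g t - f t\<bar> \<le> Lr_norm \<infinity> (\<lambda>t. g t - f t)"
        unfolding Lr_norm_infinity by (rule SUP_upper[OF t])
      also note g(2)
      finally have "\<bar>g t - f t\<bar> < e" using e(1) by (simp add: ennreal_less_iff)
      then have "g t \<in> ball (f t) e" by (simp add: dist_real_def abs_minus_commute)
      then show ?thesis using e(2) g(1) by auto
    qed
    with e(1) show ?thesis by blast
  qed
  then show "?U \<in> sets C01_borel" unfolding sets_C01_borel by (intro sigma_sets.Basic) auto
qed

text \<open>A countable, uniformly dense family of continuous functions: Bernstein polynomials with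
  rational values at the nodes.\<close>

definition rational_bernstein :: "rat list \<Rightarrow> real \<Rightarrow> real" where
  "rational_bernstein rs t = (\<Sum>k\<le>length rs - 1. of_rat (rs ! k) * Bernstein (length rs - 1) k t)"

lemma rational_bernstein_continuous: "continuous_on {0..1} (rational_bernstein rs)"
  unfolding rational_bernstein_def[abs_def] Bernstein_def by (intro continuous_intros)

lemma rational_bernstein_dense:
  assumes f: "continuous_on {0..1} f" and e: "0 < e"
  shows "\<exists>rs. \<forall>t\<in>{0..1}. \<bar>f t - rational_bernstein rs t\<bar> \<le> e"
proof -
  obtain N where N: "\<And>n x. N \<le> n \<Longrightarrow> x \<in> {0..1} \<Longrightarrow> \<bar>f x - (\<Sum>k\<le>n. f (real k / real n) * Bernstein n k x)\<bar> < e / 2"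
    using Bernstein_Weierstrass[OF f, of "e / 2"] e by auto
  have "\<exists>r :: rat. \<bar>f (real k / real N) - of_rat r\<bar> < e / 2" for k
  proof -
    obtain q where "q \<in> \<rat>" "f (real k / real N) - e / 2 < q" "q < f (real k / real N) + e / 2"
      using Rats_dense_in_real[of "f (real k / real N) - e / 2" "f (real k / real N) + e / 2"] e by auto
    moreover from this(1) obtain r where "q = of_rat r" by (rule Rats_cases)
    ultimately have "\<bar>f (real k / real N) - of_rat r\<bar> < e / 2" by linarith
    then show ?thesis by (rule exI)
  qed
  then obtain r :: "nat \<Rightarrow> rat" where r: "\<And>k. \<bar>f (real k / real N) - of_rat (r k)\<bar> < e / 2" by metis
  define rs where "rs = map r [0..<Suc N]"
  have len: "length rs - 1 = N" by (simp add: rs_def)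
  have nth: "rs ! k = r k" if "k \<le> N" for k using that by (simp add: rs_def nth_append del: upt_Suc)
  have "\<bar>f t - rational_bernstein rs t\<bar> \<le> e" if t: "t \<in> {0..1}" for t
  proof -
    have "rational_bernstein rs t = (\<Sum>k\<le>N. of_rat (r k) * Bernstein N k t)"
      unfolding rational_bernstein_def len by (intro sum.cong) (auto simp: nth)
    then have "(\<Sum>k\<le>N. f (real k / real N) * Bernstein N k t) - rational_bernstein rs t
       = (\<Sum>k\<le>N. (f (real k / real N) - of_rat (r k)) * Bernstein N k t)"
      by (simp add: left_diff_distrib sum_subtractf)
    also have "\<bar>\<dots>\<bar> \<le> (\<Sum>k\<le>N. e / 2 * Bernstein N k t)"
    proof (rule order.trans[OF sum_abs sum_mono])
      fix k
      have B: "0 \<le> Bernstein N k t" using t by (intro Bernstein_nonneg) auto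
      have "\<bar>f (real k / real N) - of_rat (r k)\<bar> * Bernstein N k t \<le> e / 2 * Bernstein N k t"
        using r[of k] by (intro mult_right_mono B) auto
      then show "\<bar>(f (real k / real N) - of_rat (r k)) * Bernstein N k t\<bar> \<le> e / 2 * Bernstein N k t"
        using B by (simp add: abs_mult)
    qed
    also have "\<dots> = e / 2" unfolding sum_distrib_left[symmetric] by (simp add: sum_Bernstein)
    finally show ?thesis using N[OF order.refl t] by linarith
  qed
  then show ?thesis by blast
qed

text \<open>A set open in the supremum norm is the union of those closed balls with radius
  \<open>1 / (k + 1)\<close> and centre in the dense family that lie inside it; the index set
  \<open>S\<close> is countable. Whether a continuous path lies in such a ball is decided at
  rational times.\<close>

lemma C01_measurableI:
  assumes T: "\<And>\<omega>. \<omega> \<in> space M \<Longrightarrow> T \<omega> \<in> C01"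
    and meas: "\<And>t. t \<in> {0..1} \<Longrightarrow> (\<lambda>\<omega>. T \<omega> t) \<in> borel_measurable M"
  shows "T \<in> measurable M C01_borel"
proof (rule measurable_sigma_sets[OF sets_C01_borel])
  show "{U. U \<subseteq> C01 \<and>
      (\<forall>f\<in>U. \<exists>e>0. \<forall>g\<in>C01. Lr_norm \<infinity> (\<lambda>t. g t - f t) < ennreal e \<longrightarrow> g \<in> U)} \<subseteq> Pow C01" by blast
  show "T \<in> space M \<rightarrow> C01" using T by blast
  fix U assume "U \<in> {U. U \<subseteq> C01 \<and>
      (\<forall>f\<in>U. \<exists>e>0. \<forall>g\<in>C01. Lr_norm \<infinity> (\<lambda>t. g t - f t) < ennreal e \<longrightarrow> g \<in> U)}"
  then have U: "\<And>f. f \<in> U \<Longrightarrow> \<exists>e>0. \<forall>g\<in>C01. Lr_norm \<infinity> (\<lambda>t. g t - f t) < ennreal e \<longrightarrow> g \<in> U" by simp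
  define ev where "ev z = {\<omega> \<in> space M. \<forall>t\<in>{0..1}. \<bar>T \<omega> t - rational_bernstein (fst z) t\<bar> \<le> 1 / real (Suc (snd z))}"
    for z :: "rat list \<times> nat"
  define S where "S = {z. \<forall>g\<in>C01. (\<forall>t\<in>{0..1}. \<bar>g t - rational_bernstein (fst z) t\<bar> \<le> 1 / real (Suc (snd z))) \<longrightarrow> g \<in> U}"
  have ev: "ev z \<in> sets M" for z
  proof -
    have "ev z = {\<omega> \<in> space M. \<forall>t\<in>{0..1} \<inter> \<rat>. \<bar>T \<omega> t - rational_bernstein (fst z) t\<bar> \<le> 1 / real (Suc (snd z))}"
      unfolding ev_def
    proof (rule Collect_cong, rule conj_cong[OF refl], rule continuous_le_iff_rational)
      fix \<omega> assume "\<omega> \<in> space M"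
      then have "continuous_on {0..1} (T \<omega>)" using T unfolding C01_def by blast
      then show "continuous_on {0..1} (\<lambda>t. \<bar>T \<omega> t - rational_bernstein (fst z) t\<bar>)"
        by (intro continuous_intros rational_bernstein_continuous)
    qed
    also have "\<dots> \<in> sets M"
      unfolding Collect_Ball_eq_INT[OF rational_01_nonempty]
    proof (rule sets.countable_INT'[OF countable_rational_01 rational_01_nonempty], intro image_subsetI)
      fix t :: real assume "t \<in> {0..1} \<inter> \<rat>"
      then have [measurable]: "(\<lambda>\<omega>. T \<omega> t) \<in> borel_measurable M" by (intro meas) auto
      show "{\<omega> \<in> space M. \<bar>T \<omega> t - rational_bernstein (fst z) t\<bar> \<le> 1 / real (Suc (snd z))} \<in> sets M"
        by measurable
    qed
    finally show ?thesis .
  qed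
  have "T -` U \<inter> space M = (\<Union>z\<in>S. ev z)"
  proof (intro equalityI subsetI)
    fix \<omega> assume "\<omega> \<in> T -` U \<inter> space M"
    then have \<omega>: "\<omega> \<in> space M" "T \<omega> \<in> U" by auto
    obtain e where e: "0 < e" "\<And>g. g \<in> C01 \<Longrightarrow> Lr_norm \<infinity> (\<lambda>t. g t - T \<omega> t) < ennreal e \<Longrightarrow> g \<in> U"
      using U[OF \<omega>(2)] by blast
    obtain k where k: "inverse (real (Suc k)) < e / 2" using reals_Archimedean[of "e / 2"] e(1) by auto
    have cont: "continuous_on {0..1} (T \<omega>)" using T[OF \<omega>(1)] unfolding C01_def by blast
    have "0 < 1 / real (Suc k)" by simp
    then obtain rs where rs: "\<And>t. t \<in> {0..1} \<Longrightarrow> \<bar>T \<omega> t - rational_bernstein rs t\<bar> \<le> 1 / real (Suc k)"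
      using rational_bernstein_dense[OF cont] by blast
    have "(rs, k) \<in> S"
      unfolding S_def
    proof (rule CollectI, intro ballI impI)
      fix g assume g: "g \<in> C01" "\<forall>t\<in>{0..1}. \<bar>g t - rational_bernstein (fst (rs, k)) t\<bar> \<le> 1 / real (Suc (snd (rs, k)))"
      have "\<bar>g t - T \<omega> t\<bar> \<le> 2 * inverse (real (Suc k))" if t: "t \<in> {0..1}" for t
      proof -
        have "\<bar>g t - rational_bernstein rs t\<bar> \<le> 1 / real (Suc k)" using g(2) t by simp
        with rs[OF t] have "\<bar>g t - T \<omega> t\<bar> \<le> 2 * (1 / real (Suc k))" by linarith
        then show ?thesis by (simp add: inverse_eq_divide)
      qed
      then have "Lr_norm \<infinity> (\<lambda>t. g t - T \<omega> t) \<le> ennreal (2 * inverse (real (Suc k)))"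
        by (subst Lr_norm_infinity_le_iff) auto
      also have "\<dots> < ennreal e" using k e(1) by (intro ennreal_lessI) auto
      finally show "g \<in> U" by (rule e(2)[OF g(1)])
    qed
    moreover have "\<omega> \<in> ev (rs, k)" using \<omega>(1) rs by (simp add: ev_def)
    ultimately show "\<omega> \<in> (\<Union>z\<in>S. ev z)" by blast
  next
    fix \<omega> assume "\<omega> \<in> (\<Union>z\<in>S. ev z)"
    then obtain z where z: "z \<in> S" "\<omega> \<in> ev z" by blast
    then have \<omega>: "\<omega> \<in> space M" unfolding ev_def by blast
    have "T \<omega> \<in> U" using z T[OF \<omega>] unfolding S_def ev_def by blast
    with \<omega> show "\<omega> \<in> T -` U \<inter> space M" by blast
  qed
  moreover have "(\<Union>z\<in>S. ev z) \<in> sets M"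
    by (rule sets.countable_UN'[OF countableI_type]) (use ev in auto)
  ultimately show "T -` U \<inter> space M \<in> sets M" by simp
qed

section \<open>The conditioned prior\<close>

locale conditioned_released_bm = half_integer_released_bm M B \<alpha> Z m
  for M :: "'w measure" and B \<alpha> Z m +
  fixes c :: real and p0 :: "real \<Rightarrow> real"
  assumes c_pos: "0 < c"
    and density: "p0 \<in> prob_densities"
    and smooth: "p0 \<in> holder_space \<alpha>"
    and p0_positive: "\<exists>a>0. \<forall>t\<in>{0..1}. a \<le> p0 t"
    and c_bound: "2 * Lr_norm \<infinity> (\<lambda>t. ln (p0 t)) \<le> ennreal c"
begin

lemma ln_p0_bound:
  assumes t: "t \<in> {0..1}"
  shows "\<bar>ln (p0 t)\<bar> \<le> c / 2"
proof -
  have "ennreal \<bar>ln (p0 t)\<bar> \<le> Lr_norm \<infinity> (\<lambda>t. ln (p0 t))"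
    unfolding Lr_norm_infinity by (rule SUP_upper[OF t])
  then have "2 * ennreal \<bar>ln (p0 t)\<bar> \<le> 2 * Lr_norm \<infinity> (\<lambda>t. ln (p0 t))"
    by (intro mult_left_mono) auto
  also note c_bound
  finally have "ennreal (2 * \<bar>ln (p0 t)\<bar>) \<le> ennreal c"
    by (simp add: ennreal_mult)
  then show ?thesis using c_pos by (simp add: ennreal_le_iff)
qed

lemma p0_gt_0: "t \<in> {0..1} \<Longrightarrow> 0 < p0 t"
  using p0_positive by force

text \<open>Deliberately wider than \<open>ln_p0_bound\<close> gives, so that \<open>p0\<close> and
  the normalised prior densities share one pair of bounds.\<close>

lemma p0_exp_bounds:
  assumes t: "t \<in> {0..1}"
  shows "exp (- 2 * c) \<le> p0 t" "p0 t \<le> exp (2 * c)"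
proof -
  have "ln (p0 t) \<le> 2 * c" "- 2 * c \<le> ln (p0 t)" using ln_p0_bound[OF t] c_pos by auto
  then have "exp (ln (p0 t)) \<le> exp (2 * c)" "exp (- 2 * c) \<le> exp (ln (p0 t))"
    by (simp_all only: exp_le_cancel_iff)
  then show "exp (- 2 * c) \<le> p0 t" "p0 t \<le> exp (2 * c)"
    unfolding exp_ln[OF p0_gt_0[OF t]] by simp_all
qed

lemma p0_bounded_measurable: "bounded_measurable p0"
  unfolding bounded_measurable_def
proof (intro conjI exI[of _ "exp (2 * c)"] ballI)
  show "p0 \<in> borel_measurable unit_lborel" using density by (simp add: prob_densities_def)
  show "\<bar>p0 t\<bar> \<le> exp (2 * c)" if "t \<in> {0..1}" for t
    using p0_exp_bounds[OF that] p0_gt_0[OF that] by simp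
qed

lemma p0_integral: "(LINT t|unit_lborel. p0 t) = 1"
proof -
  have "(\<integral>\<^sup>+ t. ennreal (p0 t) \<partial>unit_lborel) = ennreal (LINT t|unit_lborel. p0 t)"
    using p0_gt_0 by (intro nn_integral_eq_integral bounded_measurable_integrable p0_bounded_measurable AE_I2)
      (auto intro: less_imp_le)
  then have "ennreal (LINT t|unit_lborel. p0 t) = 1"
    using density by (simp add: prob_densities_def)
  then show ?thesis by (simp only: ennreal_eq_1)
qed

section \<open>The conditioning event\<close>

definition E where "E = {\<omega> \<in> space M. Lr_norm \<infinity> (\<lambda>t. W t \<omega>) \<le> ennreal c}"

lemma E_eq: "E = {\<omega> \<in> space M. \<forall>t\<in>{0..1}. \<bar>W t \<omega> - 0\<bar> \<le> c}"
  unfolding E_def Lr_norm_infinity_le_iff[OF less_imp_le[OF c_pos]] by simp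

lemma E_events: "E \<in> events"
  unfolding E_eq by (rule sup_event_measurable) auto

lemma E_space: "\<omega> \<in> E \<Longrightarrow> \<omega> \<in> space M"
  by (simp add: E_def)

lemma E_bound: "\<omega> \<in> E \<Longrightarrow> t \<in> {0..1} \<Longrightarrow> \<bar>W t \<omega>\<bar> \<le> c"
  by (simp add: E_eq)

lemma log_p0_representation:
  obtains z d L where "d 0 = 0"
    "\<And>s t. s \<in> {0..1} \<Longrightarrow> t \<in> {0..1} \<Longrightarrow> \<bar>d s - d t\<bar> \<le> L * sqrt \<bar>s - t\<bar>"
    "\<And>t. t \<in> {0..1} \<Longrightarrow>
      ln (p0 t) = (\<Sum>k\<le>m - 1. z k * t ^ k / fact k) + iterated_integral (m - 1) d t"
proof -
  obtain a where a: "0 < a" "\<And>t. t \<in> {0..1} \<Longrightarrow> a \<le> p0 t" using p0_positive by blast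
  show thesis
    by (rule log_density_representation[OF m \<alpha> smooth a(1)], erule a(2)) (rule that)
qed

lemma ln_p0_continuous: "continuous_on {0..1} (\<lambda>t. ln (p0 t))"
proof (rule log_p0_representation)
  fix z :: "nat \<Rightarrow> real" and d L assume d: "\<And>s t. s \<in> {0..1} \<Longrightarrow> t \<in> {0..1} \<Longrightarrow> \<bar>d s - d t\<bar> \<le> L * sqrt \<bar>s - t\<bar>"
    "\<And>t. t \<in> {0..1} \<Longrightarrow> ln (p0 t) = (\<Sum>k\<le>m - 1. z k * t ^ k / fact k) + iterated_integral (m - 1) d t"
  have dc: "continuous_on {0..1} d" by (rule sqrt_holder_continuous[OF d(1)])
  have "continuous_on {0..1} (\<lambda>t. ln (p0 t)) \<longleftrightarrow> continuous_on {0..1} (\<lambda>t. (\<Sum>k\<le>m - 1. z k * t ^ k / fact k) + iterated_integral (m - 1) d t)"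
    by (rule continuous_on_cong) (auto simp: d(2))
  then show ?thesis by (auto intro!: continuous_intros iterated_integral_continuous dc)
qed

lemma ln_p0_small_ball:
  "\<exists>\<kappa> C. 0 < \<kappa> \<and> 0 \<le> C \<and> (\<forall>N>0. \<kappa> ^ N \<le> prob {\<omega> \<in> space M. \<forall>t\<in>{0..1}. \<bar>W t \<omega> - ln (p0 t)\<bar> \<le> C * block_radius N})"
proof (rule log_p0_representation)
  fix z d L assume d: "d 0 = (0::real)" "\<And>s t. s \<in> {0..1} \<Longrightarrow> t \<in> {0..1} \<Longrightarrow> \<bar>d s - d t\<bar> \<le> L * sqrt \<bar>s - t\<bar>"
    "\<And>t. t \<in> {0..1} \<Longrightarrow> ln (p0 t) = (\<Sum>k\<le>m - 1. z k * t ^ k / fact k) + iterated_integral (m - 1) d t"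
  show ?thesis
  proof (rule released_small_ball[where d = d and L = L and z = z and v = "\<lambda>t. ln (p0 t)", OF d(1)], fact d(2), fact d(3))
    fix \<kappa> C assume k: "0 < \<kappa>" "0 \<le> C" "\<And>N. 0 < N \<Longrightarrow> \<kappa> ^ N \<le> prob {\<omega> \<in> space M. \<forall>t\<in>{0..1}. \<bar>W t \<omega> - ln (p0 t)\<bar> \<le> C * block_radius N}"
    show ?thesis
      by (intro exI[of _ \<kappa>] exI[of _ C] conjI allI impI k)
  qed
qed

lemma block_radius_tendsto_0: "block_radius \<longlonglongrightarrow> 0"
proof (rule tendsto_sandwich[where f = "\<lambda>_. 0" and h = "\<lambda>N. sqrt (1 / real N)"])
  show "(\<lambda>N. sqrt (1 / real N)) \<longlonglongrightarrow> 0"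
    using tendsto_real_sqrt[OF lim_1_over_n] by simp
  show "\<forall>\<^sub>F N in sequentially. 0 \<le> block_radius N"
    using block_radius_bounds(1) by (intro eventually_sequentiallyI[of 1]) (auto intro: less_imp_le)
  show "\<forall>\<^sub>F N in sequentially. block_radius N \<le> sqrt (1 / real N)"
  proof (intro eventually_sequentiallyI[of 1])
    fix N :: nat assume "1 \<le> N"
    then have "(1 / real N) ^ (m - 1) \<le> 1" by (intro power_le_one) auto
    then show "block_radius N \<le> sqrt (1 / real N)" unfolding block_radius_def by (intro mult_left_le_one_le) auto
  qed
qed (rule tendsto_const)

text \<open>The log density stays within \<open>c / 2\<close>, so a margin of \<open>c / 2\<close>
  remains up to the conditioning level.\<close>

lemma small_ball_sub_E:
  assumes "C * block_radius N \<le> c / 2"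
  shows "{\<omega> \<in> space M. \<forall>t\<in>{0..1}. \<bar>W t \<omega> - ln (p0 t)\<bar> \<le> C * block_radius N} \<subseteq> E"
proof
  fix \<omega> assume \<omega>: "\<omega> \<in> {\<omega> \<in> space M. \<forall>t\<in>{0..1}. \<bar>W t \<omega> - ln (p0 t)\<bar> \<le> C * block_radius N}"
  have "\<bar>W t \<omega> - 0\<bar> \<le> c" if t: "t \<in> {0..1}" for t
  proof -
    have "\<bar>W t \<omega> - ln (p0 t)\<bar> \<le> C * block_radius N" using \<omega> t by blast
    then show ?thesis using assms ln_p0_bound[OF t] by linarith
  qed
  then show "\<omega> \<in> E" using \<omega> by (simp add: E_eq)
qed

lemma eventually_radius:
  assumes "0 < e"
  shows "\<forall>\<^sub>F N in sequentially. C * block_radius N \<le> e"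
proof -
  have "(\<lambda>N. C * block_radius N) \<longlonglongrightarrow> C * 0" by (intro tendsto_mult tendsto_const block_radius_tendsto_0)
  then have "\<forall>\<^sub>F N in sequentially. C * block_radius N < e" by (rule order_tendstoD(2)) (use assms in simp)
  then show ?thesis by (rule eventually_mono) simp
qed

text \<open>The event contains a small ball around the log density, which has positive
  probability.\<close>

lemma E_pos: "0 < prob E"
proof -
  obtain \<kappa> C where k: "0 < \<kappa>" "0 \<le> C" "\<And>N. 0 < N \<Longrightarrow> \<kappa> ^ N \<le> prob {\<omega> \<in> space M. \<forall>t\<in>{0..1}. \<bar>W t \<omega> - ln (p0 t)\<bar> \<le> C * block_radius N}"
    using ln_p0_small_ball by blast
  have "0 < c / 2" using c_pos by simp
  from eventually_radius[OF this, of C]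
  obtain N0 where "\<And>N. N0 \<le> N \<Longrightarrow> C * block_radius N \<le> c / 2"
    unfolding eventually_sequentially by blast
  then have N: "C * block_radius (Suc N0) \<le> c / 2" by simp
  have "0 < \<kappa> ^ Suc N0" using k(1) by simp
  also have "\<dots> \<le> prob {\<omega> \<in> space M. \<forall>t\<in>{0..1}. \<bar>W t \<omega> - ln (p0 t)\<bar> \<le> C * block_radius (Suc N0)}"
    by (rule k(3)) simp
  also have "\<dots> \<le> prob E" by (rule finite_measure_mono[OF small_ball_sub_E[OF N] E_events])
  finally show ?thesis .
qed

section \<open>The conditioned measure and its densities\<close>

definition \<mu> where "\<mu> = uniform_measure M E"

lemma sets_\<mu> [simp, measurable_cong]: "sets \<mu> = sets M" and space_\<mu> [simp]: "space \<mu> = space M"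
  by (simp_all add: \<mu>_def)

lemma prob_space_\<mu>: "prob_space \<mu>"
  unfolding \<mu>_def by (rule prob_space_uniform_measure) (use E_pos in \<open>simp_all add: emeasure_eq_measure\<close>)

lemma AE_\<mu>: "AE \<omega> in \<mu>. \<omega> \<in> E"
  unfolding \<mu>_def by (subst AE_uniform_measure) (use E_pos in \<open>simp_all add: emeasure_eq_measure\<close>)

lemma measure_\<mu>: "U \<in> events \<Longrightarrow> measure \<mu> U = prob (E \<inter> U) / prob E"
  unfolding \<mu>_def using E_pos by (subst measure_uniform_measure) (simp_all add: emeasure_eq_measure)

lemma W_joint: "(\<lambda>(\<omega>, t). W t \<omega>) \<in> borel_measurable (M \<Otimes>\<^sub>M unit_lborel)"
  by (rule process_joint_measurable[OF W_measurable W_continuous])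

definition mass_W where "mass_W \<omega> = (LINT s|unit_lborel. exp (W s \<omega>))"

lemma mass_W_measurable [measurable]: "mass_W \<in> borel_measurable M"
proof -
  interpret U: prob_space unit_lborel by (rule prob_space_unit_lborel)
  note [measurable] = W_joint
  show ?thesis unfolding mass_W_def[abs_def]
    by (rule U.borel_measurable_lebesgue_integral) measurable
qed

lemma exp_W_continuous: "\<omega> \<in> space M \<Longrightarrow> continuous_on {0..1} (\<lambda>t. exp (W t \<omega>))"
  by (intro continuous_intros W_continuous)

lemma mass_W_pos: assumes \<omega>: "\<omega> \<in> space M" shows "0 < mass_W \<omega>"
proof -
  interpret U: prob_space unit_lborel by (rule prob_space_unit_lborel)
  note bm = bounded_measurable_continuous[OF exp_W_continuous[OF \<omega>]]
  have "(LINT s|unit_lborel. exp (W s \<omega>)) \<noteq> 0"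
    using integral_nonneg_eq_0_iff_AE[OF bounded_measurable_integrable[OF bm]] U.AE_False by simp
  moreover have "0 \<le> (LINT s|unit_lborel. exp (W s \<omega>))" by (intro integral_nonneg_AE) auto
  ultimately show ?thesis unfolding mass_W_def by linarith
qed

lemma mass_W_bounds: assumes \<omega>: "\<omega> \<in> E" shows "exp (- c) \<le> mass_W \<omega>" "mass_W \<omega> \<le> exp c"
proof -
  note bm = bounded_measurable_continuous[OF exp_W_continuous[OF E_space[OF \<omega>]]]
  have b: "exp (- c) \<le> exp (W s \<omega>)" "exp (W s \<omega>) \<le> exp c" if "s \<in> {0..1}" for s
    using E_bound[OF \<omega> that] by auto
  have "(LINT s|unit_lborel. exp (- c)) \<le> mass_W \<omega>" "mass_W \<omega> \<le> (LINT s|unit_lborel. exp c)"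
    unfolding mass_W_def
    using integral_mono_bounded[OF bounded_measurable_const bm b(1)]
      integral_mono_bounded[OF bm bounded_measurable_const b(2)] by simp_all
  then show "exp (- c) \<le> mass_W \<omega>" "mass_W \<omega> \<le> exp c" unfolding unit_integral_const .
qed

lemma exp_density_W: "t \<in> {0..1} \<Longrightarrow> exp_density (\<lambda>t. W t \<omega>) t = exp (W t \<omega>) / mass_W \<omega>"
  by (simp add: exp_density_def mass_W_def)

lemma exp_density_W_C01: "\<omega> \<in> space M \<Longrightarrow> exp_density (\<lambda>t. W t \<omega>) \<in> C01"
proof -
  assume \<omega>: "\<omega> \<in> space M"
  have "continuous_on {0..1} (\<lambda>t. exp (W t \<omega>) / mass_W \<omega>)"
    by (intro continuous_intros exp_W_continuous[OF \<omega>] W_continuous[OF \<omega>]) (use mass_W_pos[OF \<omega>] in auto)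
  moreover have "continuous_on {0..1} (exp_density (\<lambda>t. W t \<omega>)) \<longleftrightarrow> continuous_on {0..1} (\<lambda>t. exp (W t \<omega>) / mass_W \<omega>)"
    by (rule continuous_on_cong) (auto simp: exp_density_W)
  ultimately show ?thesis by (simp add: C01_def exp_density_def)
qed

lemma exp_density_W_measurable: "(\<lambda>\<omega>. exp_density (\<lambda>t. W t \<omega>)) \<in> measurable M C01_borel"
proof (rule C01_measurableI[OF exp_density_W_C01])
  fix t :: real assume t: "t \<in> {0..1}"
  have [measurable]: "W t \<in> borel_measurable M" by (rule W_measurable[OF t])
  show "(\<lambda>\<omega>. exp_density (\<lambda>t. W t \<omega>) t) \<in> borel_measurable M"
    unfolding exp_density_W[OF t] by measurable
qed

text \<open>Off the conditioning event, which is null for \<open>\<mu>\<close>, the default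
  \<open>p0\<close> keeps the uniform bounds and the total mass 1 valid at every sample
  point.\<close>

definition q where "q \<omega> t = (if \<omega> \<in> E then exp (W t \<omega>) / mass_W \<omega> else p0 t)"

lemma q_bounds: assumes "t \<in> {0..1}" shows "exp (- 2 * c) \<le> q \<omega> t" "q \<omega> t \<le> exp (2 * c)"
proof -
  have "exp (- 2 * c) \<le> exp (W t \<omega>) / mass_W \<omega> \<and> exp (W t \<omega>) / mass_W \<omega> \<le> exp (2 * c)" if \<omega>: "\<omega> \<in> E"
  proof
    note mb = mass_W_bounds[OF \<omega>]
    have W: "exp (- c) \<le> exp (W t \<omega>)" "exp (W t \<omega>) \<le> exp c" using E_bound[OF \<omega> assms] by auto
    have p: "0 < mass_W \<omega>" by (rule less_le_trans[OF exp_gt_zero mb(1)])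
    have "exp (W t \<omega>) / mass_W \<omega> \<le> exp c / exp (- c)" using W mb by (intro frac_le) auto
    also have "\<dots> = exp (2 * c)" by (simp add: exp_diff[symmetric])
    finally show "exp (W t \<omega>) / mass_W \<omega> \<le> exp (2 * c)" .
    have "exp (- 2 * c) = exp (- c) / exp c" by (simp add: exp_diff[symmetric])
    also have "\<dots> \<le> exp (W t \<omega>) / mass_W \<omega>" using W mb p by (intro frac_le) auto
    finally show "exp (- 2 * c) \<le> exp (W t \<omega>) / mass_W \<omega>" .
  qed
  then show "exp (- 2 * c) \<le> q \<omega> t" "q \<omega> t \<le> exp (2 * c)"
    using p0_exp_bounds[OF assms] unfolding q_def by (simp_all only: split: if_split) blast+
qed

lemma density_family_q: "density_family \<mu> q p0 (exp (- 2 * c)) (exp (2 * c))"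
proof -
  interpret \<mu>: prob_space \<mu> by (rule prob_space_\<mu>)
  show ?thesis
  proof
    have [measurable]: "W' \<in> borel_measurable (M \<Otimes>\<^sub>M unit_lborel)" if "W' = (\<lambda>z. W (snd z) (fst z))" for W'
      using W_joint that by (simp add: case_prod_beta')
    note [measurable] = E_events
    have [measurable]: "p0 \<in> borel_measurable unit_lborel" using p0_bounded_measurable by (simp add: bounded_measurable_def)
    have "(\<lambda>(\<omega>, t). q \<omega> t) \<in> borel_measurable (M \<Otimes>\<^sub>M unit_lborel)"
      unfolding q_def case_prod_beta'
      by (intro measurable_If borel_measurable_divide) measurable
    then show "(\<lambda>(\<omega>, t). q \<omega> t) \<in> borel_measurable (\<mu> \<Otimes>\<^sub>M unit_lborel)"
      by (simp cong: measurable_cong_sets sets_pair_measure_cong)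
    show "0 < exp (- 2 * c)" by simp
    show "(LINT t|unit_lborel. q \<omega> t) = 1" for \<omega>
    proof (cases "\<omega> \<in> E")
      case True
      then have "0 < mass_W \<omega>" by (intro mass_W_pos E_space)
      then have "(LINT t|unit_lborel. exp (W t \<omega>) / mass_W \<omega>) = 1" by (simp add: mass_W_def)
      then show ?thesis using True by (simp add: q_def)
    qed (simp add: q_def p0_integral)
  qed (rule q_bounds p0_exp_bounds p0_bounded_measurable p0_integral, assumption?)+
qed

end

sublocale conditioned_released_bm \<subseteq> F: density_family \<mu> q p0 "exp (- 2 * c)" "exp (2 * c)"
  by (rule density_family_q)

section \<open>From the evidence to the posterior\<close>

context density_family
begin

text \<open>The excluded samples are of four kinds: the evidence is too small, the part
  \<open>V1\<close> of small prior mass exceeds \<open>\<theta>\<close>, some test rejects, or the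
  tested part \<open>V2\<close> exceeds \<open>\<theta>\<close> although all tests accept. Outside
  them the numerator is at most \<open>2 * \<theta>\<close>.\<close>

lemma evidence_contraction:
  assumes U: "U \<in> sets \<mu>" "0 < measure \<mu> U" and ch: "0 \<le> ch"
    and chi2: "\<And>\<omega>. \<omega> \<in> U \<Longrightarrow> (\<integral>\<^sup>+ t. ennreal (p0 t * (p0 t / p \<omega> t)) \<partial>unit_lborel) \<le> ennreal (1 + ch)"
    and V: "V1 \<in> sets \<mu>" "V2 \<in> sets \<mu>" and I: "finite I"
    and q: "\<And>i. i \<in> I \<Longrightarrow> bounded_measurable (q i)"
      "\<And>i t. i \<in> I \<Longrightarrow> t \<in> {0..1} \<Longrightarrow> a \<le> q i t" "\<And>i t. i \<in> I \<Longrightarrow> t \<in> {0..1} \<Longrightarrow> q i t \<le> b"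
    and cover: "\<And>\<omega>. \<omega> \<in> V2 \<Longrightarrow> \<exists>i\<in>I. 16 * (LINT t|unit_lborel. (p \<omega> t - q i t)\<^sup>2) \<le> (LINT t|unit_lborel. (q i t - p0 t)\<^sup>2)"
    and \<theta>: "0 < \<theta>"
    and e: "(\<Sum>i\<in>I. exp (- (9 / (256 * b)) * real n * (LINT t|unit_lborel. (q i t - p0 t)\<^sup>2))) \<le> e"
  shows "\<exists>X\<in>sets P. measure P X \<le> exp (- D) + measure \<mu> V1 / \<theta> + (1 + 1 / \<theta>) * e \<and>
    (\<forall>x\<in>space P - X. enn2real (partial_evidence n (V1 \<union> V2) x) / enn2real (partial_evidence n (space \<mu>) x)
       \<le> 2 * \<theta> / (measure \<mu> U * exp (- (real n * ch + D))))"
proof -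
  interpret P: prob_space P by (rule prob_space_P)
  define u where "u = measure \<mu> U * exp (- (real n * ch + D))"
  have u: "0 < u" using U(2) by (simp add: u_def)
  define err where "err i = exp (- (9 / (256 * b)) * real n * (LINT t|unit_lborel. (q i t - p0 t)\<^sup>2))" for i
  have err0: "0 \<le> err i" for i by (simp add: err_def)
  have e': "(\<Sum>i\<in>I. err i) \<le> e" using e unfolding err_def .
  have e0: "0 \<le> e" using sum_nonneg[of I err] err0 e' by (meson order.trans)
  define T where "T = (\<Union>i\<in>I. test_set n (q i))"
  have Tsets: "T \<in> sets P" unfolding T_def by (intro sets.finite_UN I test_set_sets q)
  have PT: "measure P T \<le> e"
  proof -
    have "measure P T \<le> (\<Sum>i\<in>I. measure P (test_set n (q i)))"
      unfolding T_def by (intro P.finite_measure_subadditive_finite I) (use test_set_sets q in auto)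
    also have "\<dots> \<le> (\<Sum>i\<in>I. err i)"
    proof (rule sum_mono)
      fix i assume i: "i \<in> I"
      have "emeasure P (test_set n (q i)) \<le> ennreal (err i)"
        unfolding err_def by (rule test_errors(1)[OF q[OF i]]) auto
      then show "measure P (test_set n (q i)) \<le> err i"
        unfolding P.emeasure_eq_measure by (subst (asm) ennreal_le_iff) (auto simp: err0)
    qed
    finally show ?thesis using e' by linarith
  qed
  define X0 where "X0 = {x \<in> space P. partial_evidence n U x \<le> ennreal u}"
  define X1 where "X1 = {x \<in> space P. 1 \<le> ennreal (1 / \<theta>) * partial_evidence n V1 x}"
  define X2 where "X2 = {x \<in> space P - T. 1 \<le> ennreal (1 / \<theta>) * partial_evidence n V2 x}"
  note [measurable] = partial_evidence_measurable[OF U(1)] partial_evidence_measurable[OF V(1)]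
    partial_evidence_measurable[OF V(2)] Tsets
  have Xsets: "X0 \<in> sets P" "X1 \<in> sets P" "X2 \<in> sets P"
    unfolding X0_def X1_def X2_def by measurable
  have "emeasure P X0 \<le> ennreal (exp (- D))"
    unfolding X0_def u_def by (rule partial_evidence_lower[OF U ch chi2])
  then have PX0: "measure P X0 \<le> exp (- D)"
    unfolding P.emeasure_eq_measure by (subst (asm) ennreal_le_iff) auto
  have "emeasure P X1 \<le> ennreal (1 / \<theta>) * (1 * emeasure \<mu> V1)"
    unfolding X1_def
  proof (rule partial_evidence_upper[OF V(1) sets.top])
    fix \<omega> assume "\<omega> \<in> V1"
    then have \<omega>: "\<omega> \<in> space \<mu>" using V(1) sets.sets_into_space by blast
    have "(\<integral>\<^sup>+ x. ennreal (lr n \<omega> x) * indicator (space P) x \<partial>P) = (\<integral>\<^sup>+ x. ennreal (lr n \<omega> x) \<partial>P)"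
      by (rule nn_integral_cong) simp
    then show "(\<integral>\<^sup>+ x. ennreal (lr n \<omega> x) * indicator (space P) x \<partial>P) \<le> 1"
      using lr_integral_1[OF \<omega>] by simp
  qed
  also have "\<dots> = ennreal (measure \<mu> V1 / \<theta>)"
    using \<theta> by (simp add: emeasure_eq_measure ennreal_mult[symmetric])
  finally have PX1: "measure P X1 \<le> measure \<mu> V1 / \<theta>"
    unfolding P.emeasure_eq_measure using \<theta> by (subst (asm) ennreal_le_iff) auto
  have "emeasure P X2 \<le> ennreal (1 / \<theta>) * (ennreal e * emeasure \<mu> V2)"
    unfolding X2_def
  proof (rule partial_evidence_upper[OF V(2)])
    show "space P - T \<in> sets P" by measurable
    fix \<omega> assume \<omega>: "\<omega> \<in> V2"
    then have sp: "\<omega> \<in> space \<mu>" using V(2) sets.sets_into_space by blast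
    obtain i where i: "i \<in> I" "16 * (LINT t|unit_lborel. (p \<omega> t - q i t)\<^sup>2) \<le> (LINT t|unit_lborel. (q i t - p0 t)\<^sup>2)"
      using cover[OF \<omega>] by blast
    have "(\<integral>\<^sup>+ x. ennreal (lr n \<omega> x) * indicator (space P - T) x \<partial>P)
       \<le> (\<integral>\<^sup>+ x. ennreal (lr n \<omega> x) * indicator (space P - test_set n (q i)) x \<partial>P)"
      by (intro nn_integral_mono mult_left_mono) (use i(1) in \<open>auto simp: T_def indicator_def\<close>)
    also have "\<dots> \<le> ennreal (err i)"
      unfolding err_def by (rule test_errors(2)[OF q[OF i(1)] sp i(2)]) auto
    also have "err i \<le> (\<Sum>i\<in>I. err i)" by (rule member_le_sum[OF i(1)]) (auto simp: err0 I)
    finally show "(\<integral>\<^sup>+ x. ennreal (lr n \<omega> x) * indicator (space P - T) x \<partial>P) \<le> ennreal e"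
      using e' by (auto intro: order.trans ennreal_leI)
  qed
  also have "\<dots> \<le> ennreal (1 / \<theta>) * (ennreal e * 1)"
    using emeasure_le_1 by (intro mult_left_mono) auto
  also have "\<dots> = ennreal (1 / \<theta> * e)" using \<theta> e0 by (simp add: ennreal_mult[symmetric])
  finally have PX2: "measure P X2 \<le> 1 / \<theta> * e"
    unfolding P.emeasure_eq_measure using \<theta> e0 by (subst (asm) ennreal_le_iff) auto
  define X where "X = X0 \<union> X1 \<union> T \<union> X2"
  show ?thesis
  proof (intro bexI[of _ X] conjI ballI)
    show "X \<in> sets P" unfolding X_def by (intro sets.Un Xsets Tsets)
    have "measure P X \<le> measure P X0 + measure P X1 + measure P T + measure P X2"
      unfolding X_def
      using measure_Un_le[of "X0 \<union> X1 \<union> T" P X2] measure_Un_le[of "X0 \<union> X1" P T] measure_Un_le[of X0 P X1] Xsets Tsets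
      by (auto intro: order.trans)
    then show "measure P X \<le> exp (- D) + measure \<mu> V1 / \<theta> + (1 + 1 / \<theta>) * e"
      using PX0 PX1 PX2 PT by (simp add: distrib_right)
    fix x assume x: "x \<in> space P - X"
    then have xs: "x \<in> space P" and n: "x \<notin> X0" "x \<notin> X1" "x \<notin> X2" "x \<notin> T" by (auto simp: X_def)
    have small: "partial_evidence n V x \<le> ennreal \<theta>" if "\<not> 1 \<le> ennreal (1 / \<theta>) * partial_evidence n V x" for V
    proof -
      have "ennreal \<theta> * (ennreal (1 / \<theta>) * partial_evidence n V x) \<le> ennreal \<theta> * 1"
        using that by (intro mult_left_mono) auto
      then show ?thesis using \<theta> by (simp add: mult.assoc[symmetric] ennreal_mult[symmetric])
    qed
    have v1: "partial_evidence n V1 x \<le> ennreal \<theta>" using n(2) xs by (intro small) (simp add: X1_def)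
    have v2: "partial_evidence n V2 x \<le> ennreal \<theta>" using n(3,4) xs by (intro small) (simp add: X2_def)
    note [measurable] = lr_measurable_\<omega>[OF xs] V
    have "partial_evidence n (V1 \<union> V2) x \<le> (\<integral>\<^sup>+ \<omega>. ennreal (lr n \<omega> x) * indicator V1 \<omega> + ennreal (lr n \<omega> x) * indicator V2 \<omega> \<partial>\<mu>)"
      unfolding partial_evidence_def by (rule nn_integral_mono) (auto simp: indicator_def)
    also have "\<dots> = partial_evidence n V1 x + partial_evidence n V2 x"
      unfolding partial_evidence_def by (rule nn_integral_add) measurable
    also have "\<dots> \<le> ennreal \<theta> + ennreal \<theta>" by (rule add_mono[OF v1 v2])
    also have "\<dots> = ennreal (2 * \<theta>)" using \<theta> by (simp add: ennreal_plus[symmetric])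
    finally have num: "enn2real (partial_evidence n (V1 \<union> V2) x) \<le> 2 * \<theta>"
      using \<theta> by (intro enn2real_leI) auto
    show "enn2real (partial_evidence n (V1 \<union> V2) x) / enn2real (partial_evidence n (space \<mu>) x)
       \<le> 2 * \<theta> / (measure \<mu> U * exp (- (real n * ch + D)))"
    proof (cases "partial_evidence n (space \<mu>) x = \<infinity>")
      \<comment> \<open>An infinite evidence becomes 0 under \<open>enn2real\<close>, and the
        quotient is then 0 as well.\<close>
      case True
      then show ?thesis using \<theta> u by (simp add: u_def[symmetric])
    next
      case False
      have "ennreal u \<le> partial_evidence n U x" using n(1) xs by (simp add: X0_def)
      also have "\<dots> \<le> partial_evidence n (space \<mu>) x"
        unfolding partial_evidence_def by (rule nn_integral_mono) (auto simp: indicator_def)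
      finally have "enn2real (ennreal u) \<le> enn2real (partial_evidence n (space \<mu>) x)"
        using False by (intro enn2real_mono) (auto simp: less_top)
      then have "u \<le> enn2real (partial_evidence n (space \<mu>) x)" using u by simp
      then show ?thesis unfolding u_def[symmetric] using num \<theta> u by (intro frac_le) auto
    qed
  qed
qed

end

context conditioned_released_bm
begin

text \<open>Pulls the posterior back to the sample space. On the conditioning event the likelihood
  of the random density is the likelihood ratio times the likelihood \<open>D\<close> of
  \<open>p0\<close>, which cancels.\<close>

lemma posterior_le:
  assumes x: "x \<in> space F.P" and V: "V \<in> events"
    and A: "\<And>\<omega>. \<omega> \<in> E \<Longrightarrow> exp_density (\<lambda>t. W t \<omega>) \<in> A \<Longrightarrow> \<omega> \<in> V"
  shows "posterior (conditioned_prior M W c) n x A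
    \<le> enn2real (F.partial_evidence n V x) / enn2real (F.partial_evidence n (space \<mu>) x)"
proof -
  define T where "T \<omega> = exp_density (\<lambda>t. W t \<omega>)" for \<omega>
  have Tm: "T \<in> measurable \<mu> C01_borel"
    using exp_density_W_measurable unfolding T_def[abs_def] by (simp cong: measurable_cong_sets)
  have prior: "conditioned_prior M W c = distr \<mu> C01_borel T"
    unfolding conditioned_prior_def \<mu>_def E_def T_def ..
  have x01: "x i \<in> {0..1}" for i by (rule F.observation_range[OF x])
  define D where "D = (\<Prod>i<n. p0 (x i))"
  have D: "0 < D" unfolding D_def by (intro prod_pos p0_gt_0 x01)
  have prod_eq: "(\<Prod>i<n. T \<omega> (x i)) = D * F.lr n \<omega> x" if "\<omega> \<in> E" for \<omega>
  proof -
    have "T \<omega> (x i) = p0 (x i) * (q \<omega> (x i) / p0 (x i))" for i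
      using p0_gt_0[OF x01[of i]] that exp_density_W[OF x01, of \<omega>] by (simp add: T_def q_def)
    then show ?thesis unfolding D_def F.lr_def prod.distrib[symmetric] by simp
  qed
  note [measurable] = F.lr_measurable_\<omega>[OF x]
  have lr0: "0 \<le> F.lr n \<omega> x" if "\<omega> \<in> space M" for \<omega>
    using F.lr_pos[of \<omega> x n] that x by (simp add: less_imp_le)
  have lr_bound: "F.lr n \<omega> x \<le> (exp (2 * c) / exp (- 2 * c)) ^ n" if "\<omega> \<in> space M" for \<omega>
  proof -
    have "F.lr n \<omega> x \<le> (\<Prod>i<n. exp (2 * c) / exp (- 2 * c))"
      unfolding F.lr_def
    proof (rule prod_mono, rule conjI)
      fix i
      have "0 < p0 (x i)" by (rule p0_gt_0[OF x01])
      moreover have "0 < q \<omega> (x i)" by (rule less_le_trans[OF exp_gt_zero q_bounds(1)[OF x01]])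
      ultimately show "0 \<le> q \<omega> (x i) / p0 (x i)" by simp
      show "q \<omega> (x i) / p0 (x i) \<le> exp (2 * c) / exp (- 2 * c)"
        by (intro frac_le q_bounds p0_exp_bounds x01) auto
    qed
    then show ?thesis by simp
  qed
  have int_lr: "integrable \<mu> (\<lambda>\<omega>. F.lr n \<omega> x)"
    by (rule F.integrable_const_bound[where B = "(exp (2 * c) / exp (- 2 * c)) ^ n"])
       (use lr0 lr_bound in \<open>auto intro!: AE_I2\<close>)
  have ev: "(LINT \<omega>|\<mu>. indicator V \<omega> * F.lr n \<omega> x) = enn2real (F.partial_evidence n V x)"
    if V: "V \<in> events" for V
  proof -
    have Vm[measurable]: "V \<in> sets \<mu>" using V by simp
    have "(LINT \<omega>|\<mu>. indicator V \<omega> * F.lr n \<omega> x) = enn2real (\<integral>\<^sup>+ \<omega>. ennreal (indicator V \<omega> * F.lr n \<omega> x) \<partial>\<mu>)"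
      by (rule integral_eq_nn_integral) (use lr0 in \<open>auto intro!: AE_I2\<close>)
    also have "(\<integral>\<^sup>+ \<omega>. ennreal (indicator V \<omega> * F.lr n \<omega> x) \<partial>\<mu>) = F.partial_evidence n V x"
      unfolding F.partial_evidence_def by (rule nn_integral_cong) (auto simp: indicator_def)
    finally show ?thesis .
  qed
  have prod_meas: "(\<lambda>p. \<Prod>i<n. p (x i)) \<in> borel_measurable C01_borel"
    by (intro borel_measurable_prod C01_evaluation_measurable x01)
  have "(LINT p|conditioned_prior M W c. (\<Prod>i<n. p (x i))) = (LINT \<omega>|\<mu>. (\<Prod>i<n. T \<omega> (x i)))"
    unfolding prior by (rule integral_distr[OF Tm prod_meas])
  also have "\<dots> = (LINT \<omega>|\<mu>. D * F.lr n \<omega> x)"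
  proof (rule integral_cong_AE)
    show "(\<lambda>\<omega>. \<Prod>i<n. T \<omega> (x i)) \<in> borel_measurable \<mu>"
      by (rule measurable_compose[OF Tm prod_meas])
    show "AE \<omega> in \<mu>. (\<Prod>i<n. T \<omega> (x i)) = D * F.lr n \<omega> x"
      using AE_\<mu> by eventually_elim (rule prod_eq)
  qed measurable
  also have "\<dots> = D * (LINT \<omega>|\<mu>. indicator (space M) \<omega> * F.lr n \<omega> x)"
    unfolding integral_mult_right_zero[symmetric]
    by (rule Bochner_Integration.integral_cong) auto
  also have "\<dots> = D * enn2real (F.partial_evidence n (space \<mu>) x)"
    using ev[OF sets.top] by simp
  finally have den: "(LINT p|conditioned_prior M W c. (\<Prod>i<n. p (x i))) = D * enn2real (F.partial_evidence n (space \<mu>) x)" .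
  have num: "(LINT p:A|conditioned_prior M W c. (\<Prod>i<n. p (x i))) \<le> D * enn2real (F.partial_evidence n V x)"
  proof (cases "integrable (conditioned_prior M W c) (\<lambda>p. indicator A p * (\<Prod>i<n. p (x i)))")
    \<comment> \<open>Nothing is assumed about measurability of \<open>A\<close>; a non-integrable
      integrand has Bochner integral 0.\<close>
    case False
    then have "(LINT p:A|conditioned_prior M W c. (\<Prod>i<n. p (x i))) = 0"
      unfolding set_lebesgue_integral_def real_scaleR_def by (rule not_integrable_integral_eq)
    then show ?thesis using D by simp
  next
    case True
    then have Hm: "(\<lambda>p. indicator A p * (\<Prod>i<n. p (x i))) \<in> borel_measurable C01_borel"
      unfolding prior by (auto dest: borel_measurable_integrable)
    have Vm[measurable]: "V \<in> sets \<mu>" using V by simp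
    have "(LINT p:A|conditioned_prior M W c. (\<Prod>i<n. p (x i))) = (LINT \<omega>|\<mu>. indicator A (T \<omega>) * (\<Prod>i<n. T \<omega> (x i)))"
      unfolding set_lebesgue_integral_def real_scaleR_def prior by (rule integral_distr[OF Tm Hm])
    also have "\<dots> \<le> (LINT \<omega>|\<mu>. D * (indicator V \<omega> * F.lr n \<omega> x))"
    proof (rule integral_mono_AE)
      show "integrable \<mu> (\<lambda>\<omega>. indicator A (T \<omega>) * (\<Prod>i<n. T \<omega> (x i)))"
        using True unfolding prior by (subst (asm) integrable_distr_eq[OF Tm Hm])
      show "integrable \<mu> (\<lambda>\<omega>. D * (indicator V \<omega> * F.lr n \<omega> x))"
        using integrable_real_mult_indicator[OF Vm int_lr] by (intro integrable_mult_right) (simp add: mult.commute)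
      show "AE \<omega> in \<mu>. indicator A (T \<omega>) * (\<Prod>i<n. T \<omega> (x i)) \<le> D * (indicator V \<omega> * F.lr n \<omega> x)"
        using AE_\<mu>
      proof eventually_elim
        case (elim \<omega>)
        have "0 \<le> D * F.lr n \<omega> x" using D lr0[OF E_space[OF elim]] by simp
        then show ?case unfolding prod_eq[OF elim]
          using A[OF elim] by (auto simp: indicator_def T_def)
      qed
    qed
    also have "\<dots> = D * enn2real (F.partial_evidence n V x)"
      using ev[OF V] by simp
    finally show ?thesis .
  qed
  have "posterior (conditioned_prior M W c) n x A
      \<le> D * enn2real (F.partial_evidence n V x) / (D * enn2real (F.partial_evidence n (space \<mu>) x))"
    unfolding posterior_def den using D by (intro divide_right_mono num) auto
  then show ?thesis using D by simp
qed

end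

section \<open>Cells in coordinate space\<close>

text \<open>Since \<open>j\<^sup>2 \<ge> \<bar>j\<bar>\<close> for integers, two geometric series
  dominate, whatever the size of \<open>J\<close>.\<close>

lemma sum_exp_neg_int_le:
  fixes a :: real and J :: int
  assumes a: "0 < a"
  shows "(\<Sum>j\<in>{-J..J}. exp (- a * (real_of_int j)\<^sup>2)) \<le> 2 / (1 - exp (- a))"
proof -
  have ge: "exp (- a * (real_of_int j)\<^sup>2) \<le> exp (- a) ^ nat \<bar>j\<bar>" for j
  proof -
    have "\<bar>j\<bar> \<le> \<bar>j\<bar>\<^sup>2"
    proof (cases "j = 0")
      case False
      then show ?thesis by (intro self_le_power) auto
    qed simp
    then have "\<bar>j\<bar> \<le> j\<^sup>2" by simp
    then have "real (nat \<bar>j\<bar>) \<le> (real_of_int j)\<^sup>2"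
      by (metis (no_types, lifting) abs_ge_zero of_int_le_iff of_int_of_nat_eq of_int_power nat_0_le)
    then have "- a * (real_of_int j)\<^sup>2 \<le> real (nat \<bar>j\<bar>) * (- a)"
      using a by (simp add: mult.commute)
    then show ?thesis by (simp only: exp_of_nat_mult[symmetric] exp_le_cancel_iff)
  qed
  let ?r = "exp (- a)"
  have r: "0 \<le> ?r" "?r < 1" using a by auto
  have geo: "(\<Sum>k\<in>K. ?r ^ k) \<le> 1 / (1 - ?r)" if "finite K" for K :: "nat set"
  proof -
    have "(\<Sum>k\<in>K. ?r ^ k) \<le> (\<Sum>k. ?r ^ k)" by (rule sum_le_suminf) (use r that in auto)
    then show ?thesis using suminf_geometric[of ?r] r by simp
  qed
  have "(\<Sum>j\<in>{-J..J}. exp (- a * (real_of_int j)\<^sup>2)) \<le> (\<Sum>j\<in>{-J..J}. ?r ^ nat \<bar>j\<bar>)"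
    by (rule sum_mono) (rule ge)
  also have "\<dots> \<le> (\<Sum>j\<in>{0..J} \<union> {-J..0}. ?r ^ nat \<bar>j\<bar>)"
    by (rule sum_mono2) auto
  also have "\<dots> \<le> (\<Sum>j\<in>{0..J}. ?r ^ nat \<bar>j\<bar>) + (\<Sum>j\<in>{-J..0}. ?r ^ nat \<bar>j\<bar>)"
    by (subst sum_Un) (auto intro!: sum_nonneg)
  also have "(\<Sum>j\<in>{0..J}. ?r ^ nat \<bar>j\<bar>) = (\<Sum>k\<in>(\<lambda>j. nat \<bar>j\<bar>) ` {0..J}. ?r ^ k)"
    by (subst sum.reindex) (auto simp: inj_on_def)
  also have "\<dots> \<le> 1 / (1 - ?r)" by (rule geo) simp
  also have "(\<Sum>j\<in>{-J..0}. ?r ^ nat \<bar>j\<bar>) = (\<Sum>k\<in>(\<lambda>j. nat \<bar>j\<bar>) ` {-J..0}. ?r ^ k)"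
    by (subst sum.reindex) (auto simp: inj_on_def)
  also have "\<dots> \<le> 1 / (1 - ?r)" by (rule geo) simp
  finally show ?thesis by simp
qed

text \<open>Gaussian weights on a lattice factorise over the coordinates, so all cells are summed at
  once, with one constant factor per coordinate.\<close>

lemma sum_PiE_exp_neg_squares_le:
  fixes a :: real and J :: int
  assumes a: "0 < a" and I: "finite I" and Q: "Q \<subseteq> I \<rightarrow>\<^sub>E {-J..J}"
  shows "(\<Sum>z\<in>Q. exp (- a * (\<Sum>i\<in>I. (real_of_int (z i))\<^sup>2))) \<le> (2 / (1 - exp (- a))) ^ card I"
proof -
  have "(\<Sum>z\<in>Q. exp (- a * (\<Sum>i\<in>I. (real_of_int (z i))\<^sup>2)))
     \<le> (\<Sum>z\<in>I \<rightarrow>\<^sub>E {-J..J}. exp (- a * (\<Sum>i\<in>I. (real_of_int (z i))\<^sup>2)))"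
    by (rule sum_mono2[OF finite_PiE[OF I] Q]) auto
  also have "\<dots> = (\<Sum>z\<in>I \<rightarrow>\<^sub>E {-J..J}. \<Prod>i\<in>I. exp (- a * (real_of_int (z i))\<^sup>2))"
    by (simp add: sum_distrib_left exp_sum I)
  also have "\<dots> = (\<Prod>i\<in>I. \<Sum>j\<in>{-J..J}. exp (- a * (real_of_int j)\<^sup>2))"
    by (rule prod_sum_PiE[symmetric]) (auto simp: I)
  also have "\<dots> \<le> (\<Prod>i\<in>I. 2 / (1 - exp (- a)))"
    by (intro prod_mono conjI sum_exp_neg_int_le a sum_nonneg) auto
  finally show ?thesis by simp
qed

lemma floor_square_le: "(real_of_int \<lfloor>y\<rfloor>)\<^sup>2 \<le> 2 * y\<^sup>2 + 2" for y :: real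
proof -
  define u where "u = y - real_of_int \<lfloor>y\<rfloor>"
  have u: "0 \<le> u" "u \<le> 1" unfolding u_def by linarith+
  have "(real_of_int \<lfloor>y\<rfloor>)\<^sup>2 \<le> 2 * y\<^sup>2 + 2 * u\<^sup>2"
    using zero_le_power2[of "y + u"] unfolding u_def by (simp add: power2_eq_square algebra_simps)
  moreover have "u\<^sup>2 \<le> 1" using u by (simp add: power_le_one)
  ultimately show ?thesis by linarith
qed

context dual_polynomials
begin

lemma coord_diff:
  assumes f: "bounded_measurable f" and g: "bounded_measurable g" and i: "i < N"
  shows "coord N (\<lambda>t. f t - g t) i l = coord N f i l - coord N g i l"
  unfolding coord_def right_diff_distrib
  by (intro Bochner_Integration.integral_diff bounded_measurable_integrable bounded_measurable_mult
      poly_bm block_fun_bm f g i)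

text \<open>Equal floors put each coordinate difference within one radius. Averaging over the blocks
  gives \<open>m\<close> squared radii, and the polynomial remainder contributes the same order
  through \<open>K\<close>.\<close>

lemma cell_distance:
  assumes N: "0 < N" and f: "bounded_measurable f" and g: "bounded_measurable g"
    and fg: "block_poly_approx m N K (\<lambda>t. f t - g t)"
    and \<epsilon>: "0 < \<epsilon>" "(1 / real N) ^ (2 * (m - 1)) / N = \<epsilon>\<^sup>2"
    and cell: "\<And>i l. i < N \<Longrightarrow> l < m \<Longrightarrow> \<lfloor>coord N f i l / \<epsilon>\<rfloor> = \<lfloor>coord N g i l / \<epsilon>\<rfloor>"
  shows "(LINT t|unit_lborel. (f t - g t)\<^sup>2) \<le> (real m + 2) * (real m + ((real m * \<Psi>)\<^sup>2 + 1) * K) * \<epsilon>\<^sup>2"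
proof -
  have "(\<Sum>i<N. \<Sum>l<m. (coord N (\<lambda>t. f t - g t) i l)\<^sup>2) \<le> (\<Sum>i<N. \<Sum>l<m. \<epsilon>\<^sup>2)"
  proof (intro sum_mono)
    fix i l assume "i \<in> {..<N}" "l \<in> {..<m}"
    then have il: "i < N" "l < m" by auto
    have "\<bar>coord N f i l / \<epsilon> - coord N g i l / \<epsilon>\<bar> \<le> 1" using cell[OF il] by linarith
    then have "\<bar>(coord N f i l - coord N g i l) / \<epsilon>\<bar> \<le> 1" by (simp add: diff_divide_distrib)
    then have "\<bar>coord N f i l - coord N g i l\<bar> \<le> \<epsilon>" using \<epsilon>(1) by (simp add: abs_divide divide_le_eq)
    then show "(coord N (\<lambda>t. f t - g t) i l)\<^sup>2 \<le> \<epsilon>\<^sup>2"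
      unfolding coord_diff[OF f g il(1)] using \<epsilon>(1) abs_le_square_iff[of _ \<epsilon>] by simp
  qed
  also have "\<dots> = real N * (real m * \<epsilon>\<^sup>2)" by simp
  finally have "(\<Sum>i<N. \<Sum>l<m. (coord N (\<lambda>t. f t - g t) i l)\<^sup>2) / N \<le> real m * \<epsilon>\<^sup>2"
    using N by (simp add: divide_le_eq mult.commute)
  then have "(real m + 2) * ((\<Sum>i<N. \<Sum>l<m. (coord N (\<lambda>t. f t - g t) i l)\<^sup>2) / N + ((real m * \<Psi>)\<^sup>2 + 1) * K * \<epsilon>\<^sup>2)
      \<le> (real m + 2) * (real m * \<epsilon>\<^sup>2 + ((real m * \<Psi>)\<^sup>2 + 1) * K * \<epsilon>\<^sup>2)"
    by (intro mult_left_mono add_right_mono) auto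
  then show ?thesis
    using square_integral_le_coords[OF N fg] unfolding \<epsilon>(2) by (simp add: distrib_right mult.assoc)
qed

text \<open>The squared length of the cell index is bounded by the squared norm in units of the
  radius, so a remote cell implies a large distance and thus a large test exponent.\<close>

lemma cell_norm:
  assumes N: "0 < N" and f: "bounded_measurable f" and \<epsilon>: "0 < \<epsilon>"
  shows "(\<Sum>(i, l)\<in>{..<N} \<times> {..<m}. (real_of_int \<lfloor>coord N f i l / \<epsilon>\<rfloor>)\<^sup>2)
    \<le> 2 * real N * (real m * \<Psi>\<^sup>2 * (LINT t|unit_lborel. (f t)\<^sup>2) / \<epsilon>\<^sup>2 + real m)"
proof -
  have "(\<Sum>(i, l)\<in>{..<N} \<times> {..<m}. (real_of_int \<lfloor>coord N f i l / \<epsilon>\<rfloor>)\<^sup>2)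
     = (\<Sum>i<N. \<Sum>l<m. (real_of_int \<lfloor>coord N f i l / \<epsilon>\<rfloor>)\<^sup>2)"
    by (rule sum.cartesian_product[symmetric])
  also have "\<dots> \<le> (\<Sum>i<N. \<Sum>l<m. 2 * (coord N f i l)\<^sup>2 / \<epsilon>\<^sup>2 + 2)"
    by (intro sum_mono order.trans[OF floor_square_le]) (simp add: power_divide)
  also have "\<dots> = 2 * (\<Sum>i<N. \<Sum>l<m. (coord N f i l)\<^sup>2) / \<epsilon>\<^sup>2 + 2 * real N * real m"
    by (simp add: sum.distrib sum_distrib_left sum_divide_distrib)
  also have "\<dots> \<le> 2 * (real N * (real m * \<Psi>\<^sup>2 * (LINT t|unit_lborel. (f t)\<^sup>2))) / \<epsilon>\<^sup>2 + 2 * real N * real m"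
    using coords_le_square_integral[OF N f] by (intro add_right_mono divide_right_mono mult_left_mono) auto
  finally show ?thesis by (simp add: algebra_simps)
qed

text \<open>Confines the indices to a finite box; the sum of the errors is bounded uniformly in the
  size of the box.\<close>

lemma cell_bounded:
  assumes f: "bounded_measurable f" and R: "\<And>t. t \<in> {0..1} \<Longrightarrow> \<bar>f t\<bar> \<le> R" and \<epsilon>: "0 < \<epsilon>"
    and il: "i < N" "l < m"
  shows "\<lfloor>coord N f i l / \<epsilon>\<rfloor> \<in> {- (\<lceil>\<Psi> * R / \<epsilon>\<rceil> + 1)..\<lceil>\<Psi> * R / \<epsilon>\<rceil> + 1}"
proof -
  have bm: "bounded_measurable (\<lambda>s. f (real i / N + 1 / N * s))" by (rule block_fun_bm[OF f il(1)])
  have bma: "bounded_measurable (\<lambda>s. \<bar>f (real i / N + 1 / N * s)\<bar>)" using bm unfolding bounded_measurable_def by auto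
  have "\<bar>coord N f i l\<bar> \<le> \<Psi> * (LINT s|unit_lborel. \<bar>f (real i / N + 1 / N * s)\<bar>)"
    unfolding coord_def by (rule dual_functional_le[OF bm il(2)])
  also have "\<dots> \<le> \<Psi> * (LINT s|unit_lborel. R)"
  proof (intro mult_left_mono \<Psi>_nonneg integral_mono_bounded bma bounded_measurable_const)
    fix s :: real assume s: "s \<in> {0..1}"
    have "real i + s \<le> real N" using s il by auto
    then have "(real i + s) / N \<le> 1" using il by simp
    then show "\<bar>f (real i / N + 1 / N * s)\<bar> \<le> R" using s by (intro R) (auto simp: add_divide_distrib)
  qed
  finally have "\<bar>coord N f i l\<bar> / \<epsilon> \<le> \<Psi> * R / \<epsilon>" using \<epsilon> by (intro divide_right_mono) auto
  moreover have "\<bar>coord N f i l\<bar> / \<epsilon> = \<bar>coord N f i l / \<epsilon>\<bar>" using \<epsilon> by (simp add: abs_divide)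
  ultimately have *: "\<bar>coord N f i l / \<epsilon>\<bar> \<le> \<Psi> * R / \<epsilon>" by simp
  define y where "y = coord N f i l / \<epsilon>"
  define r where "r = \<Psi> * R / \<epsilon>"
  from * have "\<bar>y\<bar> \<le> r" by (simp add: y_def r_def)
  then have "- (\<lceil>r\<rceil> + 1) \<le> \<lfloor>y\<rfloor>" "\<lfloor>y\<rfloor> \<le> \<lceil>r\<rceil> + 1" by linarith+
  then show ?thesis unfolding y_def r_def by simp
qed

end

section \<open>The sieve\<close>

lemma exp_lipschitz_bounds:
  fixes x y R :: real
  assumes "\<bar>x\<bar> \<le> R" "\<bar>y\<bar> \<le> R"
  shows "\<bar>exp x - exp y\<bar> \<le> exp R * \<bar>x - y\<bar>" "\<bar>x - y\<bar> \<le> exp R * \<bar>exp x - exp y\<bar>"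
proof -
  have *: "exp u - exp v \<le> exp R * (u - v) \<and> u - v \<le> exp R * (exp u - exp v)"
    if uv: "v \<le> u" "\<bar>u\<bar> \<le> R" "\<bar>v\<bar> \<le> R" for u v :: real
  proof
    have "1 - (u - v) \<le> exp (- (u - v))" using exp_ge_add_one_self[of "- (u - v)"] by linarith
    then have "exp u * (1 - exp (v - u)) \<le> exp u * (u - v)" by (intro mult_left_mono) auto
    also have "\<dots> \<le> exp R * (u - v)" using uv by (intro mult_right_mono) auto
    finally show "exp u - exp v \<le> exp R * (u - v)" by (simp add: right_diff_distrib exp_add[symmetric])
    have "u - v \<le> exp (u - v) - 1" using exp_ge_add_one_self[of "u - v"] by linarith
    then have "exp v * (u - v) \<le> exp v * (exp (u - v) - 1)" by (intro mult_left_mono) auto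
    then have 1: "exp v * (u - v) \<le> exp u - exp v" by (simp add: right_diff_distrib exp_add[symmetric])
    have "exp (- R) * (u - v) \<le> exp v * (u - v)" using uv by (intro mult_right_mono) auto
    then have "exp (- R) * (u - v) \<le> exp u - exp v" using 1 by linarith
    then have "exp R * (exp (- R) * (u - v)) \<le> exp R * (exp u - exp v)" by (intro mult_left_mono) auto
    then show "u - v \<le> exp R * (exp u - exp v)" by (simp add: mult.assoc[symmetric] exp_add[symmetric])
  qed
  show "\<bar>exp x - exp y\<bar> \<le> exp R * \<bar>x - y\<bar>" "\<bar>x - y\<bar> \<le> exp R * \<bar>exp x - exp y\<bar>"
    using *[of y x] *[of x y] assms by (cases "y \<le> x"; simp add: abs_real_def)+
qed

lemma square_integral_le_scaled:
  assumes "bounded_measurable f" "bounded_measurable g" and b: "\<And>t. t \<in> {0..1} \<Longrightarrow> \<bar>f t\<bar> \<le> b * \<bar>g t\<bar>"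
  shows "(LINT t|unit_lborel. (f t)\<^sup>2) \<le> b\<^sup>2 * (LINT t|unit_lborel. (g t)\<^sup>2)"
proof -
  have "(LINT t|unit_lborel. (f t)\<^sup>2) \<le> (LINT t|unit_lborel. b\<^sup>2 * (g t)\<^sup>2)"
  proof (intro integral_mono_bounded bounded_measurable_mult bounded_measurable_const bounded_measurable_square assms(1,2))
    fix t :: real assume "t \<in> {0..1}"
    from power_mono[OF b[OF this] abs_ge_zero, of 2] show "(f t)\<^sup>2 \<le> b\<^sup>2 * (g t)\<^sup>2"
      by (simp add: power_mult_distrib)
  qed
  then show ?thesis by simp
qed

lemma dual_polynomials_obtain: "\<exists>\<psi> \<Psi>. dual_polynomials \<psi> m \<Psi> \<and> 1 \<le> \<Psi>"
proof -
  obtain \<psi> :: "nat \<Rightarrow> real poly" where \<psi>: "\<And>l k. l < m \<Longrightarrow> k < m \<Longrightarrow>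
      (LINT s|unit_lborel. poly (\<psi> l) s * s ^ k) = (if k = l then 1 else 0)"
    using dual_polynomials_exist[of m] by blast
  have "\<exists>C. \<forall>s\<in>{0..1}. \<bar>poly (\<psi> l) s\<bar> \<le> C" for l
  proof -
    have "continuous_on {0..1} (poly (\<psi> l))" by (intro continuous_intros)
    from bounded_measurable_continuous[OF this] show ?thesis unfolding bounded_measurable_def by (rule conjunct2)
  qed
  then obtain C where C: "\<And>l s. s \<in> {0..1} \<Longrightarrow> \<bar>poly (\<psi> l) s\<bar> \<le> C l" by metis
  have C0: "0 \<le> C l" for l using order.trans[OF abs_ge_zero C[of 0 l]] by simp
  \<comment> \<open>The summand 1 makes the bound positive, so that it can later be divided
    by.\<close>
  have "dual_polynomials \<psi> m (1 + (\<Sum>l<m. C l))"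
  proof
    show "(LINT s|unit_lborel. poly (\<psi> l) s * s ^ k) = (if k = l then 1 else 0)" if "l < m" "k < m" for l k
      by (rule \<psi>[OF that])
    show "\<bar>poly (\<psi> l) s\<bar> \<le> 1 + (\<Sum>l<m. C l)" if "l < m" "s \<in> {0..1}" for l s
    proof -
      have "C l \<le> (\<Sum>l<m. C l)" using that by (intro member_le_sum) (auto simp: C0)
      then show ?thesis using C[OF that(2), of l] by linarith
    qed
    show "0 \<le> 1 + (\<Sum>l<m. C l)" using sum_nonneg[of "{..<m}" C] C0 by simp
  qed
  moreover have "1 \<le> 1 + (\<Sum>l<m. C l)" using sum_nonneg[of "{..<m}" C] C0 by simp
  ultimately show ?thesis by blast
qed

context conditioned_released_bm
begin

definition logq where "logq \<omega> t = W t \<omega> - ln (mass_W \<omega>)"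

lemma logq_bm: "\<omega> \<in> E \<Longrightarrow> bounded_measurable (logq \<omega>)"
  unfolding logq_def[abs_def]
  by (intro bounded_measurable_diff bounded_measurable_const bounded_measurable_continuous W_continuous E_space)

lemma ln_p0_bm: "bounded_measurable (\<lambda>t. ln (p0 t))"
  by (rule bounded_measurable_continuous[OF ln_p0_continuous])

lemma exp_logq: "\<omega> \<in> E \<Longrightarrow> exp (logq \<omega> t) = q \<omega> t"
  using mass_W_pos[OF E_space] by (simp add: logq_def q_def exp_diff)

lemma q_pos: "t \<in> {0..1} \<Longrightarrow> 0 < q \<omega> t"
  by (rule less_le_trans[OF exp_gt_zero q_bounds(1)])

lemma logq_bound: assumes "\<omega> \<in> E" "t \<in> {0..1}" shows "\<bar>logq \<omega> t\<bar> \<le> 2 * c"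
proof -
  have "exp (logq \<omega> t) \<le> exp (2 * c)" "exp (- (2 * c)) \<le> exp (logq \<omega> t)"
    using q_bounds[OF assms(2), of \<omega>] unfolding exp_logq[OF assms(1)] by simp_all
  then show ?thesis unfolding exp_le_cancel_iff by linarith
qed

lemma ln_p0_bound': "t \<in> {0..1} \<Longrightarrow> \<bar>ln (p0 t)\<bar> \<le> 2 * c"
  using ln_p0_bound[of t] c_pos by simp

lemma q_bm: "\<omega> \<in> E \<Longrightarrow> bounded_measurable (q \<omega>)"
  by (rule F.p_bm) (simp add: E_space)

text \<open>The exponential is bi-Lipschitz on bounded logarithms. This and the next lemma translate
  between densities, on which the tests act, and log densities, in which the cells are
  formed.\<close>

lemma q_diff_le:
  assumes "\<omega> \<in> E" "\<omega>' \<in> E"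
  shows "(LINT t|unit_lborel. (q \<omega> t - q \<omega>' t)\<^sup>2) \<le> (exp (2 * c))\<^sup>2 * (LINT t|unit_lborel. (logq \<omega> t - logq \<omega>' t)\<^sup>2)"
  by (intro square_integral_le_scaled bounded_measurable_diff q_bm logq_bm assms)
     (use exp_lipschitz_bounds(1)[OF logq_bound logq_bound] assms in \<open>simp add: exp_logq\<close>)

lemma logq_diff_p0_le:
  assumes "\<omega> \<in> E"
  shows "(LINT t|unit_lborel. (logq \<omega> t - ln (p0 t))\<^sup>2) \<le> (exp (2 * c))\<^sup>2 * (LINT t|unit_lborel. (q \<omega> t - p0 t)\<^sup>2)"
  by (intro square_integral_le_scaled bounded_measurable_diff q_bm logq_bm assms ln_p0_bm p0_bounded_measurable)
     (use exp_lipschitz_bounds(2)[OF logq_bound ln_p0_bound'] assms in \<open>simp add: exp_logq p0_gt_0\<close>)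

definition sieve where "sieve N K = {\<omega> \<in> E. block_energy N \<omega> \<le> K}"

lemma sieve_events: "sieve N K \<in> events"
proof -
  note [measurable] = E_events block_energy_measurable[of N]
  have "sieve N K = E \<inter> {\<omega> \<in> space M. block_energy N \<omega> \<le> K}" by (auto simp: sieve_def E_def)
  also have "\<dots> \<in> events" by measurable
  finally show ?thesis .
qed

lemma sieve_E: "\<omega> \<in> sieve N K \<Longrightarrow> \<omega> \<in> E" by (simp add: sieve_def)

lemma logq_approx:
  assumes \<omega>: "\<omega> \<in> sieve N K" and K: "0 \<le> K"
  shows "block_poly_approx m N K (logq \<omega>)"
proof -
  have "block_poly_approx m N K (\<lambda>t. W t \<omega>)"
    by (rule block_poly_approx_of_integral[OF m sample_continuous[OF E_space[OF sieve_E[OF \<omega>]]] K W_eq])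
       (use \<omega> in \<open>simp add: sieve_def block_energy_def\<close>)
  from block_poly_approx_add_const[OF m this, of "- ln (mass_W \<omega>)"]
  show ?thesis unfolding logq_def[abs_def] by simp
qed

text \<open>The square root modulus bounds each squared block increment by
  \<open>L\<^sup>2 / N\<close>, so the target has bounded energy for every number of blocks.\<close>

lemma log_p0_approx: "\<exists>K\<ge>0. \<forall>N>0. block_poly_approx m N K (\<lambda>t. ln (p0 t))"
proof (rule log_p0_representation)
  fix z :: "nat \<Rightarrow> real" and d L assume d: "\<And>s t. s \<in> {0..1} \<Longrightarrow> t \<in> {0..1} \<Longrightarrow> \<bar>d s - d t\<bar> \<le> L * sqrt \<bar>s - t\<bar>"
    "\<And>t. t \<in> {0..1} \<Longrightarrow> ln (p0 t) = (\<Sum>k\<le>m - 1. z k * t ^ k / fact k) + iterated_integral (m - 1) d t"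
  have dc: "continuous_on {0..1} d" by (rule sqrt_holder_continuous[OF d(1)])
  have L: "0 \<le> L" using order.trans[OF abs_ge_zero d(1)[of 0 1]] by simp
  have "block_poly_approx m N (L\<^sup>2) (\<lambda>t. ln (p0 t))" if N: "0 < N" for N
  proof (rule block_poly_approx_of_integral[OF m dc zero_le_power2 d(2)])
    have "(\<Sum>i<N. LINT s|unit_lborel. (d (real i / N + 1 / N * s) - d (real i / N))\<^sup>2) \<le> (\<Sum>i<N. LINT s|unit_lborel. L\<^sup>2 * (1 / real N))"
    proof (intro sum_mono integral_mono_bounded bounded_measurable_square bounded_measurable_diff bounded_measurable_const)
      fix i assume "i \<in> {..<N}"
      then have i: "i < N" by simp
      show "bounded_measurable (\<lambda>s. d (real i / N + 1 / N * s))"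
        by (rule bounded_measurable_affine[OF bounded_measurable_continuous[OF dc]]) (use i in \<open>auto simp: field_simps\<close>)
      fix s :: real assume s: "s \<in> {0..1}"
      have "real i + s \<le> real N" using s i by auto
      then have "(real i + s) / N \<le> 1" using N by simp
      then have t: "real i / N + 1 / N * s \<in> {0..1}" "real i / N \<in> {0..1}" using s i by (auto simp: add_divide_distrib)
      have "\<bar>d (real i / N + 1 / N * s) - d (real i / N)\<bar> \<le> L * sqrt \<bar>real i / N + 1 / N * s - real i / N\<bar>"
        by (rule d(1)[OF t])
      also have "\<dots> \<le> L * sqrt (1 / N)"
        using s N L by (intro mult_left_mono) (auto simp: divide_right_mono)
      finally have "\<bar>d (real i / N + 1 / N * s) - d (real i / N)\<bar>\<^sup>2 \<le> (L * sqrt (1 / N))\<^sup>2"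
        by (intro power_mono) auto
      then show "(d (real i / N + 1 / N * s) - d (real i / N))\<^sup>2 \<le> L\<^sup>2 * (1 / real N)"
        by (simp add: power_mult_distrib power_divide)
    qed
    also have "\<dots> = L\<^sup>2" using N by simp
    finally show "(\<Sum>i<N. LINT s|unit_lborel. (d (real i / N + 1 / N * s) - d (real i / N))\<^sup>2) \<le> L\<^sup>2" .
  qed
  then show ?thesis by (intro exI[of _ "L\<^sup>2"]) auto
qed

lemma block_radius_square: "(block_radius N)\<^sup>2 = (1 / real N) ^ (2 * (m - 1)) / N"
  by (simp add: block_radius_def power_mult_distrib power_mult power_divide mult.commute[of 2])

text \<open>For \<open>m = 1\<close> the claimed bound is of order one and follows from boundedness
  of the densities. For \<open>m \<ge> 2\<close> the factor \<open>sqrt N\<close> of the passage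
  from L2 to the supremum turns the block radius into \<open>(1 / N) ^ (m - 1)\<close>.\<close>

lemma sieve_sup_bound:
  assumes K: "0 \<le> K" and R: "0 \<le> R"
  shows "\<exists>C>0. \<forall>N>0. \<forall>\<omega>\<in>sieve N K. (LINT t|unit_lborel. (q \<omega> t - p0 t)\<^sup>2) \<le> R * (block_radius N)\<^sup>2
    \<longrightarrow> (\<forall>t\<in>{0..1}. \<bar>q \<omega> t - p0 t\<bar> \<le> C * (1 / real N) ^ (m - 1))"
proof -
  let ?b = "exp (2 * c)"
  obtain \<psi> \<Psi> where "dual_polynomials \<psi> m \<Psi>" "1 \<le> \<Psi>" using dual_polynomials_obtain[of m] by blast
  then interpret dual_polynomials \<psi> m \<Psi> by simp
  obtain K0 where K0: "0 \<le> K0" "\<And>N. 0 < N \<Longrightarrow> block_poly_approx m N K0 (\<lambda>t. ln (p0 t))"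
    using log_p0_approx by blast
  define K1 where "K1 = 2 * (K + K0)"
  define C' where "C' = real m * \<Psi> * sqrt (?b\<^sup>2 * R) + (real m * \<Psi> + 1) * sqrt K1"
  have K1: "0 \<le> K1" using K K0 by (simp add: K1_def)
  have C': "0 \<le> C'" unfolding C'_def using K1 \<Psi>_nonneg R by (intro add_nonneg_nonneg mult_nonneg_nonneg) auto
  define C where "C = ?b + ?b * C'"
  have Cpos: "0 < C" unfolding C_def using C' by (intro add_pos_nonneg) auto
  have "\<bar>q \<omega> t - p0 t\<bar> \<le> C * (1 / real N) ^ (m - 1)"
    if N: "0 < N" and \<omega>: "\<omega> \<in> sieve N K"
      and L2: "(LINT t|unit_lborel. (q \<omega> t - p0 t)\<^sup>2) \<le> R * (block_radius N)\<^sup>2" and t: "t \<in> {0..1}" for N \<omega> t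
  proof (cases "2 \<le> m")
    case False
    then have "m - 1 = 0" by simp
    have "\<bar>q \<omega> t - p0 t\<bar> \<le> ?b"
      using q_bounds(2)[OF t, of \<omega>] q_pos[OF t, of \<omega>] p0_exp_bounds(2)[OF t] p0_gt_0[OF t] by linarith
    also have "\<dots> \<le> C" unfolding C_def using C' by simp
    finally show ?thesis using \<open>m - 1 = 0\<close> by simp
  next
    case True
    let ?H = "(1 / real N) ^ (m - 1)"
    let ?f = "\<lambda>t. logq \<omega> t - ln (p0 t)"
    have \<omega>E: "\<omega> \<in> E" by (rule sieve_E[OF \<omega>])
    have ap: "block_poly_approx m N K1 ?f"
      unfolding K1_def by (rule block_poly_approx_diff[OF logq_approx[OF \<omega> K] K0(2)[OF N] K K0(1)])
    have "(LINT s|unit_lborel. (?f s)\<^sup>2) \<le> ?b\<^sup>2 * (R * (block_radius N)\<^sup>2)"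
      by (rule order.trans[OF logq_diff_p0_le[OF \<omega>E]]) (intro mult_left_mono L2, simp)
    then have "real N * (LINT s|unit_lborel. (?f s)\<^sup>2) \<le> real N * (?b\<^sup>2 * (R * (block_radius N)\<^sup>2))"
      by (intro mult_left_mono) auto
    also have "\<dots> = (?b\<^sup>2 * R) * ?H\<^sup>2"
      unfolding block_radius_square using N by (simp add: power_mult[symmetric] mult.commute[of 2])
    finally have "sqrt (real N * (LINT s|unit_lborel. (?f s)\<^sup>2)) \<le> sqrt (?b\<^sup>2 * R * ?H\<^sup>2)"
      by (rule real_sqrt_le_mono)
    also have "\<dots> = sqrt (?b\<^sup>2 * R) * ?H" by (simp only: real_sqrt_mult real_sqrt_abs) simp
    finally have s: "sqrt (real N * (LINT s|unit_lborel. (?f s)\<^sup>2)) \<le> sqrt (?b\<^sup>2 * R) * ?H" .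
    have "\<bar>?f t\<bar> \<le> real m * \<Psi> * sqrt (real N * (LINT s|unit_lborel. (?f s)\<^sup>2)) + (real m * \<Psi> + 1) * (sqrt K1 * ?H)"
      by (rule sup_le_square_integral[OF True N ap t K1])
    also have "\<dots> \<le> real m * \<Psi> * (sqrt (?b\<^sup>2 * R) * ?H) + (real m * \<Psi> + 1) * (sqrt K1 * ?H)"
      using \<Psi>_nonneg by (intro add_right_mono mult_left_mono s) auto
    also have "\<dots> = C' * ?H" unfolding C'_def by (simp only: distrib_right mult.assoc)
    finally have f: "\<bar>?f t\<bar> \<le> C' * ?H" .
    have "\<bar>q \<omega> t - p0 t\<bar> \<le> ?b * \<bar>?f t\<bar>"
      using exp_lipschitz_bounds(1)[OF logq_bound[OF \<omega>E t] ln_p0_bound'[OF t]] p0_gt_0[OF t] by (simp add: exp_logq[OF \<omega>E])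
    also have "\<dots> \<le> ?b * (C' * ?H)" by (intro mult_left_mono f) auto
    also have "\<dots> \<le> C * ?H" unfolding C_def mult.assoc[symmetric] by (intro mult_right_mono) auto
    finally show ?thesis .
  qed
  then show ?thesis using Cpos by blast
qed

text \<open>One representative is taken from each cell that meets the remote part of the sieve. The
  rate \<open>\<Lambda>\<close> is arbitrary; only the radius \<open>R\<close> depends on
  it.\<close>

lemma sieve_test_net:
  assumes K: "0 \<le> K" and k: "0 < k"
  shows "\<exists>R>0. \<forall>N n. 0 < N \<longrightarrow> real N \<le> real n * (block_radius N)\<^sup>2 \<longrightarrow>
    (\<exists>I. finite I \<and> I \<subseteq> E \<and>
      (\<forall>\<omega>\<in>sieve N K. R * (block_radius N)\<^sup>2 \<le> (LINT t|unit_lborel. (q \<omega> t - p0 t)\<^sup>2) \<longrightarrow>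
        (\<exists>i\<in>I. 16 * (LINT t|unit_lborel. (q \<omega> t - q i t)\<^sup>2) \<le> (LINT t|unit_lborel. (q i t - p0 t)\<^sup>2))) \<and>
      (\<Sum>i\<in>I. exp (- k * real n * (LINT t|unit_lborel. (q i t - p0 t)\<^sup>2))) \<le> exp (- \<Lambda> * real N))"
proof -
  let ?b = "exp (2 * c)"
  obtain \<psi> \<Psi> where d: "dual_polynomials \<psi> m \<Psi>" "1 \<le> \<Psi>" using dual_polynomials_obtain[of m] by blast
  then interpret dual_polynomials \<psi> m \<Psi> by simp
  define C5 where "C5 = (real m + 2) * (real m + ((real m * \<Psi>)\<^sup>2 + 1) * (2 * (K + K)))"
  have C5: "0 \<le> C5" unfolding C5_def using K by (intro mult_nonneg_nonneg add_nonneg_nonneg) auto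
  \<comment> \<open>The reciprocal of the factor by which \<open>cell_norm\<close> and the passage
    to densities multiply the squared distance.\<close>
  define g where "g = 1 / (2 * real m * \<Psi>\<^sup>2 * ?b\<^sup>2)"
  have gpos: "0 < g" unfolding g_def using d(2) m by (intro divide_pos_pos mult_pos_pos) auto
  define A where "A = 2 / (1 - exp (- (k * g / 2)))"
  have kg: "0 < k * g / 2" using k gpos by simp
  then have Apos: "0 < A" unfolding A_def by (intro divide_pos_pos) auto
  \<comment> \<open>The second summand makes a representative close enough, relative to its distance
    from \<open>p0\<close>, for its test to cover the cell. The third cancels the additive term of
    \<open>cell_norm\<close>; the last pays for \<open>\<Lambda>\<close> and for one factor
    \<open>A\<close> per coordinate.\<close>
  define R where "R = 1 + 16 * ?b\<^sup>2 * C5 + 2 * g * real m + 2 / k * (\<bar>\<Lambda>\<bar> + real m * \<bar>ln A\<bar>)"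
  have nn: "0 \<le> 16 * ?b\<^sup>2 * C5" "0 \<le> 2 * g * real m" "0 \<le> 2 / k * (\<bar>\<Lambda>\<bar> + real m * \<bar>ln A\<bar>)"
    using C5 gpos k by auto
  have R: "0 < R" "16 * ?b\<^sup>2 * C5 \<le> R" unfolding R_def using nn by linarith+
  have R3: "k / 2 * (R - 2 * g * real m) \<ge> \<Lambda> + real m * ln A"
  proof -
    have "2 / k * (\<bar>\<Lambda>\<bar> + real m * \<bar>ln A\<bar>) \<le> R - 2 * g * real m" unfolding R_def using nn by linarith
    then have "k / 2 * (2 / k * (\<bar>\<Lambda>\<bar> + real m * \<bar>ln A\<bar>)) \<le> k / 2 * (R - 2 * g * real m)"
      using k by (intro mult_left_mono) auto
    then have "\<bar>\<Lambda>\<bar> + real m * \<bar>ln A\<bar> \<le> k / 2 * (R - 2 * g * real m)" using k by simp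
    moreover have "real m * ln A \<le> real m * \<bar>ln A\<bar>" by (intro mult_left_mono) auto
    ultimately show ?thesis by linarith
  qed
  have "\<exists>I. finite I \<and> I \<subseteq> E \<and>
      (\<forall>\<omega>\<in>sieve N K. R * (block_radius N)\<^sup>2 \<le> (LINT t|unit_lborel. (q \<omega> t - p0 t)\<^sup>2) \<longrightarrow>
        (\<exists>i\<in>I. 16 * (LINT t|unit_lborel. (q \<omega> t - q i t)\<^sup>2) \<le> (LINT t|unit_lborel. (q i t - p0 t)\<^sup>2))) \<and>
      (\<Sum>i\<in>I. exp (- k * real n * (LINT t|unit_lborel. (q i t - p0 t)\<^sup>2))) \<le> exp (- \<Lambda> * real N)"
    if N: "0 < N" and n: "real N \<le> real n * (block_radius N)\<^sup>2" for N n
  proof -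
    let ?\<epsilon> = "block_radius N"
    have \<epsilon>: "0 < ?\<epsilon>" by (rule block_radius_bounds(1)[OF N])
    define \<Delta> where "\<Delta> \<omega> = (LINT t|unit_lborel. (q \<omega> t - p0 t)\<^sup>2)" for \<omega>
    define f where "f \<omega> t = logq \<omega> t - ln (p0 t)" for \<omega> t
    define Idx where "Idx = {..<N} \<times> {..<m}"
    define S where "S = {\<omega> \<in> sieve N K. R * ?\<epsilon>\<^sup>2 \<le> \<Delta> \<omega>}"
    define cell where "cell \<omega> = (\<lambda>(i, l)\<in>Idx. \<lfloor>coord N (f \<omega>) i l / ?\<epsilon>\<rfloor>)" for \<omega>
    \<comment> \<open>Representatives are chosen inside \<open>S\<close>, so they are themselves at
      the required distance from \<open>p0\<close>.\<close>
    define rep where "rep = inv_into S cell"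
    have fbm: "bounded_measurable (f \<omega>)" if "\<omega> \<in> E" for \<omega>
      unfolding f_def[abs_def] by (intro bounded_measurable_diff logq_bm that ln_p0_bm)
    have SE: "\<omega> \<in> E" if "\<omega> \<in> S" for \<omega> using that by (auto simp: S_def sieve_def)
    have rep: "rep z \<in> S" "cell (rep z) = z" if "z \<in> cell ` S" for z
      unfolding rep_def using that by (auto intro: inv_into_into f_inv_into_f)
    define J where "J = \<lceil>\<Psi> * (4 * c) / ?\<epsilon>\<rceil> + 1"
    have Q: "cell ` S \<subseteq> Idx \<rightarrow>\<^sub>E {-J..J}"
    proof (intro image_subsetI PiE_I)
      fix \<omega> x assume "\<omega> \<in> S" and x: "x \<in> Idx"
      then have \<omega>: "\<omega> \<in> E" by (intro SE)
      obtain i l where il: "x = (i, l)" "i < N" "l < m" using x by (auto simp: Idx_def)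
      have "\<lfloor>coord N (f \<omega>) i l / ?\<epsilon>\<rfloor> \<in> {-J..J}"
        unfolding J_def
      proof (rule cell_bounded[OF fbm[OF \<omega>] _ \<epsilon> il(2,3)])
        fix t :: real assume t: "t \<in> {0..1}"
        show "\<bar>f \<omega> t\<bar> \<le> 4 * c"
          unfolding f_def using logq_bound[OF \<omega> t] ln_p0_bound'[OF t] by linarith
      qed
      then show "cell \<omega> x \<in> {-J..J}" using x by (simp add: cell_def il(1))
    next
      fix \<omega> x assume "x \<notin> Idx"
      then show "cell \<omega> x = undefined" by (simp add: cell_def)
    qed
    have finI: "finite Idx" by (simp add: Idx_def)
    have finQ: "finite (cell ` S)" by (rule finite_subset[OF Q finite_PiE[OF finI]]) simp
    \<comment> \<open>The exponent is split in two: one half uses the minimal distance and gives the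
      rate in \<open>N\<close>, the other uses the cell index and makes the sum over the cells
      converge.\<close>
    have expo: "- k * real n * \<Delta> \<omega> \<le> - (k / 2 * (R - 2 * g * real m)) * real N
        + - (k * g / 2) * (\<Sum>x\<in>Idx. (real_of_int (cell \<omega> x))\<^sup>2)" if \<omega>: "\<omega> \<in> S" for \<omega>
    proof -
      define s where "s = (\<Sum>x\<in>Idx. (real_of_int (cell \<omega> x))\<^sup>2)"
      have "s = (\<Sum>(i, l)\<in>{..<N} \<times> {..<m}. (real_of_int \<lfloor>coord N (f \<omega>) i l / ?\<epsilon>\<rfloor>)\<^sup>2)"
        unfolding s_def Idx_def[symmetric] by (rule sum.cong) (auto simp: cell_def)
      also have "\<dots> \<le> 2 * real N * (real m * \<Psi>\<^sup>2 * (LINT t|unit_lborel. (f \<omega> t)\<^sup>2) / ?\<epsilon>\<^sup>2 + real m)"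
        by (rule cell_norm[OF N fbm[OF SE[OF \<omega>]] \<epsilon>])
      also have "\<dots> \<le> 2 * real N * (real m * \<Psi>\<^sup>2 * (?b\<^sup>2 * \<Delta> \<omega>) / ?\<epsilon>\<^sup>2 + real m)"
        using logq_diff_p0_le[OF SE[OF \<omega>]] unfolding \<Delta>_def f_def
        by (intro mult_left_mono add_right_mono divide_right_mono) auto
      finally have "g * s \<le> g * (2 * real N * (real m * \<Psi>\<^sup>2 * (?b\<^sup>2 * \<Delta> \<omega>) / ?\<epsilon>\<^sup>2 + real m))"
        using gpos by (intro mult_left_mono) auto
      also have "\<dots> = real N * (\<Delta> \<omega> / ?\<epsilon>\<^sup>2) + 2 * g * real m * real N"
      proof -
        have "g * (2 * real m * \<Psi>\<^sup>2 * ?b\<^sup>2) = 1" unfolding g_def using d(2) m by simp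
        then have "g * (2 * real m * \<Psi>\<^sup>2 * ?b\<^sup>2) * (real N * (\<Delta> \<omega> / ?\<epsilon>\<^sup>2)) = real N * (\<Delta> \<omega> / ?\<epsilon>\<^sup>2)" by simp
        then show ?thesis by (simp add: algebra_simps)
      qed
      finally have 1: "g * s \<le> real N * (\<Delta> \<omega> / ?\<epsilon>\<^sup>2) + 2 * g * real m * real N" .
      have "R \<le> \<Delta> \<omega> / ?\<epsilon>\<^sup>2" using \<omega> \<epsilon> by (simp add: S_def pos_le_divide_eq)
      then have 2: "real N * R \<le> real N * (\<Delta> \<omega> / ?\<epsilon>\<^sup>2)" by (intro mult_left_mono) auto
      have "0 \<le> \<Delta> \<omega>" unfolding \<Delta>_def by (intro integral_nonneg_AE) auto
      then have "real N * (\<Delta> \<omega> / ?\<epsilon>\<^sup>2) \<le> real n * ?\<epsilon>\<^sup>2 * (\<Delta> \<omega> / ?\<epsilon>\<^sup>2)"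
        by (intro mult_right_mono n) auto
      also have "\<dots> = real n * \<Delta> \<omega>" using \<epsilon> by simp
      finally have 3: "real N * (\<Delta> \<omega> / ?\<epsilon>\<^sup>2) \<le> real n * \<Delta> \<omega>" .
      have "X + Y - Z \<le> 2 * V" if "Y \<le> U + Z" "X \<le> U" "U \<le> V" for U V X Y Z :: real
        using that by linarith
      from this[OF 1 2 3] have "real N * R + g * s - 2 * g * real m * real N \<le> 2 * (real n * \<Delta> \<omega>)" .
      then have "k / 2 * (real N * R + g * s - 2 * g * real m * real N) \<le> k / 2 * (2 * (real n * \<Delta> \<omega>))"
        using k by (intro mult_left_mono) auto
      then show ?thesis unfolding s_def[symmetric] by (simp add: algebra_simps)
    qed
    show ?thesis
    proof (intro exI[of _ "rep ` cell ` S"] conjI ballI impI)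
      show "finite (rep ` cell ` S)" by (intro finite_imageI finQ)
      show "rep ` cell ` S \<subseteq> E" using rep(1) SE by blast
    next
      fix \<omega> assume \<omega>: "\<omega> \<in> sieve N K" "R * ?\<epsilon>\<^sup>2 \<le> (LINT t|unit_lborel. (q \<omega> t - p0 t)\<^sup>2)"
      then have \<omega>S: "\<omega> \<in> S" by (simp add: S_def \<Delta>_def)
      define i where "i = rep (cell \<omega>)"
      have i: "i \<in> S" "cell i = cell \<omega>" unfolding i_def using rep \<omega>S by auto
      have isv: "i \<in> sieve N K" using i by (simp add: S_def)
      have ap: "block_poly_approx m N (2 * (K + K)) (\<lambda>t. f \<omega> t - f i t)"
        unfolding f_def using block_poly_approx_diff[OF logq_approx[OF \<omega>(1) K] logq_approx[OF isv K] K K] by simp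
      have "(LINT t|unit_lborel. (f \<omega> t - f i t)\<^sup>2) \<le> C5 * ?\<epsilon>\<^sup>2"
        unfolding C5_def
      proof (rule cell_distance[OF N fbm[OF SE[OF \<omega>S]] fbm[OF SE[OF i(1)]] ap \<epsilon> block_radius_square[symmetric]])
        fix j l assume "j < N" "l < m"
        then have x: "(j, l) \<in> Idx" by (simp add: Idx_def)
        have "cell \<omega> (j, l) = cell i (j, l)" using i(2) by simp
        then show "\<lfloor>coord N (f \<omega>) j l / ?\<epsilon>\<rfloor> = \<lfloor>coord N (f i) j l / ?\<epsilon>\<rfloor>" using x by (simp add: cell_def)
      qed
      then have "(LINT t|unit_lborel. (logq \<omega> t - logq i t)\<^sup>2) \<le> C5 * ?\<epsilon>\<^sup>2" by (simp add: f_def)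
      then have "16 * (?b\<^sup>2 * (LINT t|unit_lborel. (logq \<omega> t - logq i t)\<^sup>2)) \<le> 16 * (?b\<^sup>2 * (C5 * ?\<epsilon>\<^sup>2))"
        by (intro mult_left_mono) auto
      then have "16 * (LINT t|unit_lborel. (q \<omega> t - q i t)\<^sup>2) \<le> 16 * ?b\<^sup>2 * C5 * ?\<epsilon>\<^sup>2"
        using q_diff_le[OF SE[OF \<omega>S] SE[OF i(1)]] by (simp only: mult.assoc)
      also have "\<dots> \<le> R * ?\<epsilon>\<^sup>2" by (intro mult_right_mono R) auto
      also have "\<dots> \<le> (LINT t|unit_lborel. (q i t - p0 t)\<^sup>2)" using i(1) by (simp add: S_def \<Delta>_def)
      finally show "\<exists>i\<in>rep ` cell ` S. 16 * (LINT t|unit_lborel. (q \<omega> t - q i t)\<^sup>2) \<le> (LINT t|unit_lborel. (q i t - p0 t)\<^sup>2)"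
        using \<omega>S unfolding i_def by blast
    next
      have "(\<Sum>i\<in>rep ` cell ` S. exp (- k * real n * \<Delta> i)) \<le> (\<Sum>z\<in>cell ` S. exp (- k * real n * \<Delta> (rep z)))"
        using sum_image_le[OF finQ, of "\<lambda>i. exp (- k * real n * \<Delta> i)" rep] by (simp add: comp_def)
      also have "\<dots> \<le> (\<Sum>z\<in>cell ` S. exp (- (k / 2 * (R - 2 * g * real m)) * real N) * exp (- (k * g / 2) * (\<Sum>x\<in>Idx. (real_of_int (z x))\<^sup>2)))"
      proof (rule sum_mono)
        fix z assume z: "z \<in> cell ` S"
        show "exp (- k * real n * \<Delta> (rep z)) \<le> exp (- (k / 2 * (R - 2 * g * real m)) * real N) * exp (- (k * g / 2) * (\<Sum>x\<in>Idx. (real_of_int (z x))\<^sup>2))"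
          using expo[OF rep(1)[OF z]] unfolding rep(2)[OF z] exp_add[symmetric] exp_le_cancel_iff .
      qed
      also have "\<dots> = exp (- (k / 2 * (R - 2 * g * real m)) * real N) * (\<Sum>z\<in>cell ` S. exp (- (k * g / 2) * (\<Sum>x\<in>Idx. (real_of_int (z x))\<^sup>2)))"
        by (rule sum_distrib_left[symmetric])
      also have "\<dots> \<le> exp (- (k / 2 * (R - 2 * g * real m)) * real N) * A ^ card Idx"
        unfolding A_def by (intro mult_left_mono sum_PiE_exp_neg_squares_le[OF kg finI Q]) auto
      also have "A ^ card Idx = exp (real N * (real m * ln A))"
        using Apos by (simp add: Idx_def card_cartesian_product exp_of_nat_mult power_mult[symmetric] mult.commute)
      also have "exp (- (k / 2 * (R - 2 * g * real m)) * real N) * exp (real N * (real m * ln A))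
          \<le> exp (- \<Lambda> * real N)"
      proof -
        have "(\<Lambda> + real m * ln A) * real N \<le> k / 2 * (R - 2 * g * real m) * real N"
          by (intro mult_right_mono R3) auto
        then show ?thesis unfolding exp_add[symmetric] exp_le_cancel_iff by (simp add: algebra_simps)
      qed
      finally show "(\<Sum>i\<in>rep ` cell ` S. exp (- k * real n * (LINT t|unit_lborel. (q i t - p0 t)\<^sup>2))) \<le> exp (- \<Lambda> * real N)"
        unfolding \<Delta>_def .
    qed
  qed
  then show ?thesis using R(1) by blast
qed

end

section \<open>Interpolation of norms\<close>

lemma Lr_norm_cong:
  assumes "\<And>t. t \<in> {0..1} \<Longrightarrow> f t = g t"
  shows "Lr_norm r f = Lr_norm r g"
proof -
  have "(\<integral>\<^sup>+ t. ennreal (\<bar>f t\<bar> powr enn2real r) \<partial>unit_lborel) = (\<integral>\<^sup>+ t. ennreal (\<bar>g t\<bar> powr enn2real r) \<partial>unit_lborel)"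
    by (rule nn_integral_cong) (simp add: assms)
  moreover have "(SUP t\<in>{0..1}. ennreal \<bar>f t\<bar>) = (SUP t\<in>{0..1}. ennreal \<bar>g t\<bar>)"
    by (rule SUP_cong) (simp_all add: assms)
  ultimately show ?thesis by (simp add: Lr_norm_def)
qed

lemma Lr_norm_finite_le:
  assumes r: "r \<noteq> \<infinity>" "1 \<le> r" and g: "bounded_measurable g" and B: "0 \<le> B"
    and le: "\<And>t. t \<in> {0..1} \<Longrightarrow> \<bar>f t\<bar> powr enn2real r \<le> g t"
    and int: "(LINT t|unit_lborel. g t) \<le> B powr enn2real r"
  shows "Lr_norm r f \<le> ennreal B"
proof -
  define \<rho> where "\<rho> = enn2real r"
  have \<rho>: "0 < \<rho>" using r by (cases r) (auto simp: \<rho>_def)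
  have g0: "0 \<le> g t" if "t \<in> {0..1}" for t using order.trans[OF powr_ge_zero le[OF that]] .
  define I where "I = (\<integral>\<^sup>+ t. ennreal (\<bar>f t\<bar> powr \<rho>) \<partial>unit_lborel)"
  have "I \<le> (\<integral>\<^sup>+ t. ennreal (g t) \<partial>unit_lborel)"
    unfolding I_def \<rho>_def by (rule nn_integral_mono) (use le in \<open>auto intro!: ennreal_leI\<close>)
  also have "\<dots> = ennreal (LINT t|unit_lborel. g t)"
    by (intro nn_integral_eq_integral bounded_measurable_integrable g AE_I2) (simp add: g0)
  also have "\<dots> \<le> ennreal (B powr \<rho>)" using int unfolding \<rho>_def by (rule ennreal_leI)
  finally have I: "I \<le> ennreal (B powr \<rho>)" .
  then have fin: "I \<noteq> \<infinity>" by (auto simp: top_unique)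
  have "enn2real I \<le> B powr \<rho>" using I by (intro enn2real_leI) auto
  then have "enn2real I powr (1 / \<rho>) \<le> (B powr \<rho>) powr (1 / \<rho>)"
    using \<rho> by (intro powr_mono2) auto
  also have "\<dots> = B" using \<rho> B by (simp add: powr_powr)
  finally have "ennreal (enn2real I powr (1 / \<rho>)) \<le> ennreal B" by (rule ennreal_leI)
  then show ?thesis using r fin unfolding Lr_norm_def I_def \<rho>_def Let_def by simp
qed

text \<open>For finite \<open>r \<ge> 2\<close> interpolate between the uniform and the quadratic bound; for \<open>r < 2\<close>
  truncate at the level of the quadratic bound.\<close>

lemma Lr_norm_interpolation:
  assumes r: "1 \<le> r" and m: "1 \<le> m" and C: "0 < C" and R: "0 < R"
  shows "\<exists>K>0. \<forall>\<tau> f. 0 < \<tau> \<longrightarrow> bounded_measurable f \<longrightarrow> (\<forall>t\<in>{0..1}. \<bar>f t\<bar> \<le> C * \<tau> ^ (m - 1)) \<longrightarrow>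
    (LINT t|unit_lborel. (f t)\<^sup>2) \<le> R * (\<tau> ^ (2 * (m - 1)) * \<tau>) \<longrightarrow>
    Lr_norm r f \<le> ennreal (K * \<tau> powr (real m - 1 + enn2real (1 / max r 2)))"
proof (cases "r = \<infinity>")
  case True
  have "Lr_norm r f \<le> ennreal (C * \<tau> powr (real m - 1 + enn2real (1 / max r 2)))"
    if "0 < \<tau>" "\<forall>t\<in>{0..1}. \<bar>f t\<bar> \<le> C * \<tau> ^ (m - 1)" for \<tau> f
  proof -
    have "C * \<tau> powr (real m - 1 + enn2real (1 / max r 2)) = C * \<tau> ^ (m - 1)"
      using True that(1) m by (simp add: max_def top_unique powr_realpow[symmetric] of_nat_diff)
    then show ?thesis unfolding True using that C by (subst Lr_norm_infinity_le_iff) auto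
  qed
  then show ?thesis using C by blast
next
  case False
  define \<rho> where "\<rho> = enn2real r"
  have r_eq: "r = ennreal \<rho>" and \<rho>: "1 \<le> \<rho>" using False r by (cases r; auto simp: \<rho>_def)+
  have exponent: "enn2real (1 / max r 2) = 1 / max \<rho> 2"
  proof -
    have "max r 2 = ennreal (max \<rho> 2)"
      unfolding r_eq using \<rho> by (simp add: max_def ennreal_le_iff ennreal_numeral[symmetric] del: ennreal_numeral)
    then have "1 / max r 2 = ennreal (1 / max \<rho> 2)"
      using divide_ennreal[of 1 "max \<rho> 2"] by simp
    then show ?thesis by simp
  qed
  show ?thesis
  proof (cases "2 \<le> \<rho>")
    case True
    \<comment> \<open>From \<open>\<bar>f t\<bar> powr \<rho> \<le> S powr (\<rho> - 2) * (f
      t)\<^sup>2\<close> with \<open>S\<close> the uniform bound, after taking the root of order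
      \<open>\<rho>\<close>; the power of \<open>\<tau>\<close> becomes
      \<open>m - 1 + 1 / \<rho>\<close>.\<close>
    define K where "K = C powr ((\<rho> - 2) / \<rho>) * R powr (1 / \<rho>)"
    have K: "0 < K" using C R by (simp add: K_def)
    have "Lr_norm r f \<le> ennreal (K * \<tau> powr (real m - 1 + enn2real (1 / max r 2)))"
      if \<tau>: "0 < \<tau>" and f: "bounded_measurable f" "\<forall>t\<in>{0..1}. \<bar>f t\<bar> \<le> C * \<tau> ^ (m - 1)"
        "(LINT t|unit_lborel. (f t)\<^sup>2) \<le> R * (\<tau> ^ (2 * (m - 1)) * \<tau>)" for \<tau> f
    proof (rule Lr_norm_finite_le[OF False r])
      let ?S = "C * \<tau> ^ (m - 1)"
      have S: "0 < ?S" using C \<tau> by simp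
      show "bounded_measurable (\<lambda>t. ?S powr (\<rho> - 2) * (f t)\<^sup>2)"
        by (intro bounded_measurable_mult bounded_measurable_const bounded_measurable_square f)
      show "0 \<le> K * \<tau> powr (real m - 1 + enn2real (1 / max r 2))" using K by simp
      fix t :: real assume t: "t \<in> {0..1}"
      have "\<bar>f t\<bar> powr \<rho> = \<bar>f t\<bar> powr (\<rho> - 2) * \<bar>f t\<bar> powr 2"
        unfolding powr_add[symmetric] by simp
      also have "\<dots> \<le> ?S powr (\<rho> - 2) * \<bar>f t\<bar> powr 2"
        using f(2) t True by (intro mult_right_mono powr_mono2) auto
      also have "\<bar>f t\<bar> powr 2 = (f t)\<^sup>2" by simp
      finally show "\<bar>f t\<bar> powr enn2real r \<le> ?S powr (\<rho> - 2) * (f t)\<^sup>2" by (simp add: \<rho>_def)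
    next
      let ?S = "C * \<tau> ^ (m - 1)"
      have "(LINT t|unit_lborel. ?S powr (\<rho> - 2) * (f t)\<^sup>2) \<le> ?S powr (\<rho> - 2) * (R * (\<tau> ^ (2 * (m - 1)) * \<tau>))"
        using f(3) by (simp add: mult_left_mono)
      also have "\<dots> = (K * \<tau> powr (real m - 1 + enn2real (1 / max r 2))) powr enn2real r"
      proof -
        define x where "x = ln \<tau>"
        define y where "y = ln C"
        define z where "z = ln R"
        \<comment> \<open>In logarithmic variables the identity of powers becomes linear in the
          exponents.\<close>
        have e: "\<tau> = exp x" "C = exp y" "R = exp z" using \<tau> C R by (simp_all add: x_def y_def z_def)
        have m1: "real (m - 1) = real m - 1" using m by simp
        show ?thesis
          unfolding exponent \<rho>_def[symmetric] K_def e powr_def using True \<rho> m1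
          by (simp add: exp_of_nat_mult[symmetric] exp_add[symmetric] field_simps)
      qed
      finally show "(LINT t|unit_lborel. ?S powr (\<rho> - 2) * (f t)\<^sup>2) \<le> (K * \<tau> powr (real m - 1 + enn2real (1 / max r 2))) powr enn2real r" .
    qed
    then show ?thesis using K by blast
  next
    case small: False
    define K where "K = (R + 1) powr (1 / \<rho>)"
    have K: "0 < K" using R by (simp add: K_def)
    have "Lr_norm r f \<le> ennreal (K * \<tau> powr (real m - 1 + enn2real (1 / max r 2)))"
      if \<tau>: "0 < \<tau>" and f: "bounded_measurable f"
        "(LINT t|unit_lborel. (f t)\<^sup>2) \<le> R * (\<tau> ^ (2 * (m - 1)) * \<tau>)" for \<tau> f
    proof (rule Lr_norm_finite_le[OF False r])
      \<comment> \<open>The truncation level: its square is the power of \<open>\<tau>\<close> in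
        the L2 bound. Above it the negative power \<open>\<rho> - 2\<close> is largest at the level;
        below it \<open>f\<close> is bounded by the level itself.\<close>
      let ?\<epsilon> = "\<tau> powr (real m - 1 / 2)"
      have \<epsilon>: "0 < ?\<epsilon>" using \<tau> by simp
      show "bounded_measurable (\<lambda>t. ?\<epsilon> powr (\<rho> - 2) * (f t)\<^sup>2 + ?\<epsilon> powr \<rho>)"
        by (intro bounded_measurable_add bounded_measurable_mult bounded_measurable_const bounded_measurable_square f)
      show "0 \<le> K * \<tau> powr (real m - 1 + enn2real (1 / max r 2))" using K by simp
      fix t :: real assume t: "t \<in> {0..1}"
      have "\<bar>f t\<bar> powr \<rho> \<le> ?\<epsilon> powr (\<rho> - 2) * (f t)\<^sup>2 + ?\<epsilon> powr \<rho>"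
      proof (cases "\<bar>f t\<bar> \<le> ?\<epsilon>")
        case True
        then have "\<bar>f t\<bar> powr \<rho> \<le> ?\<epsilon> powr \<rho>" using \<rho> by (intro powr_mono2) auto
        moreover have "0 \<le> ?\<epsilon> powr (\<rho> - 2) * (f t)\<^sup>2" by simp
        ultimately show ?thesis by linarith
      next
        case False
        have "\<bar>f t\<bar> powr \<rho> = \<bar>f t\<bar> powr (\<rho> - 2) * \<bar>f t\<bar> powr 2"
          unfolding powr_add[symmetric] by simp
        also have "\<dots> \<le> ?\<epsilon> powr (\<rho> - 2) * \<bar>f t\<bar> powr 2"
          using False small \<epsilon> by (intro mult_right_mono powr_mono2') auto
        also have "\<bar>f t\<bar> powr 2 = (f t)\<^sup>2" by simp
        finally show ?thesis by (simp add: add_increasing2)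
      qed
      then show "\<bar>f t\<bar> powr enn2real r \<le> ?\<epsilon> powr (\<rho> - 2) * (f t)\<^sup>2 + ?\<epsilon> powr \<rho>" by (simp add: \<rho>_def)
    next
      let ?\<epsilon> = "\<tau> powr (real m - 1 / 2)"
      interpret U: prob_space unit_lborel by (rule prob_space_unit_lborel)
      have "(LINT t|unit_lborel. ?\<epsilon> powr (\<rho> - 2) * (f t)\<^sup>2 + ?\<epsilon> powr \<rho>)
         = ?\<epsilon> powr (\<rho> - 2) * (LINT t|unit_lborel. (f t)\<^sup>2) + ?\<epsilon> powr \<rho>"
        using bounded_measurable_integrable[OF bounded_measurable_square[OF f(1)]]
        by (subst Bochner_Integration.integral_add) auto
      also have "\<dots> \<le> ?\<epsilon> powr (\<rho> - 2) * (R * (\<tau> ^ (2 * (m - 1)) * \<tau>)) + ?\<epsilon> powr \<rho>"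
        using f(2) by (intro add_right_mono mult_left_mono) auto
      also have "\<dots> = (R + 1) * ?\<epsilon> powr \<rho>"
      proof -
        have "?\<epsilon> powr (\<rho> - 2) * (\<tau> ^ (2 * (m - 1)) * \<tau>) = ?\<epsilon> powr \<rho>"
        proof -
          define x where "x = ln \<tau>"
          have e: "\<tau> = exp x" using \<tau> by (simp add: x_def)
          have m1: "real (m - 1) = real m - 1" using m by simp
          show ?thesis unfolding e powr_def using m1
            by (simp add: exp_of_nat_mult[symmetric] exp_add[symmetric] field_simps)
        qed
        then show ?thesis by (simp add: distrib_right mult.left_commute)
      qed
      also have "\<dots> = (K * \<tau> powr (real m - 1 + enn2real (1 / max r 2))) powr enn2real r"
        unfolding exponent \<rho>_def[symmetric] K_def using small R \<rho> \<tau>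
        by (simp add: powr_mult powr_powr)
      finally show "(LINT t|unit_lborel. ?\<epsilon> powr (\<rho> - 2) * (f t)\<^sup>2 + ?\<epsilon> powr \<rho>) \<le> (K * \<tau> powr (real m - 1 + enn2real (1 / max r 2))) powr enn2real r" .
    qed
    then show ?thesis using K by blast
  qed
qed

section \<open>Posterior contraction\<close>

context conditioned_released_bm
begin

text \<open>The normaliser of \<open>p0\<close> is 1, and pointwise factors between
  \<open>exp (- e)\<close> and \<open>exp e\<close> survive integration.\<close>

lemma mass_W_near_1:
  assumes \<omega>: "\<omega> \<in> space M" and e: "\<And>t. t \<in> {0..1} \<Longrightarrow> \<bar>W t \<omega> - ln (p0 t)\<bar> \<le> e"
  shows "\<bar>ln (mass_W \<omega>)\<bar> \<le> e"
proof -
  note bm = bounded_measurable_continuous[OF exp_W_continuous[OF \<omega>]]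
  have W: "exp (- e) * p0 t \<le> exp (W t \<omega>)" "exp (W t \<omega>) \<le> exp e * p0 t" if t: "t \<in> {0..1}" for t
  proof -
    have "- e + ln (p0 t) \<le> W t \<omega>" "W t \<omega> \<le> e + ln (p0 t)" using e[OF t] by linarith+
    then have "exp (- e + ln (p0 t)) \<le> exp (W t \<omega>)" "exp (W t \<omega>) \<le> exp (e + ln (p0 t))" by simp_all
    then show "exp (- e) * p0 t \<le> exp (W t \<omega>)" "exp (W t \<omega>) \<le> exp e * p0 t"
      unfolding exp_add exp_ln[OF p0_gt_0[OF t]] by simp_all
  qed
  have bmc: "bounded_measurable (\<lambda>t. k * p0 t)" for k
    by (intro bounded_measurable_mult bounded_measurable_const p0_bounded_measurable)
  have "exp (- e) \<le> mass_W \<omega>" "mass_W \<omega> \<le> exp e"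
    using integral_mono_bounded[OF bmc bm W(1)] integral_mono_bounded[OF bm bmc W(2)]
    by (simp_all add: mass_W_def p0_integral)
  then have "ln (exp (- e)) \<le> ln (mass_W \<omega>)" "ln (mass_W \<omega>) \<le> ln (exp e)"
    using mass_W_pos[OF \<omega>] by (simp_all only: ln_le_cancel_iff exp_gt_zero)
  then show ?thesis by simp
qed

text \<open>Expand \<open>p0\<^sup>2 / q = 2 * p0 - q + (q - p0)\<^sup>2 / q\<close>; the first two
  terms integrate to 1. The error \<open>2 * e\<close> comes from the path and its normaliser. The
  third power of \<open>exp (2 * c)\<close> consists of two factors from the squared Lipschitz bound
  and one from \<open>1 / q\<close>.\<close>

lemma small_ball_chi2:
  assumes \<omega>: "\<omega> \<in> E" and e: "\<And>t. t \<in> {0..1} \<Longrightarrow> \<bar>W t \<omega> - ln (p0 t)\<bar> \<le> e"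
  shows "(\<integral>\<^sup>+ t. ennreal (p0 t * (p0 t / q \<omega> t)) \<partial>unit_lborel) \<le> ennreal (1 + (exp (2 * c)) ^ 3 * (2 * e)\<^sup>2)"
proof -
  interpret U: prob_space unit_lborel by (rule prob_space_unit_lborel)
  let ?b = "exp (2 * c)"
  let ?g = "\<lambda>t. 2 * p0 t - q \<omega> t + ?b ^ 3 * (2 * e)\<^sup>2"
  have bm: "bounded_measurable ?g"
    by (intro bounded_measurable_add bounded_measurable_diff bounded_measurable_mult bounded_measurable_const
        p0_bounded_measurable q_bm \<omega>)
  have le: "p0 t * (p0 t / q \<omega> t) \<le> ?g t" if t: "t \<in> {0..1}" for t
  proof -
    have qp: "0 < q \<omega> t" by (rule q_pos[OF t])
    have "\<bar>logq \<omega> t - ln (p0 t)\<bar> \<le> 2 * e"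
      using e[OF t] mass_W_near_1[OF E_space[OF \<omega>] e] unfolding logq_def by linarith
    then have b: "?b * \<bar>logq \<omega> t - ln (p0 t)\<bar> \<le> ?b * (2 * e)" by (intro mult_left_mono) auto
    have "\<bar>q \<omega> t - p0 t\<bar> \<le> ?b * \<bar>logq \<omega> t - ln (p0 t)\<bar>"
      using exp_lipschitz_bounds(1)[OF logq_bound[OF \<omega> t] ln_p0_bound'[OF t]] p0_gt_0[OF t] by (simp add: exp_logq[OF \<omega>])
    also note b
    finally have "\<bar>q \<omega> t - p0 t\<bar> \<le> ?b * (2 * e)" .
    then have "\<bar>q \<omega> t - p0 t\<bar>\<^sup>2 \<le> (?b * (2 * e))\<^sup>2" by (intro power_mono) auto
    then have sq: "(q \<omega> t - p0 t)\<^sup>2 \<le> ?b\<^sup>2 * (2 * e)\<^sup>2" by (simp add: power_mult_distrib)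
    have "1 / q \<omega> t \<le> 1 / exp (- 2 * c)" using q_bounds(1)[OF t] by (intro divide_left_mono) (auto simp: qp)
    then have "1 / q \<omega> t \<le> ?b" by (simp add: exp_minus inverse_eq_divide)
    then have "(q \<omega> t - p0 t)\<^sup>2 * (1 / q \<omega> t) \<le> (?b\<^sup>2 * (2 * e)\<^sup>2) * ?b"
      using qp by (intro mult_mono sq) auto
    also have "(?b\<^sup>2 * (2 * e)\<^sup>2) * ?b = ?b ^ 3 * (2 * e)\<^sup>2" by (simp add: power2_eq_square power3_eq_cube mult_ac)
    finally have "(q \<omega> t - p0 t)\<^sup>2 / q \<omega> t \<le> ?b ^ 3 * (2 * e)\<^sup>2" by simp
    moreover have "p0 t * (p0 t / q \<omega> t) = 2 * p0 t - q \<omega> t + (q \<omega> t - p0 t)\<^sup>2 / q \<omega> t"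
      using qp by (simp add: field_simps power2_eq_square)
    ultimately show ?thesis by linarith
  qed
  have pos: "0 \<le> p0 t * (p0 t / q \<omega> t)" if "t \<in> {0..1}" for t
    using p0_gt_0[OF that] q_pos[OF that, of \<omega>] by simp
  have "(\<integral>\<^sup>+ t. ennreal (p0 t * (p0 t / q \<omega> t)) \<partial>unit_lborel) \<le> (\<integral>\<^sup>+ t. ennreal (?g t) \<partial>unit_lborel)"
    by (rule nn_integral_mono) (use le in \<open>auto intro!: ennreal_leI\<close>)
  also have "\<dots> = ennreal (LINT t|unit_lborel. ?g t)"
    by (intro nn_integral_eq_integral bounded_measurable_integrable bm AE_I2) (use order.trans[OF pos le] in simp)
  also have "(LINT t|unit_lborel. ?g t) = 1 + ?b ^ 3 * (2 * e)\<^sup>2"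
    using bounded_measurable_integrable[OF p0_bounded_measurable] bounded_measurable_integrable[OF q_bm[OF \<omega>]]
      F.mass[of \<omega>] E_space[OF \<omega>] by (simp add: p0_integral)
  finally show ?thesis .
qed

lemma q_distance_measurable: "(\<lambda>\<omega>. LINT t|unit_lborel. (q \<omega> t - p0 t)\<^sup>2) \<in> borel_measurable M"
proof -
  interpret U: prob_space unit_lborel by (rule prob_space_unit_lborel)
  have "(\<lambda>(\<omega>, t). q \<omega> t) \<in> borel_measurable (M \<Otimes>\<^sub>M unit_lborel)"
    using F.joint by (simp cong: measurable_cong_sets sets_pair_measure_cong)
  then have [measurable]: "(\<lambda>z. q (fst z) (snd z)) \<in> borel_measurable (M \<Otimes>\<^sub>M unit_lborel)"
    by (simp add: case_prod_beta')
  have [measurable]: "p0 \<in> borel_measurable unit_lborel" using p0_bounded_measurable by (simp add: bounded_measurable_def)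
  have "(\<lambda>(\<omega>, t). (q \<omega> t - p0 t)\<^sup>2) \<in> borel_measurable (M \<Otimes>\<^sub>M unit_lborel)"
    unfolding case_prod_beta' by measurable
  then show ?thesis by (rule U.borel_measurable_lebesgue_integral)
qed

lemma sieve_complement:
  assumes N: "0 < N"
  shows "measure \<mu> (E - sieve N K) \<le> exp (real N * (1 / 2 - K / 4)) / prob E"
proof -
  have ev: "E - sieve N K \<in> events" by (intro sets.Diff E_events sieve_events)
  have [measurable]: "block_energy N \<in> borel_measurable M" by (rule block_energy_measurable)
  have "prob (E \<inter> (E - sieve N K)) \<le> prob {\<omega> \<in> space M. K < block_energy N \<omega>}"
    by (rule finite_measure_mono) (auto simp: sieve_def E_space)
  also have "\<dots> \<le> exp (real N * (1 / 2 - K / 4))" by (rule block_energy_tail[OF N])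
  finally show ?thesis unfolding measure_\<mu>[OF ev] using E_pos by (intro divide_right_mono) auto
qed

text \<open>The constant \<open>D\<close> bounds \<open>n\<close> times the squared radius in units
  of \<open>N\<close>. The excluded probability adds 1 for low evidence, \<open>1 / prob E\<close>
  for the complement of the sieve and 2 for the tests.\<close>

lemma posterior_sieve_contraction:
  assumes D: "0 \<le> D"
  shows "\<exists>K R N0. 0 \<le> K \<and> 0 < R \<and> (\<forall>N n. 0 < N \<longrightarrow> N0 \<le> N \<longrightarrow> real N \<le> real n * (block_radius N)\<^sup>2 \<longrightarrow>
    real n * (block_radius N)\<^sup>2 \<le> D * real N \<longrightarrow>
    (\<exists>X\<in>sets F.P. measure F.P X \<le> (3 + 1 / prob E) * exp (- real N) \<and>
      (\<forall>x\<in>space F.P - X. \<forall>A. (\<forall>\<omega>\<in>sieve N K. exp_density (\<lambda>t. W t \<omega>) \<in> A \<longrightarrow>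
          R * (block_radius N)\<^sup>2 \<le> (LINT t|unit_lborel. (q \<omega> t - p0 t)\<^sup>2)) \<longrightarrow>
        posterior (conditioned_prior M W c) n x A \<le> 2 * exp (- real N))))"
proof -
  interpret P: prob_space F.P by (rule F.prob_space_P)
  let ?b = "exp (2 * c)"
  obtain \<kappa> C where k: "0 < \<kappa>" "0 \<le> C" "\<And>N. 0 < N \<Longrightarrow> \<kappa> ^ N \<le> prob {\<omega> \<in> space M. \<forall>t\<in>{0..1}. \<bar>W t \<omega> - ln (p0 t)\<bar> \<le> C * block_radius N}"
    using ln_p0_small_ball by blast
  have "0 < c / 2" using c_pos by simp
  from eventually_radius[OF this, of C]
  obtain N0 where N0: "\<And>N. N0 \<le> N \<Longrightarrow> C * block_radius N \<le> c / 2"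
    unfolding eventually_sequentially by blast
  \<comment> \<open>Chosen so that the total chi-square cost of the small ball is
    \<open>B * (real n * (block_radius N)\<^sup>2)\<close>.\<close>
  define B where "B = 4 * ?b ^ 3 * C\<^sup>2"
  have B0: "0 \<le> B" by (simp add: B_def)
  \<comment> \<open>The lower bound for the evidence, with one more factor \<open>exp (- N)\<close>,
    is at least \<open>exp (- K0 * N)\<close>: 2 counts the two factors \<open>exp (- N)\<close>,
    \<open>B * D\<close> the chi-square cost and \<open>ln \<kappa>\<close> the small ball.\<close>
  define K0 where "K0 = \<bar>2 + B * D - ln \<kappa>\<bar>"
  \<comment> \<open>With this energy bound the tail rate \<open>1 / 2 - K / 4\<close> equals
    \<open>- (K0 + 3 / 2)\<close>, which absorbs \<open>1 / \<theta>\<close> and leaves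
    \<open>exp (- N)\<close>.\<close>
  define K where "K = 4 * (K0 + 2)"
  have K: "0 \<le> K" by (simp add: K_def K0_def)
  define l where "l = 9 / (256 * ?b)"
  have l: "0 < l" by (simp add: l_def)
  obtain R where R: "0 < R" "\<And>N n. 0 < N \<Longrightarrow> real N \<le> real n * (block_radius N)\<^sup>2 \<Longrightarrow>
    \<exists>I. finite I \<and> I \<subseteq> E \<and>
      (\<forall>\<omega>\<in>sieve N K. R * (block_radius N)\<^sup>2 \<le> (LINT t|unit_lborel. (q \<omega> t - p0 t)\<^sup>2) \<longrightarrow>
        (\<exists>i\<in>I. 16 * (LINT t|unit_lborel. (q \<omega> t - q i t)\<^sup>2) \<le> (LINT t|unit_lborel. (q i t - p0 t)\<^sup>2))) \<and>
      (\<Sum>i\<in>I. exp (- l * real n * (LINT t|unit_lborel. (q i t - p0 t)\<^sup>2))) \<le> exp (- (K0 + 1) * real N)"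
    using sieve_test_net[OF K l, of "K0 + 1"] by blast
  have main: "\<exists>X\<in>sets F.P. measure F.P X \<le> (3 + 1 / prob E) * exp (- real N) \<and>
      (\<forall>x\<in>space F.P - X. \<forall>A. (\<forall>\<omega>\<in>sieve N K. exp_density (\<lambda>t. W t \<omega>) \<in> A \<longrightarrow>
          R * (block_radius N)\<^sup>2 \<le> (LINT t|unit_lborel. (q \<omega> t - p0 t)\<^sup>2)) \<longrightarrow>
        posterior (conditioned_prior M W c) n x A \<le> 2 * exp (- real N))"
    if N: "0 < N" and NN0: "N0 \<le> N" and n1: "real N \<le> real n * (block_radius N)\<^sup>2"
      and n2: "real n * (block_radius N)\<^sup>2 \<le> D * real N" for N n
  proof -
    let ?\<epsilon> = "block_radius N"
    obtain I where I: "finite I" "I \<subseteq> E"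
      "\<And>\<omega>. \<omega> \<in> sieve N K \<Longrightarrow> R * ?\<epsilon>\<^sup>2 \<le> (LINT t|unit_lborel. (q \<omega> t - p0 t)\<^sup>2) \<Longrightarrow>
        \<exists>i\<in>I. 16 * (LINT t|unit_lborel. (q \<omega> t - q i t)\<^sup>2) \<le> (LINT t|unit_lborel. (q i t - p0 t)\<^sup>2)"
      "(\<Sum>i\<in>I. exp (- l * real n * (LINT t|unit_lborel. (q i t - p0 t)\<^sup>2))) \<le> exp (- (K0 + 1) * real N)"
      using R(2)[OF N n1] by blast
    define U where "U = {\<omega> \<in> space M. \<forall>t\<in>{0..1}. \<bar>W t \<omega> - ln (p0 t)\<bar> \<le> C * ?\<epsilon>}"
    have UE: "U \<subseteq> E" unfolding U_def by (rule small_ball_sub_E[OF N0[OF NN0]])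
    have Uev: "U \<in> events" unfolding U_def by (rule sup_event_measurable[OF ln_p0_continuous])
    have "\<kappa> ^ N \<le> prob U" unfolding U_def by (rule k(3)[OF N])
    also have "\<dots> \<le> prob U / prob E"
      using E_pos prob_le_1[of E] by (simp add: pos_le_divide_eq mult_left_le)
    also have "\<dots> = measure \<mu> U" unfolding measure_\<mu>[OF Uev] using UE by (simp add: Int_absorb1)
    finally have \<mu>U: "\<kappa> ^ N \<le> measure \<mu> U" .
    have \<mu>Upos: "0 < measure \<mu> U" by (rule less_le_trans[OF zero_less_power[OF k(1)] \<mu>U])
    define ch where "ch = ?b ^ 3 * (2 * (C * ?\<epsilon>))\<^sup>2"
    have ch: "0 \<le> ch" by (simp add: ch_def)
    have chi2: "(\<integral>\<^sup>+ t. ennreal (p0 t * (p0 t / q \<omega> t)) \<partial>unit_lborel) \<le> ennreal (1 + ch)" if \<omega>: "\<omega> \<in> U" for \<omega>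
      unfolding ch_def using \<omega> UE by (intro small_ball_chi2) (auto simp: U_def)
    have "real n * ch = B * (real n * ?\<epsilon>\<^sup>2)" by (simp add: ch_def B_def power_mult_distrib)
    also have "\<dots> \<le> B * (D * real N)" by (intro mult_left_mono n2 B0)
    finally have nch: "real n * ch \<le> B * D * real N" by simp
    \<comment> \<open>The evidence bound times \<open>exp (- N)\<close>, so that the posterior
      quotient becomes \<open>2 * exp (- N)\<close>.\<close>
    define \<theta> where "\<theta> = exp (- real N) * (measure \<mu> U * exp (- (real n * ch + real N)))"
    have \<theta>: "0 < \<theta>" using \<mu>Upos by (simp add: \<theta>_def)
    have \<theta>inv: "1 / \<theta> \<le> exp (K0 * real N)"
    proof -
      have "exp (- (K0 * real N)) \<le> exp (- real N) * (exp (real N * ln \<kappa>) * exp (- (B * D * real N + real N)))"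
      proof -
        have "(2 + B * D - ln \<kappa>) * real N \<le> K0 * real N" unfolding K0_def by (intro mult_right_mono) auto
        then show ?thesis unfolding exp_add[symmetric] exp_le_cancel_iff by (simp add: algebra_simps)
      qed
      also have "\<dots> \<le> \<theta>"
        unfolding \<theta>_def using \<mu>U nch k(1) by (intro mult_mono mult_left_mono) (auto simp: exp_of_nat_mult)
      finally have "1 / \<theta> \<le> 1 / exp (- (K0 * real N))" using \<theta> by (intro divide_left_mono) auto
      then show ?thesis by (simp add: exp_minus inverse_eq_divide)
    qed
    define V1 where "V1 = E - sieve N K"
    define V2 where "V2 = {\<omega> \<in> sieve N K. R * ?\<epsilon>\<^sup>2 \<le> (LINT t|unit_lborel. (q \<omega> t - p0 t)\<^sup>2)}"
    have V1: "V1 \<in> events" unfolding V1_def by (intro sets.Diff E_events sieve_events)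
    have V2: "V2 \<in> events"
    proof -
      note [measurable] = q_distance_measurable sieve_events[of N K]
      have "V2 = sieve N K \<inter> {\<omega> \<in> space M. R * ?\<epsilon>\<^sup>2 \<le> (LINT t|unit_lborel. (q \<omega> t - p0 t)\<^sup>2)}"
        unfolding V2_def using sieve_E E_space by blast
      also have "\<dots> \<in> events" by measurable
      finally show ?thesis .
    qed
    have cover: "\<exists>i\<in>I. 16 * (LINT t|unit_lborel. (q \<omega> t - q i t)\<^sup>2) \<le> (LINT t|unit_lborel. (q i t - p0 t)\<^sup>2)"
      if "\<omega> \<in> V2" for \<omega>
      using that unfolding V2_def by (intro I(3)) auto
    have qbm: "bounded_measurable (q i)" if "i \<in> I" for i by (rule q_bm) (use I(2) that in blast)
    have ql: "exp (- 2 * c) \<le> q i t" "q i t \<le> exp (2 * c)" if "t \<in> {0..1}" for i t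
      using q_bounds[OF that, of i] by blast+
    have "\<exists>X\<in>sets F.P. measure F.P X \<le> exp (- real N) + measure \<mu> V1 / \<theta> + (1 + 1 / \<theta>) * exp (- (K0 + 1) * real N) \<and>
      (\<forall>x\<in>space F.P - X. enn2real (F.partial_evidence n (V1 \<union> V2) x) / enn2real (F.partial_evidence n (space \<mu>) x)
       \<le> 2 * \<theta> / (measure \<mu> U * exp (- (real n * ch + real N))))"
      by (rule F.evidence_contraction[where I = I and q = q, OF _ \<mu>Upos ch chi2 _ _ I(1) qbm ql cover \<theta> I(4)[unfolded l_def]])
         (simp_all add: Uev V1 V2)
    then obtain X where X: "X \<in> sets F.P"
      "measure F.P X \<le> exp (- real N) + measure \<mu> V1 / \<theta> + (1 + 1 / \<theta>) * exp (- (K0 + 1) * real N)"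
      "\<And>x. x \<in> space F.P - X \<Longrightarrow> enn2real (F.partial_evidence n (V1 \<union> V2) x) / enn2real (F.partial_evidence n (space \<mu>) x)
       \<le> 2 * \<theta> / (measure \<mu> U * exp (- (real n * ch + real N)))"
      by blast
    have ratio: "2 * \<theta> / (measure \<mu> U * exp (- (real n * ch + real N))) = 2 * exp (- real N)"
      unfolding \<theta>_def using \<mu>Upos by simp
    have K0: "0 \<le> K0" by (simp add: K0_def)
    have t1: "measure \<mu> V1 / \<theta> \<le> 1 / prob E * exp (- real N)"
    proof -
      have "measure \<mu> V1 * (1 / \<theta>) \<le> (exp (real N * (1 / 2 - K / 4)) / prob E) * exp (K0 * real N)"
        unfolding V1_def using E_pos \<theta> by (intro mult_mono sieve_complement[OF N] \<theta>inv) auto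
      also have "\<dots> = 1 / prob E * (exp (real N * (1 / 2 - K / 4)) * exp (K0 * real N))" by simp
      also have "exp (real N * (1 / 2 - K / 4)) * exp (K0 * real N) \<le> exp (- real N)"
        unfolding exp_add[symmetric] exp_le_cancel_iff by (simp add: K_def algebra_simps)
      finally show ?thesis using E_pos by (simp add: mult_left_mono divide_right_mono)
    qed
    have t2: "(1 + 1 / \<theta>) * exp (- (K0 + 1) * real N) \<le> 2 * exp (- real N)"
    proof -
      have "1 \<le> exp (K0 * real N)" using K0 by simp
      then have "1 + 1 / \<theta> \<le> 2 * exp (K0 * real N)" using \<theta>inv by linarith
      then have "(1 + 1 / \<theta>) * exp (- (K0 + 1) * real N) \<le> 2 * exp (K0 * real N) * exp (- (K0 + 1) * real N)"
        by (intro mult_right_mono) auto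
      also have "\<dots> = 2 * exp (- real N)"
        unfolding mult.assoc exp_add[symmetric] by (simp add: algebra_simps)
      finally show ?thesis .
    qed
    show ?thesis
    proof (intro bexI[OF _ X(1)] conjI ballI allI impI)
      show "measure F.P X \<le> (3 + 1 / prob E) * exp (- real N)"
        using X(2) t1 t2 by (simp add: distrib_right)
      fix x A assume x: "x \<in> space F.P - X" and A: "\<forall>\<omega>\<in>sieve N K. exp_density (\<lambda>t. W t \<omega>) \<in> A \<longrightarrow>
          R * ?\<epsilon>\<^sup>2 \<le> (LINT t|unit_lborel. (q \<omega> t - p0 t)\<^sup>2)"
      have "posterior (conditioned_prior M W c) n x A
         \<le> enn2real (F.partial_evidence n (V1 \<union> V2) x) / enn2real (F.partial_evidence n (space \<mu>) x)"
      proof (rule posterior_le)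
        show "x \<in> space F.P" using x by simp
        show "V1 \<union> V2 \<in> events" by (intro sets.Un V1 V2)
        fix \<omega> assume "\<omega> \<in> E" "exp_density (\<lambda>t. W t \<omega>) \<in> A"
        then show "\<omega> \<in> V1 \<union> V2" using A unfolding V1_def V2_def by blast
      qed
      also have "\<dots> \<le> 2 * exp (- real N)" using X(3)[OF x] unfolding ratio .
      finally show "posterior (conditioned_prior M W c) n x A \<le> 2 * exp (- real N)" .
    qed
  qed
  show ?thesis
    by (intro exI[of _ K] exI[of _ R] exI[of _ N0] conjI K R(1) allI impI main)
qed

end

text \<open>The exponent is \<open>2 * m = 2 * \<alpha> + 1\<close>. Rounding down loses at most a
  factor 2, so \<open>n\<close> times the squared block radius lies between \<open>N\<close> and
  \<open>4 ^ m * N\<close>.\<close>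

lemma block_count:
  fixes m n :: nat
  assumes m: "1 \<le> m" and n: "1 \<le> n"
  defines "N \<equiv> nat \<lfloor>real n powr (1 / (2 * real m))\<rfloor>"
  shows "0 < N" "real N ^ (2 * m) \<le> real n" "real n powr (1 / (2 * real m)) \<le> 2 * real N"
    "real n \<le> (2 * real N) ^ (2 * m)"
proof -
  define y where "y = real n powr (1 / (2 * real m))"
  have "1 powr (1 / (2 * real m)) \<le> y" unfolding y_def using n by (intro powr_mono2) auto
  then have y: "1 \<le> y" by simp
  have yn: "y ^ (2 * m) = real n"
  proof -
    have "y ^ (2 * m) = y powr (2 * real m)" using y by (simp add: powr_realpow[symmetric])
    then show ?thesis unfolding y_def using m n by (simp add: powr_powr)
  qed
  have N: "1 \<le> N" "real N \<le> y" "y \<le> real N + 1"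
    using y unfolding N_def y_def[symmetric] by linarith+
  then show "0 < N" by simp
  show "real N ^ (2 * m) \<le> real n" unfolding yn[symmetric] by (rule power_mono[OF N(2)]) simp
  have "y \<le> 2 * real N" using N by linarith
  then show "real n powr (1 / (2 * real m)) \<le> 2 * real N" by (simp add: y_def)
  show "real n \<le> (2 * real N) ^ (2 * m)" unfolding yn[symmetric] using y N by (intro power_mono) auto
qed

lemma block_count_tendsto:
  assumes m: "1 \<le> m"
  shows "filterlim (\<lambda>n. nat \<lfloor>real n powr (1 / (2 * real m))\<rfloor>) at_top sequentially"
  unfolding filterlim_at_top
proof
  fix Z :: nat
  show "\<forall>\<^sub>F n in sequentially. Z \<le> nat \<lfloor>real n powr (1 / (2 * real m))\<rfloor>"
  proof (rule eventually_sequentiallyI)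
    fix n assume n: "Z ^ (2 * m) \<le> n"
    have "real Z ^ (2 * m) \<le> real n" using n by (metis of_nat_le_iff of_nat_power)
    then have "(real Z ^ (2 * m)) powr (1 / (2 * real m)) \<le> real n powr (1 / (2 * real m))"
      by (intro powr_mono2) auto
    moreover have "(real Z ^ (2 * m)) powr (1 / (2 * real m)) = real Z"
    proof (cases "Z = 0")
      case False
      then have "real Z ^ (2 * m) = real Z powr (2 * real m)" by (simp add: powr_realpow[symmetric])
      then show ?thesis using m by (simp add: powr_powr)
    qed (use m in simp)
    ultimately show "Z \<le> nat \<lfloor>real n powr (1 / (2 * real m))\<rfloor>" by linarith
  qed
qed

context conditioned_released_bm
begin

text \<open>With \<open>\<alpha> = m - 1 / 2\<close> the exponent of the rate is that of
  \<open>1 / N\<close> divided by \<open>2 * m\<close>; rounding of \<open>N\<close> costs the power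
  of 2. From \<open>n = 3\<close> on the logarithmic factor is at least 1.\<close>

lemma contraction_rate_ge:
  assumes n: "3 \<le> n" and N: "N = nat \<lfloor>real n powr (1 / (2 * real m))\<rfloor>"
  shows "(1 / real N) powr (real m - 1 + enn2real (1 / max r 2))
    \<le> 2 powr (real m - 1 + enn2real (1 / max r 2)) * contraction_rate \<alpha> r n"
    and "0 < contraction_rate \<alpha> r n"
proof -
  let ?\<gamma> = "real m - 1 + enn2real (1 / max r 2)"
  have \<gamma>: "0 \<le> ?\<gamma>" using m by simp
  have n1: "1 \<le> n" using n by simp
  note bc = block_count[OF m n1, folded N]
  let ?y = "real n powr (1 / (2 * real m))"
  have y: "0 < ?y" using n by simp
  have "1 / real N = 2 / (2 * real N)" by simp
  also have "\<dots> \<le> 2 / ?y" by (intro divide_left_mono bc(3)) (use bc(1) y in auto)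
  finally have "(1 / real N) powr ?\<gamma> \<le> (2 / ?y) powr ?\<gamma>"
    by (intro powr_mono2 \<gamma>) auto
  also have "\<dots> = 2 powr ?\<gamma> * real n powr (- (?\<gamma> / (2 * real m)))"
    by (simp add: powr_divide powr_powr powr_minus_divide)
  finally have 1: "(1 / real N) powr ?\<gamma> \<le> 2 powr ?\<gamma> * real n powr (- (?\<gamma> / (2 * real m)))" .
  have "exp 1 \<le> real n" using exp_le n by linarith
  then have "1 \<le> ln (real n)" using n by (subst ln_ge_iff) auto
  then have f: "1 \<le> (if r = \<infinity> then sqrt (ln (real n)) else 1)" by simp
  have rate: "contraction_rate \<alpha> r n = real n powr (- (?\<gamma> / (2 * real m))) * (if r = \<infinity> then sqrt (ln (real n)) else 1)"
    unfolding contraction_rate_def \<alpha> by (simp add: algebra_simps)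
  have "real n powr (- (?\<gamma> / (2 * real m))) * 1 \<le> contraction_rate \<alpha> r n"
    unfolding rate by (intro mult_left_mono f) auto
  then have "2 powr ?\<gamma> * real n powr (- (?\<gamma> / (2 * real m))) \<le> 2 powr ?\<gamma> * contraction_rate \<alpha> r n"
    by (intro mult_left_mono) auto
  with 1 show "(1 / real N) powr ?\<gamma> \<le> 2 powr ?\<gamma> * contraction_rate \<alpha> r n" by linarith
  show "0 < contraction_rate \<alpha> r n"
    unfolding rate using f n by (intro mult_pos_pos) auto
qed

text \<open>By contraposition: on the sieve a small L2 distance forces a small uniform distance, and
  interpolation then puts the density strictly inside the \<open>Lr_norm\<close> ball. So sieve
  members outside that ball satisfy the separation required for contraction.\<close>

lemma posterior_contraction:
  assumes r: "1 \<le> r"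
  shows "\<exists>K::real. \<forall>\<epsilon>>0.
    (\<lambda>n. measure (iid_dist p0)
       {x \<in> space (iid_dist p0).
          \<epsilon> < posterior (conditioned_prior M W c) n x
                {p \<in> prob_densities. ennreal (K * contraction_rate \<alpha> r n) \<le> Lr_norm r (\<lambda>t. p t - p0 t)}})
    \<longlonglongrightarrow> 0"
proof -
  interpret P: prob_space F.P by (rule F.prob_space_P)
  let ?\<gamma> = "real m - 1 + enn2real (1 / max r 2)"
  define N where "N n = nat \<lfloor>real n powr (1 / (2 * real m))\<rfloor>" for n :: nat
  have "0 \<le> (4::real) ^ m" by simp
  from posterior_sieve_contraction[OF this]
  obtain J R N0 where J: "0 \<le> J" and R: "0 < R" and con: "\<And>N n. 0 < N \<Longrightarrow> N0 \<le> N \<Longrightarrow> real N \<le> real n * (block_radius N)\<^sup>2 \<Longrightarrow>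
    real n * (block_radius N)\<^sup>2 \<le> 4 ^ m * real N \<Longrightarrow>
    \<exists>X\<in>sets F.P. measure F.P X \<le> (3 + 1 / prob E) * exp (- real N) \<and>
      (\<forall>x\<in>space F.P - X. \<forall>A. (\<forall>\<omega>\<in>sieve N J. exp_density (\<lambda>t. W t \<omega>) \<in> A \<longrightarrow>
          R * (block_radius N)\<^sup>2 \<le> (LINT t|unit_lborel. (q \<omega> t - p0 t)\<^sup>2)) \<longrightarrow>
        posterior (conditioned_prior M W c) n x A \<le> 2 * exp (- real N))"
    by (elim exE conjE) (rule that, assumption+, blast)
  obtain C where C: "0 < C" "\<And>N \<omega> t. 0 < N \<Longrightarrow> \<omega> \<in> sieve N J \<Longrightarrow>
      (LINT t|unit_lborel. (q \<omega> t - p0 t)\<^sup>2) \<le> R * (block_radius N)\<^sup>2 \<Longrightarrow> t \<in> {0..1} \<Longrightarrow>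
      \<bar>q \<omega> t - p0 t\<bar> \<le> C * (1 / real N) ^ (m - 1)"
    using sieve_sup_bound[OF J less_imp_le[OF R]] by blast
  obtain K' where K': "0 < K'" "\<And>\<tau> f. 0 < \<tau> \<Longrightarrow> bounded_measurable f \<Longrightarrow> (\<forall>t\<in>{0..1}. \<bar>f t\<bar> \<le> C * \<tau> ^ (m - 1)) \<Longrightarrow>
    (LINT t|unit_lborel. (f t)\<^sup>2) \<le> R * (\<tau> ^ (2 * (m - 1)) * \<tau>) \<Longrightarrow> Lr_norm r f \<le> ennreal (K' * \<tau> powr ?\<gamma>)"
    using Lr_norm_interpolation[OF r m C(1) R] by blast
  \<comment> \<open>The added 1 makes the comparison with the rate strict, which contradicts
    membership in the closed complement \<open>A n\<close>.\<close>
  define K where "K = K' * 2 powr ?\<gamma> + 1"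
  define A where "A n = {p \<in> prob_densities. ennreal (K * contraction_rate \<alpha> r n) \<le> Lr_norm r (\<lambda>t. p t - p0 t)}" for n
  have bound: "\<exists>X\<in>sets F.P. measure F.P X \<le> (3 + 1 / prob E) * exp (- real (N n)) \<and>
      (\<forall>x\<in>space F.P - X. posterior (conditioned_prior M W c) n x (A n) \<le> 2 * exp (- real (N n)))"
    if n: "3 \<le> n" and NN: "N0 \<le> N n" for n
  proof -
    have n1: "1 \<le> n" using n by simp
    note bc = block_count[OF m n1, folded N_def]
    let ?\<tau> = "1 / real (N n)"
    have \<tau>: "0 < ?\<tau>" using bc(1) by simp
    have \<epsilon>: "(block_radius (N n))\<^sup>2 = ?\<tau> ^ (2 * (m - 1)) * ?\<tau>" by (simp add: block_radius_square)
    obtain k where k: "m = Suc k" using m by (cases m) auto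
    have e1: "real n * (block_radius (N n))\<^sup>2 = real n / real (N n) ^ (2 * m) * real (N n)"
      unfolding \<epsilon> using bc(1) k by (simp add: field_simps)
    have p: "0 < real (N n) ^ (2 * m)" using bc(1) by simp
    have ge1: "1 \<le> real n / real (N n) ^ (2 * m)" using bc(2) p by (simp add: pos_le_divide_eq)
    have n1: "real (N n) \<le> real n * (block_radius (N n))\<^sup>2"
      unfolding e1 using mult_right_mono[OF ge1, of "real (N n)"] by (simp del: times_divide_eq_left)
    have "real n / real (N n) ^ (2 * m) \<le> 4 ^ m"
      using bc(4) p by (simp add: pos_divide_le_eq power_mult_distrib power_mult)
    then have n2: "real n * (block_radius (N n))\<^sup>2 \<le> 4 ^ m * real (N n)"
      unfolding e1 by (intro mult_right_mono) auto
    note rate = contraction_rate_ge[OF n N_def[of n], of r]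
    have sep: "R * (block_radius (N n))\<^sup>2 \<le> (LINT t|unit_lborel. (q \<omega> t - p0 t)\<^sup>2)"
      if \<omega>: "\<omega> \<in> sieve (N n) J" and in_A: "exp_density (\<lambda>t. W t \<omega>) \<in> A n" for \<omega>
    proof (rule ccontr)
      assume "\<not> ?thesis"
      then have L2: "(LINT t|unit_lborel. (q \<omega> t - p0 t)\<^sup>2) \<le> R * (block_radius (N n))\<^sup>2" by simp
      note \<omega>E = sieve_E[OF \<omega>]
      have "Lr_norm r (\<lambda>t. q \<omega> t - p0 t) \<le> ennreal (K' * ?\<tau> powr ?\<gamma>)"
      proof (rule K'(2)[OF \<tau>])
        show "bounded_measurable (\<lambda>t. q \<omega> t - p0 t)"
          by (intro bounded_measurable_diff q_bm \<omega>E p0_bounded_measurable)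
        show "\<forall>t\<in>{0..1}. \<bar>q \<omega> t - p0 t\<bar> \<le> C * ?\<tau> ^ (m - 1)"
          using C(2)[OF bc(1) \<omega> L2] by blast
        show "(LINT t|unit_lborel. (q \<omega> t - p0 t)\<^sup>2) \<le> R * (?\<tau> ^ (2 * (m - 1)) * ?\<tau>)"
          using L2 unfolding \<epsilon> .
      qed
      also have "\<dots> \<le> ennreal (K' * (2 powr ?\<gamma> * contraction_rate \<alpha> r n))"
        by (intro ennreal_leI mult_left_mono rate(1)) (use K'(1) in simp)
      also have "\<dots> < ennreal (K * contraction_rate \<alpha> r n)"
        using rate(2) K'(1) by (intro ennreal_lessI) (auto simp: K_def algebra_simps intro!: add_pos_nonneg)
      finally have "Lr_norm r (\<lambda>t. q \<omega> t - p0 t) < ennreal (K * contraction_rate \<alpha> r n)" .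
      moreover have "Lr_norm r (\<lambda>t. exp_density (\<lambda>t. W t \<omega>) t - p0 t) = Lr_norm r (\<lambda>t. q \<omega> t - p0 t)"
        by (rule Lr_norm_cong) (simp add: exp_density_W q_def \<omega>E)
      ultimately show False using in_A by (simp add: A_def not_le[symmetric])
    qed
    obtain X where X: "X \<in> sets F.P" "measure F.P X \<le> (3 + 1 / prob E) * exp (- real (N n))"
      "\<And>x A. x \<in> space F.P - X \<Longrightarrow> (\<forall>\<omega>\<in>sieve (N n) J. exp_density (\<lambda>t. W t \<omega>) \<in> A \<longrightarrow>
          R * (block_radius (N n))\<^sup>2 \<le> (LINT t|unit_lborel. (q \<omega> t - p0 t)\<^sup>2)) \<Longrightarrow>
        posterior (conditioned_prior M W c) n x A \<le> 2 * exp (- real (N n))"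
      using con[OF bc(1) NN n1 n2] by blast
    show ?thesis
      by (intro bexI[OF _ X(1)] conjI X(2) ballI X(3)) (use sep in blast)+
  qed
  have N_inf: "filterlim N at_top sequentially"
    unfolding N_def[abs_def] by (rule block_count_tendsto[OF m])
  have exp0: "(\<lambda>n. exp (- real (N n))) \<longlonglongrightarrow> 0"
    by (rule filterlim_compose[OF exp_at_bot], rule filterlim_compose[OF filterlim_uminus_at_bot_at_top],
        rule filterlim_compose[OF filterlim_real_sequentially N_inf])
  have main: "(\<lambda>n. measure F.P {x \<in> space F.P. \<epsilon> < posterior (conditioned_prior M W c) n x (A n)}) \<longlonglongrightarrow> 0"
    if \<epsilon>: "0 < \<epsilon>" for \<epsilon>
  proof (rule tendsto_sandwich[where f = "\<lambda>_. 0" and h = "\<lambda>n. (3 + 1 / prob E) * exp (- real (N n))"])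
    show "(\<lambda>n. (3 + 1 / prob E) * exp (- real (N n))) \<longlonglongrightarrow> 0"
      using tendsto_mult[OF tendsto_const exp0, of "3 + 1 / prob E"] by simp
    have "\<forall>\<^sub>F n in sequentially. exp (- real (N n)) < \<epsilon> / 2"
      by (rule order_tendstoD(2)[OF exp0]) (use \<epsilon> in simp)
    moreover have "\<forall>\<^sub>F n in sequentially. N0 \<le> N n"
      using N_inf unfolding filterlim_at_top by blast
    moreover have "\<forall>\<^sub>F n in sequentially. 3 \<le> n" by (rule eventually_ge_at_top)
    ultimately show "\<forall>\<^sub>F n in sequentially. measure F.P {x \<in> space F.P. \<epsilon> < posterior (conditioned_prior M W c) n x (A n)}
      \<le> (3 + 1 / prob E) * exp (- real (N n))"
    proof eventually_elim
      case (elim n)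
      obtain X where X: "X \<in> sets F.P" "measure F.P X \<le> (3 + 1 / prob E) * exp (- real (N n))"
        "\<And>x. x \<in> space F.P - X \<Longrightarrow> posterior (conditioned_prior M W c) n x (A n) \<le> 2 * exp (- real (N n))"
        using bound[OF elim(3,2)] by blast
      have "{x \<in> space F.P. \<epsilon> < posterior (conditioned_prior M W c) n x (A n)} \<subseteq> X"
      proof
        fix x assume x: "x \<in> {x \<in> space F.P. \<epsilon> < posterior (conditioned_prior M W c) n x (A n)}"
        show "x \<in> X"
        proof (rule ccontr)
          assume "x \<notin> X"
          then have "posterior (conditioned_prior M W c) n x (A n) \<le> 2 * exp (- real (N n))" using x by (intro X(3)) auto
          then show False using x elim(1) by auto
        qed
      qed
      \<comment> \<open>Monotonicity of the measure requires measurability only of the larger set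
        \<open>X\<close>.\<close>
      then have "measure F.P {x \<in> space F.P. \<epsilon> < posterior (conditioned_prior M W c) n x (A n)} \<le> measure F.P X"
        by (rule P.finite_measure_mono[OF _ X(1)])
      then show ?case using X(2) by linarith
    qed
  qed auto
  show ?thesis
    by (rule exI[of _ K]) (use main in \<open>simp add: A_def\<close>)
qed

end

theorem proposition4:
  fixes M :: "'w measure" and B :: "real \<Rightarrow> 'w \<Rightarrow> real" and Z :: "nat \<Rightarrow> 'w \<Rightarrow> real"
    and \<alpha> c :: real and r :: ennreal and p0 :: "real \<Rightarrow> real"
  assumes r: "1 \<le> r"
    and alpha: "\<exists>m::nat. 1 \<le> m \<and> \<alpha> = real m - 1 / 2"
    and density: "p0 \<in> prob_densities"
    and smooth: "p0 \<in> holder_space \<alpha>"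
    and bounded: "\<exists>a>0. \<exists>b. \<forall>t\<in>{0..1}. a \<le> p0 t \<and> p0 t \<le> b"
    and c_pos: "0 < c"
    and c_bound: "2 * Lr_norm \<infinity> (\<lambda>t. ln (p0 t)) \<le> ennreal c"
    and process: "released_integrated_bm M B \<alpha> Z"
  shows "\<exists>K::real. \<forall>\<epsilon>>0.
    (\<lambda>n. measure (iid_dist p0)
       {x \<in> space (iid_dist p0).
          \<epsilon> < posterior (conditioned_prior M (released_bm \<alpha> B Z) c) n x
                {p \<in> prob_densities.
                   ennreal (K * contraction_rate \<alpha> r n) \<le> Lr_norm r (\<lambda>t. p t - p0 t)}})
    \<longlonglongrightarrow> 0"
proof -
  obtain m :: nat where m: "1 \<le> m" "\<alpha> = real m - 1 / 2" using alpha by blast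
  have "conditioned_released_bm M B \<alpha> Z m c p0"
    unfolding conditioned_released_bm_def conditioned_released_bm_axioms_def
      half_integer_released_bm_def half_integer_released_bm_axioms_def
    using process m density smooth bounded c_pos c_bound by blast
  then show ?thesis by (rule conditioned_released_bm.posterior_contraction[OF _ r])
qed

end
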